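(* Let $n, b$ be positive integers and let $f \in \mathbb{Z}[x]$ be a polynomial of degree $n$ satisfying $\|f\|_\infty < 2^b$. In addition, let $x_1, \ldots, x_m$ be distinct integers with $|x_i| < 2^b$ for all $i$ and $m \le n$. Then one can determine (by a deterministic algorithm), for each $1 \le i \le m$, whether $f(x_i) = 0$, in $\tilde{O}(nb + \min(n^2, nb^2))$ time.
   Context: $\|f\|_\infty$ denotes the largest absolute value of a coefficient of $f$. The input consists of the coefficients of $f$ and the integers $x_1,\ldots,x_m$. Running time is measured in bit operations, and $\tilde{O}(T)$ suppresses polylogarithmic factors in the parameters $n, b$. *)

theory Defs
  imports Complex_Main "HOL-Library.Log_Nat" "HOL-Computational_Algebra.Polynomial"
begin

definition inf_norm :: "int poly \<Rightarrow> int"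
  where "inf_norm f = Max ((\<lambda>i. \<bar>coeff f i\<bar>) ` {..degree f})"

text \<open>
  Model of computation: a random access machine with logarithmic cost. The memory consists
  of arrays of integers (an execution only touches the finitely many arrays named in the program),
  and programs are finite syntactic objects, so the model is uniform. Every operation
  is charged with (at least, up to a constant factor) the number of bit operations
  it takes by the elementary schoolbook method, and every
  memory access with the lengths of the address and of the transferred content. In particular,
  multiplication and division are charged quadratically, so that no
  fast integer arithmetic is built into the model.
\<close>

text \<open>Binary length, including one bit for the sign.\<close>

definition len :: "int \<Rightarrow> nat"
  where "len a = nat (bitlen \<bar>a\<bar>) + 1"

datatype binop = Plus | Minus | Times | Divide | ShiftL | ShiftR | Less

text \<open>
  Division and right shift round towards minus infinity, division by zero yields zero,
  and shifting by a negative amount does nothing.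
\<close>

fun op_val :: "binop \<Rightarrow> int \<Rightarrow> int \<Rightarrow> int" where
  "op_val Plus a b = a + b"
| "op_val Minus a b = a - b"
| "op_val Times a b = a * b"
| "op_val Divide a b = a div b"
| "op_val ShiftL a b = a * 2 ^ nat b"
| "op_val ShiftR a b = a div 2 ^ nat b"
| "op_val Less a b = (if a < b then 1 else 0)"

fun op_cost :: "binop \<Rightarrow> int \<Rightarrow> int \<Rightarrow> nat" where
  "op_cost Times a b = len a * len b"
| "op_cost Divide a b = len a * len b"
| "op_cost ShiftL a b = len a + len b + nat b"
| "op_cost _ a b = len a + len b"

type_synonym store = "nat \<Rightarrow> int \<Rightarrow> int"

text \<open>\<open>Read k e\<close> is the content of array \<open>k\<close> at the index given by the value of \<open>e\<close>.\<close>

datatype expr = Const int | Read nat expr | Op binop expr expr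

fun val :: "expr \<Rightarrow> store \<Rightarrow> int" where
  "val (Const c) s = c"
| "val (Read k e) s = s k (val e s)"
| "val (Op p e1 e2) s = op_val p (val e1 s) (val e2 s)"

fun cost :: "expr \<Rightarrow> store \<Rightarrow> nat" where
  "cost (Const c) s = len c"
| "cost (Read k e) s = cost e s + len (val e s) + len (s k (val e s))"
| "cost (Op p e1 e2) s = cost e1 s + cost e2 s + op_cost p (val e1 s) (val e2 s)"

datatype prog =
    Skip
  | Write nat expr expr
  | Seq prog prog
  | If expr prog prog
  | While expr prog

text \<open>
  \<open>exec c s t s'\<close>: started in memory \<open>s\<close>, the program \<open>c\<close> halts in memory \<open>s'\<close> after \<open>t\<close> bit
  operations. A guard counts as true iff its value is nonzero.
\<close>

inductive exec :: "prog \<Rightarrow> store \<Rightarrow> nat \<Rightarrow> store \<Rightarrow> bool" where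
  Skip: "exec Skip s 1 s"
| Write: "exec (Write k i e) s
    (cost i s + cost e s + len (val i s) + len (val e s))
    (s(k := (s k)(val i s := val e s)))"
| Seq: "exec c1 s t1 s1 \<Longrightarrow> exec c2 s1 t2 s2 \<Longrightarrow> exec (Seq c1 c2) s (t1 + t2) s2"
| IfTrue: "val e s \<noteq> 0 \<Longrightarrow> exec c1 s t s1 \<Longrightarrow>
    exec (If e c1 c2) s (cost e s + len (val e s) + t) s1"
| IfFalse: "val e s = 0 \<Longrightarrow> exec c2 s t s1 \<Longrightarrow>
    exec (If e c1 c2) s (cost e s + len (val e s) + t) s1"
| WhileFalse: "val e s = 0 \<Longrightarrow> exec (While e c) s (cost e s + len (val e s)) s"
| WhileTrue: "val e s \<noteq> 0 \<Longrightarrow> exec c s t1 s1 \<Longrightarrow> exec (While e c) s1 t2 s2 \<Longrightarrow>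
    exec (While e c) s (cost e s + len (val e s) + t1 + t2) s2"

inductive_cases exec_SkipE: "exec Skip s t s'"
inductive_cases exec_WriteE: "exec (Write k i e) s t s'"
inductive_cases exec_SeqE: "exec (Seq c1 c2) s t s'"
inductive_cases exec_IfE: "exec (If e c1 c2) s t s'"
inductive_cases exec_WhileE: "exec (While e c) s t s'"

lemma exec_deterministic:
  "exec c s t s' \<Longrightarrow> exec c s u s'' \<Longrightarrow> u = t \<and> s'' = s'"
proof (induction arbitrary: u s'' rule: exec.induct)
  case (Skip s)
  then show ?case by (rule exec_SkipE) simp
next
  case (Write k i e s)
  then show ?case by (rule exec_WriteE) simp
next
  case (Seq c1 s t1 s1 c2 t2 s2)
  from Seq.prems show ?case
    by (rule exec_SeqE) (metis Seq.IH)
next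
  case (IfTrue e s c1 t s1 c2)
  from IfTrue.prems show ?case
    by (rule exec_IfE) (metis IfTrue.hyps(1) IfTrue.IH)+
next
  case (IfFalse e s c2 t s1 c1)
  from IfFalse.prems show ?case
    by (rule exec_IfE) (metis IfFalse.hyps(1) IfFalse.IH)+
next
  case (WhileFalse e s c)
  from WhileFalse.prems show ?case
    by (rule exec_WhileE) (metis WhileFalse.hyps)+
next
  case (WhileTrue e s c t1 s1 t2 s2)
  from WhileTrue.prems show ?case
    by (rule exec_WhileE) (metis WhileTrue.hyps(1) WhileTrue.IH)+
qed

text \<open>
  Input: the coefficients of \<open>f\<close> in array 0, the points in array 1, and the lengths
  of these two lists (the degree and the number of points) in array 2; the rest of the
  memory is zero. The bound \<open>b\<close> on the bit sizes is not part of the input.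
\<close>

definition input :: "int poly \<Rightarrow> int list \<Rightarrow> store" where
  "input f xs = (\<lambda>k i.
     if k = 0 \<and> 0 \<le> i then coeff f (nat i)
     else if k = 1 \<and> 0 \<le> i \<and> i < int (length xs) then xs ! nat i
     else if k = 2 \<and> i = 0 then int (degree f)
     else if k = 2 \<and> i = 1 then int (length xs)
     else 0)"

text \<open>Output: cell \<open>i\<close> of array 3 is 1 if the \<open>i\<close>-th point is a root of \<open>f\<close>, and 0 otherwise.\<close>

definition correct_output :: "int poly \<Rightarrow> int list \<Rightarrow> store \<Rightarrow> bool" where
  "correct_output f xs s \<longleftrightarrow>
     (\<forall>i < length xs. s 3 (int i) = (if poly f (xs ! i) = 0 then 1 else 0))"

text \<open>
  Soft-O in two positive integer parameters, uniformly in both. The logarithm is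
  at least 1 on the given range.
\<close>

definition soft_O :: "(nat \<Rightarrow> nat \<Rightarrow> real) \<Rightarrow> (nat \<Rightarrow> nat \<Rightarrow> real) set" where
  "soft_O g = {h. \<exists>C k. \<forall>n b. 1 \<le> n \<longrightarrow> 1 \<le> b \<longrightarrow>
     \<bar>h n b\<bar> \<le> C * \<bar>g n b\<bar> * log 2 (real n + real b) ^ k}"

end

theory Submission
 imports Defs "HOL-Number_Theory.Cong" "HOL-Computational_Algebra.Polynomial_FPS"
begin

text \<open>
 Let \<open>S\<close> exceed the absolute values of all coefficients and points, and let \<open>B\<close> be a power of 2 with
 \<open>S < 2^B\<close>. The points with \<open>2^l \<le> \<bar>a\<bar> < 2^(2 * l)\<close>, for \<open>l\<close> a power of 2, are treated together: Horner's
 scheme runs from the top in blocks of \<open>s\<close> coefficients, with \<open>s\<close> about \<open>8 * B / l\<close>, and a point is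
 dropped as soon as the value of a leading part exceeds \<open>S\<close> in absolute value. A root is never dropped,
 since the value of a leading part is cancelled by the remaining low terms. Conversely at most \<open>s\<close>
 points survive the first block: a polynomial with bounded coefficients and small values at more
 points would have a leading coefficient of absolute value below 1. Hence all blocks after the first
 require only a single evaluation at \<open>s\<close> points, and the total cost is quasi-linear in \<open>n * b\<close>.

 A block is evaluated at \<open>s\<close> points by the transposed form of the subproduct tree: the values are
 coefficients of the products of the block, as a polynomial, with the series \<open>1 / (1 - a X)\<close>, and these are
 obtained by going down the tree from the inverse of the product of all \<open>1 - a X\<close>. Polynomials are packed
 into integers (Kronecker substitution), the inverse is computed by Newton's iteration, and integers
 are multiplied by the method of Schoenhage and Strassen, which needs only additions and shifts apart
 from products of numbers of bounded length.\<close>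

section \<open>Costs of programs\<close>

text \<open>The sizes of classes and blocks are matched. A point of \<open>2 * l\<close> bits raised
  to the power \<open>s\<close> has about \<open>16 * B\<close> bits, so every number attached to a
  point has O(B) bits, and a block at \<open>s\<close> points costs \<open>s * B\<close> up to
  logarithms. The first block needs about \<open>n / s\<close> such evaluations, and so do all the
  other blocks together; hence a class costs \<open>n * B\<close>, and there are only about
  \<open>log B\<close> classes. Shorter blocks would spoil the bound on the surviving points, longer
  ones would make the powers of the points too long. The point 0 lies outside all classes and is
  decided by the constant coefficient; 1 and -1 are added to the lowest class. Since
  \<open>b\<close> is not given, \<open>B\<close> is computed from the input. The machine charges
  the schoolbook cost for products and divisions, so fast multiplication has to be a program itself,
  in a language without recursion and local variables. The recursion is therefore carried out level
  by level: all subproblems of one depth occupy one stretch of a binary heap and are processed by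
  the same loops.\<close>

lemma less_two_power: "x <= n ==> x < 2 ^ n" for x :: nat
 using less_exp[of n] by linarith

lemma len_le: "abs v < 2 ^ n ==> len v <= n + 1"
 unfolding len_def using bitlen_le_iff_power[of "abs v" n] by (simp add: nat_le_iff)

lemma less_len: "abs v < 2 ^ len v"
proof -
 have "abs v < 2 ^ nat (bitlen (abs v))"
  using bitlen_le_iff_power[of "abs v" "nat (bitlen (abs v))"] by (simp add: bitlen_nonneg)
 also have "... <= 2 ^ len v" by (simp add: len_def)
 finally show ?thesis .
qed

lemma abs_div_le: "abs (a div b) <= abs a" for a b :: int
proof -
 have *: "abs (c div d) <= abs c" if "0 <= d" for c d :: int
  using that by (smt (verit) div_by_1 div_int_pos_iff zdiv_eq_0_iff zdiv_mono2 zdiv_mono2_neg)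
 show ?thesis using *[of b a] *[of "- b" "- a"] by (cases "0 <= b") auto
qed

text \<open>A program that only reads numbers of at most \<open>L\<close> bits and only shifts by at most \<open>L\<close>
 has cost linear in \<open>L\<close>, with a factor depending on its syntax only.\<close>

fun small :: "nat => expr => store => bool" where
 "small L (Const c) s = True"
| "small L (Read k e) s = (small L e s & abs (s k (val e s)) < 2 ^ L)"
| "small L (Op p e1 e2) s = (small L e1 s & small L e2 s & p ~= Divide &
  (p = ShiftL --> val e2 s <= int L) & (p = Times --> len (val e1 s) * len (val e2 s) <= L))"

text \<open>Bits of a value in units of \<open>L + 1\<close>. The one unit per operation pays for a
  carry or for a left shift by at most \<open>L\<close>; a read takes one unit because
  \<open>small\<close> bounds its result by \<open>L\<close> bits.\<close>

fun val_wt :: "expr => nat" where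
 "val_wt (Const c) = len c"
| "val_wt (Read k e) = 1"
| "val_wt (Op p e1 e2) = val_wt e1 + val_wt e2 + 1"

fun cost_wt :: "expr => nat" where
 "cost_wt (Const c) = len c"
| "cost_wt (Read k e) = cost_wt e + val_wt e + 2"
| "cost_wt (Op p e1 e2) = cost_wt e1 + cost_wt e2 + val_wt e1 + val_wt e2 + 3"

lemma abs_val_less: "small L e s ==> abs (val e s) < 2 ^ (val_wt e * (L + 1))"
proof (induction e)
 case (Const c)
 have "abs c < 2 ^ len c" by (rule less_len)
 also have "(2::int) ^ len c <= 2 ^ (len c * (L + 1))" by (intro power_increasing) auto
 finally show ?case by simp
next
 case (Read k e)
 hence "abs (s k (val e s)) < 2 ^ L" by simp
 also have "(2::int) ^ L <= 2 ^ (val_wt (Read k e) * (L + 1))" by (intro power_increasing) auto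
 finally show ?case by simp
next
 case (Op p e1 e2)
 define x y where "x = val e1 s" and "y = val e2 s"
 define m n where "m = val_wt e1 * (L + 1)" and "n = val_wt e2 * (L + 1)"
 have x: "abs x < 2 ^ m" and y: "abs y < 2 ^ n"
  using Op by (simp_all add: x_def y_def m_def n_def)
 have mn: "(2::int) ^ m <= 2 ^ (m + n)" "(2::int) ^ n <= 2 ^ (m + n)"
  "(2::int) ^ (m + n + 1) <= 2 ^ (m + n + L + 1)" "(2::int) ^ (m + L) <= 2 ^ (m + n + L + 1)"
  "(2::int) ^ m <= 2 ^ (m + n + L + 1)"
  by (intro power_increasing; simp)+
 have "abs (op_val p x y) < 2 ^ (m + n + L + 1)"
 proof (cases p)
  case Plus
  have "abs (x + y) <= abs x + abs y" by simp
  also have "... < 2 ^ (m + n) + 2 ^ (m + n)" using x y mn(1,2) by linarith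
  finally have "abs (op_val p x y) < 2 ^ (m + n + 1)" using Plus by simp
  thus ?thesis using mn(3) by (rule less_le_trans)
 next
  case Minus
  have "abs (x - y) <= abs x + abs y" by simp
  also have "... < 2 ^ (m + n) + 2 ^ (m + n)" using x y mn(1,2) by linarith
  finally have "abs (op_val p x y) < 2 ^ (m + n + 1)" using Minus by simp
  thus ?thesis using mn(3) by (rule less_le_trans)
 next
  case Times
  have "abs (x * y) <= 2 ^ m * 2 ^ n"
  using x y by (simp add: abs_mult mult_mono less_imp_le)
  also have "... < 2 ^ (m + n + 1)" by (simp add: power_add)
  finally have "abs (op_val p x y) < 2 ^ (m + n + 1)" using Times by simp
  thus ?thesis using mn(3) by (rule less_le_trans)
 next
  case Divide
  have "abs (op_val p x y) < 2 ^ m" using Divide x abs_div_le[of x y] by simp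
  thus ?thesis using mn(5) by (rule less_le_trans)
 next
  case ShiftL
  hence "nat y <= L" using Op.prems by (simp add: y_def nat_le_iff)
  hence "(2::int) ^ nat y <= 2 ^ L" by (intro power_increasing) auto
  hence "abs (x * 2 ^ nat y) < 2 ^ m * 2 ^ L"
  unfolding abs_mult using x by (intro mult_less_le_imp_less) auto
  hence "abs (op_val p x y) < 2 ^ (m + L)" using ShiftL by (simp add: power_add)
  thus ?thesis using mn(4) by (rule less_le_trans)
 next
  case ShiftR
  have "abs (op_val p x y) < 2 ^ m" using ShiftR x abs_div_le[of x "2 ^ nat y"] by simp
  thus ?thesis using mn(5) by (rule less_le_trans)
 next
  case Less
  have "(1::int) < 2 ^ (m + n + L + 1)" by (rule one_less_power) auto
  thus ?thesis using Less by simp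
 qed
 thus ?case by (simp add: x_def y_def m_def n_def algebra_simps)
qed

lemma len_val_le: "small L e s ==> len (val e s) <= (val_wt e + 1) * (L + 1)"
 using len_le[OF abs_val_less, of L e s] by simp

lemma cost_le: "small L e s ==> cost e s <= cost_wt e * (L + 1)"
proof (induction e)
 case (Const c)
 show ?case by simp
next
 case (Read k e)
 have "len (s k (val e s)) <= L + 1" using Read.prems by (intro len_le) auto
 with Read len_val_le[of L e s] show ?case by (simp add: algebra_simps)
next
 case (Op p e1 e2)
 define x y where "x = val e1 s" and "y = val e2 s"
 have x: "len x <= (val_wt e1 + 1) * (L + 1)" and y: "len y <= (val_wt e2 + 1) * (L + 1)"
  using Op.prems by (simp_all only: small.simps x_def y_def len_val_le)
 have "op_cost p x y <= (val_wt e1 + val_wt e2 + 3) * (L + 1)"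
  using Op.prems x y by (cases p) (auto simp: algebra_simps x_def y_def)
 with Op show ?case by (simp add: algebra_simps x_def y_def)
qed

section \<open>Total correctness with time bounds\<close>

definition runs :: "prog => store => nat => (store => bool) => bool" where
 "runs c s T Q = ((EX t s'. exec c s t s' & t <= T & Q s'))"

lemma runs_mono: "runs c s T Q ==> T <= T' ==> (!!s'. Q s' ==> Q' s') ==> runs c s T' Q'"
 unfolding runs_def by (meson order_trans)

lemma runs_Seq:
 assumes "runs c s T1 R" "!!s1. R s1 ==> runs d s1 T2 Q" "T1 + T2 <= T"
 shows "runs (Seq c d) s T Q"
proof -
 obtain t1 s1 where 1: "exec c s t1 s1" "t1 <= T1" "R s1" using assms(1) unfolding runs_def by blast
 obtain t2 s2 where 2: "exec d s1 t2 s2" "t2 <= T2" "Q s2"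
  using assms(2)[OF 1(3)] unfolding runs_def by blast
 have "exec (Seq c d) s (t1 + t2) s2" using 1 2 by (intro exec.Seq)
 thus ?thesis using 1 2 assms(3) unfolding runs_def
  by (intro exI[of _ "t1 + t2"] exI[of _ s2]) auto
qed

text \<open>For code without loops the side conditions \<open>small\<close> are collected together
  with the postcondition, so that one simplification proves correctness and the time bound. Loops
  are excluded by the clause \<open>False\<close> and have rules of their own.\<close>

fun wp :: "nat => prog => (store => bool) => store => bool" where
 "wp L Skip Q s = (Q s)"
| "wp L (Write k i e) Q s = (small L i s & small L e s &
  Q (s(k := (s k)(val i s := val e s))))"
| "wp L (Seq c d) Q s = (wp L c (wp L d Q) s)"
| "wp L (If e c d) Q s = (small L e s & (if val e s ~= 0 then wp L c Q s else wp L d Q s))"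
| "wp L (While e c) Q s = (False)"

fun wt :: "prog => nat" where
 "wt Skip = 1"
| "wt (Write k i e) = cost_wt i + cost_wt e + val_wt i + val_wt e + 2"
| "wt (Seq c d) = wt c + wt d"
| "wt (If e c d) = cost_wt e + val_wt e + 1 + wt c + wt d"
| "wt (While e c) = 0"

lemma runs_wp: "wp L c Q s ==> runs c s (wt c * (L + 1)) Q"
proof (induction c arbitrary: s Q)
 case Skip
 have "exec Skip s 1 s" by (rule exec.Skip)
 thus ?case using Skip unfolding runs_def by fastforce
next
 case (Write k i e)
 have "exec (Write k i e) s (cost i s + cost e s + len (val i s) + len (val e s))
  (s(k := (s k)(val i s := val e s)))" by (rule exec.Write)
 moreover have "cost i s + cost e s + len (val i s) + len (val e s)
  <= wt (Write k i e) * (L + 1)"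
  using Write cost_le[of L i s] cost_le[of L e s] len_val_le[of L i s] len_val_le[of L e s]
  by (simp add: algebra_simps)
 ultimately show ?case using Write unfolding runs_def by fastforce
next
 case (Seq c d)
 thus ?case
  by (intro runs_Seq[where R = "wp L d Q"]) (auto simp: algebra_simps)
next
 case (If e c d)
 have e: "cost e s + len (val e s) <= (cost_wt e + val_wt e + 1) * (L + 1)"
  using If.prems cost_le[of L e s] len_val_le[of L e s] by (simp add: algebra_simps)
 show ?case
 proof (cases "val e s = 0")
  case True
  hence "runs d s (wt d * (L + 1)) Q" using If by simp
  then obtain t s' where t: "exec d s t s'" "t <= wt d * (L + 1)" "Q s'"
  unfolding runs_def by blast
  have "exec (If e c d) s (cost e s + len (val e s) + t) s'" using True t by (intro exec.IfFalse)
  thus ?thesis unfolding runs_def using t e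
  by (intro exI[of _ "cost e s + len (val e s) + t"] exI[of _ s']) (auto simp: algebra_simps)
 next
  case False
  hence "runs c s (wt c * (L + 1)) Q" using If by simp
  then obtain t s' where t: "exec c s t s'" "t <= wt c * (L + 1)" "Q s'"
  unfolding runs_def by blast
  have "exec (If e c d) s (cost e s + len (val e s) + t) s'" using False t by (intro exec.IfTrue)
  thus ?thesis unfolding runs_def using t e
  by (intro exI[of _ "cost e s + len (val e s) + t"] exI[of _ s']) (auto simp: algebra_simps)
 qed
qed simp

text \<open>The number \<open>m\<close> bounds the iterations that are still possible. An iteration
  may lower it by more than one: the cost \<open>T j\<close> of a value passed over is contained in
  the sum anyway. The at most \<open>m + 1\<close> tests of the guard are charged
  separately.\<close>

lemma runs_While:
 fixes T :: "nat => nat"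
 assumes "I m s"
  and "!!m s. I m s ==> small L e s"
  and "!!s. I 0 s ==> val e s = 0"
  and "!!m s. I (Suc m) s ==> val e s ~= 0 ==> runs c s (T m) (%s'. EX m' <= m. I m' s')"
 shows "runs (While e c) s ((SUM j<m. T j) + (m + 1) * ((cost_wt e + val_wt e + 1) * (L + 1)))
  (%s'. (EX m'. I m' s') & val e s' = 0)"
 using assms(1)
proof (induction m arbitrary: s rule: less_induct)
 case (less m)
 define G where "G = (cost_wt e + val_wt e + 1) * (L + 1)"
 have e: "cost e s + len (val e s) <= G"
  using cost_le[OF assms(2)[OF less.prems]] len_val_le[OF assms(2)[OF less.prems]]
  by (simp add: algebra_simps G_def)
 show ?case
 proof (cases "val e s = 0")
  case True
  hence "exec (While e c) s (cost e s + len (val e s)) s" by (rule exec.WhileFalse)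
  thus ?thesis using True less.prems e unfolding runs_def G_def[symmetric]
  by (intro exI[of _ "cost e s + len (val e s)"] exI[of _ s]) auto
 next
  case False
  then obtain l where m: "m = Suc l" using assms(3) less.prems by (cases m) auto
  obtain t1 s1 m' where 1: "exec c s t1 s1" "t1 <= T l" "m' <= l" "I m' s1"
  using assms(4)[of l s] less.prems False m unfolding runs_def by blast
  obtain t2 s2 where 2: "exec (While e c) s1 t2 s2" "t2 <= (SUM j<m'. T j) + (m' + 1) * G"
  "EX m'. I m' s2" "val e s2 = 0"
  using less.IH[of m' s1] 1 m unfolding runs_def G_def by auto
  have "exec (While e c) s (cost e s + len (val e s) + t1 + t2) s2"
  using False 1 2 by (intro exec.WhileTrue)
  moreover have "cost e s + len (val e s) + t1 + t2 <= (SUM j<m. T j) + (m + 1) * G"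
  proof -
  have "(SUM j<m'. T j) <= (SUM j<l. T j)" using 1 by (intro sum_mono2) auto
  moreover have "(m' + 1) * G <= (l + 1) * G" using 1 by (intro mult_right_mono) auto
  ultimately have "t2 <= (SUM j<l. T j) + (l + 1) * G" using 2 by linarith
  thus ?thesis using 1 e m by simp
  qed
  ultimately show ?thesis using 2 unfolding runs_def G_def by blast
 qed
qed

section \<open>Counting loops and frame conditions\<close>

abbreviation Var :: "nat => expr" where "Var k == Read k (Const 0)"
abbreviation Assign :: "nat => expr => prog" where "Assign k e == Write k (Const 0) e"

abbreviation add_expr (infixl "[+]" 65) where "a [+] b == Op Plus a b"
abbreviation sub_expr (infixl "[-]" 65) where "a [-] b == Op Minus a b"
abbreviation shl_expr (infixl "[<<]" 70) where "a [<<] b == Op ShiftL a b"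
abbreviation shr_expr (infixl "[>>]" 70) where "a [>>] b == Op ShiftR a b"
abbreviation less_expr (infix "[<]" 50) where "a [<] b == Op Less a b"
abbreviation Seq_syntax (infixr ";;" 40) where "c ;; d == Seq c d"

definition For :: "nat => expr => expr => prog => prog" where
 "For v lo hi c = (Assign v lo ;; While (Var v [<] hi) (c ;; Assign v (Var v [+] Const 1)))"

text \<open>Weights do not depend on which array is accessed, so array 0 can stand for the
  counter.\<close>

definition for_wt :: "expr => expr => nat" where
 "for_wt lo hi = wt (Assign 0 lo) + wt (Assign 0 (Var 0 [+] Const 1))
  + cost_wt (Var 0 [<] hi) + val_wt (Var 0 [<] hi) + 1"

text \<open>The expression \<open>hi\<close> is evaluated before every iteration, so the invariant
  has to fix its value. The measure for the underlying loop is the number \<open>b - j\<close> of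
  iterations left.\<close>

lemma runs_For_sum:
 fixes a b :: nat
 assumes ab: "val lo s = int a" "small L lo s" "a <= b"
  and I0: "I a (s(v := (s v)(0 := int a)))"
  and v: "!!j s. I j s ==> s v 0 = int j & abs (int j) < 2 ^ L"
  and hi: "!!j s. I j s ==> small L hi s & val hi s = int b"
  and body: "!!j s. a <= j ==> j < b ==> I j s ==>
  runs c s (T j) (%s'. s' v 0 = int j & I (Suc j) (s'(v := (s' v)(0 := int j + 1))))"
 shows "runs (For v lo hi c) s ((SUM j=a..<b. T j) + (b - a + 1) * (for_wt lo hi * (L + 1))) (I b)"
proof -
 define w1 where "w1 = wt (Assign v lo)"
 define w2 where "w2 = wt (Assign v (Var v [+] Const 1))"
 define w3 where "w3 = cost_wt (Var v [<] hi) + val_wt (Var v [<] hi) + 1"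
 have wt: "for_wt lo hi = w1 + w2 + w3" by (simp add: for_wt_def w1_def w2_def w3_def)
 let ?J = "%m s. m <= b - a & I (b - m) s"
 have "runs (While (Var v [<] hi) (c ;; Assign v (Var v [+] Const 1))) s1
  ((SUM m<b-a. T (b - Suc m) + w2 * (L + 1)) + (b - a + 1) * (w3 * (L + 1)))
  (%s'. (EX m'. ?J m' s') & val (Var v [<] hi) s' = 0)"
  if "I a s1" for s1
  unfolding w3_def
 proof (rule runs_While[where I = ?J])
  show "?J (b - a) s1" using that ab by simp
 next
  fix m s
  assume "?J m s"
  thus "small L (Var v [<] hi) s" using v[of "b - m" s] hi[of "b - m" s] by auto
 next
  fix s
  assume "?J 0 s"
  thus "val (Var v [<] hi) s = 0" using v[of b s] hi[of b s] by auto
 next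
  fix m s
  assume J: "?J (Suc m) s" and "val (Var v [<] hi) s ~= 0"
  let ?j = "b - Suc m"
  have j: "a <= ?j" "?j < b" "Suc ?j = b - m" using J by auto
  show "runs (c ;; Assign v (Var v [+] Const 1)) s (T (b - Suc m) + w2 * (L + 1))
  (%s'. EX m' <= m. ?J m' s')"
  proof (rule runs_Seq[OF body[OF j(1,2)] _ order_refl])
  show "I ?j s" using J by simp
  next
  fix s1
  assume s1: "s1 v 0 = int ?j & I (Suc ?j) (s1(v := (s1 v)(0 := int ?j + 1)))"
  have "abs (int ?j) < 2 ^ L" using v J by blast
  thus "runs (Assign v (Var v [+] Const 1)) s1 (w2 * (L + 1)) (%s'. EX m' <= m. ?J m' s')"
  unfolding w2_def using s1 J j
  by (intro runs_wp) (auto simp: fun_upd_def intro!: exI[of _ m])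
  qed
 qed
 hence loop: "runs (While (Var v [<] hi) (c ;; Assign v (Var v [+] Const 1))) s1
  ((SUM j=a..<b. T j) + (b - a) * (w2 * (L + 1)) + (b - a + 1) * (w3 * (L + 1))) (I b)"
  if "I a s1" for s1
 proof (rule runs_mono)
  show "I a s1" by fact
 next
  have "(SUM m<b-a. T (b - Suc m)) = (SUM j=a..<b. T j)"
  by (rule sum.reindex_bij_witness[of _ "%j. b - Suc j" "%m. b - Suc m"]) auto
  thus "(SUM m<b-a. T (b - Suc m) + w2 * (L + 1)) + (b - a + 1) * (w3 * (L + 1))
  <= (SUM j=a..<b. T j) + (b - a) * (w2 * (L + 1)) + (b - a + 1) * (w3 * (L + 1))"
  by (simp add: sum.distrib algebra_simps)
 next
  fix s'
  assume "(EX m'. ?J m' s') & val (Var v [<] hi) s' = 0"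
  then obtain m where m: "m <= b - a" "I (b - m) s'" "val (Var v [<] hi) s' = 0" by blast
  hence "m = 0" using v[OF m(2)] hi[OF m(2)] ab(3) by (auto split: if_splits)
  thus "I b s'" using m by simp
 qed
 show ?thesis
  unfolding For_def
 proof (rule runs_Seq)
  show "runs (Assign v lo) s (w1 * (L + 1)) (I a)"
  unfolding w1_def using ab I0 by (intro runs_wp) auto
  show "I a s1 ==> runs (While (Var v [<] hi) (c ;; Assign v (Var v [+] Const 1))) s1
  ((SUM j=a..<b. T j) + (b - a) * (w2 * (L + 1)) + (b - a + 1) * (w3 * (L + 1))) (I b)" for s1
  by (rule loop)
  show "w1 * (L + 1) + ((SUM j=a..<b. T j) + (b - a) * (w2 * (L + 1)) + (b - a + 1) * (w3 * (L + 1)))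
  <= (SUM j=a..<b. T j) + (b - a + 1) * (for_wt lo hi * (L + 1))"
  unfolding wt by (simp add: algebra_simps)
 qed
qed

lemma runs_For:
 fixes a b :: nat
 assumes "val lo s = int a" "small L lo s" "a <= b"
  and "I a (s(v := (s v)(0 := int a)))"
  and "!!j s. I j s ==> s v 0 = int j & abs (int j) < 2 ^ L"
  and "!!j s. I j s ==> small L hi s & val hi s = int b"
  and "!!j s. a <= j ==> j < b ==> I j s ==>
  runs c s T (%s'. s' v 0 = int j & I (Suc j) (s'(v := (s' v)(0 := int j + 1))))"
 shows "runs (For v lo hi c) s ((b - a + 1) * (T + for_wt lo hi * (L + 1))) (I b)"
proof -
 have "runs (For v lo hi c) s ((SUM j=a..<b. T) + (b - a + 1) * (for_wt lo hi * (L + 1))) (I b)"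
  by (rule runs_For_sum[where I = I and T = "%_. T"]) (fact assms)+
 thus ?thesis by (rule runs_mono) (auto simp: algebra_simps)
qed

text \<open>The frame condition carried by all postconditions: \<open>M\<close> collects the arrays
  a program may change, and \<open>sameD\<close> transfers everything known about the
  others.\<close>

definition same :: "nat set => store => store => bool" where
 "same M s s' = ((ALL k. k ~: M --> s k = s' k))"

lemma sameD: "same M s s' ==> k ~: M ==> s k = s' k"
 by (simp add: same_def)

lemma same_upd [simp]: "k : M ==> same M (s(k := f)) s' \<longleftrightarrow> same M s s'"
 by (auto simp: same_def)

lemma same_refl [simp]: "same M s s"
 by (simp add: same_def)

lemma same_trans: "same M s s' ==> same M' s' s'' ==> M <= N ==> M' <= N ==> same N s s''"
 unfolding same_def by (metis subsetD)

text \<open>When entry \<open>e\<close> is computed, the part from \<open>a\<close> to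
  \<open>e - 1\<close> is new and all other entries of \<open>W\<close> are old. The values
  \<open>F\<close> may therefore depend on old entries of \<open>W\<close> itself, which is how heap
  levels are computed in place from their parents or children.\<close>

lemma runs_map:
 fixes a b :: nat and F :: "nat => int"
 assumes lo: "val lo s0 = int a" "small L lo s0" "a <= b" "b < 2 ^ L"
  and M: "v : M" "W ~: M"
  and hi: "!!s. same (insert W M) s s0 ==> small L hi s & val hi s = int b"
  and body: "!!e s. a <= e ==> e < b ==> same (insert W M) s s0 ==> s v 0 = int e ==>
  (!!i. s W (int i) = (if a <= i & i < e then F i else s0 W (int i))) ==>
  runs c s T (%s'. same (insert W M) s' s0 & s' v 0 = int e & s' W (int e) = F e &
  (ALL i. i ~= e --> s' W (int i) = s W (int i)))"
 shows "runs (For v lo hi c) s0 ((b - a + 1) * (T + for_wt lo hi * (L + 1)))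
  (%s. same (insert W M) s s0 &
  (ALL i. s W (int i) = (if a <= i & i < b then F i else s0 W (int i))))"
proof -
 let ?I = "%j s. a <= j & j <= b & same (insert W M) s s0 & s v 0 = int j &
  (ALL i. s W (int i) = (if a <= i & i < j then F i else s0 W (int i)))"
 have vW: "v ~= W" using M by auto
 show ?thesis
 proof (rule runs_mono[OF runs_For[where I = ?I and a = a and b = b and L = L, OF lo(1-3)]])
  show "?I a (s0(v := (s0 v)(0 := int a)))" using lo(3) M(1) vW by auto
  show "s v 0 = int j & abs (int j) < 2 ^ L" if "?I j s" for j s
  proof -
  have "j < 2 ^ L" using that lo(4) by linarith
  thus ?thesis using that by simp
  qed
  show "small L hi s & val hi s = int b" if "?I j s" for j s
  using that hi by blast
  fix j s
  assume j: "a <= j" "j < b" and I: "?I j s"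
  show "runs c s T (%s'. s' v 0 = int j & ?I (Suc j) (s'(v := (s' v)(0 := int j + 1))))"
  by (rule runs_mono[OF body[OF j]]) (use I j M vW in "auto simp: less_Suc_eq")
 qed auto
qed

lemma runs_map_wp:
 fixes a b :: nat and F :: "nat => int"
 assumes "val lo s0 = int a" "small L lo s0" "a <= b" "b < 2 ^ L" "v : M" "W ~: M"
  and "!!s. same (insert W M) s s0 ==> small L hi s & val hi s = int b"
  and "!!e s. a <= e ==> e < b ==> same (insert W M) s s0 ==> s v 0 = int e ==>
  (!!i. s W (int i) = (if a <= i & i < e then F i else s0 W (int i))) ==>
  wp L c (%s'. same (insert W M) s' s0 & s' v 0 = int e & s' W (int e) = F e &
  (ALL i. i ~= e --> s' W (int i) = s W (int i))) s"
 shows "runs (For v lo hi c) s0 ((b - a + 1) * ((wt c + for_wt lo hi) * (L + 1)))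
  (%s. same (insert W M) s s0 &
  (ALL i. s W (int i) = (if a <= i & i < b then F i else s0 W (int i))))"
 unfolding add_mult_distrib[of "wt c"] using assms(8)
 by (intro runs_map[OF assms(1-7)] runs_wp) auto

lemma runs_map_vars:
 fixes a b :: nat and F :: "nat => int"
 assumes ab: "s0 p 0 = int a" "s0 q 0 = int b" "a <= b" "b < 2 ^ L"
  and M: "v : M" "W ~: M" "q ~: insert W M"
  and body: "!!e s. a <= e ==> e < b ==> same (insert W M) s s0 ==> s v 0 = int e ==>
  (!!i. s W (int i) = (if a <= i & i < e then F i else s0 W (int i))) ==>
  runs c s T (%s'. same (insert W M) s' s0 & s' v 0 = int e & s' W (int e) = F e &
  (ALL i. i ~= e --> s' W (int i) = s W (int i)))"
 shows "runs (For v (Var p) (Var q) c) s0 ((b - a + 1) * (T + for_wt (Var p) (Var q) * (L + 1)))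
  (%s. same (insert W M) s s0 &
  (ALL i. s W (int i) = (if a <= i & i < b then F i else s0 W (int i))))"
proof (rule runs_map[OF _ _ ab(3,4) M(1,2) _ body])
 have "a < 2 ^ L" using ab by linarith
 thus "val (Var p) s0 = int a" "small L (Var p) s0" using ab(1) by simp_all
 show "small L (Var q) s & val (Var q) s = int b" if "same (insert W M) s s0" for s
  using sameD[OF that M(3)] ab(2,4) by simp
qed

lemma runs_map_vars_wp:
 fixes a b :: nat and F :: "nat => int"
 assumes "s0 p 0 = int a" "s0 q 0 = int b" "a <= b" "b < 2 ^ L" "v : M" "W ~: M" "q ~: insert W M"
  and "!!e s. a <= e ==> e < b ==> same (insert W M) s s0 ==> s v 0 = int e ==>
  (!!i. s W (int i) = (if a <= i & i < e then F i else s0 W (int i))) ==>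
  wp L c (%s'. same (insert W M) s' s0 & s' v 0 = int e & s' W (int e) = F e &
  (ALL i. i ~= e --> s' W (int i) = s W (int i))) s"
 shows "runs (For v (Var p) (Var q) c) s0 ((b - a + 1) * ((wt c + for_wt (Var p) (Var q)) * (L + 1)))
  (%s. same (insert W M) s s0 &
  (ALL i. s W (int i) = (if a <= i & i < b then F i else s0 W (int i))))"
 unfolding add_mult_distrib[of "wt c"]
 by (rule runs_map_vars[where ?s0.0 = s0 and p = p and q = q and a = a and b = b and v = v and W = W and M = M and L = L, OF assms(1-7)], rule runs_wp, rule assms(8), assumption+)

text \<open>The frame \<open>M\<close> contains the counter, while \<open>M - {v}\<close> in the
  hypothesis on the body says that the body itself leaves the counter alone; accordingly
  \<open>J\<close> must be insensitive to it.\<close>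

lemma runs_ForM:
 fixes a b :: nat
 assumes lo: "val lo s = int a" "small L lo s" and ab: "a <= b" "b < 2 ^ L" and v: "v : M"
  and J: "J a s" "!!j s h. J j (s(v := h)) = J j s"
  and hi: "!!s'. same M s' s ==> small L hi s' & val hi s' = int b"
  and body: "!!j s'. a <= j ==> j < b ==> same M s' s ==> s' v 0 = int j ==> J j s' ==>
  runs c s' T (%s''. same (M - {v}) s'' s' & J (Suc j) s'')"
 shows "runs (For v lo hi c) s ((b - a + 1) * (T + for_wt lo hi * (L + 1))) (%s'. same M s' s & J b s')"
proof -
 define I where "I = (%j s'. same M s' s & s' v 0 = int j & j <= b & J j s')"
 have "runs (For v lo hi c) s ((b - a + 1) * (T + for_wt lo hi * (L + 1))) (I b)"
 proof (rule runs_For[where I = I, OF lo ab(1)])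
  show "I a (s(v := (s v)(0 := int a)))" using v J ab by (simp add: I_def)
  fix j s'
  assume I: "I j s'"
  hence "j < 2 ^ L" using ab by (simp add: I_def)
  thus "s' v 0 = int j & abs (int j) < 2 ^ L" using I by (simp add: I_def)
  show "small L hi s' & val hi s' = int b" using I hi by (simp add: I_def)
  assume j: "a <= j" "j < b"
  show "runs c s' T (%s''. s'' v 0 = int j & I (Suc j) (s''(v := (s'' v)(0 := int j + 1))))"
  proof (rule runs_mono[OF body[OF j]])
  fix s''
  assume *: "same (M - {v}) s'' s' & J (Suc j) s''"
  hence "same M s'' s" "s'' v 0 = int j" using I unfolding same_def I_def by simp_all
  thus "s'' v 0 = int j & I (Suc j) (s''(v := (s'' v)(0 := int j + 1)))"
  using * j J(2) v by (simp add: I_def)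
  qed (use I in "simp_all add: I_def")
 qed
 thus ?thesis by (rule runs_mono) (simp_all add: I_def)
qed

text \<open>Costs are expressed as multiples of a unit \<open>V\<close>, so that in nested programs
  only the factors have to be added up.\<close>

lemma runs_ForS:
 fixes a b :: nat
 assumes "val lo s = int a" "small L lo s" "a <= b" "b < 2 ^ L" "L + 1 <= V" "v : M"
  and "J a s" "!!j s h. J j (s(v := h)) = J j s"
  and "!!s'. same M s' s ==> small L hi s' & val hi s' = int b"
  and "!!j s'. a <= j ==> j < b ==> same M s' s ==> s' v 0 = int j ==> J j s' ==>
  runs c s' (K * V) (%s''. same (M - {v}) s'' s' & J (Suc j) s'')"
 shows "runs (For v lo hi c) s (((b - a + 1) * (K + for_wt lo hi)) * V) (%s'. same M s' s & J b s')"
proof (rule runs_mono)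
 show "runs (For v lo hi c) s ((b - a + 1) * (K * V + for_wt lo hi * (L + 1))) (%s'. same M s' s & J b s')"
  by (rule runs_ForM[where J = J and M = M]) (fact assms)+
 show "(b - a + 1) * (K * V + for_wt lo hi * (L + 1)) <= (b - a + 1) * (K + for_wt lo hi) * V"
  unfolding add_mult_distrib[of K] mult.assoc using assms(5) by (intro mult_le_mono2 add_left_mono)
qed

section \<open>Fast Fourier transform modulo Fermat numbers\<close>

text \<open>Since \<open>2 ^ N\<close> is -1 modulo \<open>2 ^ N + 1\<close>, the high part is
  subtracted from the low part. This takes only shifts and subtractions, but the result is no
  canonical representative and may be negative.\<close>

definition red :: "nat => int => int" where
 "red N x = x mod 2 ^ N - x div 2 ^ N"

lemma red_cong: "[red N x = x] (mod 2 ^ N + 1)"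
proof -
 have "x = x div 2 ^ N * 2 ^ N + x mod 2 ^ N" by (simp only: div_mult_mod_eq)
 hence "red N x - x = (2 ^ N + 1) * (- (x div 2 ^ N))"
  unfolding red_def by (simp only: algebra_simps)
 thus ?thesis by (metis cong_iff_dvd_diff dvd_triv_left)
qed

lemma abs_red_le:
 assumes "abs x <= 2 ^ N * m"
 shows "abs (red N x) <= 2 ^ N + m"
proof -
 have "- (2 ^ N * m) div 2 ^ N = - m" by (metis minus_mult_right nonzero_mult_div_cancel_left power_not_zero zero_neq_numeral)
 hence "x div 2 ^ N <= m" "- m <= x div 2 ^ N"
  using assms zdiv_mono1[of x "2 ^ N * m" "2 ^ N"] zdiv_mono1[of "- (2 ^ N * m)" x "2 ^ N"]
  by auto
 moreover have "0 <= x mod 2 ^ N" "x mod 2 ^ N < 2 ^ N" by simp_all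
 ultimately show ?thesis unfolding red_def by linarith
qed

text \<open>The first reduction leaves at most \<open>5 * 2 ^ N\<close>, the second one at most
  \<open>2 ^ N + 5\<close>. Residues are kept in this redundant range, rounded up to
  \<open>2 ^ N + 8\<close>, so that the butterflies need no comparisons.\<close>

lemma abs_red_red_le:
 assumes "abs x <= 2 ^ (2 * N + 2)"
 shows "abs (red N (red N x)) <= 2 ^ N + 8"
proof -
 have "(2::int) ^ (2 * N + 2) = 2 ^ N * (4 * 2 ^ N)" by (simp add: power_add power_even_eq power2_eq_square)
 hence "abs (red N x) <= 2 ^ N + 4 * 2 ^ N" using assms by (intro abs_red_le) simp
 hence "abs (red N x) <= 2 ^ N * 5" by simp
 from abs_red_le[OF this] show ?thesis by simp
qed

lemma red_red_cong: "[red N (red N x) = x] (mod 2 ^ N + 1)"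
 using red_cong cong_trans by blast

text \<open>The factorisation of \<open>x^K + 1\<close> modulo \<open>2^N + 1\<close>: the node \<open>p\<close> of a binary heap stands for
 the factor \<open>x^m - 2^e\<close> with \<open>e = root_exp N p\<close>, whose children are
 \<open>x^(m/2) - 2^(e/2)\<close> and \<open>x^(m/2) + 2^(e/2)\<close>.\<close>

fun root_exp :: "nat => nat => nat" where
 "root_exp N p = (if p <= 1 then N else root_exp N (p div 2) div 2 + (if odd p then N else 0))"

declare root_exp.simps [simp del]

lemma root_exp_1 [simp]: "root_exp N (Suc 0) = N"
 by (subst root_exp.simps) simp

lemma root_exp_even: "1 <= p ==> root_exp N (2 * p) = root_exp N p div 2"
 by (subst root_exp.simps) simp

lemma root_exp_odd: "1 <= p ==> root_exp N (2 * p + 1) = root_exp N p div 2 + N"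
 by (subst root_exp.simps) simp

lemma root_exp_less: "0 < N ==> root_exp N p < 2 * N"
proof (induction N p rule: root_exp.induct)
 case (1 N p)
 thus ?case by (subst root_exp.simps) auto
qed

text \<open>Exponents start at \<open>2 ^ t\<close> and are halved once per layer; the summand
  \<open>2 ^ t\<close> of a right child does not disturb the divisibility. Hence all halvings down
  to depth \<open>t\<close> are exact.\<close>

lemma two_pow_dvd_root_exp:
 "2 ^ d <= p ==> p < 2 ^ Suc d ==> d <= t ==> 2 ^ (t - d) dvd root_exp (2 ^ t) p"
proof (induction d arbitrary: p)
 case 0
 hence "p = 1" by simp
 thus ?case by simp
next
 case (Suc d)
 have t: "(2::nat) ^ (t - d) = 2 * 2 ^ (t - Suc d)" using Suc.prems by (simp flip: power_Suc)
 have "2 ^ (t - d) dvd root_exp (2 ^ t) (p div 2)" using Suc.prems by (intro Suc.IH) auto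
 hence "2 ^ (t - Suc d) dvd root_exp (2 ^ t) (p div 2) div 2" unfolding t by auto
 moreover have "(2::nat) ^ (t - Suc d) dvd 2 ^ t" by (intro le_imp_power_dvd) auto
 moreover have "2 <= p"
 proof -
  have "(2::nat) * 1 <= 2 * 2 ^ d" by (intro mult_left_mono) simp_all
  thus ?thesis using Suc.prems(1) by (simp only: power_Suc mult_1_right)
 qed
 ultimately show ?case by (subst root_exp.simps) auto
qed

section \<open>Powers of two as roots of unity modulo a Fermat number\<close>

abbreviation rt :: "nat => nat => int" where "rt N p == 2 ^ root_exp N p"

lemma two_pow_cong: "[2 ^ N = - 1] (mod 2 ^ N + 1 :: int)"
 by (simp add: cong_iff_dvd_diff)

text \<open>Halving the exponent takes a square root, provided that the exponent is even; this is
  the case above depth \<open>t\<close>.\<close>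

lemma rt_even_square:
 assumes "2 ^ d <= p" "p < 2 ^ Suc d" "d < t"
 shows "rt (2 ^ t) (2 * p) ^ 2 = rt (2 ^ t) p"
proof -
 have "2 ^ (t - d) dvd root_exp (2 ^ t) p" using assms by (intro two_pow_dvd_root_exp) auto
 hence "2 dvd root_exp (2 ^ t) p" using assms(3) by (elim dvd_trans[rotated]) simp
 moreover have "1 <= p" using assms(1) one_le_power[of "2::nat" d] by linarith
 ultimately show ?thesis by (simp add: root_exp_even flip: power_mult)
qed

text \<open>The additional \<open>N\<close> in the exponent of a right child contributes the factor
  \<open>2 ^ N\<close>, which is -1.\<close>

lemma rt_odd: "1 <= p ==> [rt N (2 * p + 1) = - rt N (2 * p)] (mod 2 ^ N + 1)"
 using cong_mult[OF cong_refl two_pow_cong, of "2 ^ (root_exp N p div 2)" N]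
 unfolding root_exp_odd by (simp add: root_exp_even power_add)

lemma rt_odd_square:
 assumes "2 ^ d <= p" "p < 2 ^ Suc d" "d < t"
 shows "[rt (2 ^ t) (2 * p + 1) ^ 2 = rt (2 ^ t) p] (mod 2 ^ 2 ^ t + 1)"
proof -
 have "1 <= p" using assms(1) one_le_power[of "2::nat" d] by linarith
 hence "[rt (2 ^ t) (2 * p + 1) ^ 2 = (- rt (2 ^ t) (2 * p)) ^ 2] (mod 2 ^ 2 ^ t + 1)"
  by (intro cong_pow rt_odd)
 thus ?thesis using rt_even_square[OF assms] by simp
qed

text \<open>Squaring leads from a node to its parent, and the top of the heap stands for
  \<open>2 ^ N\<close>, that is -1.\<close>

lemma rt_power_cong:
 "2 ^ d <= p ==> p < 2 ^ Suc d ==> d <= t ==> [rt (2 ^ t) p ^ 2 ^ d = - 1] (mod 2 ^ 2 ^ t + 1)"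
proof (induction d arbitrary: p)
 case 0
 hence "p = 1" by simp
 thus ?case using two_pow_cong[of "2 ^ t"] by simp
next
 case (Suc d)
 define q where "q = p div 2"
 have q: "2 ^ d <= q" "q < 2 ^ Suc d" "d < t" using Suc.prems by (auto simp: q_def)
 have "p = 2 * q | p = 2 * q + 1" by (auto simp: q_def)
 hence "[rt (2 ^ t) p ^ 2 = rt (2 ^ t) q] (mod 2 ^ 2 ^ t + 1)"
  using rt_even_square[OF q] rt_odd_square[OF q] by auto
 hence "[(rt (2 ^ t) p ^ 2) ^ 2 ^ d = rt (2 ^ t) q ^ 2 ^ d] (mod 2 ^ 2 ^ t + 1)"
  by (rule cong_pow)
 moreover have "[rt (2 ^ t) q ^ 2 ^ d = - 1] (mod 2 ^ 2 ^ t + 1)" using q by (intro Suc.IH) auto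
 ultimately show ?case by (simp add: power_mult cong_trans)
qed

lemma sum_even_odd: "(SUM j<2 * n. f j) = (SUM j<n. f (2 * j) + f (2 * j + 1))"
 for f :: "nat => 'a :: comm_monoid_add"
 by (induction n) (simp_all add: algebra_simps)

text \<open>Coefficient \<open>i\<close> of \<open>SUM i<2^k. x i * X^i\<close> modulo the factor \<open>X^(2^(k-d)) - rt N p\<close> at depth \<open>d\<close>.\<close>

definition residue :: "nat => nat => (nat => int) => nat => nat => nat => int" where
 "residue N k x d p i = (SUM j<2 ^ d. x (i + j * 2 ^ (k - d)) * rt N p ^ j)"

text \<open>The terms with even and with odd \<open>j\<close> are separated. As \<open>c ^ 2\<close>
  is the root of the parent, each half is a residue at the parent, the odd half with one more factor
  \<open>c\<close>.\<close>

lemma residue_split: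
 assumes "d < k" and c: "[c ^ 2 = rt N p] (mod F)"
 shows "[(SUM j<2 ^ Suc d. x (i + j * 2 ^ (k - Suc d)) * c ^ j)
  = residue N k x d p i + c * residue N k x d p (i + 2 ^ (k - Suc d))] (mod F)"
proof -
 define m where "m = (2::nat) ^ (k - Suc d)"
 have m: "2 ^ (k - d) = 2 * m" using assms by (simp add: m_def Suc_diff_Suc flip: power_Suc)
 have "(SUM j<2 ^ Suc d. x (i + j * m) * c ^ j)
  = (SUM j<2 ^ d. x (i + j * (2 * m)) * (c ^ 2) ^ j)
  + c * (SUM j<2 ^ d. x (i + m + j * (2 * m)) * (c ^ 2) ^ j)"
  unfolding power_mult[symmetric] power_Suc sum_even_odd sum_distrib_left sum.distrib[symmetric]
  by (rule sum.cong) (simp_all add: algebra_simps)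
 moreover have "[(SUM j<2 ^ d. x (i' + j * (2 * m)) * (c ^ 2) ^ j) = residue N k x d p i'] (mod F)" for i'
  unfolding residue_def m by (intro cong_sum cong_mult cong_refl cong_pow c)
 ultimately show ?thesis unfolding m_def[symmetric]
  by (auto intro!: cong_add cong_mult)
qed

lemma residue_even:
 assumes "2 ^ d <= p" "p < 2 ^ Suc d" "d < t" "d < k"
 shows "[residue (2 ^ t) k x (Suc d) (2 * p) i = residue (2 ^ t) k x d p i
  + rt (2 ^ t) (2 * p) * residue (2 ^ t) k x d p (i + 2 ^ (k - Suc d))] (mod 2 ^ 2 ^ t + 1)"
 unfolding residue_def[of _ _ _ "Suc d"] using rt_even_square[OF assms(1-3)] assms(4)
 by (intro residue_split) auto

lemma residue_odd:
 assumes "2 ^ d <= p" "p < 2 ^ Suc d" "d < t" "d < k"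
 shows "[residue (2 ^ t) k x (Suc d) (2 * p + 1) i = residue (2 ^ t) k x d p i
  - rt (2 ^ t) (2 * p) * residue (2 ^ t) k x d p (i + 2 ^ (k - Suc d))] (mod 2 ^ 2 ^ t + 1)"
proof -
 have "1 <= p" using assms(1) one_le_power[of "2::nat" d] by linarith
 hence "[rt (2 ^ t) (2 * p + 1) * residue (2 ^ t) k x d p (i + 2 ^ (k - Suc d))
  = - rt (2 ^ t) (2 * p) * residue (2 ^ t) k x d p (i + 2 ^ (k - Suc d))] (mod 2 ^ 2 ^ t + 1)"
  by (intro cong_mult rt_odd cong_refl)
 from cong_add[OF cong_refl this, of "residue (2 ^ t) k x d p i"]
 show ?thesis
  unfolding residue_def[of _ _ _ "Suc d"] using rt_odd_square[OF assms(1-3)] assms(4)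
  by (intro cong_trans[OF residue_split[of d k "rt (2 ^ t) (2 * p + 1)"]]) auto
qed

section \<open>Products of polynomials modulo \<open>X ^ K + 1\<close>\<close>

definition negacyclic :: "nat => (nat => int) => (nat => int) => nat => int" where
 "negacyclic K x y i = (SUM j<K. x j * (if j <= i then y (i - j) else - y (K + i - j)))"

lemma sum_lessThan_split: "m <= n ==> (SUM i<n. f i) = (SUM i<m. f i) + (SUM i=m..<n. f i)"
 for f :: "nat => 'a :: comm_monoid_add"
 using sum.atLeastLessThan_concat[of 0 m n f] by (simp add: atLeast0LessThan)

text \<open>Multiplication by \<open>c ^ j\<close> shifts the coefficients by \<open>j\<close>
  places; those that leave at the top come back at the bottom with the opposite sign.\<close>

lemma negacyclic_cong:
 assumes c: "[c ^ K = - 1] (mod F)"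
 shows "[(SUM i<K. x i * c ^ i) * (SUM i<K. y i * c ^ i) = (SUM i<K. negacyclic K x y i * c ^ i)] (mod F)"
proof -
 have shift: "[c ^ j * (SUM i<K. y i * c ^ i)
  = (SUM i<K. (if j <= i then y (i - j) else - y (K + i - j)) * c ^ i)] (mod F)" if "j < K" for j
 proof -
  have "c ^ j * (SUM i<K. y i * c ^ i) = (SUM i<K. y i * c ^ (i + j))"
  by (simp add: sum_distrib_left power_add algebra_simps)
  also have "... = (SUM i<K - j. y i * c ^ (i + j)) + (SUM i=K-j..<K. y i * c ^ (i + j))"
  using that by (intro sum_lessThan_split) simp
  also have "(SUM i<K - j. y i * c ^ (i + j)) = (SUM i=j..<K. y (i - j) * c ^ i)"
  by (rule sum.reindex_bij_witness[of _ "%i. i - j" "%i. i + j"]) auto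
  also have "(SUM i=K-j..<K. y i * c ^ (i + j)) = (SUM i<j. y (K + i - j) * (c ^ K * c ^ i))"
  unfolding power_add[symmetric]
  by (rule sum.reindex_bij_witness[of _ "%i. K + i - j" "%i. i + j - K"]) (use that in auto)
  also have "[(SUM i=j..<K. y (i - j) * c ^ i) + (SUM i<j. y (K + i - j) * (c ^ K * c ^ i))
  = (SUM i=j..<K. y (i - j) * c ^ i) + (SUM i<j. y (K + i - j) * (- 1 * c ^ i))] (mod F)"
  by (intro cong_add cong_sum cong_mult cong_refl c)
  also have "(SUM i=j..<K. y (i - j) * c ^ i) + (SUM i<j. y (K + i - j) * (- 1 * c ^ i))
  = (SUM i=j..<K. (if j <= i then y (i - j) else - y (K + i - j)) * c ^ i)
  + (SUM i<j. (if j <= i then y (i - j) else - y (K + i - j)) * c ^ i)"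
  by (intro arg_cong2[where f = "(+)"] sum.cong) auto
  also have "... = (SUM i<K. (if j <= i then y (i - j) else - y (K + i - j)) * c ^ i)"
  using that by (subst sum_lessThan_split[of j K]) (simp_all only: add.commute less_imp_le)
  finally show ?thesis .
 qed
 have "(SUM i<K. x i * c ^ i) * (SUM i<K. y i * c ^ i) = (SUM j<K. x j * (c ^ j * (SUM i<K. y i * c ^ i)))"
  by (simp add: sum_distrib_right mult.assoc)
 also have "[... = (SUM j<K. x j * (SUM i<K. (if j <= i then y (i - j) else - y (K + i - j)) * c ^ i))] (mod F)"
  by (intro cong_sum cong_mult cong_refl shift) simp
 also have "(SUM j<K. x j * (SUM i<K. (if j <= i then y (i - j) else - y (K + i - j)) * c ^ i))
  = (SUM j<K. SUM i<K. x j * (if j <= i then y (i - j) else - y (K + i - j)) * c ^ i)"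
  by (simp add: sum_distrib_left mult.assoc)
 also have "... = (SUM i<K. negacyclic K x y i * c ^ i)"
  unfolding negacyclic_def sum_distrib_right by (rule sum.swap)
 finally show ?thesis .
qed

lemma abs_negacyclic_le:
 assumes "!!i. i < K ==> abs (x i) <= m" "!!i. i < K ==> abs (y i) <= m" "i < K"
 shows "abs (negacyclic K x y i) <= int K * m ^ 2"
proof -
 have "abs (negacyclic K x y i) <= (SUM j<K. abs (x j * (if j <= i then y (i - j) else - y (K + i - j))))"
  unfolding negacyclic_def by (rule sum_abs)
 also have "... <= (SUM j<K. m * m)"
 proof (intro sum_mono)
  fix j
  assume "j : {..<K}"
  hence "abs (x j) <= m" "abs (if j <= i then y (i - j) else - y (K + i - j)) <= m"
  using assms by auto
  thus "abs (x j * (if j <= i then y (i - j) else - y (K + i - j))) <= m * m"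
  unfolding abs_mult by (intro mult_mono) auto
 qed
 finally show ?thesis by (simp add: power2_eq_square)
qed

section \<open>Programs for digits, butterflies, pointwise products and recombination\<close>

definition split_body :: prog where
 "split_body = (Assign 28 (Read 10 (Var 27 [>>] Const 1)) ;;
  If (Var 27 [-] ((Var 27 [>>] Const 1) [<<] Const 1))
  (Write 10 (Var 27) (Var 28 [>>] Var 33))
  (Write 10 (Var 27) (Var 28 [-] ((Var 28 [>>] Var 33) [<<] Var 33))))"

definition split_loop :: prog where
 "split_loop = For 27 (Var 34) (Var 35) split_body"

definition split_wt :: nat where
 "split_wt = wt split_body + for_wt (Var 34) (Var 35)"

text \<open>The parent \<open>e div 2\<close> lies below \<open>lo\<close> because of
  \<open>hi <= 2 * lo\<close>, so it has not been overwritten by the same pass. Left children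
  receive the low bits, right children the signed high part.\<close>

lemma runs_split_loop:
 assumes s: "s 34 0 = int lo" "s 35 0 = int hi" "s 33 0 = int h"
  and lo: "lo <= hi" "hi < 2 ^ L" "hi <= 2 * lo" "1 <= L" "h <= L"
  and A: "!!e. lo <= e ==> e < hi ==> abs (s 10 (int (e div 2))) < 2 ^ L"
 shows "runs split_loop s ((hi - lo + 1) * (split_wt * (L + 1)))
  (%s'. same {10, 27, 28} s' s & (ALL i. s' 10 (int i) = (if lo <= i & i < hi
  then if even i then s 10 (int (i div 2)) mod 2 ^ h else s 10 (int (i div 2)) div 2 ^ h
  else s 10 (int i))))"
proof -
 have h: "h < 2 ^ L" "lo < 2 ^ L" using lo less_exp[of L] by linarith+
 show ?thesis
  unfolding split_loop_def split_wt_def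
 proof (rule runs_map_vars_wp)
  fix e s1
  assume e: "lo <= e" "e < hi" and s1: "same {10, 27, 28} s1 s" "s1 27 0 = int e"
  and W: "!!i. s1 10 (int i) = (if lo <= i & i < e
  then if even i then s 10 (int (i div 2)) mod 2 ^ h else s 10 (int (i div 2)) div 2 ^ h
  else s 10 (int i))"
  have "~ lo <= e div 2" using e lo by linarith
  hence A1: "s1 10 (int (e div 2)) = s 10 (int (e div 2))" using W by simp
  have e': "e < 2 ^ L" using e lo by linarith
  have s33: "s1 33 0 = int h" using sameD[OF s1(1), of 33] s by simp
  have par: "int e - int (e div 2) * 2 = (if even e then 0 else 1)" by presburger
  show "wp L split_body (%s'. same {10, 27, 28} s' s & s' 27 0 = int e &
  s' 10 (int e) = (if even e then s 10 (int (e div 2)) mod 2 ^ h else s 10 (int (e div 2)) div 2 ^ h) &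
  (ALL i. i ~= e --> s' 10 (int i) = s1 10 (int i))) s1"
  using s1 A1 A[OF e] e' s33 h lo(4,5) par
  by (auto simp: split_body_def minus_div_mult_eq_mod zdiv_int)
 qed (use s lo h in simp_all)
qed

lemma init_cost: "2 <= h ==> w * l + (h - 1) * ((a + c) * l) <= h * ((p + a + c + w) * l)" for h :: nat
proof -
 assume "2 <= h"
 hence "w * l <= h * (w * l)" "(h - 1) * ((a + c) * l) <= h * ((a + c) * l)" by simp_all
 hence "w * l + (h - 1) * ((a + c) * l) <= h * (w * l) + h * ((a + c) * l)" by (rule add_mono)
 thus ?thesis by (simp add: algebra_simps)
qed

lemma int_one_le_two_power: "(1::int) <= 2 ^ n"
 by simp

lemma two_power_add_8: "(2::int) ^ N + 8 <= 2 ^ (N + 4)"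
proof -
 have "(2::int) ^ (N + 4) = 16 * 2 ^ N" by (simp add: power_add)
 thus ?thesis using int_one_le_two_power[of N] by linarith
qed

lemma parity_int: "int x - int (x div 2) * 2 = (if even x then 0 else 1)"
 by presburger

definition exps :: prog where
 "exps = (Write 13 (Const 1) (Var 24) ;;
  For 27 (Const 2) (Var 35)
  (If (Var 27 [-] ((Var 27 [>>] Const 1) [<<] Const 1))
  (Write 13 (Var 27) ((Read 13 (Var 27 [>>] Const 1) [>>] Const 1) [+] Var 24))
  (Write 13 (Var 27) (Read 13 (Var 27 [>>] Const 1) [>>] Const 1))))"

definition exps_wt :: nat where
 "exps_wt = wt exps + wt (If (Var 27 [-] ((Var 27 [>>] Const 1) [<<] Const 1))
  (Write 13 (Var 27) ((Read 13 (Var 27 [>>] Const 1) [>>] Const 1) [+] Var 24))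
  (Write 13 (Var 27) (Read 13 (Var 27 [>>] Const 1) [>>] Const 1))) + for_wt (Const 2) (Var 35)
  + wt (Write 13 (Const 1) (Var 24))"

lemma runs_exps:
 assumes s: "s 35 0 = int hi" "s 24 0 = int N"
  and lo: "2 <= hi" "hi < 2 ^ L" "2 * N < 2 ^ L" "1 <= L" "1 <= N"
 shows "runs exps s (hi * (exps_wt * (L + 1)))
  (%s'. same {13, 27} s' s & (ALL i. 1 <= i --> i < hi --> s' 13 (int i) = int (root_exp N i)))"
proof -
 let ?c = "If (Var 27 [-] ((Var 27 [>>] Const 1) [<<] Const 1))
  (Write 13 (Var 27) ((Read 13 (Var 27 [>>] Const 1) [>>] Const 1) [+] Var 24))
  (Write 13 (Var 27) (Read 13 (Var 27 [>>] Const 1) [>>] Const 1))"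
 define s0 where "s0 = s(13 := (s 13)(1 := int N))"
 have s0: "s0 35 0 = int hi" "s0 24 0 = int N" "s0 13 1 = int N" "same {13, 27} s0 s"
  using s by (auto simp: s0_def)
 have loop: "runs (For 27 (Const 2) (Var 35) ?c) s0
  ((hi - 2 + 1) * ((wt ?c + for_wt (Const 2) (Var 35)) * (L + 1)))
  (%s'. same {13, 27} s' s0 & (ALL i. s' 13 (int i) = (if 2 <= i & i < hi
  then int (root_exp N i) else s0 13 (int i))))"
 proof (rule runs_map_wp)
  fix e s1
  assume e: "2 <= e" "e < hi" and s1: "same {13, 27} s1 s0" "s1 27 0 = int e"
  and W: "!!i. s1 13 (int i) = (if 2 <= i & i < e then int (root_exp N i) else s0 13 (int i))"
  have A1: "s1 13 (int (e div 2)) = int (root_exp N (e div 2))"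
  proof (cases "2 <= e div 2")
  case True
  thus ?thesis using W e by simp
  next
  case False
  hence "e div 2 = 1" using e by simp
  thus ?thesis using W[of 1] s0 by simp
  qed
  have b: "root_exp N (e div 2) < 2 ^ L" using root_exp_less[of N "e div 2"] lo by simp
  have e': "e < 2 ^ L" using e lo by linarith
  have s24: "s1 24 0 = int N" using sameD[OF s1(1), of 24] s0 by simp
  have par: "int e - int (e div 2) * 2 = (if even e then 0 else 1)" by presburger
  have E: "root_exp N e = root_exp N (e div 2) div 2 + (if odd e then N else 0)"
  using e by (subst root_exp.simps) simp
  show "wp L ?c (%s'. same {13, 27} s' s0 & s' 27 0 = int e &
  s' 13 (int e) = int (root_exp N e) & (ALL i. i ~= e --> s' 13 (int i) = s1 13 (int i))) s1"
  using s1 A1 e' s24 lo par b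
  by (auto simp: minus_div_mult_eq_mod zdiv_int E)
 next
  fix s1
  assume "same {13, 27} s1 s0"
  thus "small L (Var 35) s1 & val (Var 35) s1 = int hi" using sameD[of _ s1 s0 35] s0 lo by simp
 qed (use s lo in simp_all)
 show ?thesis
  unfolding exps_def
 proof (rule runs_Seq[where R = "%s'. s' = s0"])
  show "runs (Write 13 (Const 1) (Var 24)) s (wt (Write 13 (Const 1) (Var 24)) * (L + 1)) (%s'. s' = s0)"
  using s lo by (intro runs_wp) (simp add: s0_def)
  show "runs (For 27 (Const 2) (Var 35) ?c) s1
  ((hi - 1) * ((wt ?c + for_wt (Const 2) (Var 35)) * (L + 1)))
  (%s'. same {13, 27} s' s & (ALL i. 1 <= i --> i < hi --> s' 13 (int i) = int (root_exp N i)))"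
  if "s1 = s0" for s1
  unfolding that
  proof (rule runs_mono[OF loop])
  fix s'
  assume a: "same {13, 27} s' s0 & (ALL i. s' 13 (int i) = (if 2 <= i & i < hi
  then int (root_exp N i) else s0 13 (int i)))"
  have "s' 13 (int i) = int (root_exp N i)" if "1 <= i" "i < hi" for i
  using a[THEN conjunct2, rule_format, of i] that s0(3) by (cases "i = 1") auto
  thus "same {13, 27} s' s & (ALL i. 1 <= i --> i < hi --> s' 13 (int i) = int (root_exp N i))"
  using a s0(4) same_trans[of "{13, 27}" s' s0 "{13, 27}" s] by blast
  next
  have "hi - 2 + 1 = hi - 1" using lo by simp
  thus "(hi - 2 + 1) * ((wt ?c + for_wt (Const 2) (Var 35)) * (L + 1))
  <= (hi - 1) * ((wt ?c + for_wt (Const 2) (Var 35)) * (L + 1))" by (simp only: order_refl)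
  qed
  show "wt (Write 13 (Const 1) (Var 24)) * (L + 1) +
  (hi - 1) * ((wt ?c + for_wt (Const 2) (Var 35)) * (L + 1)) <= hi * (exps_wt * (L + 1))"
  unfolding exps_wt_def using lo(1) by (rule init_cost)
 qed
qed

definition red_var :: prog where
 "red_var = Assign 38 (Var 38 [-] ((Var 38 [>>] Var 24) [<<] Var 24) [-] (Var 38 [>>] Var 24))"

lemma wp_red_var [simp]:
 assumes "s 24 0 = int N" "N < 2 ^ L" "N <= L" "abs (s 38 0) < 2 ^ L"
 shows "wp L red_var Q s = (Q (s(38 := (s 38)(0 := red N (s 38 0)))))"
 using assms by (simp add: red_var_def red_def minus_div_mult_eq_mod)

text \<open>Cells shared by the programs of the multiplication: arrays 10 (operands), 11 (products),
  12 (scratch) and 13 (exponents of the roots); 20, 21, 22 hold the exponents \<open>t\<close>,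
  \<open>g\<close>, \<open>k\<close>, 24 holds \<open>N\<close>, 25 and 26 hold \<open>d\<close> and
  \<open>j\<close> with their powers of two in 37 and 36, and 34, 35 delimit the current loop. Here
  29 receives the side of the butterfly and 31 the exponent of its root.\<close>

definition node_vars :: prog where
 "node_vars = (Assign 28 (Var 27 [>>] Var 26) ;; Assign 30 (Var 28 [>>] Const 1) ;;
  Assign 29 (Var 28 [-] (Var 30 [<<] Const 1)) ;;
  Assign 30 (Var 30 [-] ((Var 30 [>>] Var 25) [<<] Var 25) [+] Var 37) ;;
  Assign 31 (Read 13 (Var 30 [<<] Const 1)))"

text \<open>The two halves with distance \<open>2 ^ j\<close> belong to the heap node
  \<open>2 ^ d + ...\<close>; the remainder modulo \<open>2 ^ d\<close> forgets which number is
  being transformed, so one loop serves all transforms of a level. The exponent is that of the left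
  child, the right child having the negative root.\<close>

definition twiddle :: "nat => nat => nat => nat => nat" where
 "twiddle N d j e = root_exp N (2 * (2 ^ d + (e div 2 ^ j div 2) mod 2 ^ d))"

lemma twiddle_less: "1 <= N ==> twiddle N d j e < N"
 using root_exp_less[of N "2 ^ d + (e div 2 ^ j div 2) mod 2 ^ d"]
 unfolding twiddle_def by (subst root_exp_even) (auto intro: trans_le_add1)

lemma wp_node_vars:
 assumes s: "s 27 0 = int e" "s 26 0 = int j" "s 25 0 = int d" "s 37 0 = 2 ^ d"
  and E: "s 13 (int (2 * (2 ^ d + (e div 2 ^ j div 2) mod 2 ^ d))) = int (twiddle N d j e)"
  and L: "e < 2 ^ L" "j <= L" "d + 2 <= L" "N < 2 ^ L" "1 <= N"
  and Q: "!!s'. same {28, 29, 30, 31} s' s ==> s' 29 0 = (if even (e div 2 ^ j) then 0 else 1) ==>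
  s' 31 0 = int (twiddle N d j e) ==> Q s'"
 shows "wp L node_vars Q s"
proof -
 define D :: nat where "D = 2 ^ d"
 define x where "x = e div 2 ^ j"
 define y where "y = x div 2"
 define z where "z = y mod 2 ^ d"
 define w where "w = twiddle N d j e"
 have x: "x < 2 ^ L" "int e div 2 ^ j = int x"
  using L(1) by (simp_all add: x_def zdiv_int) (meson div_le_dividend le_less_trans)
 have y: "y < 2 ^ L" "int x div 2 = int y" "int x - int y * 2 = (if even x then 0 else 1)"
  using x(1) parity_int[of x]  by (simp_all add: y_def zdiv_int)
 have z: "int y - int y div 2 ^ d * 2 ^ d = int z" by (simp add: z_def minus_div_mult_eq_mod zmod_int)
 have D: "s 37 0 = int D" using s by (simp add: D_def)
 have b: "j < 2 ^ L" "d < 2 ^ L" "w < 2 ^ L"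
  using L less_exp[of L] twiddle_less[of N d j e] unfolding w_def by linarith+
 have zD: "z + D < 2 ^ L"
 proof -
  have "z < 2 ^ d" by (simp add: z_def)
  hence "z + D < 2 ^ (d + 1)" by (simp add: D_def)
  also have "(2::nat) ^ (d + 1) <= 2 ^ L" using L by (intro power_increasing) auto
  finally show ?thesis .
 qed
 have E': "s 13 ((int z + int D) * 2) = int w"
  using E by (simp add: x_def y_def z_def D_def w_def algebra_simps)
 have "D < 2 ^ L" using zD by simp
 moreover have "int z + int D < 2 ^ L" using zD by (simp flip: of_nat_add)
 ultimately show ?thesis
  using s(1-3) D E' x y z b L(1-3)
  by (simp add: node_vars_def) (intro conjI impI Q; simp add: x_def w_def)
qed

text \<open>Every butterfly is evaluated twice, once for each of its outputs. The results go to
  array 12, since both inputs are needed again for the partner.\<close>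

definition fwd_body :: prog where
 "fwd_body = (node_vars ;;
  If (Var 29)
  (Assign 38 (Read 10 (Var 27 [-] Var 36) [-] (Read 10 (Var 27) [<<] Var 31)))
  (Assign 38 (Read 10 (Var 27) [+] (Read 10 (Var 27 [+] Var 36) [<<] Var 31))) ;;
  red_var ;; red_var ;; Write 12 (Var 27) (Var 38))"

definition fwd_loop :: prog where
 "fwd_loop = For 27 (Var 34) (Var 35) fwd_body"

definition fwd_wt :: nat where
 "fwd_wt = wt fwd_body + for_wt (Var 34) (Var 35)"

text \<open>One layer of the transform: \<open>d\<close> is the depth of the parents, \<open>2^j\<close> the distance of the
 two halves.\<close>

definition fwd :: "nat => nat => nat => (nat => int) => nat => int" where
 "fwd N d j a e = red N (red N (if even (e div 2 ^ j)
  then a e + a (e + 2 ^ j) * 2 ^ twiddle N d j e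
  else a (e - 2 ^ j) - a e * 2 ^ twiddle N d j e))"

text \<open>Division by 2 is multiplication by \<open>- (2 ^ (N - 1))\<close>, because
  \<open>2 * 2 ^ (N - 1)\<close> is -1. For the second half the power of two from the forward
  butterfly is removed at the same time, and the sign is absorbed by the order of the
  difference.\<close>

definition bwd :: "nat => nat => nat => (nat => int) => nat => int" where
 "bwd N d j a e = red N (red N (if even (e div 2 ^ j)
  then - (a e + a (e + 2 ^ j)) * 2 ^ (N - 1)
  else (a e - a (e - 2 ^ j)) * 2 ^ (N - 1 - twiddle N d j e)))"

lemma odd_div_ge: "odd (e div 2 ^ j) ==> 2 ^ j <= (e :: nat)"
 by (metis div_less even_zero linorder_not_less)

text \<open>As \<open>hi\<close> is a multiple of \<open>2 * 2 ^ j\<close>, no pair of halves is cut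
  by the end of the range, and the partner of an index in a first half stays inside.\<close>

lemma even_div_add_less:
 assumes "even (e div 2 ^ j)" "e < hi" "2 * 2 ^ j dvd hi"
 shows "e + 2 ^ j < (hi :: nat)"
proof -
 define J x where "J = (2::nat) ^ j" and "x = e div J"
 obtain q where q: "hi = 2 * J * q" using assms by (auto simp: J_def)
 have J: "0 < J" by (simp add: J_def)
 have "x < 2 * q" using assms(2) J unfolding x_def q by (simp add: less_mult_imp_div_less mult.commute mult.left_commute)
 moreover have "even x" using assms(1) by (simp add: x_def J_def)
 ultimately have "x + 2 <= 2 * q" by presburger
 hence "J * (x + 2) <= J * (2 * q)" by (rule mult_le_mono2)
 hence "J * (x + 2) <= hi" unfolding q by (simp only: mult.assoc mult.left_commute)
 moreover have "e < J * (x + 1)" using J unfolding x_def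
  by (metis Suc_eq_plus1 dividend_less_times_div mult_Suc_right add.commute)
 ultimately show ?thesis unfolding J_def[symmetric] by (simp add: algebra_simps)
qed

lemma odd_div_diff_ge:
 assumes "odd (e div 2 ^ j)" "lo <= e" "2 * 2 ^ j dvd lo"
 shows "lo <= e - (2::nat) ^ j"
proof -
 define J x where "J = (2::nat) ^ j" and "x = e div J"
 obtain q where q: "lo = 2 * J * q" using assms by (auto simp: J_def)
 have J: "0 < J" by (simp add: J_def)
 have "2 * q <= x" using div_le_mono[OF assms(2), of J] J unfolding x_def q by (simp add: mult.assoc)
 moreover have "odd x" using assms(1) by (simp add: x_def J_def)
 ultimately have "2 * q + 1 <= x" by presburger
 hence "J * (2 * q + 1) <= J * x" by (rule mult_le_mono2)
 also have "J * x <= e" unfolding x_def by simp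
 finally show ?thesis unfolding J_def[symmetric] q by (simp add: algebra_simps)
qed

text \<open>By \<open>4 <= N\<close> the excess 8 is at most half of \<open>2 ^ N\<close>. All
  combinations formed in a butterfly then stay below \<open>4 * 2 ^ (2 * N)\<close>, the range
  covered by two reductions.\<close>

lemma fwd_bound:
 fixes u v :: int
 assumes "abs u <= 2 ^ N + 8" "abs v <= 2 ^ N + 8" "w < N" "4 <= N"
 shows "abs (u + v * 2 ^ w) <= 2 ^ (2 * N + 2)" "abs (u - v * 2 ^ w) <= 2 ^ (2 * N + 2)"
  "abs ((u + v) * 2 ^ w) <= 2 ^ (2 * N + 2)" "abs ((u - v) * 2 ^ w) <= 2 ^ (2 * N + 2)"
proof -
 have N: "(2::int) ^ 4 <= 2 ^ N" using assms by (intro power_increasing) auto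
 have w: "(2::int) ^ w <= 2 ^ N" "(1::int) <= 2 ^ w" using assms by (intro power_increasing) auto
 have e: "(2::int) ^ (2 * N + 2) = 2 * 2 ^ N * (2 * 2 ^ N)" by (simp add: power_add power_even_eq power2_eq_square)
 have uv: "abs u <= 2 * 2 ^ N" "abs v <= 2 * 2 ^ N" "abs u + abs v <= 2 * 2 ^ N + 16" using assms N by auto
 have v: "abs (v * 2 ^ w) <= (2 ^ N + 8) * 2 ^ N" "abs u <= (2 ^ N + 8) * 2 ^ N"
  using assms w mult_mono[of "abs v" "2 ^ N + 8" "2 ^ w" "2 ^ N"] mult_mono[of "abs u" "2 ^ N + 8" "1" "2 ^ N"] N
  by (simp_all add: abs_mult)
 have "2 * ((2 ^ N + 8) * 2 ^ N) <= 2 * 2 ^ N * (2 * (2 :: int) ^ N)" using N by simp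
 thus "abs (u + v * 2 ^ w) <= 2 ^ (2 * N + 2)" "abs (u - v * 2 ^ w) <= 2 ^ (2 * N + 2)"
  unfolding e using v by linarith+
 have *: "abs (x * 2 ^ w) <= 2 ^ (2 * N + 2)" if "abs x <= abs u + abs v" for x
 proof -
  have "abs x <= 2 * (2 * 2 ^ N)" using that uv N by linarith
  hence "abs x * 2 ^ w <= 2 * (2 * 2 ^ N) * 2 ^ N" using w N by (intro mult_mono) auto
  thus ?thesis unfolding e abs_mult by simp
 qed
 show "abs ((u + v) * 2 ^ w) <= 2 ^ (2 * N + 2)" "abs ((u - v) * 2 ^ w) <= 2 ^ (2 * N + 2)"
  by (intro * abs_triangle_ineq abs_triangle_ineq4)+
qed

lemma red_less:
 assumes "abs x <= 2 ^ (2 * N + 2)" "2 * N + 4 <= L"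
 shows "abs x < 2 ^ L" "abs (red N x) < 2 ^ L" "abs (red N (red N x)) < 2 ^ L"
proof -
 have 1: "(2::int) ^ (2 * N + 4) <= 2 ^ L" using assms by (intro power_increasing) auto
 have e: "(2::int) ^ (2 * N + 2) = 2 ^ N * (4 * 2 ^ N)" "(2::int) ^ (2 * N + 4) = 4 * (2 ^ N * (4 * 2 ^ N))"
  by (simp_all add: power_add power_even_eq power2_eq_square)
 have N: "(1::int) <= 2 ^ N" by simp
 have N2: "(2::int) ^ N * 1 <= 2 ^ N * 2 ^ N" by (intro mult_left_mono) auto
 show "abs x < 2 ^ L" using assms(1) 1 N2 N unfolding e by linarith
 have "abs (red N x) <= 2 ^ N + 4 * 2 ^ N" using assms(1) unfolding e by (intro abs_red_le) simp
 thus "abs (red N x) < 2 ^ L" using 1 N N2 unfolding e by linarith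
 show "abs (red N (red N x)) < 2 ^ L"
  using abs_red_red_le[OF assms(1)] 1 N N2 unfolding e by linarith
qed

lemma runs_fwd_loop:
 assumes s: "s 34 0 = int lo" "s 35 0 = int hi" "s 24 0 = int N" "s 25 0 = int d" "s 26 0 = int j"
  "s 36 0 = 2 ^ j" "s 37 0 = 2 ^ d"
  and E: "!!i. 1 <= i ==> i < 2 * (2 * 2 ^ d) ==> s 13 (int i) = int (root_exp N i)"
  and A: "!!i. lo <= i ==> i < hi ==> abs (s 10 (int i)) <= 2 ^ N + 8"
  and dv: "2 * 2 ^ j dvd lo" "2 * 2 ^ j dvd hi"
  and L: "lo <= hi" "hi < 2 ^ L" "2 * N + 4 <= L" "4 <= N" "j + 1 <= L" "d + 2 <= L"
 shows "runs fwd_loop s ((hi - lo + 1) * (fwd_wt * (L + 1)))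
  (%s'. same {12, 27, 28, 29, 30, 31, 38} s' s & (ALL i. s' 12 (int i) = (if lo <= i & i < hi
  then fwd N d j (%i. s 10 (int i)) i else s 12 (int i))))"
 unfolding fwd_loop_def fwd_wt_def
proof (rule runs_map_vars_wp[where M = "{27, 28, 29, 30, 31, 38}"])
 fix e s1
 assume e: "lo <= e" "e < hi" and s1: "same {12, 27, 28, 29, 30, 31, 38} s1 s" "s1 27 0 = int e"
 define J :: nat where "J = 2 ^ j"
 note s1' = sameD[OF s1(1)]
 have JL: "J < 2 ^ L" unfolding J_def using L by simp
 have tw: "s1 13 (int (2 * (2 ^ d + (e div 2 ^ j div 2) mod 2 ^ d))) = int (twiddle N d j e)"
  unfolding twiddle_def s1'[of 13, simplified] by (intro E) (auto intro: trans_le_add1)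
 have twN: "twiddle N d j e < N" using L by (intro twiddle_less) simp
 have NL: "N < 2 ^ L" using less_exp[of L] L by linarith
 show "wp L fwd_body (%s'. same {12, 27, 28, 29, 30, 31, 38} s' s & s' 27 0 = int e &
  s' 12 (int e) = fwd N d j (%i. s 10 (int i)) e &
  (ALL i. i ~= e --> s' 12 (int i) = s1 12 (int i))) s1"
  unfolding fwd_body_def wp.simps(3)
 proof (rule wp_node_vars[OF s1(2) _ _ _ tw])
  fix s2
  assume s2: "same {28, 29, 30, 31} s2 s1" "s2 29 0 = (if even (e div 2 ^ j) then 0 else 1)"
  "s2 31 0 = int (twiddle N d j e)"
  note s2' = sameD[OF s2(1)]
  have v: "s2 27 0 = int e" "s2 24 0 = int N" "s2 36 0 = int J" "s2 10 = s 10" "s2 12 = s1 12"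
  using s s1(2) by (simp_all add: s1' s2' J_def)
  have sm: "same {12, 27, 28, 29, 30, 31, 38} s2 s" using s1(1) s2(1) by (auto simp: same_def)
  note twb = fwd_bound[OF _ _ twN L(4)]
  have eL: "e < 2 ^ L" "N <= L" "twiddle N d j e <= L" "twiddle N d j e < 2 ^ L" using e L twN NL by linarith+
  have Ae: "abs (s 10 (int e)) <= 2 ^ N + 8" using e by (intro A)
  have NL': "(2::int) ^ N + 8 < 2 ^ L"
  proof -
  have "(2::int) ^ N + 8 <= 2 ^ (N + 4)" by (rule two_power_add_8)
  also have "... < (2::int) ^ L" using L by (intro power_strict_increasing) auto
  finally show ?thesis .
  qed
  show "wp L (prog.If (Var 29) (Assign 38 (Read 10 (Var 27 [-] Var 36) [-] Read 10 (Var 27) [<<] Var 31))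
  (Assign 38 (Read 10 (Var 27) [+] Read 10 (Var 27 [+] Var 36) [<<] Var 31)))
  (wp L red_var (wp L red_var (wp L (Write 12 (Var 27) (Var 38))
  (%s'. same {12, 27, 28, 29, 30, 31, 38} s' s & s' 27 0 = int e &
  s' 12 (int e) = fwd N d j (%i. s 10 (int i)) e &
  (ALL i. i ~= e --> s' 12 (int i) = s1 12 (int i)))))) s2"
  proof (cases "even (e div 2 ^ j)")
  case True
  have A2: "abs (s 10 (int e + int J)) <= 2 ^ N + 8"
  using A[of "e + J"] e even_div_add_less[OF True e(2) dv(2)] by (simp add: J_def)
  note b = red_less[OF twb(1)[OF Ae A2] L(3)]
  show ?thesis
  using True v sm s2 eL b Ae A2 NL' NL JL by (simp add: wp_red_var[of _ N] fwd_def J_def)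
  next
  case False
  have J: "J <= e" using odd_div_ge[OF False] by (simp add: J_def)
  have A2: "abs (s 10 (int e - int J)) <= 2 ^ N + 8"
  using A[of "e - J"] e J odd_div_diff_ge[OF False e(1) dv(1)] by (simp add: of_nat_diff J_def)
  note b = red_less[OF twb(2)[OF A2 Ae] L(3)]
  show ?thesis
  using False v sm s2 eL b Ae A2 NL' NL JL J by (simp add: wp_red_var[of _ N] fwd_def J_def of_nat_diff)
  qed
 qed (use s L e NL in "simp_all add: s1'")
qed (use s L in simp_all)

definition bwd_body :: prog where
 "bwd_body = (node_vars ;;
  If (Var 29)
  (Assign 38 ((Read 11 (Var 27) [-] Read 11 (Var 27 [-] Var 36)) [<<] (Var 24 [-] Const 1 [-] Var 31)))
  (Assign 38 ((Const 0 [-] (Read 11 (Var 27) [+] Read 11 (Var 27 [+] Var 36))) [<<] (Var 24 [-] Const 1))) ;;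
  red_var ;; red_var ;; Write 12 (Var 27) (Var 38))"

definition bwd_loop :: prog where
 "bwd_loop = For 27 (Var 34) (Var 35) bwd_body"

definition bwd_wt :: nat where
 "bwd_wt = wt bwd_body + for_wt (Var 34) (Var 35)"

lemma runs_bwd_loop:
 assumes s: "s 34 0 = int lo" "s 35 0 = int hi" "s 24 0 = int N" "s 25 0 = int d" "s 26 0 = int j"
  "s 36 0 = 2 ^ j" "s 37 0 = 2 ^ d"
  and E: "!!i. 1 <= i ==> i < 2 * (2 * 2 ^ d) ==> s 13 (int i) = int (root_exp N i)"
  and A: "!!i. lo <= i ==> i < hi ==> abs (s 11 (int i)) <= 2 ^ N + 8"
  and dv: "2 * 2 ^ j dvd lo" "2 * 2 ^ j dvd hi"
  and L: "lo <= hi" "hi < 2 ^ L" "2 * N + 4 <= L" "4 <= N" "j + 1 <= L" "d + 2 <= L"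
 shows "runs bwd_loop s ((hi - lo + 1) * (bwd_wt * (L + 1)))
  (%s'. same {12, 27, 28, 29, 30, 31, 38} s' s & (ALL i. s' 12 (int i) = (if lo <= i & i < hi
  then bwd N d j (%i. s 11 (int i)) i else s 12 (int i))))"
 unfolding bwd_loop_def bwd_wt_def
proof (rule runs_map_vars_wp[where M = "{27, 28, 29, 30, 31, 38}"])
 fix e s1
 assume e: "lo <= e" "e < hi" and s1: "same {12, 27, 28, 29, 30, 31, 38} s1 s" "s1 27 0 = int e"
 define J :: nat where "J = 2 ^ j"
 note s1' = sameD[OF s1(1)]
 have JL: "J < 2 ^ L" unfolding J_def using L by simp
 have tw: "s1 13 (int (2 * (2 ^ d + (e div 2 ^ j div 2) mod 2 ^ d))) = int (twiddle N d j e)"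
  unfolding twiddle_def s1'[of 13, simplified] by (intro E) (auto intro: trans_le_add1)
 have twN: "twiddle N d j e < N" using L by (intro twiddle_less) simp
 have NL: "N < 2 ^ L" using less_exp[of L] L by linarith
 show "wp L bwd_body (%s'. same {12, 27, 28, 29, 30, 31, 38} s' s & s' 27 0 = int e &
  s' 12 (int e) = bwd N d j (%i. s 11 (int i)) e &
  (ALL i. i ~= e --> s' 12 (int i) = s1 12 (int i))) s1"
  unfolding bwd_body_def wp.simps(3)
 proof (rule wp_node_vars[OF s1(2) _ _ _ tw])
  fix s2
  assume s2: "same {28, 29, 30, 31} s2 s1" "s2 29 0 = (if even (e div 2 ^ j) then 0 else 1)"
  "s2 31 0 = int (twiddle N d j e)"
  note s2' = sameD[OF s2(1)]
  have v: "s2 27 0 = int e" "s2 24 0 = int N" "s2 36 0 = int J" "s2 11 = s 11" "s2 12 = s1 12"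
  using s s1(2) by (simp_all add: s1' s2' J_def)
  have sm: "same {12, 27, 28, 29, 30, 31, 38} s2 s" using s1(1) s2(1) by (auto simp: same_def)
  have N1: "N - 1 < N" "N - 1 - twiddle N d j e < N" using L by simp_all
  have eL: "e < 2 ^ L" "N <= L" "twiddle N d j e <= L" "twiddle N d j e < 2 ^ L" using e L twN NL by linarith+
  have nat_eq: "nat (int N - 1) = N - 1" "nat (int N - 1 - int (twiddle N d j e)) = N - 1 - twiddle N d j e"
  "int N <= 1 + int L" "int N <= 1 + (int (twiddle N d j e) + int L)"
  using twN eL by linarith+
  have Ae: "abs (s 11 (int e)) <= 2 ^ N + 8" using e by (intro A)
  have NL': "(2::int) ^ N + 8 < 2 ^ L"
  proof -
  have "(2::int) ^ N + 8 <= 2 ^ (N + 4)" by (rule two_power_add_8)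
  also have "... < (2::int) ^ L" using L by (intro power_strict_increasing) auto
  finally show ?thesis .
  qed
  show "wp L (prog.If (Var 29)
  (Assign 38 ((Read 11 (Var 27) [-] Read 11 (Var 27 [-] Var 36)) [<<] (Var 24 [-] Const 1 [-] Var 31)))
  (Assign 38 ((Const 0 [-] (Read 11 (Var 27) [+] Read 11 (Var 27 [+] Var 36))) [<<] (Var 24 [-] Const 1))))
  (wp L red_var (wp L red_var (wp L (Write 12 (Var 27) (Var 38))
  (%s'. same {12, 27, 28, 29, 30, 31, 38} s' s & s' 27 0 = int e &
  s' 12 (int e) = bwd N d j (%i. s 11 (int i)) e &
  (ALL i. i ~= e --> s' 12 (int i) = s1 12 (int i)))))) s2"
  proof (cases "even (e div 2 ^ j)")
  case True
  have A2: "abs (s 11 (int e + int J)) <= 2 ^ N + 8"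
  using A[of "e + J"] e even_div_add_less[OF True e(2) dv(2)] by (simp add: J_def)
  have "abs ((- (s 11 (int e) + s 11 (int e + int J))) * 2 ^ (N - 1)) <= 2 ^ (2 * N + 2)"
  unfolding mult_minus_left abs_minus_cancel by (rule fwd_bound(3)[OF Ae A2 N1(1) L(4)])
  note b = red_less[OF this L(3)]
  have eq: "- s 11 (int e) - s 11 (int e + int J) = - (s 11 (int e) + s 11 (int e + int J))" by simp
  show ?thesis
  using True v sm s2 eL b Ae A2 NL' NL JL nat_eq
  by (simp add: wp_red_var[of _ N] bwd_def J_def eq del: minus_add_distrib mult_minus_left)
  next
  case False
  have J: "J <= e" using odd_div_ge[OF False] by (simp add: J_def)
  have A2: "abs (s 11 (int e - int J)) <= 2 ^ N + 8"
  using A[of "e - J"] e J odd_div_diff_ge[OF False e(1) dv(1)] by (simp add: of_nat_diff J_def)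
  note b = red_less[OF fwd_bound(4)[OF Ae A2 N1(2) L(4)] L(3)]
  show ?thesis
  using False v sm s2 eL b Ae A2 NL' NL JL J nat_eq
  by (simp add: wp_red_var[of _ N] bwd_def J_def of_nat_diff)
  qed
 qed (use s L e NL in "simp_all add: s1'")
qed (use s L in simp_all)

definition copy_loop :: "nat => prog" where
 "copy_loop k = For 27 (Var 34) (Var 35) (Write k (Var 27) (Read 12 (Var 27)))"

definition copy_wt :: nat where
 "copy_wt = wt (Write 0 (Var 27) (Read 12 (Var 27))) + for_wt (Var 34) (Var 35)"

lemma runs_copy_loop:
 assumes k: "k : {10, 11}"
  and s: "s 34 0 = int lo" "s 35 0 = int hi"
  and L: "lo <= hi" "hi < 2 ^ L"
  and A: "!!e. lo <= e ==> e < hi ==> abs (s 12 (int e)) < 2 ^ L"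
 shows "runs (copy_loop k) s ((hi - lo + 1) * (copy_wt * (L + 1)))
  (%s'. same {k, 27} s' s & (ALL i. s' k (int i) = (if lo <= i & i < hi then s 12 (int i) else s k (int i))))"
proof -
 have wt: "wt (Write 0 (Var 27) (Read 12 (Var 27))) = wt (Write k (Var 27) (Read 12 (Var 27)))"
  by simp
 show ?thesis
 unfolding copy_loop_def copy_wt_def wt
 proof (rule runs_map_vars_wp)
  fix e s1
  assume e: "lo <= e" "e < hi" and s1: "same {k, 27} s1 s" "s1 27 0 = int e"
  have "s1 12 = s 12" using sameD[OF s1(1), of 12] k by auto
  thus "wp L (Write k (Var 27) (Read 12 (Var 27))) (%s'. same {k, 27} s' s & s' 27 0 = int e &
  s' k (int e) = s 12 (int e) & (ALL i. i ~= e --> s' k (int i) = s1 k (int i))) s1"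
  using s1 e L A[of e] k by auto
 qed (use s L k in auto)
qed

text \<open>The first factors fill one half of the next heap level and the second factors the other
  half, so the factors of the product at \<open>e\<close> stand at \<open>e + lo\<close> and
  \<open>e + 2 * lo\<close>.\<close>

definition prod_loop :: prog where
 "prod_loop = For 27 (Var 34) (Var 35)
  (Write 11 (Var 27) (Op Times (Read 10 (Var 27 [+] Var 34)) (Read 10 (Var 27 [+] Var 34 [+] Var 34))))"

definition prod_wt :: nat where
 "prod_wt = wt (Write 11 (Var 27) (Op Times (Read 10 (Var 27 [+] Var 34)) (Read 10 (Var 27 [+] Var 34 [+] Var 34))))
  + for_wt (Var 34) (Var 35)"

lemma runs_prod_loop:
 assumes s: "s 34 0 = int lo" "s 35 0 = int hi"
  and L: "lo <= hi" "hi < 2 ^ L" "1156 <= L"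
  and A: "!!e. 2 * lo <= e ==> e < hi + 2 * lo ==> abs (s 10 (int e)) < 2 ^ 33"
 shows "runs prod_loop s ((hi - lo + 1) * (prod_wt * (L + 1)))
  (%s'. same {11, 27} s' s & (ALL i. s' 11 (int i) = (if lo <= i & i < hi
  then s 10 (int (i + lo)) * s 10 (int (i + 2 * lo)) else s 11 (int i))))"
 unfolding prod_loop_def prod_wt_def
proof (rule runs_map_vars_wp)
 fix e s1
 assume e: "lo <= e" "e < hi" and s1: "same {11, 27} s1 s" "s1 27 0 = int e"
 have "s1 10 = s 10" "s1 34 0 = int lo" using sameD[OF s1(1), of 10] sameD[OF s1(1), of 34] s by auto
 moreover have "abs (s 10 (int (e + lo))) < 2 ^ 33" "abs (s 10 (int (e + 2 * lo))) < 2 ^ 33"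
  using e A[of "e + lo"] A[of "e + 2 * lo"] by simp_all
 \<comment> \<open>The condition \<open>small\<close> admits a product only if the product of the
   lengths is at most \<open>L\<close>; 34 * 34 = 1156 explains the bound assumed for
   \<open>L\<close>.\<close>
 moreover have "len (s 10 (int (e + lo))) * len (s 10 (int (e + 2 * lo))) <= (33 + 1) * (33 + 1)"
  by (intro mult_mono len_le calculation) auto
 moreover have "(2::int) ^ 33 <= 2 ^ L" using L by (intro power_increasing) auto
 ultimately show "wp L (Write 11 (Var 27) (Op Times (Read 10 (Var 27 [+] Var 34)) (Read 10 (Var 27 [+] Var 34 [+] Var 34))))
  (%s'. same {11, 27} s' s & s' 27 0 = int e &
  s' 11 (int e) = s 10 (int (e + lo)) * s 10 (int (e + 2 * lo)) & (ALL i. i ~= e --> s' 11 (int i) = s1 11 (int i))) s1"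
  using s1 e L by (simp add: algebra_simps)
qed (use s L in auto)

text \<open>The balanced representative modulo \<open>2 ^ N + 1\<close>. A single correction
  suffices where it is applied, since the residues there are at most \<open>2 ^ N + 8\<close> in
  absolute value.\<close>

definition centre :: "nat => int => int" where
 "centre N x = (if 2 ^ (N - 1) < x then x - (2 ^ N + 1) else if x < - (2 ^ (N - 1)) then x + (2 ^ N + 1) else x)"

definition sym_loop :: prog where
 "sym_loop = For 27 (Var 34) (Var 35)
  (Assign 28 (Read 11 (Var 27)) ;;
  If (Var 39 [<] Var 28) (Write 11 (Var 27) (Var 28 [-] Var 40))
  (If (Var 28 [<] (Const 0 [-] Var 39)) (Write 11 (Var 27) (Var 28 [+] Var 40))
  (Write 11 (Var 27) (Var 28))))"

definition sym_wt :: nat where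
 "sym_wt = wt (Assign 28 (Read 11 (Var 27)) ;;
  If (Var 39 [<] Var 28) (Write 11 (Var 27) (Var 28 [-] Var 40))
  (If (Var 28 [<] (Const 0 [-] Var 39)) (Write 11 (Var 27) (Var 28 [+] Var 40))
  (Write 11 (Var 27) (Var 28)))) + for_wt (Var 34) (Var 35)"

lemma runs_sym_loop:
 assumes s: "s 34 0 = int lo" "s 35 0 = int hi" "s 39 0 = 2 ^ (N - 1)" "s 40 0 = 2 ^ N + 1"
  and L: "lo <= hi" "hi < 2 ^ L" "N + 2 <= L"
  and A: "!!e. lo <= e ==> e < hi ==> abs (s 11 (int e)) < 2 ^ L"
 shows "runs sym_loop s ((hi - lo + 1) * (sym_wt * (L + 1)))
  (%s'. same {11, 27, 28} s' s & (ALL i. s' 11 (int i) = (if lo <= i & i < hi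
  then centre N (s 11 (int i)) else s 11 (int i))))"
 unfolding sym_loop_def sym_wt_def
proof (rule runs_map_vars_wp[where M = "{27, 28}"])
 fix e s1
 assume e: "lo <= e" "e < hi" and s1: "same {11, 27, 28} s1 s" "s1 27 0 = int e"
  and W: "!!i. s1 11 (int i) = (if lo <= i & i < e then centre N (s 11 (int i)) else s 11 (int i))"
 have v: "s1 11 (int e) = s 11 (int e)" "s1 39 0 = 2 ^ (N - 1)" "s1 40 0 = 2 ^ N + 1"
  using sameD[OF s1(1), of 39] sameD[OF s1(1), of 40] s W by auto
 have b: "(2::int) ^ (N - 1) < 2 ^ L" "(2::int) ^ (N + 1) < 2 ^ L" using L by (intro power_strict_increasing; simp)+
 have "(2::int) ^ N + 1 < 2 ^ L" using b(2) int_one_le_two_power[of N] unfolding power_add power_one_right by linarith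
 thus "wp L (Assign 28 (Read 11 (Var 27)) ;;
  If (Var 39 [<] Var 28) (Write 11 (Var 27) (Var 28 [-] Var 40))
  (If (Var 28 [<] (Const 0 [-] Var 39)) (Write 11 (Var 27) (Var 28 [+] Var 40))
  (Write 11 (Var 27) (Var 28)))) (%s'. same {11, 27, 28} s' s & s' 27 0 = int e &
  s' 11 (int e) = centre N (s 11 (int e)) & (ALL i. i ~= e --> s' 11 (int i) = s1 11 (int i))) s1"
  using s1 e L A[of e] v b by (auto simp: centre_def)
qed (use s L in auto)

definition join_loop :: prog where
 "join_loop = For 27 (Var 34) (Var 35) (Write 11 (Var 27)
  (Read 11 (Var 27 [+] Var 27) [+] (Read 11 (Var 27 [+] Var 27 [+] Const 1) [<<] Var 33)))"

definition join_wt :: nat where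
 "join_wt = wt (Write 11 (Var 27)
  (Read 11 (Var 27 [+] Var 27) [+] (Read 11 (Var 27 [+] Var 27 [+] Const 1) [<<] Var 33)))
  + for_wt (Var 34) (Var 35)"

lemma runs_join_loop:
 assumes s: "s 34 0 = int lo" "s 35 0 = int hi" "s 33 0 = int h"
  and L: "lo <= hi" "hi < 2 ^ L" "h <= L" "hi <= 2 * lo"
  and A: "!!e. 2 * lo <= e ==> e < 2 * hi ==> abs (s 11 (int e)) < 2 ^ L"
 shows "runs join_loop s ((hi - lo + 1) * (join_wt * (L + 1)))
  (%s'. same {11, 27} s' s & (ALL i. s' 11 (int i) = (if lo <= i & i < hi
  then s 11 (int (2 * i)) + s 11 (int (2 * i + 1)) * 2 ^ h else s 11 (int i))))"
 unfolding join_loop_def join_wt_def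
proof (rule runs_map_vars_wp)
 fix e s1
 assume e: "lo <= e" "e < hi" and s1: "same {11, 27} s1 s" "s1 27 0 = int e"
  and W: "!!i. s1 11 (int i) = (if lo <= i & i < e
  then s 11 (int (2 * i)) + s 11 (int (2 * i + 1)) * 2 ^ h else s 11 (int i))"
 have "s1 11 (int (2 * e)) = s 11 (int (2 * e))" "s1 11 (int (2 * e + 1)) = s 11 (int (2 * e + 1))"
  "s1 33 0 = int h" unfolding W using sameD[OF s1(1), of 33] s e by auto
 moreover have "h < 2 ^ L" using L less_exp[of L] by linarith
 moreover have "abs (s 11 (int (2 * e))) < 2 ^ L" "abs (s 11 (int (2 * e + 1))) < 2 ^ L" using e by (intro A; simp)+
 ultimately show "wp L (Write 11 (Var 27)
  (Read 11 (Var 27 [+] Var 27) [+] (Read 11 (Var 27 [+] Var 27 [+] Const 1) [<<] Var 33)))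
  (%s'. same {11, 27} s' s & s' 27 0 = int e &
  s' 11 (int e) = s 11 (int (2 * e)) + s 11 (int (2 * e + 1)) * 2 ^ h &
  (ALL i. i ~= e --> s' 11 (int i) = s1 11 (int i))) s1"
  using s1 e L by (simp add: add.commute flip: mult_2)
qed (use s L in auto)

definition red_loop :: prog where
 "red_loop = For 27 (Var 34) (Var 35)
  (Assign 38 (Read 11 (Var 27)) ;; red_var ;; red_var ;; Write 11 (Var 27) (Var 38))"

definition red_wt :: nat where
 "red_wt = wt (Assign 38 (Read 11 (Var 27)) ;; red_var ;; red_var ;; Write 11 (Var 27) (Var 38))
  + for_wt (Var 34) (Var 35)"

lemma runs_red_loop:
 assumes s: "s 34 0 = int lo" "s 35 0 = int hi" "s 24 0 = int N"
  and L: "lo <= hi" "hi < 2 ^ L" "2 * N + 4 <= L"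
  and A: "!!e. lo <= e ==> e < hi ==> abs (s 11 (int e)) <= 2 ^ (2 * N + 2)"
 shows "runs red_loop s ((hi - lo + 1) * (red_wt * (L + 1)))
  (%s'. same {11, 27, 38} s' s & (ALL i. s' 11 (int i) = (if lo <= i & i < hi
  then red N (red N (s 11 (int i))) else s 11 (int i))))"
 unfolding red_loop_def red_wt_def
proof (rule runs_map_vars_wp[where M = "{27, 38}"])
 fix e s1
 assume e: "lo <= e" "e < hi" and s1: "same {11, 27, 38} s1 s" "s1 27 0 = int e"
  and W: "!!i. s1 11 (int i) = (if lo <= i & i < e then red N (red N (s 11 (int i))) else s 11 (int i))"
 have v: "s1 11 (int e) = s 11 (int e)" "s1 24 0 = int N"
  using sameD[OF s1(1), of 24] s W by auto
 have "N <= L" "N < 2 ^ L" using L less_exp[of L] by linarith+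
 thus "wp L (Assign 38 (Read 11 (Var 27)) ;; red_var ;; red_var ;; Write 11 (Var 27) (Var 38))
  (%s'. same {11, 27, 38} s' s & s' 27 0 = int e &
  s' 11 (int e) = red N (red N (s 11 (int e))) & (ALL i. i ~= e --> s' 11 (int i) = s1 11 (int i))) s1"
  using s1 e L red_less[OF A[OF e] L(3)] v by (simp add: wp_red_var[of _ N])
qed (use s L in auto)

section \<open>Correctness of the transform, layer by layer\<close>

definition transf :: "nat => nat => nat => nat => (nat => int) => (nat => int) => bool" where
 "transf N k p d x a = ((ALL B < 2 ^ d. ALL i < 2 ^ (k - d).
  [a (p * 2 ^ k + B * 2 ^ (k - d) + i) = residue N k x d (2 ^ d + B) i] (mod 2 ^ N + 1)))"

lemma transf_0: "transf N k p 0 (%i. a (p * 2 ^ k + i)) a"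
 by (simp add: transf_def residue_def)

lemma transf_cong:
 assumes "transf N k p d x a" "d <= k" "!!e. p * 2 ^ k <= e ==> e < (p + 1) * 2 ^ k ==> a' e = a e"
 shows "transf N k p d x a'"
 unfolding transf_def
proof (intro allI impI)
 fix B i :: nat
 assume B: "B < 2 ^ d" and i: "i < 2 ^ (k - d)"
 have "(B + 1) * 2 ^ (k - d) <= 2 ^ d * 2 ^ (k - d)" using B by (intro mult_right_mono) auto
 also have "(2::nat) ^ d * 2 ^ (k - d) = 2 ^ k" using assms(2) by (simp flip: power_add)
 finally have "B * 2 ^ (k - d) + i < 2 ^ k" using i by simp
 hence "a' (p * 2 ^ k + B * 2 ^ (k - d) + i) = a (p * 2 ^ k + B * 2 ^ (k - d) + i)"
  by (intro assms(3)) auto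
 thus "[a' (p * 2 ^ k + B * 2 ^ (k - d) + i) = residue N k x d (2 ^ d + B) i] (mod 2 ^ N + 1)"
  using assms(1) B i unfolding transf_def by simp
qed

text \<open>The index is read in binary: the number \<open>p\<close>, then the block
  \<open>B\<close> of depth \<open>Suc d\<close>, then the position \<open>i\<close> in the block.
  The lowest bit of \<open>B\<close> separates the two halves of a butterfly, the other bits of
  \<open>B\<close> are the parent.\<close>

lemma leaf_index:
 fixes p :: nat
 assumes "d < k" "B < 2 * 2 ^ d" "i < 2 ^ (k - Suc d)"
 defines "e == p * 2 ^ k + B * 2 ^ (k - Suc d) + i"
 shows "even (e div 2 ^ (k - Suc d)) = (even B)"
  and "e div 2 ^ (k - Suc d) div 2 mod 2 ^ d = B div 2"
  and "e < (p + 1) * 2 ^ k"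
proof -
 define m where "m = (2::nat) ^ (k - Suc d)"
 have m: "(2::nat) ^ k = 2 * (2 ^ d * m)" using assms(1)
  by (simp add: m_def flip: power_add power_Suc)
 have e: "e = (2 * (p * 2 ^ d) + B) * m + i" unfolding e_def m_def[symmetric] m by (simp add: algebra_simps)
 have "i < m" using assms(3) by (simp add: m_def)
 hence ed: "e div m = 2 * (p * 2 ^ d) + B" unfolding e by simp
 thus "even (e div 2 ^ (k - Suc d)) = (even B)" by (simp add: m_def)
 have "(2 * (p * 2 ^ d) + B) div 2 = p * 2 ^ d + B div 2" by simp
 thus "e div 2 ^ (k - Suc d) div 2 mod 2 ^ d = B div 2"
  using ed assms(2) unfolding m_def[symmetric] by (simp add: less_mult_imp_div_less mult.commute)
 have "(B + 1) * m <= (2 * 2 ^ d) * m" using assms(2) by (intro mult_right_mono) auto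
 thus "e < (p + 1) * 2 ^ k" unfolding e m using `i < m` by (simp add: algebra_simps)
qed

text \<open>Entries are known only up to congruence, which the lazy reductions respect. The two
  outputs of a butterfly are the remainders of the residue at a node modulo the factors of its two
  children.\<close>

lemma transf_fwd:
 assumes tr: "transf (2 ^ t) k p d x a" and d: "d < k" "k <= t"
  and a': "!!e. p * 2 ^ k <= e ==> e < (p + 1) * 2 ^ k ==> a' e = fwd (2 ^ t) d (k - Suc d) a e"
 shows "transf (2 ^ t) k p (Suc d) x a'"
 unfolding transf_def
proof (intro allI impI)
 let ?F = "2 ^ 2 ^ t + 1 :: int"
 fix B' i :: nat
 assume B': "B' < 2 ^ Suc d" and i: "i < 2 ^ (k - Suc d)"
 define m where "m = (2::nat) ^ (k - Suc d)"
 have m: "2 ^ (k - d) = 2 * m" using d by (simp add: m_def Suc_diff_Suc flip: power_Suc)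
 have "B' < 2 * 2 ^ d" using B' by simp
 note li = leaf_index[OF d(1) this i, of p]
 define B where "B = B' div 2"
 define e where "e = p * 2 ^ k + B' * m + i"
 have B: "B < 2 ^ d" using B' by (simp add: B_def less_mult_imp_div_less mult.commute)
 have tw: "twiddle (2 ^ t) d (k - Suc d) e = root_exp (2 ^ t) (2 * (2 ^ d + B))"
  unfolding twiddle_def e_def m_def B_def li(2) ..
 have node: "2 ^ d <= 2 ^ d + B" "2 ^ d + B < 2 ^ Suc d" "d < t" using B d by simp_all
 have tr': "[a (p * 2 ^ k + B * (2 * m) + i') = residue (2 ^ t) k x d (2 ^ d + B) i'] (mod ?F)" if "i' < 2 * m" for i'
  using tr B that unfolding transf_def m by blast
 have "[a' e = residue (2 ^ t) k x (Suc d) (2 ^ Suc d + B') i] (mod ?F)"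
 proof (cases "even B'")
  case True
  hence BB: "B' = 2 * B" by (simp add: B_def)
  have "a' e = red (2 ^ t) (red (2 ^ t) (a e + a (e + m) * rt (2 ^ t) (2 * (2 ^ d + B))))"
  using a'[of e] li True unfolding fwd_def tw m_def[symmetric] e_def[symmetric] by (simp add: e_def)
  also have "[... = a e + a (e + m) * rt (2 ^ t) (2 * (2 ^ d + B))] (mod ?F)" by (rule red_red_cong)
  also have "[a e + a (e + m) * rt (2 ^ t) (2 * (2 ^ d + B)) = residue (2 ^ t) k x d (2 ^ d + B) i
  + residue (2 ^ t) k x d (2 ^ d + B) (i + m) * rt (2 ^ t) (2 * (2 ^ d + B))] (mod ?F)"
  using tr'[of i] tr'[of "i + m"] i unfolding e_def BB m_def[symmetric]
  by (intro cong_add cong_mult cong_refl) (simp_all add: algebra_simps)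
  also have "[residue (2 ^ t) k x d (2 ^ d + B) i
  + residue (2 ^ t) k x d (2 ^ d + B) (i + m) * rt (2 ^ t) (2 * (2 ^ d + B))
  = residue (2 ^ t) k x (Suc d) (2 * (2 ^ d + B)) i] (mod ?F)"
  using residue_even[OF node d(1), of x i] unfolding m_def by (simp add: cong_sym_eq mult.commute)
  finally show ?thesis by (simp add: BB)
 next
  case False
  hence BB: "B' = 2 * B + 1" by (simp add: B_def)
  have em: "e - m = p * 2 ^ k + B * (2 * m) + i" "e = p * 2 ^ k + B * (2 * m) + (i + m)"
  by (simp_all add: e_def BB algebra_simps)
  have "a' e = red (2 ^ t) (red (2 ^ t) (a (e - m) - a e * rt (2 ^ t) (2 * (2 ^ d + B))))"
  using a'[of e] li False unfolding fwd_def tw m_def[symmetric] e_def[symmetric] by (simp add: e_def)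
  also have "[... = a (e - m) - a e * rt (2 ^ t) (2 * (2 ^ d + B))] (mod ?F)" by (rule red_red_cong)
  also have "[a (e - m) - a e * rt (2 ^ t) (2 * (2 ^ d + B)) = residue (2 ^ t) k x d (2 ^ d + B) i
  - residue (2 ^ t) k x d (2 ^ d + B) (i + m) * rt (2 ^ t) (2 * (2 ^ d + B))] (mod ?F)"
  unfolding em(1) using tr'[of i] tr'[of "i + m"] i unfolding em(2)[symmetric] m_def[symmetric]
  by (intro cong_diff cong_mult cong_refl) simp_all
  also have "[residue (2 ^ t) k x d (2 ^ d + B) i
  - residue (2 ^ t) k x d (2 ^ d + B) (i + m) * rt (2 ^ t) (2 * (2 ^ d + B))
  = residue (2 ^ t) k x (Suc d) (2 * (2 ^ d + B) + 1) i] (mod ?F)"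
  using residue_odd[OF node d(1), of x i] unfolding m_def by (simp add: cong_sym_eq mult.commute)
  finally show ?thesis by (simp add: BB)
 qed
 thus "[a' (p * 2 ^ k + B' * 2 ^ (k - Suc d) + i) = residue (2 ^ t) k x (Suc d) (2 ^ Suc d + B') i] (mod ?F)"
  by (simp add: e_def m_def)
qed

text \<open>Siblings hold \<open>r i + 2 ^ w * r (i + m)\<close> and
  \<open>r i - 2 ^ w * r (i + m)\<close> for the residue \<open>r\<close> of the parent; sum and
  difference give both entries back.\<close>

lemma transf_bwd:
 assumes tr: "transf (2 ^ t) k p (Suc d) x a" and d: "d < k" "k <= t"
  and a': "!!e. p * 2 ^ k <= e ==> e < (p + 1) * 2 ^ k ==> a' e = bwd (2 ^ t) d (k - Suc d) a e"
 shows "transf (2 ^ t) k p d x a'"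
 unfolding transf_def
proof (intro allI impI)
 let ?F = "2 ^ 2 ^ t + 1 :: int"
 fix B i :: nat
 assume B: "B < 2 ^ d" and i: "i < 2 ^ (k - d)"
 define m where "m = (2::nat) ^ (k - Suc d)"
 have m: "2 ^ (k - d) = 2 * m" using d by (simp add: m_def Suc_diff_Suc flip: power_Suc)
 define r where "r = residue (2 ^ t) k x d (2 ^ d + B)"
 define w where "w = root_exp (2 ^ t) (2 * (2 ^ d + B))"
 have node: "2 ^ d <= 2 ^ d + B" "2 ^ d + B < 2 ^ Suc d" "d < t" using B d by simp_all
 have w: "w < 2 ^ t" using twiddle_less[of "2 ^ t" d 0 "2 * B"] B by (simp add: twiddle_def w_def)
 have c1: "[a (p * 2 ^ k + 2 * B * m + i') = r i' + 2 ^ w * r (i' + m)] (mod ?F)" if "i' < m" for i'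
 proof -
  have "[a (p * 2 ^ k + 2 * B * m + i') = residue (2 ^ t) k x (Suc d) (2 ^ Suc d + 2 * B) i'] (mod ?F)"
  using tr B that unfolding transf_def m_def by simp
  also have "[residue (2 ^ t) k x (Suc d) (2 ^ Suc d + 2 * B) i' = r i' + 2 ^ w * r (i' + m)] (mod ?F)"
  using residue_even[OF node d(1), of x i'] unfolding m_def r_def w_def by simp
  finally show ?thesis .
 qed
 have c2: "[a (p * 2 ^ k + (2 * B + 1) * m + i') = r i' - 2 ^ w * r (i' + m)] (mod ?F)" if "i' < m" for i'
 proof -
  have "[a (p * 2 ^ k + (2 * B + 1) * m + i') = residue (2 ^ t) k x (Suc d) (2 ^ Suc d + (2 * B + 1)) i'] (mod ?F)"
  using tr[unfolded transf_def, rule_format, of "2 * B + 1" i'] B that unfolding m_def by simp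
  also have "[residue (2 ^ t) k x (Suc d) (2 ^ Suc d + (2 * B + 1)) i' = r i' - 2 ^ w * r (i' + m)] (mod ?F)"
  using residue_odd[OF node d(1), of x i'] unfolding m_def r_def w_def by simp
  finally show ?thesis .
 qed
 \<comment> \<open>In both cases below the collected factors amount to \<open>- (2 ^ 2 ^ t)\<close>,
   which is 1 in this ring.\<close>
 have F: "[- (2 ^ 2 ^ t) * y = y] (mod ?F)" for y :: int
  using cong_mult[OF cong_uminus[OF two_pow_cong[of "2 ^ t"]] cong_refl, of y] by simp
 define e where "e = p * 2 ^ k + B * (2 * m) + i"
 have "[a' e = r i] (mod ?F)"
 proof (cases "i < m")
  case True
  have B2: "2 * B < 2 * 2 ^ d" using B by simp
  have e: "e = p * 2 ^ k + (2 * B) * m + i" by (simp add: e_def)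
  note li = leaf_index[OF d(1) B2 True[unfolded m_def], of p, folded m_def, folded e]
  have "a' e = red (2 ^ t) (red (2 ^ t) (- (a e + a (e + m)) * 2 ^ (2 ^ t - 1)))"
  using a'[of e] li unfolding bwd_def m_def[symmetric] by (simp add: e)
  also have "[... = - (a e + a (e + m)) * 2 ^ (2 ^ t - 1)] (mod ?F)" by (rule red_red_cong)
  also have "e + m = p * 2 ^ k + (2 * B + 1) * m + i" by (simp add: e algebra_simps)
  also have "[- (a e + a (p * 2 ^ k + (2 * B + 1) * m + i)) * 2 ^ (2 ^ t - 1)
  = - ((r i + 2 ^ w * r (i + m)) + (r i - 2 ^ w * r (i + m))) * 2 ^ (2 ^ t - 1)] (mod ?F)"
  unfolding e by (intro cong_mult cong_refl cong_uminus cong_add c1 c2 True)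
  also have "- ((r i + 2 ^ w * r (i + m)) + (r i - 2 ^ w * r (i + m))) * 2 ^ (2 ^ t - 1)
  = - (2 * 2 ^ (2 ^ t - 1)) * r i" by (simp add: algebra_simps)
  also have "(2::int) * 2 ^ (2 ^ t - 1) = 2 ^ 2 ^ t" by (simp flip: power_Suc)
  also note F
  finally show ?thesis .
 next
  case False
  define i' where "i' = i - m"
  have i': "i' < m" "i = i' + m" using False i m by (auto simp: i'_def)
  have B2: "2 * B + 1 < 2 * 2 ^ d" using B by simp
  have e: "e = p * 2 ^ k + (2 * B + 1) * m + i'" by (simp add: e_def i' algebra_simps)
  note li = leaf_index[OF d(1) B2 i'(1)[unfolded m_def], of p, folded m_def, folded e]
  have tw: "twiddle (2 ^ t) d (k - Suc d) e = w"
  using li(2) unfolding twiddle_def m_def w_def by simp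
  have "a' e = red (2 ^ t) (red (2 ^ t) ((a e - a (e - m)) * 2 ^ (2 ^ t - 1 - w)))"
  using a'[of e] li unfolding bwd_def m_def[symmetric] tw by (simp add: e)
  also have "[... = (a e - a (e - m)) * 2 ^ (2 ^ t - 1 - w)] (mod ?F)" by (rule red_red_cong)
  also have "e - m = p * 2 ^ k + 2 * B * m + i'" by (simp add: e algebra_simps)
  also have "[(a e - a (p * 2 ^ k + 2 * B * m + i')) * 2 ^ (2 ^ t - 1 - w)
  = ((r i' - 2 ^ w * r (i' + m)) - (r i' + 2 ^ w * r (i' + m))) * 2 ^ (2 ^ t - 1 - w)] (mod ?F)"
  unfolding e by (intro cong_mult cong_refl cong_diff c1 c2 i')
  also have "((r i' - 2 ^ w * r (i' + m)) - (r i' + 2 ^ w * r (i' + m))) * 2 ^ (2 ^ t - 1 - w)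
  = - (2 * 2 ^ w * 2 ^ (2 ^ t - 1 - w)) * r i" by (simp add: algebra_simps i')
  also have "(2::int) * 2 ^ w * 2 ^ (2 ^ t - 1 - w) = 2 ^ 2 ^ t"
  using w by (simp flip: power_Suc power_add)
  also note F
  finally show ?thesis .
 qed
 thus "[a' (p * 2 ^ k + B * 2 ^ (k - d) + i) = residue (2 ^ t) k x d (2 ^ d + B) i] (mod ?F)"
  unfolding m e_def r_def .
qed

lemma abs_fwd_le:
 assumes a: "!!i. lo <= i ==> i < hi ==> abs (a i) <= 2 ^ N + 8" and N: "4 <= N"
  and e: "lo <= e" "e < hi" "2 * 2 ^ j dvd lo" "2 * 2 ^ j dvd hi"
 shows "abs (fwd N d j a e) <= 2 ^ N + 8"
proof (cases "even (e div 2 ^ j)")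
 case True
 have "twiddle N d j e < N" using N by (intro twiddle_less) simp
 hence "abs (a e + a (e + 2 ^ j) * 2 ^ twiddle N d j e) <= 2 ^ (2 * N + 2)"
  using even_div_add_less[OF True e(2,4)] e N by (intro fwd_bound(1) a) auto
 thus ?thesis using True unfolding fwd_def by (auto intro!: abs_red_red_le)
next
 case False
 have "twiddle N d j e < N" using N by (intro twiddle_less) simp
 hence "abs (a (e - 2 ^ j) - a e * 2 ^ twiddle N d j e) <= 2 ^ (2 * N + 2)"
  using odd_div_diff_ge[OF False e(1,3)] e N by (intro fwd_bound(2) a) auto
 thus ?thesis using False unfolding fwd_def by (auto intro!: abs_red_red_le)
qed

lemma abs_bwd_le:
 assumes a: "!!i. lo <= i ==> i < hi ==> abs (a i) <= 2 ^ N + 8" and N: "4 <= N"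
  and e: "lo <= e" "e < hi" "2 * 2 ^ j dvd lo" "2 * 2 ^ j dvd hi"
 shows "abs (bwd N d j a e) <= 2 ^ N + 8"
proof (cases "even (e div 2 ^ j)")
 case True
 have "N - 1 < N" using N by simp
 hence "abs ((a e + a (e + 2 ^ j)) * 2 ^ (N - 1)) <= 2 ^ (2 * N + 2)"
  using even_div_add_less[OF True e(2,4)] e N by (intro fwd_bound(3) a) auto
 hence "abs (- (a e + a (e + 2 ^ j)) * 2 ^ (N - 1)) <= 2 ^ (2 * N + 2)"
  unfolding mult_minus_left abs_minus_cancel .
 thus ?thesis using True unfolding bwd_def by (auto intro!: abs_red_red_le)
next
 case False
 have "N - 1 - twiddle N d j e < N" using N by simp
 hence "abs ((a e - a (e - 2 ^ j)) * 2 ^ (N - 1 - twiddle N d j e)) <= 2 ^ (2 * N + 2)"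
  using odd_div_diff_ge[OF False e(1,3)] e N by (intro fwd_bound(4) a) auto
 thus ?thesis using False unfolding bwd_def by (auto intro!: abs_red_red_le)
qed

section \<open>Complete transforms, cutting into digits and joining of digits\<close>

definition stage_vars :: prog where
 "stage_vars = (Assign 26 (Var 22 [-] Var 25 [-] Const 1) ;;
  Assign 36 (Const 1 [<<] Var 26) ;; Assign 37 (Const 1 [<<] Var 25))"

lemma runs_stage_vars:
 assumes s: "s 22 0 = int k" "s 25 0 = int d" and d: "d < k" "k < L"
 shows "runs stage_vars s (wt stage_vars * (L + 1))
  (%s'. same {26, 36, 37} s' s & s' 26 0 = int (k - Suc d) & s' 36 0 = 2 ^ (k - Suc d) & s' 37 0 = 2 ^ d)"
proof (rule runs_wp)
 have k: "int k - int d - 1 = int (k - Suc d)" using d by simp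
 have "d < 2 ^ L" "k < 2 ^ L" "k - Suc d < 2 ^ L" "k - Suc d <= L" "d <= L" using d less_exp[of L] by linarith+
 thus "wp L stage_vars (%s'. same {26, 36, 37} s' s & s' 26 0 = int (k - Suc d) &
  s' 36 0 = 2 ^ (k - Suc d) & s' 37 0 = 2 ^ d) s"
  using s k unfolding stage_vars_def by (simp del: of_nat_diff)
qed

definition fft :: prog where
 "fft = For 25 (Const 0) (Var 22) (stage_vars ;; fwd_loop ;; copy_loop 10)"

definition fft_wt :: nat where
 "fft_wt = fwd_wt + copy_wt + wt stage_vars + for_wt (Const 0) (Var 22)"

text \<open>One call transforms all numbers of a level: the last clause speaks of every
  \<open>p\<close> whose segment of \<open>2 ^ k\<close> entries lies in the range.\<close>

lemma runs_fft:
 assumes s: "s 22 0 = int k" "s 24 0 = int (2 ^ t)" "s 34 0 = int lo" "s 35 0 = int hi"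
  and E: "!!i. 1 <= i ==> i < 2 ^ Suc k ==> s 13 (int i) = int (root_exp (2 ^ t) i)"
  and A: "!!i. lo <= i ==> i < hi ==> abs (s 10 (int i)) <= 2 ^ 2 ^ t + 8"
  and L: "lo <= hi" "hi < 2 ^ L" "2 * 2 ^ t + 4 <= L" "k <= t" "2 <= t" "k + 2 <= L"
  and dv: "2 ^ k dvd lo" "2 ^ k dvd hi"
 shows "runs fft s ((k + 1) * ((hi - lo + 1) * (fft_wt * (L + 1))))
  (%s'. same {10, 12, 25, 26, 27, 28, 29, 30, 31, 36, 37, 38} s' s &
  (ALL i. ~ (lo <= i & i < hi) --> s' 10 (int i) = s 10 (int i)) &
  (ALL i. lo <= i --> i < hi --> abs (s' 10 (int i)) <= 2 ^ 2 ^ t + 8) &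
  (ALL p. lo <= p * 2 ^ k --> (p + 1) * 2 ^ k <= hi -->
  transf (2 ^ t) k p k (%i. s 10 (int (p * 2 ^ k + i))) (%i. s' 10 (int i))))"
proof -
 let ?M = "{10, 12, 25, 26, 27, 28, 29, 30, 31, 36, 37, 38} :: nat set"
 define N :: nat where "N = 2 ^ t"
 have N4: "4 <= N" using power_increasing[of 2 t "2::nat"] L by (simp add: N_def)
 have NL: "2 * N + 4 <= L" using L by (simp add: N_def)
 define I where "I d s' = (d <= k & s' 25 0 = int d & same ?M s' s &
  (ALL i. ~ (lo <= i & i < hi) --> s' 10 (int i) = s 10 (int i)) &
  (ALL i. lo <= i --> i < hi --> abs (s' 10 (int i)) <= 2 ^ N + 8) &
  (ALL p. lo <= p * 2 ^ k --> (p + 1) * 2 ^ k <= hi -->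
  transf N k p d (%i. s 10 (int (p * 2 ^ k + i))) (%i. s' 10 (int i))))" for d s'
 have "runs fft s ((k - 0 + 1) * (((wt stage_vars * (L + 1)) + (hi - lo + 1) * (fwd_wt * (L + 1))
  + (hi - lo + 1) * (copy_wt * (L + 1))) + for_wt (Const 0) (Var 22) * (L + 1))) (I k)"
  unfolding fft_def
 proof (rule runs_For)
  show "I 0 (s(25 := (s 25)(0 := int 0)))"
  unfolding I_def using A transf_0[of N k _ "%i. s 10 (int i)"] by (auto simp: N_def)
 next
  fix j s'
  assume I: "I j s'"
  have "j < 2 ^ L" using I L less_exp[of L] unfolding I_def by linarith
  thus "s' 25 0 = int j & abs (int j) < 2 ^ L" using I by (simp add: I_def)
  have "k < 2 ^ L" using L less_exp[of L] by linarith
  thus "small L (Var 22) s' & val (Var 22) s' = int k"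
  using I sameD[of ?M s' s 22] s unfolding I_def by simp
 next
  fix d s1
  assume d: "d < k" and I: "I d s1"
  have s1: "s1 25 0 = int d" "same ?M s1 s" using I unfolding I_def by auto
  note s1' = sameD[OF s1(2)]
  have dvd: "2 * 2 ^ (k - Suc d) dvd lo" "2 * 2 ^ (k - Suc d) dvd hi"
  proof -
  have "(2::nat) * 2 ^ (k - Suc d) dvd 2 ^ k"
  using d by (metis Suc_diff_Suc le_imp_power_dvd power_Suc diff_le_self)
  thus "2 * 2 ^ (k - Suc d) dvd lo" "2 * 2 ^ (k - Suc d) dvd hi" using dv dvd_trans by blast+
  qed
  define f where "f = fwd N d (k - Suc d) (%i. s1 10 (int i))"
  have f: "abs (f i) <= 2 ^ N + 8" if "lo <= i" "i < hi" for i
  unfolding f_def using I that N4 dvd by (intro abs_fwd_le[of lo hi]) (auto simp: I_def)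
  have NL': "(2::int) ^ N + 8 < 2 ^ L"
  proof -
  have "(2::int) ^ N + 8 <= 2 ^ (N + 4)" by (rule two_power_add_8)
  also have "... < (2::int) ^ L" using NL N4 by (intro power_strict_increasing) auto
  finally show ?thesis .
  qed
  show "runs (stage_vars ;; fwd_loop ;; copy_loop 10) s1
  (wt stage_vars * (L + 1) + (hi - lo + 1) * (fwd_wt * (L + 1)) + (hi - lo + 1) * (copy_wt * (L + 1)))
  (%s'. s' 25 0 = int d & I (Suc d) (s'(25 := (s' 25)(0 := int d + 1))))"
  proof (rule runs_Seq[OF runs_stage_vars[where k = k and d = d and L = L]])
  fix s2
  assume s2: "same {26, 36, 37} s2 s1 & s2 26 0 = int (k - Suc d) & s2 36 0 = 2 ^ (k - Suc d) & s2 37 0 = 2 ^ d"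
  note s2' = sameD[OF conjunct1[OF s2]]
  show "runs (fwd_loop ;; copy_loop 10) s2 ((hi - lo + 1) * (fwd_wt * (L + 1)) + (hi - lo + 1) * (copy_wt * (L + 1)))
  (%s'. s' 25 0 = int d & I (Suc d) (s'(25 := (s' 25)(0 := int d + 1))))"
  proof (rule runs_Seq[OF runs_fwd_loop[where lo = lo and hi = hi and N = N and d = d and j = "k - Suc d" and L = L]])
  show "s2 13 (int i) = int (root_exp N i)" if "1 <= i" "i < 2 * (2 * 2 ^ d)" for i
  proof -
  have "(2::nat) ^ Suc (Suc d) <= 2 ^ Suc k" using d by (intro power_increasing) auto
  hence "i < 2 ^ Suc k" using that by simp
  thus ?thesis using E[of i] that by (simp add: s1' s2' N_def)
  qed
  next
  fix s3
  assume s3: "same {12, 27, 28, 29, 30, 31, 38} s3 s2 & (ALL i. s3 12 (int i) = (if lo <= i & i < hi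
  then fwd N d (k - Suc d) (%i. s2 10 (int i)) i else s2 12 (int i)))"
  note s3' = sameD[OF conjunct1[OF s3]]
  have W: "s3 12 (int i) = f i" if "lo <= i" "i < hi" for i
  using s3 that unfolding f_def by (simp add: s2')
  show "runs (copy_loop 10) s3 ((hi - lo + 1) * (copy_wt * (L + 1)))
  (%s'. s' 25 0 = int d & I (Suc d) (s'(25 := (s' 25)(0 := int d + 1))))"
  proof (rule runs_mono[OF runs_copy_loop[where lo = lo and hi = hi]])
  show "abs (s3 12 (int e)) < 2 ^ L" if "lo <= e" "e < hi" for e
  using f[OF that] W[OF that] NL' by simp
  next
  fix s4
  assume s4: "same {10, 27} s4 s3 & (ALL i. s4 10 (int i) = (if lo <= i & i < hi then s3 12 (int i) else s3 10 (int i)))"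
  note s4' = sameD[OF conjunct1[OF s4]]
  have s4_10: "s4 10 (int i) = (if lo <= i & i < hi then f i else s1 10 (int i))" for i
  using s4 W[of i] by (simp add: s2' s3')
  have "same ?M s4 s"
  using s4 s3 s2 s1 unfolding same_def by auto
  moreover have "transf N k p (Suc d) (%i. s 10 (int (p * 2 ^ k + i))) (%i. s4 10 (int i))"
  if "lo <= p * 2 ^ k" "(p + 1) * 2 ^ k <= hi" for p
  unfolding N_def
  proof (rule transf_fwd)
  show "transf (2 ^ t) k p d (%i. s 10 (int (p * 2 ^ k + i))) (%i. s1 10 (int i))"
  using I that unfolding I_def N_def by blast
  show "s4 10 (int e) = fwd (2 ^ t) d (k - Suc d) (%i. s1 10 (int i)) e"
  if "p * 2 ^ k <= e" "e < (p + 1) * 2 ^ k" for e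
  using that `lo <= p * 2 ^ k` `(p + 1) * 2 ^ k <= hi` unfolding s4_10 f_def N_def by simp
  qed (use d L in auto)
  ultimately show "s4 25 0 = int d & I (Suc d) (s4(25 := (s4 25)(0 := int d + 1)))"
  using d I f s1(1) unfolding I_def by (simp add: s4_10 s4' s3' s2')
  qed (use s L in "simp_all add: s1' s2' s3'")
  next
  show "abs (s2 10 (int i)) <= 2 ^ N + 8" if "lo <= i" "i < hi" for i
  using I that by (simp add: I_def s2')
  qed (use s s1 s2 L d dvd N4 NL in "simp_all add: s1' s2' N_def")
  next
  show "k < L" using L by simp
  qed (use s s1 d in "simp_all add: s1'")
 qed (use L in simp_all)
 thus ?thesis
 proof (rule runs_mono)
  have "wt stage_vars * (L + 1) <= (hi - lo + 1) * (wt stage_vars * (L + 1))"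
  "for_wt (Const 0) (Var 22) * (L + 1) <= (hi - lo + 1) * (for_wt (Const 0) (Var 22) * (L + 1))" by simp_all
  hence "wt stage_vars * (L + 1) + (hi - lo + 1) * (fwd_wt * (L + 1)) + (hi - lo + 1) * (copy_wt * (L + 1))
  + for_wt (Const 0) (Var 22) * (L + 1) <= (hi - lo + 1) * (fft_wt * (L + 1))"
  unfolding fft_wt_def by (simp add: algebra_simps)
  thus "(k - 0 + 1) * (wt stage_vars * (L + 1) + (hi - lo + 1) * (fwd_wt * (L + 1)) + (hi - lo + 1) * (copy_wt * (L + 1))
  + for_wt (Const 0) (Var 22) * (L + 1)) <= (k + 1) * ((hi - lo + 1) * (fft_wt * (L + 1)))"
  by (simp only: diff_zero) (rule mult_le_mono2)
 qed (simp add: I_def N_def)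
qed

definition ifft :: prog where
 "ifft = For 41 (Const 0) (Var 22)
  (Assign 25 (Var 22 [-] Var 41 [-] Const 1) ;; stage_vars ;; bwd_loop ;; copy_loop 11)"

definition ifft_wt :: nat where
 "ifft_wt = wt (Assign 25 (Var 22 [-] Var 41 [-] Const 1)) + bwd_wt + copy_wt + wt stage_vars
  + for_wt (Const 0) (Var 22)"

text \<open>The polynomial \<open>x\<close> is quantified inside the postcondition. The program does
  not know it, and for any \<open>x\<close> of which the input is a transform, the output contains
  the coefficients of \<open>x\<close> up to congruence.\<close>

lemma runs_ifft:
 assumes s: "s 22 0 = int k" "s 24 0 = int (2 ^ t)" "s 34 0 = int lo" "s 35 0 = int hi"
  and E: "!!i. 1 <= i ==> i < 2 ^ Suc k ==> s 13 (int i) = int (root_exp (2 ^ t) i)"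
  and A: "!!i. lo <= i ==> i < hi ==> abs (s 11 (int i)) <= 2 ^ 2 ^ t + 8"
  and L: "lo <= hi" "hi < 2 ^ L" "2 * 2 ^ t + 4 <= L" "k <= t" "2 <= t" "k + 2 <= L"
  and dv: "2 ^ k dvd lo" "2 ^ k dvd hi"
 shows "runs ifft s ((k + 1) * ((hi - lo + 1) * (ifft_wt * (L + 1))))
  (%s'. same {11, 12, 25, 26, 27, 28, 29, 30, 31, 36, 37, 38, 41} s' s &
  (ALL i. ~ (lo <= i & i < hi) --> s' 11 (int i) = s 11 (int i)) &
  (ALL i. lo <= i --> i < hi --> abs (s' 11 (int i)) <= 2 ^ 2 ^ t + 8) &
  (ALL p x. lo <= p * 2 ^ k --> (p + 1) * 2 ^ k <= hi --> transf (2 ^ t) k p k x (%i. s 11 (int i)) -->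
  transf (2 ^ t) k p 0 x (%i. s' 11 (int i))))"
proof -
 let ?M = "{11, 12, 25, 26, 27, 28, 29, 30, 31, 36, 37, 38, 41} :: nat set"
 define N :: nat where "N = 2 ^ t"
 have N4: "4 <= N" using power_increasing[of 2 t "2::nat"] L by (simp add: N_def)
 have NL: "2 * N + 4 <= L" using L by (simp add: N_def)
 define I where "I d s' = (d <= k & s' 41 0 = int d & same ?M s' s &
  (ALL i. ~ (lo <= i & i < hi) --> s' 11 (int i) = s 11 (int i)) &
  (ALL i. lo <= i --> i < hi --> abs (s' 11 (int i)) <= 2 ^ N + 8) &
  (ALL p x. lo <= p * 2 ^ k --> (p + 1) * 2 ^ k <= hi --> transf N k p k x (%i. s 11 (int i)) -->
  transf N k p (k - d) x (%i. s' 11 (int i))))" for d s'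
 have "runs ifft s ((k - 0 + 1) * ((wt (Assign 25 (Var 22 [-] Var 41 [-] Const 1)) * (L + 1) +
  ((wt stage_vars * (L + 1)) + (hi - lo + 1) * (bwd_wt * (L + 1))
  + (hi - lo + 1) * (copy_wt * (L + 1)))) + for_wt (Const 0) (Var 22) * (L + 1))) (I k)"
  unfolding ifft_def
 proof (rule runs_For)
  show "I 0 (s(41 := (s 41)(0 := int 0)))"
  unfolding I_def using A by (auto simp: N_def)
 next
  fix j s'
  assume I: "I j s'"
  have "j < 2 ^ L" using I L less_exp[of L] unfolding I_def by linarith
  thus "s' 41 0 = int j & abs (int j) < 2 ^ L" using I by (simp add: I_def)
  have "k < 2 ^ L" using L less_exp[of L] by linarith
  thus "small L (Var 22) s' & val (Var 22) s' = int k"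
  using I sameD[of ?M s' s 22] s unfolding I_def by simp
 next
  fix u s0
  assume u: "u < k" and I: "I u s0"
  define d where "d = k - Suc u"
  have d: "d < k" "int k - int u - 1 = int d" "k - u = Suc d" "k - Suc u = d" using u by (simp_all add: d_def)
  have s0: "s0 41 0 = int u" "same ?M s0 s" using I unfolding I_def by auto
  note s0' = sameD[OF s0(2)]
  define s1 where "s1 = s0(25 := (s0 25)(0 := int d))"
  have s1: "s1 25 0 = int d" "same ?M s1 s" "s1 11 = s0 11" "s1 41 0 = int u" using s0 by (simp_all add: s1_def)
  note s1' = sameD[OF s1(2)]
  have dvd: "2 * 2 ^ (k - Suc d) dvd lo" "2 * 2 ^ (k - Suc d) dvd hi"
  proof -
  have "(2::nat) * 2 ^ (k - Suc d) dvd 2 ^ k"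
  using d by (metis Suc_diff_Suc le_imp_power_dvd power_Suc diff_le_self)
  thus "2 * 2 ^ (k - Suc d) dvd lo" "2 * 2 ^ (k - Suc d) dvd hi" using dv dvd_trans by blast+
  qed
  define f where "f = bwd N d (k - Suc d) (%i. s1 11 (int i))"
  have f: "abs (f i) <= 2 ^ N + 8" if "lo <= i" "i < hi" for i
  unfolding f_def using I that N4 dvd by (intro abs_bwd_le[of lo hi]) (auto simp: I_def s1)
  have NL': "(2::int) ^ N + 8 < 2 ^ L"
  proof -
  have "(2::int) ^ N + 8 <= 2 ^ (N + 4)" by (rule two_power_add_8)
  also have "... < (2::int) ^ L" using NL N4 by (intro power_strict_increasing) auto
  finally show ?thesis .
  qed
  show "runs (Assign 25 (Var 22 [-] Var 41 [-] Const 1) ;; stage_vars ;; bwd_loop ;; copy_loop 11) s0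
  (wt (Assign 25 (Var 22 [-] Var 41 [-] Const 1)) * (L + 1) +
  (wt stage_vars * (L + 1) + (hi - lo + 1) * (bwd_wt * (L + 1)) + (hi - lo + 1) * (copy_wt * (L + 1))))
  (%s'. s' 41 0 = int u & I (Suc u) (s'(41 := (s' 41)(0 := int u + 1))))"
  proof (rule runs_Seq[where R = "%s'. s' = s1"])
  have "u < 2 ^ L" "k < 2 ^ L" using u L less_exp[of L] by linarith+
  thus "runs (Assign 25 (Var 22 [-] Var 41 [-] Const 1)) s0
  (wt (Assign 25 (Var 22 [-] Var 41 [-] Const 1)) * (L + 1)) (%s'. s' = s1)"
  using s0 s d by (intro runs_wp) (simp add: s0' s1_def)
  next
  fix s1'
  assume "s1' = s1"
  thus "runs (stage_vars ;; bwd_loop ;; copy_loop 11) s1'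
  (wt stage_vars * (L + 1) + (hi - lo + 1) * (bwd_wt * (L + 1)) + (hi - lo + 1) * (copy_wt * (L + 1)))
  (%s'. s' 41 0 = int u & I (Suc u) (s'(41 := (s' 41)(0 := int u + 1))))"
  proof (intro runs_Seq[OF runs_stage_vars[where k = k and d = d and L = L]])
  fix s2
  assume s2: "same {26, 36, 37} s2 s1' & s2 26 0 = int (k - Suc d) & s2 36 0 = 2 ^ (k - Suc d) & s2 37 0 = 2 ^ d"
  have s2': "s2 k = s1 k" if "k ~: {26, 36, 37}" for k using sameD[OF conjunct1[OF s2] that] `s1' = s1` by simp
  show "runs (bwd_loop ;; copy_loop 11) s2 ((hi - lo + 1) * (bwd_wt * (L + 1)) + (hi - lo + 1) * (copy_wt * (L + 1)))
  (%s'. s' 41 0 = int u & I (Suc u) (s'(41 := (s' 41)(0 := int u + 1))))"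
  proof (rule runs_Seq[OF runs_bwd_loop[where lo = lo and hi = hi and N = N and d = d and j = "k - Suc d" and L = L]])
  show "s2 13 (int i) = int (root_exp N i)" if "1 <= i" "i < 2 * (2 * 2 ^ d)" for i
  proof -
  have "(2::nat) ^ Suc (Suc d) <= 2 ^ Suc k" using d by (intro power_increasing) auto
  hence "i < 2 ^ Suc k" using that by simp
  thus ?thesis using E[of i] that by (simp add: s1' s2' N_def)
  qed
  next
  fix s3
  assume s3: "same {12, 27, 28, 29, 30, 31, 38} s3 s2 & (ALL i. s3 12 (int i) = (if lo <= i & i < hi
  then bwd N d (k - Suc d) (%i. s2 11 (int i)) i else s2 12 (int i)))"
  note s3' = sameD[OF conjunct1[OF s3]]
  have W: "s3 12 (int i) = f i" if "lo <= i" "i < hi" for i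
  using s3 that unfolding f_def by (simp add: s2')
  show "runs (copy_loop 11) s3 ((hi - lo + 1) * (copy_wt * (L + 1)))
  (%s'. s' 41 0 = int u & I (Suc u) (s'(41 := (s' 41)(0 := int u + 1))))"
  proof (rule runs_mono[OF runs_copy_loop[where lo = lo and hi = hi]])
  show "abs (s3 12 (int e)) < 2 ^ L" if "lo <= e" "e < hi" for e
  using f[OF that] W[OF that] NL' by simp
  next
  fix s4
  assume s4: "same {11, 27} s4 s3 & (ALL i. s4 11 (int i) = (if lo <= i & i < hi then s3 12 (int i) else s3 11 (int i)))"
  note s4' = sameD[OF conjunct1[OF s4]]
  have s4_11: "s4 11 (int i) = (if lo <= i & i < hi then f i else s0 11 (int i))" for i
  using s4 W[of i] by (simp add: s2' s3' s1)
  have "same ?M s4 s"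
  using s4 s3 s2 s1 `s1' = s1` unfolding same_def by auto
  moreover have "transf N k p d x (%i. s4 11 (int i))"
  if "lo <= p * 2 ^ k" "(p + 1) * 2 ^ k <= hi" "transf N k p k x (%i. s 11 (int i))" for p x
  unfolding N_def
  proof (rule transf_bwd)
  show "transf (2 ^ t) k p (Suc d) x (%i. s1 11 (int i))"
  using I that unfolding I_def N_def s1(3) d(3) by blast
  show "s4 11 (int e) = bwd (2 ^ t) d (k - Suc d) (%i. s1 11 (int i)) e"
  if "p * 2 ^ k <= e" "e < (p + 1) * 2 ^ k" for e
  using that `lo <= p * 2 ^ k` `(p + 1) * 2 ^ k <= hi` unfolding s4_11 f_def N_def by simp
  qed (use d L in auto)
  ultimately show "s4 41 0 = int u & I (Suc u) (s4(41 := (s4 41)(0 := int u + 1)))"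
  using u d I f s1(4) unfolding I_def by (simp add: s4_11 s4' s3' s2')
  qed (use s L in "simp_all add: s1' s2' s3'")
  next
  show "abs (s2 11 (int i)) <= 2 ^ N + 8" if "lo <= i" "i < hi" for i
  using I that by (simp add: I_def s2' s1)
  qed (use s s1 s2 L d(1) dvd N4 NL in "simp_all add: s1' s2' N_def")
  next
  show "k < L" using L by simp
  qed (use s s1 d(1) in "simp_all add: s1'")
  qed simp
 qed (use L in simp_all)
 thus ?thesis
 proof (rule runs_mono)
  define w where "w = wt (Assign 25 (Var 22 [-] Var 41 [-] Const 1))"
  have "w * (L + 1) <= (hi - lo + 1) * (w * (L + 1))" "wt stage_vars * (L + 1) <= (hi - lo + 1) * (wt stage_vars * (L + 1))"
  "for_wt (Const 0) (Var 22) * (L + 1) <= (hi - lo + 1) * (for_wt (Const 0) (Var 22) * (L + 1))" by simp_all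
  hence "w * (L + 1) + (wt stage_vars * (L + 1) + (hi - lo + 1) * (bwd_wt * (L + 1)) + (hi - lo + 1) * (copy_wt * (L + 1)))
  + for_wt (Const 0) (Var 22) * (L + 1) <= (hi - lo + 1) * (ifft_wt * (L + 1))"
  unfolding ifft_wt_def w_def[symmetric] by (simp add: algebra_simps)
  thus "(k - 0 + 1) * (wt (Assign 25 (Var 22 [-] Var 41 [-] Const 1)) * (L + 1) +
  (wt stage_vars * (L + 1) + (hi - lo + 1) * (bwd_wt * (L + 1)) + (hi - lo + 1) * (copy_wt * (L + 1)))
  + for_wt (Const 0) (Var 22) * (L + 1)) <= (k + 1) * ((hi - lo + 1) * (ifft_wt * (L + 1)))"
  unfolding w_def[symmetric] by (simp only: diff_zero) (rule mult_le_mono2)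
 qed (simp add: I_def N_def)
qed

definition split_init :: prog where
 "split_init = (Assign 33 (Const 1 [<<] (Var 20 [-] Var 25 [-] Const 1)) ;;
  Assign 34 (Const 1 [<<] (Var 21 [+] Var 25 [+] Const 1)) ;;
  Assign 35 (Var 34 [<<] Const 1))"

definition split :: prog where
 "split = For 25 (Const 0) (Var 22) (split_init ;; split_loop)"

definition split_stage_wt :: nat where
 "split_stage_wt = wt split_init + split_wt + for_wt (Const 0) (Var 22)"

text \<open>Cost of a pass over all \<open>2^g\<close> numbers of \<open>2^t\<close> bits, up to a constant factor.\<close>

definition unit :: "nat => nat => nat => nat" where
 "unit g t X = 2 ^ (g + t + 3) * (X + 10)"

text \<open>At depth \<open>d\<close> each number is cut into \<open>2 ^ d\<close> pieces of
  \<open>2 ^ (t - d)\<close> bits, and the product does not depend on \<open>d\<close>. The term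
  \<open>4 * 2 ^ (t - k)\<close> leaves room for the longer coefficients met when joining, and
  \<open>X\<close> for indices.\<close>

lemma stage_cost:
 assumes "lo = (2::nat) ^ (g + d)" "d <= k" "k <= t" "L <= 2 * 2 ^ (t - d) + 4 * 2 ^ (t - k) + X + 8"
 shows "(2 * lo + 1) * (L + 1) <= unit g t X"
proof -
 have e: "(2::nat) ^ d * 2 ^ (t - d) = 2 ^ t" using assms by (simp flip: power_add)
 have "(2::nat) ^ d * 2 ^ (t - k) <= 2 ^ k * 2 ^ (t - k)" using assms by (intro mult_right_mono power_increasing) auto
 hence e2: "(2::nat) ^ d * 2 ^ (t - k) <= 2 ^ t" using assms by (simp flip: power_add)
 have e3: "(2::nat) ^ d <= 2 ^ t" using assms by (intro power_increasing) auto
 have "2 ^ d * (L + 1) <= 2 ^ d * (2 * 2 ^ (t - d) + 4 * 2 ^ (t - k) + X + 9)" using assms(4) by (intro mult_left_mono) auto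
 also have "... = 2 * (2 ^ d * 2 ^ (t - d)) + 4 * (2 ^ d * 2 ^ (t - k)) + 2 ^ d * (X + 9)" by (simp add: algebra_simps)
 also have "... <= 2 * 2 ^ t + 4 * 2 ^ t + 2 ^ t * (X + 9)"
  unfolding e using e2 mult_le_mono1[OF e3, of "X + 9"] by linarith
 also have "... <= 2 * 2 ^ t * (X + 10)" by (simp add: algebra_simps)
 finally have *: "2 ^ g * (2 ^ d * (L + 1)) <= 2 ^ g * (2 * 2 ^ t * (X + 10))" by (rule mult_le_mono2)
 have "(2 * lo + 1) * (L + 1) <= (4 * lo) * (L + 1)"
  using one_le_power[of "2::nat" "g + d"] unfolding assms(1) by (intro mult_right_mono) auto
 also have "... = 4 * (2 ^ g * (2 ^ d * (L + 1)))" by (simp add: assms(1) power_add algebra_simps)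
 also have "... <= 4 * (2 ^ g * (2 * 2 ^ t * (X + 10)))" using * by (rule mult_le_mono2)
 also have "... = unit g t X" by (simp add: unit_def power_add)
 finally show ?thesis .
qed

lemma runs_split:
 assumes s: "s 20 0 = int t" "s 21 0 = int g" "s 22 0 = int k"
  and A: "!!i. 2 ^ g <= i ==> i < 2 ^ (g + 1) ==> abs (s 10 (int i)) <= 2 ^ 2 ^ t + 8"
  and X: "k <= t" "t <= X" "g + k + 2 <= X"
 shows "runs split s ((k + 1) * (split_stage_wt * unit g t X))
  (%s'. same {10, 25, 27, 28, 33, 34, 35} s' s &
  (ALL i < 2 ^ (g + 1). s' 10 (int i) = s 10 (int i)) &
  (ALL i. 2 ^ (g + k) <= i --> i < 2 ^ (g + k + 1) --> abs (s' 10 (int i)) <= 2 ^ 2 ^ (t - k) + 8) &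
  (ALL p. 2 ^ g <= p --> p < 2 ^ (g + 1) -->
  s 10 (int p) = (SUM i<2 ^ k. s' 10 (int (p * 2 ^ k + i)) * (2 ^ 2 ^ (t - k)) ^ i)))"
proof -
 let ?M = "{10, 25, 27, 28, 33, 34, 35} :: nat set"
 define I where "I d s' = (d <= k & s' 25 0 = int d & same ?M s' s &
  (ALL i < 2 ^ (g + 1). s' 10 (int i) = s 10 (int i)) &
  (ALL i. 2 ^ (g + d) <= i --> i < 2 ^ (g + d + 1) --> abs (s' 10 (int i)) <= 2 ^ 2 ^ (t - d) + 8) &
  (ALL p. 2 ^ g <= p --> p < 2 ^ (g + 1) -->
  s 10 (int p) = (SUM i<2 ^ d. s' 10 (int (p * 2 ^ d + i)) * (2 ^ 2 ^ (t - d)) ^ i)))" for d s'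
 have "runs split s ((k - 0 + 1) * ((wt split_init + split_wt) * unit g t X + for_wt (Const 0) (Var 22) * (X + 1))) (I k)"
  unfolding split_def
 proof (rule runs_For)
  show "I 0 (s(25 := (s 25)(0 := int 0)))"
  unfolding I_def using A by auto
 next
  fix j s'
  assume I: "I j s'"
  have "j < 2 ^ X" using I X less_two_power[of j X] unfolding I_def by linarith
  thus "s' 25 0 = int j & abs (int j) < 2 ^ X" using I by (simp add: I_def)
  have "k < 2 ^ X" using X by (intro less_two_power) simp
  thus "small X (Var 22) s' & val (Var 22) s' = int k"
  using I sameD[of ?M s' s 22] s unfolding I_def by simp
 next
  fix d s1
  assume d: "d < k" and I: "I d s1"
  define h :: nat where "h = 2 ^ (t - Suc d)"
  define lo :: nat where "lo = 2 ^ (g + Suc d)"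
  define L where "L = 2 ^ (t - d) + X + 5"
  have s1: "s1 25 0 = int d" "same ?M s1 s" using I unfolding I_def by auto
  note s1' = sameD[OF s1(2)]
  have hh: "2 ^ (t - d) = 2 * h" using d X by (simp add: h_def Suc_diff_Suc flip: power_Suc)
  have XL: "X <= L" by (simp add: L_def)
  have hL: "h <= L" "h < 2 ^ L" using less_two_power[of h] unfolding L_def hh by auto
  have loX: "2 * lo < 2 ^ L" "lo < 2 ^ L"
  proof -
  have "(2::nat) ^ Suc (g + Suc d) < 2 ^ L" using X d by (intro power_strict_increasing) (auto simp: L_def)
  thus "2 * lo < 2 ^ L" by (simp add: lo_def)
  thus "lo < 2 ^ L" by linarith
  qed
  have cost: "(2 * lo + 1) * (L + 1) <= unit g t X"
  by (rule stage_cost[OF lo_def, of k]) (use d X in "auto simp: L_def hh h_def")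
  have n: "nat (int t - int d - 1) = t - Suc d" "nat (int g + int d + 1) = g + Suc d"
  "int t <= 1 + (int d + int L)" "int t - int d - 1 <= int L" "int g + int d + 1 <= int L"
  using X d XL by auto
  have vars: "t < 2 ^ L" "g < 2 ^ L" "d < 2 ^ L" using X XL d by (auto intro!: less_two_power)
  define s2 where "s2 = s1(33 := (s1 33)(0 := int h), 34 := (s1 34)(0 := int lo), 35 := (s1 35)(0 := int (2 * lo)))"
  have s2: "s2 33 0 = int h" "s2 34 0 = int lo" "s2 35 0 = int (2 * lo)" "s2 10 = s1 10" "s2 25 0 = int d" "same ?M s2 s"
  using s1 by (simp_all add: s2_def)
  have "runs (split_init ;; split_loop) s1 ((wt split_init + split_wt) * unit g t X)
  (%s'. s' 25 0 = int d & I (Suc d) (s'(25 := (s' 25)(0 := int d + 1))))"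
  proof (rule runs_Seq[where R = "%s'. s' = s2"])
  show "runs split_init s1 (wt split_init * (L + 1)) (%s'. s' = s2)"
  proof (rule runs_wp)
  have i: "int h = 2 ^ (t - Suc d)" "int lo = 2 ^ (g + Suc d)" by (simp_all add: h_def lo_def)
  have "int lo < 2 ^ L" using loX by simp
  hence "(2::int) ^ (g + Suc d) < 2 ^ L" unfolding i(2) .
  thus "wp L split_init (%s'. s' = s2) s1"
  using s s1(1) n vars X by (simp add: split_init_def s2_def s1' i L_def)
  qed
  next
  fix s2'
  assume "s2' = s2"
  have A: "abs (s1 10 (int (e div 2))) <= 2 ^ (2 * h) + 8" if "lo <= e" "e < 2 * lo" for e
  proof -
  have "2 ^ (g + d) <= e div 2" "e div 2 < 2 ^ (g + d + 1)" using that by (auto simp: lo_def)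
  thus ?thesis using I unfolding I_def hh by blast
  qed
  have AL: "(2::int) ^ (2 * h) + 8 < 2 ^ L"
  proof -
  have "(2::int) ^ (2 * h) + 8 <= 2 ^ (2 * h + 4)" by (rule two_power_add_8)
  also have "... < (2::int) ^ L" by (intro power_strict_increasing) (auto simp: L_def hh)
  finally show ?thesis .
  qed
  show "runs split_loop s2' ((2 * lo - lo + 1) * (split_wt * (L + 1)))
  (%s'. s' 25 0 = int d & I (Suc d) (s'(25 := (s' 25)(0 := int d + 1))))"
  unfolding `s2' = s2`
  proof (rule runs_mono[OF runs_split_loop[where lo = lo and hi = "2 * lo" and h = h and L = L]])
  show "abs (s2 10 (int (e div 2))) < 2 ^ L" if "lo <= e" "e < 2 * lo" for e
  using A[OF that] AL by (simp add: s2)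
  next
  fix s3
  assume s3: "same {10, 27, 28} s3 s2 & (ALL i. s3 10 (int i) = (if lo <= i & i < 2 * lo
  then if even i then s2 10 (int (i div 2)) mod 2 ^ h else s2 10 (int (i div 2)) div 2 ^ h
  else s2 10 (int i)))"
  have s3_10: "s3 10 (int i) = (if lo <= i & i < 2 * lo
  then if even i then s1 10 (int (i div 2)) mod 2 ^ h else s1 10 (int (i div 2)) div 2 ^ h
  else s1 10 (int i))" for i using s3 by (simp add: s2)
  note s3' = sameD[OF conjunct1[OF s3]]
  have "same ?M s3 s"
  using s3 s2(6) unfolding same_def by auto
  moreover have "s3 10 (int i) = s 10 (int i)" if "i < 2 ^ (g + 1)" for i
  proof -
  have "(2::nat) ^ (g + 1) <= lo" unfolding lo_def by (intro power_increasing) auto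
  thus ?thesis using I that unfolding I_def s3_10 by simp
  qed
  moreover have "abs (s3 10 (int i)) <= 2 ^ h + 8" if "lo <= i" "i < 2 * lo" for i
  proof -
  define y where "y = s1 10 (int (i div 2))"
  \<comment> \<open>The excess 8 is weakened to \<open>8 * 2 ^ h\<close>, so that it is 8 again
    after the removal of the low \<open>h\<close> bits.\<close>
  have y: "abs y <= 2 ^ h * (2 ^ h + 8)"
  proof -
  have "abs y <= 2 ^ h * 2 ^ h + 1 * 8"
  using A[OF that] unfolding y_def power_even_eq power2_eq_square by simp
  also have "... <= 2 ^ h * 2 ^ h + 2 ^ h * 8" by (intro add_left_mono mult_right_mono) auto
  finally show ?thesis by (simp add: algebra_simps)
  qed
  have "y div 2 ^ h <= 2 ^ h + 8"
  using y zdiv_mono1[of y "2 ^ h * (2 ^ h + 8)" "2 ^ h"] by simp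
  moreover have "- (2 ^ h + 8) <= y div 2 ^ h"
  proof -
  have "2 ^ h * - (2 ^ h + 8) <= y" using y by (simp add: algebra_simps)
  hence "(2 ^ h * - (2 ^ h + 8)) div 2 ^ h <= y div 2 ^ h" by (intro zdiv_mono1) auto
  moreover have "(2 ^ h * - (2 ^ h + 8)) div 2 ^ h = - (2 ^ h + 8 :: int)"
  by (rule nonzero_mult_div_cancel_left) simp
  ultimately show ?thesis by simp
  qed
  moreover have "0 <= y mod 2 ^ h" "y mod 2 ^ h < 2 ^ h" by simp_all
  ultimately have "abs (y div 2 ^ h) <= 2 ^ h + 8" "abs (y mod 2 ^ h) <= 2 ^ h + 8" by linarith+
  thus ?thesis using that unfolding s3_10 y_def[symmetric] by simp
  qed
  moreover have "s 10 (int p) = (SUM i<2 ^ Suc d. s3 10 (int (p * 2 ^ Suc d + i)) * (2 ^ h) ^ i)"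
  if p: "2 ^ g <= p" "p < 2 ^ (g + 1)" for p
  proof -
  have "s 10 (int p) = (SUM i<2 ^ d. s1 10 (int (p * 2 ^ d + i)) * (2 ^ (2 * h)) ^ i)"
  using I p unfolding I_def hh by blast
  also have "... = (SUM i<2 ^ d. s3 10 (int (p * 2 ^ Suc d + 2 * i)) * (2 ^ h) ^ (2 * i)
  + s3 10 (int (p * 2 ^ Suc d + (2 * i + 1))) * (2 ^ h) ^ (2 * i + 1))"
  proof (rule sum.cong)
  fix i :: nat
  assume "i : {..<2 ^ d}"
  hence i: "i < 2 ^ d" by simp
  define q where "q = p * 2 ^ d + i"
  have q: "p * 2 ^ Suc d + 2 * i = 2 * q" "p * 2 ^ Suc d + (2 * i + 1) = 2 * q + 1" by (simp_all add: q_def algebra_simps)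
  have "2 ^ g * 2 ^ d <= p * 2 ^ d" using p by (intro mult_right_mono) auto
  hence q1: "2 ^ (g + d) <= q" unfolding q_def power_add by linarith
  have "(p + 1) * 2 ^ d <= 2 ^ (g + 1) * 2 ^ d" using p by (intro mult_right_mono) auto
  hence q2: "q < 2 ^ (g + Suc d)" using i unfolding q_def by (simp add: power_add algebra_simps)
  have q3: "s3 10 (int (2 * q)) = s1 10 (int q) mod 2 ^ h" "s3 10 (int (2 * q + 1)) = s1 10 (int q) div 2 ^ h"
  using q1 q2 unfolding s3_10 lo_def by simp_all
  have "(2 ^ (2 * h)) ^ i = ((2::int) ^ h) ^ (2 * i)" by (simp add: mult.commute mult.left_commute flip: power_mult)
  hence E: "s1 10 (int q) * (2 ^ (2 * h)) ^ i =
  (s1 10 (int q) mod 2 ^ h + s1 10 (int q) div 2 ^ h * 2 ^ h) * (2 ^ h) ^ (2 * i)"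
  by (simp only: mod_div_mult_eq)
  show "s1 10 (int (p * 2 ^ d + i)) * (2 ^ (2 * h)) ^ i =
  s3 10 (int (p * 2 ^ Suc d + 2 * i)) * (2 ^ h) ^ (2 * i)
  + s3 10 (int (p * 2 ^ Suc d + (2 * i + 1))) * (2 ^ h) ^ (2 * i + 1)"
  unfolding q q3 q_def[symmetric] E power_add[of _ "2 * i" 1] power_one_right
  by (simp only: distrib_right distrib_left mult.assoc mult.left_commute mult.commute)
  qed simp
  also have "... = (SUM i<2 * 2 ^ d. s3 10 (int (p * 2 ^ Suc d + i)) * (2 ^ h) ^ i)"
  by (rule sum_even_odd[symmetric])
  finally show ?thesis by simp
  qed
  ultimately show "s3 25 0 = int d & I (Suc d) (s3(25 := (s3 25)(0 := int d + 1)))"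
  using d unfolding I_def by (simp add: s3' s2 lo_def h_def)
  qed (use loX hL s2 in "auto simp: L_def")
  next
  have "wt split_init * (L + 1) <= wt split_init * ((2 * lo + 1) * (L + 1))"
  by (intro mult_le_mono2) simp
  moreover have "(2 * lo - lo + 1) * (split_wt * (L + 1)) <= split_wt * ((2 * lo + 1) * (L + 1))"
  by (simp add: algebra_simps)
  ultimately have "wt split_init * (L + 1) + (2 * lo - lo + 1) * (split_wt * (L + 1))
  <= (wt split_init + split_wt) * ((2 * lo + 1) * (L + 1))"
  unfolding add_mult_distrib[of "wt split_init"] by (rule add_mono)
  also have "... <= (wt split_init + split_wt) * unit g t X" using cost by (rule mult_le_mono2)
  finally show "wt split_init * (L + 1) + (2 * lo - lo + 1) * (split_wt * (L + 1))
  <= (wt split_init + split_wt) * unit g t X" .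
  qed
  thus "runs (split_init ;; split_loop) s1 ((wt split_init + split_wt) * unit g t X)
  (%s'. s' 25 0 = int d & I (Suc d) (s'(25 := (s' 25)(0 := int d + 1))))" .
 qed (use X in simp_all)
 thus ?thesis
 proof (rule runs_mono)
  have "X + 1 <= 1 * (X + 10)" by simp
  also have "... <= unit g t X" unfolding unit_def by (intro mult_right_mono) auto
  finally have "for_wt (Const 0) (Var 22) * (X + 1) <= for_wt (Const 0) (Var 22) * unit g t X" by (rule mult_le_mono2)
  hence "(wt split_init + split_wt) * unit g t X + for_wt (Const 0) (Var 22) * (X + 1) <= split_stage_wt * unit g t X"
  unfolding split_stage_wt_def by (simp add: algebra_simps)
  thus "(k - 0 + 1) * ((wt split_init + split_wt) * unit g t X + for_wt (Const 0) (Var 22) * (X + 1))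
  <= (k + 1) * (split_stage_wt * unit g t X)" by (simp only: diff_zero) (rule mult_le_mono2)
 qed (simp add: I_def)
qed

definition join_init :: prog where
 "join_init = (Assign 25 (Var 22 [-] Var 41 [-] Const 1) ;;
  Assign 33 (Const 1 [<<] (Var 20 [-] Var 25 [-] Const 1)) ;;
  Assign 34 (Const 1 [<<] (Var 21 [+] Var 25)) ;;
  Assign 35 (Var 34 [<<] Const 1))"

definition join :: prog where
 "join = For 41 (Const 0) (Var 22) (join_init ;; join_loop)"

definition join_stage_wt :: nat where
 "join_stage_wt = wt join_init + join_wt + for_wt (Const 0) (Var 22)"

lemma sum_two_pow_le: "1 <= c ==> (SUM i<m. (2 ^ c) ^ i) <= ((2::int) ^ c) ^ m"
proof (induction m)
 case (Suc m)
 have "(2::int) ^ 1 <= 2 ^ c" using Suc.prems by (intro power_increasing) auto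
 hence "2 * (2 ^ c) ^ m <= 2 ^ c * (2 ^ c :: int) ^ m" by (intro mult_right_mono) auto
 moreover have "(SUM i<m. (2 ^ c) ^ i) <= ((2::int) ^ c) ^ m" using Suc by blast
 ultimately show ?case unfolding sum.lessThan_Suc power_Suc by linarith
qed simp

text \<open>Coefficients are up to four times as long as the distance \<open>2 ^ (t - k)\<close> of
  the shifts, so neighbours overlap. By the geometric series the assembled number nevertheless
  exceeds \<open>2 ^ t\<close> bits by the length of one coefficient only.\<close>

lemma runs_join:
 assumes s: "s 20 0 = int t" "s 21 0 = int g" "s 22 0 = int k"
  and A: "!!i. 2 ^ (g + k) <= i ==> i < 2 ^ (g + k + 1) ==> abs (s 11 (int i)) <= 2 ^ (4 * 2 ^ (t - k))"
  and X: "k <= t" "t <= X" "g + k + 2 <= X"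
 shows "runs join s ((k + 1) * (join_stage_wt * unit g t X))
  (%s'. same {11, 25, 27, 33, 34, 35, 41} s' s &
  (ALL p. 2 ^ g <= p --> p < 2 ^ (g + 1) -->
  s' 11 (int p) = (SUM i<2 ^ k. s 11 (int (p * 2 ^ k + i)) * (2 ^ 2 ^ (t - k)) ^ i)
  & abs (s' 11 (int p)) <= 2 ^ (4 * 2 ^ (t - k) + 2 ^ t)))"
proof -
 let ?M = "{11, 25, 27, 33, 34, 35, 41} :: nat set"
 define c :: nat where "c = 2 ^ (t - k)"
 define J where "J u q = (SUM i<2 ^ u. s 11 (int (q * 2 ^ u + i)) * (2 ^ c) ^ i)" for u q
 have J0: "J 0 q = s 11 (int q)" for q by (simp add: J_def)
 have J_Suc: "J (Suc u) q = J u (2 * q) + J u (2 * q + 1) * 2 ^ (c * 2 ^ u)" for u q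
 proof -
  have "J (Suc u) q = (SUM i<2 ^ u. s 11 (int (q * 2 ^ Suc u + i)) * (2 ^ c) ^ i)
  + (SUM i=2^u..<2 ^ Suc u. s 11 (int (q * 2 ^ Suc u + i)) * (2 ^ c) ^ i)"
  unfolding J_def by (intro sum_lessThan_split) simp
  also have "(SUM i=2^u..<2 ^ Suc u. s 11 (int (q * 2 ^ Suc u + i)) * (2 ^ c) ^ i)
  = (SUM i<2 ^ u. s 11 (int ((2 * q + 1) * 2 ^ u + i)) * ((2 ^ c) ^ i * 2 ^ (c * 2 ^ u)))"
  by (rule sum.reindex_bij_witness[of _ "%i. i + 2 ^ u" "%i. i - 2 ^ u"])
  (auto simp: algebra_simps power_mult simp flip: power_add)
  also have "... = J u (2 * q + 1) * 2 ^ (c * 2 ^ u)"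
  unfolding J_def sum_distrib_right by (simp only: mult.assoc)
  finally show ?thesis by (simp add: J_def algebra_simps)
 qed
 have J_le: "abs (J u q) <= 2 ^ (4 * c + c * 2 ^ u)" if "u <= k" "2 ^ (g + (k - u)) <= q" "q < 2 ^ (g + (k - u) + 1)" for u q
 proof -
  have e: "(2::nat) ^ (g + (k - u)) * 2 ^ u = 2 ^ (g + k)" "(2::nat) ^ (g + (k - u) + 1) * 2 ^ u = 2 ^ (g + k + 1)"
  using that by (simp_all flip: power_add power_Suc)
  have "2 ^ (g + (k - u)) * 2 ^ u <= q * 2 ^ u" "(q + 1) * 2 ^ u <= 2 ^ (g + (k - u) + 1) * 2 ^ u"
  using that by (intro mult_right_mono; simp)+
  hence q: "2 ^ (g + k) <= q * 2 ^ u" "(q + 1) * 2 ^ u <= 2 ^ (g + k + 1)" unfolding e by simp_all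
  have "abs (J u q) <= (SUM i<2 ^ u. abs (s 11 (int (q * 2 ^ u + i)) * (2 ^ c) ^ i))" unfolding J_def by (rule sum_abs)
  also have "... <= (SUM i<2 ^ u. 2 ^ (4 * c) * (2 ^ c) ^ i)"
  proof (intro sum_mono)
  fix i :: nat
  assume "i : {..<2 ^ u}"
  hence "abs (s 11 (int (q * 2 ^ u + i))) <= 2 ^ (4 * c)" unfolding c_def using q by (intro A) auto
  thus "abs (s 11 (int (q * 2 ^ u + i)) * (2 ^ c) ^ i) <= 2 ^ (4 * c) * (2 ^ c) ^ i"
  unfolding abs_mult by (intro mult_mono) auto
  qed
  also have "... = 2 ^ (4 * c) * (SUM i<2 ^ u. (2 ^ c) ^ i)" by (simp add: sum_distrib_left)
  also have "... <= 2 ^ (4 * c) * (2 ^ c) ^ 2 ^ u" by (intro mult_left_mono sum_two_pow_le) (auto simp: c_def)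
  finally show ?thesis by (simp add: power_add power_mult)
 qed
 define I where "I u s' = (u <= k & s' 41 0 = int u & same ?M s' s &
  (ALL q. 2 ^ (g + (k - u)) <= q --> q < 2 ^ (g + (k - u) + 1) --> s' 11 (int q) = J u q))" for u s'
 have "runs join s ((k - 0 + 1) * ((wt join_init + join_wt) * unit g t X + for_wt (Const 0) (Var 22) * (X + 1))) (I k)"
  unfolding join_def
 proof (rule runs_For)
  show "I 0 (s(41 := (s 41)(0 := int 0)))"
  unfolding I_def by (auto simp: J0)
 next
  fix j s'
  assume I: "I j s'"
  have "j < 2 ^ X" using I X less_two_power[of j X] unfolding I_def by linarith
  thus "s' 41 0 = int j & abs (int j) < 2 ^ X" using I by (simp add: I_def)
  have "k < 2 ^ X" using X by (intro less_two_power) simp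
  thus "small X (Var 22) s' & val (Var 22) s' = int k"
  using I sameD[of ?M s' s 22] s unfolding I_def by simp
 next
  fix u s1
  assume u: "u < k" and I: "I u s1"
  define d where "d = k - Suc u"
  have d: "d < k" "int k - int u - 1 = int d" "k - u = Suc d" "k - Suc u = d" using u by (simp_all add: d_def)
  define h :: nat where "h = 2 ^ (t - Suc d)"
  define lo :: nat where "lo = 2 ^ (g + d)"
  define L where "L = 2 ^ (t - d) + 4 * c + X + 5"
  have s1: "s1 41 0 = int u" "same ?M s1 s" using I unfolding I_def by auto
  note s1' = sameD[OF s1(2)]
  have hh: "2 ^ (t - d) = 2 * h" using d X by (simp add: h_def Suc_diff_Suc flip: power_Suc)
  have hc: "h = c * 2 ^ u" using d X u by (simp add: h_def c_def flip: power_add)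
  have XL: "X <= L" by (simp add: L_def)
  have hL: "h <= L" "h < 2 ^ L" using less_two_power[of h] unfolding L_def hh by auto
  have loX: "2 * lo < 2 ^ L" "lo < 2 ^ L"
  proof -
  have "(2::nat) ^ Suc (g + d) < 2 ^ L" using X d(1) by (intro power_strict_increasing) (auto simp: L_def)
  thus "2 * lo < 2 ^ L" by (simp add: lo_def)
  thus "lo < 2 ^ L" by linarith
  qed
  have cost: "(2 * lo + 1) * (L + 1) <= unit g t X"
  by (rule stage_cost[OF lo_def, of k]) (use d(1) X in "auto simp: L_def c_def")
  have n: "nat (int t - int d - 1) = t - Suc d" "nat (int g + int d) = g + d"
  "int t <= 1 + (int d + int L)" "int t - int d - 1 <= int L" "int g + int d <= int L"
  using X d(1) XL by auto
  have vars: "t < 2 ^ L" "g < 2 ^ L" "d < 2 ^ L" "k < 2 ^ L" "u < 2 ^ L" using X XL d(1) u by (auto intro!: less_two_power)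
  define s2 where "s2 = s1(25 := (s1 25)(0 := int d), 33 := (s1 33)(0 := int h), 34 := (s1 34)(0 := int lo), 35 := (s1 35)(0 := int (2 * lo)))"
  have s2: "s2 33 0 = int h" "s2 34 0 = int lo" "s2 35 0 = int (2 * lo)" "s2 11 = s1 11" "s2 41 0 = int u" "same ?M s2 s"
  using s1 by (simp_all add: s2_def)
  show "runs (join_init ;; join_loop) s1 ((wt join_init + join_wt) * unit g t X)
  (%s'. s' 41 0 = int u & I (Suc u) (s'(41 := (s' 41)(0 := int u + 1))))"
  proof (rule runs_Seq[where R = "%s'. s' = s2"])
  show "runs join_init s1 (wt join_init * (L + 1)) (%s'. s' = s2)"
  proof (rule runs_wp)
  have i: "int h = 2 ^ (t - Suc d)" "int lo = 2 ^ (g + d)" by (simp_all add: h_def lo_def)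
  have "int lo < 2 ^ L" using loX by simp
  hence "(2::int) ^ (g + d) < 2 ^ L" unfolding i(2) .
  thus "wp L join_init (%s'. s' = s2) s1"
  using s s1(1) n vars X d(2) by (simp add: join_init_def s2_def s1' i L_def mult.commute)
  qed
  next
  fix s2'
  assume "s2' = s2"
  have AL: "(2::int) ^ (4 * c + c * 2 ^ u) < 2 ^ L"
  by (intro power_strict_increasing) (auto simp: L_def hh hc)
  have r1: "lo <= q ==> 2 ^ (g + (k - u)) <= 2 * q" "q < 2 * lo ==> 2 * q + 1 < 2 ^ (g + (k - u) + 1)" for q
  unfolding d(3) lo_def by auto
  show "runs join_loop s2' ((2 * lo - lo + 1) * (join_wt * (L + 1)))
  (%s'. s' 41 0 = int u & I (Suc u) (s'(41 := (s' 41)(0 := int u + 1))))"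
  unfolding `s2' = s2`
  proof (rule runs_mono[OF runs_join_loop[where lo = lo and hi = "2 * lo" and h = h and L = L]])
  fix e
  assume e: "2 * lo <= e" "e < 2 * (2 * lo)"
  have e': "2 ^ (g + (k - u)) <= e" "e < 2 ^ (g + (k - u) + 1)" using e unfolding d(3) lo_def by simp_all
  hence "s1 11 (int e) = J u e" using I unfolding I_def by blast
  thus "abs (s2 11 (int e)) < 2 ^ L" using le_less_trans[OF J_le[OF _ e'] AL] u by (simp add: s2)
  next
  fix s3
  assume s3: "same {11, 27} s3 s2 & (ALL i. s3 11 (int i) = (if lo <= i & i < 2 * lo
  then s2 11 (int (2 * i)) + s2 11 (int (2 * i + 1)) * 2 ^ h else s2 11 (int i)))"
  have s3_11: "s3 11 (int i) = s1 11 (int (2 * i)) + s1 11 (int (2 * i + 1)) * 2 ^ h"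
  if "lo <= i" "i < 2 * lo" for i using s3 that by (simp add: s2)
  note s3' = sameD[OF conjunct1[OF s3]]
  have "same ?M s3 s"
  using s3 s2(6) unfolding same_def by auto
  moreover have "s3 11 (int q) = J (Suc u) q" if "lo <= q" "q < 2 * lo" for q
  proof -
  have Iq: "s1 11 (int e) = J u e" if "2 ^ (g + (k - u)) <= e" "e < 2 ^ (g + (k - u) + 1)" for e
  using I that unfolding I_def by blast
  have "s1 11 (int (2 * q)) = J u (2 * q)" "s1 11 (int (2 * q + 1)) = J u (2 * q + 1)"
  by (rule Iq; use r1[of q] that in linarith)+
  thus ?thesis using that by (simp only: s3_11 J_Suc hc)
  qed
  ultimately show "s3 41 0 = int u & I (Suc u) (s3(41 := (s3 41)(0 := int u + 1)))"
  using u d unfolding I_def by (simp add: s3' s2 lo_def)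
  qed (use loX hL s2 in "auto simp: L_def")
  next
  have "wt join_init * (L + 1) <= wt join_init * ((2 * lo + 1) * (L + 1))"
  by (intro mult_le_mono2) simp
  moreover have "(2 * lo - lo + 1) * (join_wt * (L + 1)) <= join_wt * ((2 * lo + 1) * (L + 1))"
  by (simp add: algebra_simps)
  ultimately have "wt join_init * (L + 1) + (2 * lo - lo + 1) * (join_wt * (L + 1))
  <= (wt join_init + join_wt) * ((2 * lo + 1) * (L + 1))"
  unfolding add_mult_distrib[of "wt join_init"] by (rule add_mono)
  also have "... <= (wt join_init + join_wt) * unit g t X" using cost by (rule mult_le_mono2)
  finally show "wt join_init * (L + 1) + (2 * lo - lo + 1) * (join_wt * (L + 1))
  <= (wt join_init + join_wt) * unit g t X" .
  qed
 qed (use X in simp_all)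
 thus ?thesis
 proof (rule runs_mono)
  have "X + 1 <= 1 * (X + 10)" by simp
  also have "... <= unit g t X" unfolding unit_def by (intro mult_right_mono) auto
  finally have "for_wt (Const 0) (Var 22) * (X + 1) <= for_wt (Const 0) (Var 22) * unit g t X" by (rule mult_le_mono2)
  hence "(wt join_init + join_wt) * unit g t X + for_wt (Const 0) (Var 22) * (X + 1) <= join_stage_wt * unit g t X"
  unfolding join_stage_wt_def by (simp add: algebra_simps)
  thus "(k - 0 + 1) * ((wt join_init + join_wt) * unit g t X + for_wt (Const 0) (Var 22) * (X + 1))
  <= (k + 1) * (join_stage_wt * unit g t X)" by (simp only: diff_zero) (rule mult_le_mono2)
 next
  fix s'
  assume I: "I k s'"
  have ct: "c * 2 ^ k = 2 ^ t" using X by (simp add: c_def flip: power_add)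
  have "abs (J k p) <= 2 ^ (4 * c + 2 ^ t)" if "2 ^ g <= p" "p < 2 ^ (g + 1)" for p
  using J_le[of k p] that by (simp add: ct)
  thus "same {11, 25, 27, 33, 34, 35, 41} s' s &
  (ALL p. 2 ^ g <= p --> p < 2 ^ (g + 1) -->
  s' 11 (int p) = (SUM i<2 ^ k. s 11 (int (p * 2 ^ k + i)) * (2 ^ 2 ^ (t - k)) ^ i)
  & abs (s' 11 (int p)) <= 2 ^ (4 * 2 ^ (t - k) + 2 ^ t))"
  using I unfolding I_def J_def c_def by simp
 qed
qed

section \<open>Multiplication of large integers\<close>

text \<open>The summand 2 gives the smaller ring \<open>N = 4 * 2 ^ (t - k)\<close> bits for digits
  of \<open>2 ^ (t - k)\<close> bits: twofold length for a product of digits, and the rest for a sum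
  of \<open>2 ^ k\<close> such products with sign.\<close>

definition prep_vars :: prog where
 "prep_vars = (Assign 23 (Var 20 [-] Var 22 [+] Const 2) ;; Assign 24 (Const 1 [<<] Var 23) ;;
  Assign 35 (Const 1 [<<] (Var 22 [+] Const 1)))"

definition range_vars :: prog where
 "range_vars = (Assign 34 (Const 1 [<<] (Var 21 [+] Var 22)) ;; Assign 35 (Var 34 [<<] Const 1))"

definition prep :: prog where
 "prep = (prep_vars ;; exps ;; range_vars)"

definition prep_wt :: nat where
 "prep_wt = wt prep_vars + exps_wt + wt range_vars"

text \<open>The \<open>2 ^ (g + k)\<close> residues at the leaves are four times as long as the
  digits, so a pass over them still costs a bounded number of units.\<close>

lemma leaf_cost:
 assumes "lo = (2::nat) ^ (g + k)" "k <= t" "L <= 2 * 2 ^ (t - k + 2) + 4 + X"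
 shows "(2 * lo + 1) * (L + 1) <= 2 * unit g t X"
proof -
 have e: "(2::nat) ^ k * 2 ^ (t - k) = 2 ^ t" using assms by (simp flip: power_add)
 have e3: "(2::nat) ^ k <= 2 ^ t" using assms by (intro power_increasing) auto
 have "2 ^ k * (L + 1) <= 2 ^ k * (8 * 2 ^ (t - k) + X + 5)" using assms(3) by (intro mult_left_mono) (auto simp: power_add)
 also have "... = 8 * (2 ^ k * 2 ^ (t - k)) + 2 ^ k * (X + 5)" by (simp add: algebra_simps)
 also have "... <= 8 * 2 ^ t + 2 ^ t * (X + 5)"
  unfolding e using mult_le_mono1[OF e3, of "X + 5"] by linarith
 also have "... <= 2 * 2 ^ t * (X + 10)" by (simp add: algebra_simps)
 finally have *: "2 ^ g * (2 ^ k * (L + 1)) <= 2 ^ g * (2 * 2 ^ t * (X + 10))" by (rule mult_le_mono2)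
 have "(2 * lo + 1) * (L + 1) <= (4 * lo) * (L + 1)"
  using one_le_power[of "2::nat" "g + k"] unfolding assms(1) by (intro mult_right_mono) auto
 also have "... = 4 * (2 ^ g * (2 ^ k * (L + 1)))" by (simp add: assms(1) power_add algebra_simps)
 also have "... <= 4 * (2 ^ g * (2 * 2 ^ t * (X + 10)))" using * by (rule mult_le_mono2)
 also have "... <= 2 * unit g t X" by (simp add: unit_def power_add)
 finally show ?thesis .
qed

lemma runs_prep:
 assumes s: "s 20 0 = int t" "s 21 0 = int g" "s 22 0 = int k"
  and X: "k <= t" "t + 2 <= X" "g + k + 2 <= X"
 defines "N == 2 ^ (t - k + 2)"
 shows "runs prep s (2 * (prep_wt * unit g t X))
  (%s'. same {13, 23, 24, 27, 34, 35} s' s & s' 24 0 = int N &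
  s' 34 0 = int (2 ^ (g + k)) & s' 35 0 = int (2 * 2 ^ (g + k)) &
  (ALL i. 1 <= i --> i < 2 ^ Suc k --> s' 13 (int i) = int (root_exp N i)))"
proof -
 define L where "L = 2 * N + 4 + X"
 define lo :: nat where "lo = 2 ^ (g + k)"
 define m where "m = t - k + 2"
 have XL: "X <= L" "X < L" by (simp_all add: L_def)
 have cost: "(2 * lo + 1) * (L + 1) <= 2 * unit g t X"
  by (rule leaf_cost[OF lo_def X(1)]) (simp add: L_def N_def)
 define s1 where "s1 = s(23 := (s 23)(0 := int m), 24 := (s 24)(0 := int N), 35 := (s 35)(0 := int (2 ^ Suc k)))"
 have s1: "s1 24 0 = int N" "s1 35 0 = int (2 ^ Suc k)" "same {23, 24, 35} s1 s" by (simp_all add: s1_def)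
 have vars: "t < 2 ^ L" "g < 2 ^ L" "k < 2 ^ L" "m < 2 ^ L" using X XL by (auto intro!: less_two_power simp: m_def)
 have pow: "(2::int) ^ m < 2 ^ L" "(2::nat) ^ (g + k) < 2 ^ L" "(2::int) ^ (g + k) < 2 ^ L" "2 ^ Suc k < (2::nat) ^ L"
  using X XL by (intro power_strict_increasing; simp add: m_def)+
 show ?thesis
  unfolding prep_def
 proof (rule runs_Seq[where R = "%s'. s' = s1"])
  show "runs prep_vars s (wt prep_vars * (L + 1)) (%s'. s' = s1)"
  proof (rule runs_wp)
  have n: "int t - int k + 2 = int m" "nat (int k + 1) = Suc k" "N = 2 ^ m" "int m <= int L"
  using X XL by (auto simp: m_def N_def)
  show "wp L prep_vars (%s'. s' = s1) s"
  using s vars X pow XL n by (simp add: prep_vars_def s1_def)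
  qed
 next
  fix s1'
  assume "s1' = s1"
  show "runs (exps ;; range_vars) s1' (2 ^ Suc k * (exps_wt * (L + 1)) + wt range_vars * (L + 1))
  (%s'. same {13, 23, 24, 27, 34, 35} s' s & s' 24 0 = int N &
  s' 34 0 = int (2 ^ (g + k)) & s' 35 0 = int (2 * 2 ^ (g + k)) &
  (ALL i. 1 <= i --> i < 2 ^ Suc k --> s' 13 (int i) = int (root_exp N i)))"
  unfolding `s1' = s1`
  proof (rule runs_Seq[OF runs_exps[where hi = "2 ^ Suc k" and N = N and L = L]])
  show "2 * N < 2 ^ L" by (rule less_two_power) (simp add: L_def)
  show "1 <= N" by (simp add: N_def)
  fix s2
  assume s2: "same {13, 27} s2 s1 & (ALL i. 1 <= i --> i < 2 ^ Suc k --> s2 13 (int i) = int (root_exp N i))"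
  note s2' = sameD[OF conjunct1[OF s2]]
  have sm: "same {13, 23, 24, 27, 34, 35} s2 s" using s2 s1(3) unfolding same_def by auto
  have v2: "s2 21 0 = int g" "s2 22 0 = int k" "s2 24 0 = int N" using s by (simp_all add: s2' s1_def)
  have n: "nat (int g + int k) = g + k" by simp
  show "runs range_vars s2 (wt range_vars * (L + 1))
  (%s'. same {13, 23, 24, 27, 34, 35} s' s & s' 24 0 = int N &
  s' 34 0 = int (2 ^ (g + k)) & s' 35 0 = int (2 * 2 ^ (g + k)) &
  (ALL i. 1 <= i --> i < 2 ^ Suc k --> s' 13 (int i) = int (root_exp N i)))"
  by (rule runs_wp)
  (use v2 n vars pow X XL sm s2 in "simp add: range_vars_def mult.commute")
  qed (use s1 pow XL X in simp_all)
 next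
  have "(2::nat) ^ Suc k <= 2 * lo" unfolding lo_def power_add by simp
  hence "2 ^ Suc k * (exps_wt * (L + 1)) <= (2 * lo + 1) * (exps_wt * (L + 1))" by (intro mult_le_mono1) simp
  moreover have "w * (L + 1) <= (2 * lo + 1) * (w * (L + 1))" for w by simp
  ultimately have "wt prep_vars * (L + 1) + (2 ^ Suc k * (exps_wt * (L + 1)) + wt range_vars * (L + 1))
  <= (2 * lo + 1) * (wt prep_vars * (L + 1)) + ((2 * lo + 1) * (exps_wt * (L + 1)) + (2 * lo + 1) * (wt range_vars * (L + 1)))"
  by (intro add_mono)
  also have "... = prep_wt * ((2 * lo + 1) * (L + 1))" by (simp only: prep_wt_def algebra_simps)
  also have "... <= prep_wt * (2 * unit g t X)" using cost by (rule mult_le_mono2)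
  finally show "wt prep_vars * (L + 1) + (2 ^ Suc k * (exps_wt * (L + 1)) + wt range_vars * (L + 1))
  <= 2 * (prep_wt * unit g t X)" by simp
 qed
qed

text \<open>The numbers \<open>a p\<close> (roots) are cut into digits \<open>x\<close>, whose transforms are stored in the leaves.\<close>

definition level :: "nat => nat => (nat => int) => bool" where
 "level t g a = ((ALL p. 2 ^ g <= p --> p < 2 ^ (g + 1) -->
  (EX x. (ALL i < 2 ^ (t div 2). abs (x i) <= 2 ^ 2 ^ (t - t div 2) + 8) &
  a p = (SUM i<2 ^ (t div 2). x i * (2 ^ 2 ^ (t - t div 2)) ^ i) &
  transf (2 ^ (t - t div 2 + 2)) (t div 2) p (t div 2) x a)))"

text \<open>Only indices up to the end of the leaves matter; deeper levels of the recursion, stored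
  further up in the heap, leave the property intact.\<close>

lemma level_cong:
 assumes "level t g a" "!!i. i < 2 ^ (g + t div 2 + 1) ==> a' i = a i"
 shows "level t g a'"
 unfolding level_def
proof (intro allI impI)
 fix p :: nat
 assume p: "2 ^ g <= p" "p < 2 ^ (g + 1)"
 define k where "k = t div 2"
 have "(p + 1) * 2 ^ k <= 2 ^ (g + 1) * 2 ^ k" using p by (intro mult_right_mono) auto
 hence pk: "(p + 1) * 2 ^ k <= 2 ^ (g + t div 2 + 1)" by (simp add: power_add k_def)
 have "(p + 1) * 1 <= (p + 1) * 2 ^ k" by (intro mult_le_mono2) simp
 hence "p + 1 <= (p + 1) * 2 ^ k" by (simp only: mult_1_right)
 hence "p + 1 <= 2 ^ (g + t div 2 + 1)" using pk by (rule order_trans)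
 hence pp: "p < 2 ^ (g + t div 2 + 1)" by simp
 obtain x where x: "ALL i < 2 ^ k. abs (x i) <= 2 ^ 2 ^ (t - k) + 8" "a p = (SUM i<2 ^ k. x i * (2 ^ 2 ^ (t - k)) ^ i)"
  "transf (2 ^ (t - k + 2)) k p k x a" using assms(1) p unfolding level_def k_def by blast
 have "transf (2 ^ (t - k + 2)) k p k x a'"
  by (rule transf_cong[OF x(3)]) (use pk assms(2) in "auto simp: k_def")
 thus "EX x. (ALL i < 2 ^ (t div 2). abs (x i) <= 2 ^ 2 ^ (t - t div 2) + 8) &
  a' p = (SUM i<2 ^ (t div 2). x i * (2 ^ 2 ^ (t - t div 2)) ^ i) &
  transf (2 ^ (t - t div 2 + 2)) (t div 2) p (t div 2) x a'"
  using x assms(2)[OF pp] unfolding k_def[symmetric] by auto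
qed

definition down :: prog where
 "down = (Assign 22 (Var 20 [>>] Const 1) ;; split ;; prep ;; fft)"

definition down_wt :: nat where
 "down_wt = wt (Assign 22 (Var 20 [>>] Const 1)) + split_stage_wt + 2 * prep_wt + 2 * fft_wt"

lemma one_le_unit: "X + 1 <= unit g t X"
proof -
 have "X + 1 <= 1 * (X + 10)" by simp
 also have "... <= unit g t X" unfolding unit_def by (intro mult_right_mono) auto
 finally show ?thesis .
qed

text \<open>The bound on the leaves in the last clause is the hypothesis on the operands of the next
  level, whose modulus is \<open>2 ^ 2 ^ (t - t div 2 + 2) + 1\<close>.\<close>

lemma runs_down:
 assumes s: "s 20 0 = int t" "s 21 0 = int g"
  and A: "!!i. 2 ^ g <= i ==> i < 2 ^ (g + 1) ==> abs (s 10 (int i)) <= 2 ^ 2 ^ t + 8"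
  and X: "6 <= t" "t + 2 <= X" "g + t div 2 + 2 <= X"
 shows "runs down s ((t div 2 + 1) * (down_wt * unit g t X))
  (%s'. same {10, 12, 13, 22, 23, 24, 25, 26, 27, 28, 29, 30, 31, 33, 34, 35, 36, 37, 38} s' s &
  (ALL i < 2 ^ (g + 1). s' 10 (int i) = s 10 (int i)) & level t g (%i. s' 10 (int i)) &
  (ALL i. 2 ^ (g + t div 2) <= i --> i < 2 ^ (g + t div 2 + 1) -->
  abs (s' 10 (int i)) <= 2 ^ 2 ^ (t - t div 2 + 2) + 8))"
proof -
 let ?M = "{10, 12, 13, 22, 23, 24, 25, 26, 27, 28, 29, 30, 31, 33, 34, 35, 36, 37, 38} :: nat set"
 define k where "k = t div 2"
 define N :: nat where "N = 2 ^ (t - k + 2)"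
 have k: "1 <= k" "k <= t" "k <= t - k + 2" using X by (auto simp: k_def)
 define s1 where "s1 = s(22 := (s 22)(0 := int k))"
 have s1: "s1 20 0 = int t" "s1 21 0 = int g" "s1 22 0 = int k" "same ?M s1 s" "s1 10 = s 10"
  using s by (simp_all add: s1_def)
 define P where "P s' = (same ?M s' s &
  (ALL i < 2 ^ (g + 1). s' 10 (int i) = s 10 (int i)) & level t g (%i. s' 10 (int i)) &
  (ALL i. 2 ^ (g + k) <= i --> i < 2 ^ (g + k + 1) --> abs (s' 10 (int i)) <= 2 ^ N + 8))" for s'
 define lo :: nat where "lo = 2 ^ (g + k)"
 have "runs down s (wt (Assign 22 (Var 20 [>>] Const 1)) * (X + 1) + ((k + 1) * (split_stage_wt * unit g t X)
  + (2 * (prep_wt * unit g t X) + (k + 1) * ((2 * lo - lo + 1) * (fft_wt * ((2 * N + 4 + X) + 1)))))) P"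
  unfolding down_def
 proof (rule runs_Seq[where R = "%s'. s' = s1"])
  have "t < 2 ^ X" using less_exp[of X] X by linarith
  moreover have "int t div 2 = int k" by (simp add: k_def zdiv_int)
  ultimately show "runs (Assign 22 (Var 20 [>>] Const 1)) s (wt (Assign 22 (Var 20 [>>] Const 1)) * (X + 1)) (%s'. s' = s1)"
  using s by (intro runs_wp) (simp add: s1_def)
 next
  fix s1'
  assume "s1' = s1"
  show "runs (split ;; prep ;; fft) s1' ((k + 1) * (split_stage_wt * unit g t X)
  + (2 * (prep_wt * unit g t X) + (k + 1) * ((2 * lo - lo + 1) * (fft_wt * ((2 * N + 4 + X) + 1))))) P"
  unfolding `s1' = s1`
  proof (rule runs_Seq[OF runs_split[where t = t and g = g and k = k and X = X]])
  fix s2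
  assume s2: "same {10, 25, 27, 28, 33, 34, 35} s2 s1 &
  (ALL i < 2 ^ (g + 1). s2 10 (int i) = s1 10 (int i)) &
  (ALL i. 2 ^ (g + k) <= i --> i < 2 ^ (g + k + 1) --> abs (s2 10 (int i)) <= 2 ^ 2 ^ (t - k) + 8) &
  (ALL p. 2 ^ g <= p --> p < 2 ^ (g + 1) -->
  s1 10 (int p) = (SUM i<2 ^ k. s2 10 (int (p * 2 ^ k + i)) * (2 ^ 2 ^ (t - k)) ^ i))"
  note s2' = sameD[OF conjunct1[OF s2]]
  have v2: "s2 20 0 = int t" "s2 21 0 = int g" "s2 22 0 = int k" using s1 by (simp_all add: s2')
  show "runs (prep ;; fft) s2 (2 * (prep_wt * unit g t X) + (k + 1) * ((2 * lo - lo + 1) * (fft_wt * ((2 * N + 4 + X) + 1)))) P"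
  proof (rule runs_Seq[OF runs_prep[where t = t and g = g and k = k and X = X]])
  fix s3
  assume s3: "same {13, 23, 24, 27, 34, 35} s3 s2 & s3 24 0 = int (2 ^ (t - k + 2)) &
  s3 34 0 = int (2 ^ (g + k)) & s3 35 0 = int (2 * 2 ^ (g + k)) &
  (ALL i. 1 <= i --> i < 2 ^ Suc k --> s3 13 (int i) = int (root_exp (2 ^ (t - k + 2)) i))"
  note s3' = sameD[OF conjunct1[OF s3]]
  show "runs fft s3 ((k + 1) * ((2 * lo - lo + 1) * (fft_wt * ((2 * N + 4 + X) + 1)))) P"
  proof (rule runs_mono[OF runs_fft[where t = "t - k + 2" and k = k]])
  show "s3 22 0 = int k" using v2 by (simp add: s3')
  show "s3 24 0 = int (2 ^ (t - k + 2))" "s3 34 0 = int lo" "s3 35 0 = int (2 * lo)"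
  using s3 unfolding lo_def by blast+
  show "s3 13 (int i) = int (root_exp (2 ^ (t - k + 2)) i)" if "1 <= i" "i < 2 ^ Suc k" for i
  using s3 that by blast
  show "abs (s3 10 (int i)) <= 2 ^ 2 ^ (t - k + 2) + 8" if "lo <= i" "i < 2 * lo" for i
  proof -
  have "abs (s2 10 (int i)) <= 2 ^ 2 ^ (t - k) + 8" using s2 that unfolding lo_def by simp
  also have "(2::int) ^ 2 ^ (t - k) <= 2 ^ 2 ^ (t - k + 2)" by (intro power_increasing) auto
  finally show ?thesis by (simp add: s3')
  qed
  show "2 * lo < 2 ^ (2 * N + 4 + X)"
  proof -
  have "2 * lo = 2 ^ Suc (g + k)" by (simp add: lo_def)
  also have "... < (2::nat) ^ (2 * N + 4 + X)" using X by (intro power_strict_increasing) (auto simp: k_def)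
  finally show ?thesis .
  qed
  show "2 ^ k dvd lo" "2 ^ k dvd 2 * lo" by (simp_all add: lo_def power_add)
  next
  fix s4
  assume s4: "same {10, 12, 25, 26, 27, 28, 29, 30, 31, 36, 37, 38} s4 s3 &
  (ALL i. ~ (lo <= i & i < 2 * lo) --> s4 10 (int i) = s3 10 (int i)) &
  (ALL i. lo <= i --> i < 2 * lo --> abs (s4 10 (int i)) <= 2 ^ 2 ^ (t - k + 2) + 8) &
  (ALL p. lo <= p * 2 ^ k --> (p + 1) * 2 ^ k <= 2 * lo -->
  transf (2 ^ (t - k + 2)) k p k (%i. s3 10 (int (p * 2 ^ k + i))) (%i. s4 10 (int i)))"
  have "same ?M s4 s"
  using s4 s3 s2 s1(4) unfolding same_def by auto
  moreover have unch: "s4 10 (int i) = s 10 (int i)" if "i < 2 ^ (g + 1)" for i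
  proof -
  have "(2::nat) ^ (g + 1) <= lo" unfolding lo_def using k by (intro power_increasing) auto
  hence "s4 10 (int i) = s3 10 (int i)" using s4 that by simp
  also have "... = s 10 (int i)" using s2 that by (simp add: s3' s1)
  finally show ?thesis .
  qed
  moreover have "abs (s4 10 (int i)) <= 2 ^ N + 8" if "2 ^ (g + k) <= i" "i < 2 ^ (g + k + 1)" for i
  using s4 that unfolding N_def lo_def by simp
  moreover have "level t g (%i. s4 10 (int i))"
  unfolding level_def k_def[symmetric]
  proof (intro allI impI)
  fix p :: nat
  assume p: "2 ^ g <= p" "p < 2 ^ (g + 1)"
  have "2 ^ g * 2 ^ k <= p * 2 ^ k" "(p + 1) * 2 ^ k <= 2 ^ (g + 1) * 2 ^ k"
  using p by (intro mult_right_mono; simp)+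
  hence pl: "lo <= p * 2 ^ k" "(p + 1) * 2 ^ k <= 2 * lo" by (simp_all add: lo_def power_add)
  define x where "x i = s2 10 (int (p * 2 ^ k + i))" for i
  have "ALL i < 2 ^ k. abs (x i) <= 2 ^ 2 ^ (t - k) + 8"
  proof (intro allI impI)
  fix i :: nat
  assume "i < 2 ^ k"
  hence "2 ^ (g + k) <= p * 2 ^ k + i" "p * 2 ^ k + i < 2 ^ (g + k + 1)" using pl unfolding lo_def by simp_all
  thus "abs (x i) <= 2 ^ 2 ^ (t - k) + 8" using s2 unfolding x_def by blast
  qed
  moreover have "s4 10 (int p) = (SUM i<2 ^ k. x i * (2 ^ 2 ^ (t - k)) ^ i)"
  using s2 p unch[OF p(2)] unfolding x_def s1(5) by simp
  moreover have "transf (2 ^ (t - k + 2)) k p k x (%i. s4 10 (int i))"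
  using s4 pl unfolding x_def by (simp add: s3')
  ultimately show "EX x. (ALL i<2 ^ k. abs (x i) <= 2 ^ 2 ^ (t - k) + 8) &
  s4 10 (int p) = (SUM i<2 ^ k. x i * (2 ^ 2 ^ (t - k)) ^ i) &
  transf (2 ^ (t - k + 2)) k p k x (%i. s4 10 (int i))" by blast
  qed
  ultimately show "P s4" unfolding P_def by blast
  qed (use k X in "auto simp: N_def k_def")
  qed (use v2 k X in "auto simp: k_def")
  next
  show "abs (s1 10 (int i)) <= 2 ^ 2 ^ t + 8" if "2 ^ g <= i" "i < 2 ^ (g + 1)" for i
  using A that by (simp add: s1)
  qed (use s1 k X in "auto simp: k_def")
 qed simp
 thus ?thesis
 proof (rule runs_mono)
  define w where "w = wt (Assign 22 (Var 20 [>>] Const 1))"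
  define U where "U = unit g t X"
  have "w * (X + 1) <= w * U" unfolding U_def using one_le_unit by (rule mult_le_mono2)
  hence 1: "w * (X + 1) <= (k + 1) * (w * U)" by simp
  have "2 * (prep_wt * U) <= (k + 1) * (2 * prep_wt * U)" by simp
  moreover have "(2 * lo - lo + 1) * (fft_wt * ((2 * N + 4 + X) + 1)) <= fft_wt * ((2 * lo + 1) * ((2 * N + 4 + X) + 1))"
  by (simp add: algebra_simps)
  moreover have "fft_wt * ((2 * lo + 1) * ((2 * N + 4 + X) + 1)) <= fft_wt * (2 * U)"
  unfolding U_def by (intro mult_le_mono2 leaf_cost[OF lo_def k(2)]) (simp add: N_def)
  ultimately have "w * (X + 1) + ((k + 1) * (split_stage_wt * U)
  + (2 * (prep_wt * U) + (k + 1) * ((2 * lo - lo + 1) * (fft_wt * ((2 * N + 4 + X) + 1)))))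
  <= (k + 1) * (w * U) + ((k + 1) * (split_stage_wt * U) + ((k + 1) * (2 * prep_wt * U) + (k + 1) * (fft_wt * (2 * U))))"
  using 1 by (intro add_mono mult_le_mono2) linarith+
  also have "... = (k + 1) * (down_wt * U)" unfolding down_wt_def w_def[symmetric] by (simp add: algebra_simps)
  finally show "wt (Assign 22 (Var 20 [>>] Const 1)) * (X + 1) + ((k + 1) * (split_stage_wt * unit g t X)
  + (2 * (prep_wt * unit g t X) + (k + 1) * ((2 * lo - lo + 1) * (fft_wt * ((2 * N + 4 + X) + 1)))))
  <= (t div 2 + 1) * (down_wt * unit g t X)" by (simp only: w_def U_def k_def)
 qed (simp add: P_def N_def k_def)
qed

lemma centre_cong: "[centre N z = z] (mod 2 ^ N + 1)"
proof -
 have "centre N z - z = - (2 ^ N + 1) | centre N z - z = 0 | centre N z - z = 2 ^ N + 1"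
  unfolding centre_def by auto
 thus ?thesis unfolding cong_iff_dvd_diff by (metis dvd_0_right dvd_minus_iff dvd_refl)
qed

text \<open>The balanced value is at most \<open>2 ^ (N - 1) + 1\<close>, so its distance from
  \<open>w\<close> is less than the modulus by which that distance is divisible.\<close>

lemma centre_eqI:
 assumes "[z = w] (mod 2 ^ N + 1)" "abs z <= 2 ^ N + 8" "abs w < 2 ^ (N - 2)" "6 <= N"
 shows "centre N z = w"
proof -
 define y :: int where "y = 2 ^ (N - 2)"
 have e: "(2::int) ^ N = 4 * y" "(2::int) ^ (N - 1) = 2 * y"
 proof -
  have "N = Suc (Suc (N - 2))" "N - 1 = Suc (N - 2)" using assms(4) by auto
  hence "(2::int) ^ N = 2 ^ Suc (Suc (N - 2))" "(2::int) ^ (N - 1) = 2 ^ Suc (N - 2)" by simp_all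
  thus "(2::int) ^ N = 4 * y" "(2::int) ^ (N - 1) = 2 * y" by (simp_all add: y_def)
 qed
 have y: "2 ^ 4 <= y" unfolding y_def using assms(4) by (intro power_increasing) auto
 have "[centre N z = w] (mod 2 ^ N + 1)" using centre_cong assms(1) by (rule cong_trans)
 hence "2 ^ N + 1 dvd centre N z - w" by (simp add: cong_iff_dvd_diff)
 moreover have "abs (centre N z) <= 2 * y + 1" using assms(2) y unfolding centre_def e by auto
 hence "abs (centre N z - w) < 2 ^ N + 1" using assms(3) unfolding e y_def[symmetric] by linarith
 ultimately have "centre N z - w = 0" using dvd_imp_le_int[of "centre N z - w" "2 ^ N + 1"] by fastforce
 thus ?thesis by simp
qed

text \<open>The products of level \<open>g\<close> have their operands on heap level
  \<open>g + 1\<close>, with the two factors of a product at distance \<open>2 ^ g\<close>.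
  Descending \<open>k\<close> layers sends an index \<open>q\<close> to
  \<open>q * 2 ^ k + i\<close>, so leaves belonging to the factors of a product are again placed in
  this way.\<close>

definition prods :: "nat => nat => (nat => int) => (nat => int) => bool" where
 "prods N g a z = ((ALL e. 2 ^ g <= e --> e < 2 ^ (g + 1) -->
  [z e = a (e + 2 ^ g) * a (e + 2 * 2 ^ g)] (mod 2 ^ N + 1) & abs (z e) <= 2 ^ N + 8))"

lemma transf_final: "transf N k p k x a =
  ((ALL B < 2 ^ k. [a (p * 2 ^ k + B) = (SUM j<2 ^ k. x j * rt N (2 ^ k + B) ^ j)] (mod 2 ^ N + 1)))"
 by (simp add: transf_def residue_def)

text \<open>Pointwise products of transforms represent the negacyclic product of the digits. Just
  this product is wanted one level up: the \<open>2 ^ k\<close>-th power of the base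
  \<open>2 ^ 2 ^ (t - k)\<close> is \<open>2 ^ 2 ^ t\<close>, that is -1 modulo the larger Fermat
  number. Therefore the recursion needs no padding by zeros.\<close>

lemma level_prods:
 assumes lev: "level t (Suc g) a" and t: "6 <= t"
  and leaf: "prods (2 ^ (t - t div 2 + 2)) (g + t div 2) a z"
  and e: "2 ^ g <= e" "e < 2 ^ (g + 1)"
 obtains w where "transf (2 ^ (t - t div 2 + 2)) (t div 2) e (t div 2) w z"
  "!!i. i < 2 ^ (t div 2) ==> abs (w i) < 2 ^ (2 ^ (t - t div 2 + 2) - 2)"
  "[(SUM i<2 ^ (t div 2). w i * (2 ^ 2 ^ (t - t div 2)) ^ i) = a (e + 2 ^ g) * a (e + 2 * 2 ^ g)] (mod 2 ^ 2 ^ t + 1)"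
proof -
 define k where "k = t div 2"
 define c :: nat where "c = 2 ^ (t - k)"
 define N :: nat where "N = 2 ^ (t - k + 2)"
 have k: "3 <= k" "k <= t - k" "k <= t" using t by (auto simp: k_def)
 have N: "N = 4 * c" by (simp add: N_def c_def power_add)
 have c: "2 ^ k <= c" unfolding c_def using k by (intro power_increasing) auto
 have c8: "8 <= c"
 proof -
  have "(2::nat) ^ 3 <= 2 ^ k" using k by (intro power_increasing) auto
  thus ?thesis using c by simp
 qed
 \<comment> \<open>A coefficient has \<open>k\<close> bits for the number of terms and
   \<open>c + 1\<close> bits for each factor, which has to remain below
   \<open>4 * c - 2\<close>.\<close>
 have kc: "k + 4 < 2 * c"
 proof -
  have "k < 2 ^ k" by (rule less_exp)
  thus ?thesis using c c8 by linarith
 qed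
 have "2 ^ Suc g <= e + 2 ^ g" "e + 2 ^ g < 2 ^ (Suc g + 1)" using e by simp_all
 with lev obtain x where x: "!!i. i < 2 ^ k ==> abs (x i) <= 2 ^ c + 8" "a (e + 2 ^ g) = (SUM i<2 ^ k. x i * (2 ^ c) ^ i)"
  "transf N k (e + 2 ^ g) k x a"
  unfolding level_def k_def[symmetric] c_def N_def by blast
 have "2 ^ Suc g <= e + 2 * 2 ^ g" "e + 2 * 2 ^ g < 2 ^ (Suc g + 1)" using e by simp_all
 with lev obtain y where y: "!!i. i < 2 ^ k ==> abs (y i) <= 2 ^ c + 8" "a (e + 2 * 2 ^ g) = (SUM i<2 ^ k. y i * (2 ^ c) ^ i)"
  "transf N k (e + 2 * 2 ^ g) k y a"
  unfolding level_def k_def[symmetric] c_def N_def by blast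
 define w where "w = negacyclic (2 ^ k) x y"
 have "abs (w i) < 2 ^ (N - 2)" if "i < 2 ^ k" for i
 proof -
  have "(2::int) ^ 8 <= 2 ^ c" using c8 by (intro power_increasing) auto
  hence "abs (x i) <= 2 ^ (c + 1)" "abs (y i) <= 2 ^ (c + 1)" if "i < 2 ^ k" for i
  using x(1)[OF that] y(1)[OF that] by (simp_all add: power_add)
  hence "abs (w i) <= int (2 ^ k) * (2 ^ (c + 1)) ^ 2"
  unfolding w_def using that by (intro abs_negacyclic_le) auto
  also have "... = 2 ^ (k + (c + 1) * 2)" by (simp add: power_add power_mult)
  also have "... < 2 ^ (N - 2)" using kc unfolding N by (intro power_strict_increasing) auto
  finally show ?thesis .
 qed
 moreover have "transf N k e k w z"
  unfolding transf_final
 proof (intro allI impI)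
  fix B :: nat
  assume B: "B < 2 ^ k"
  let ?c = "rt N (2 ^ k + B)"
  define q where "q = e * 2 ^ k + B"
  have "2 ^ g * 2 ^ k <= e * 2 ^ k" "(e + 1) * 2 ^ k <= 2 ^ (g + 1) * 2 ^ k"
  using e by (intro mult_right_mono; simp)+
  hence "2 ^ g * 2 ^ k <= q" "q < 2 * (2 ^ g * 2 ^ k)" using B
  by (simp only: q_def trans_le_add1, simp add: q_def)
  hence q: "2 ^ (g + k) <= q" "q < 2 ^ (g + k + 1)" by (simp_all add: power_add)
  have qq: "q + 2 ^ (g + k) = (e + 2 ^ g) * 2 ^ k + B" "q + 2 * 2 ^ (g + k) = (e + 2 * 2 ^ g) * 2 ^ k + B"
  by (simp_all add: q_def algebra_simps power_add)
  have "[z q = a (q + 2 ^ (g + k)) * a (q + 2 * 2 ^ (g + k))] (mod 2 ^ N + 1)"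
  using leaf q unfolding prods_def k_def[symmetric] N_def by blast
  also have "[a (q + 2 ^ (g + k)) * a (q + 2 * 2 ^ (g + k)) = (SUM j<2 ^ k. x j * ?c ^ j) * (SUM j<2 ^ k. y j * ?c ^ j)] (mod 2 ^ N + 1)"
  unfolding qq using x(3) y(3) B unfolding transf_final by (intro cong_mult) blast+
  also have "[(SUM j<2 ^ k. x j * ?c ^ j) * (SUM j<2 ^ k. y j * ?c ^ j) = (SUM j<2 ^ k. w j * ?c ^ j)] (mod 2 ^ N + 1)"
  unfolding w_def N_def by (intro negacyclic_cong rt_power_cong) (use B k in auto)
  finally show "[z (e * 2 ^ k + B) = (SUM j<2 ^ k. w j * ?c ^ j)] (mod 2 ^ N + 1)" unfolding q_def .
 qed
 moreover have "[(SUM i<2 ^ k. w i * (2 ^ c) ^ i) = a (e + 2 ^ g) * a (e + 2 * 2 ^ g)] (mod 2 ^ 2 ^ t + 1)"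
 proof -
  have "((2::int) ^ c) ^ 2 ^ k = 2 ^ 2 ^ t" using k by (simp add: c_def flip: power_mult power_add)
  hence "[((2::int) ^ c) ^ 2 ^ k = - 1] (mod 2 ^ 2 ^ t + 1)" using two_pow_cong by simp
  from negacyclic_cong[OF this, of x y] show ?thesis unfolding w_def x(2) y(2) by (rule cong_sym)
 qed
 ultimately show thesis using that unfolding k_def N_def c_def by blast
qed

definition sym_vars :: prog where
 "sym_vars = (Assign 39 (Const 1 [<<] (Var 24 [-] Const 1)) ;; Assign 40 ((Const 1 [<<] Var 24) [+] Const 1))"

lemma runs_sym_vars:
 assumes "s 24 0 = int N" "N < L" "1 <= N"
 shows "runs sym_vars s (wt sym_vars * (L + 1))
  (%s'. same {39, 40} s' s & s' 39 0 = 2 ^ (N - 1) & s' 40 0 = 2 ^ N + 1)"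
proof (rule runs_wp)
 have "N < 2 ^ L" using assms less_exp[of L] by linarith
 moreover have "nat (int N - 1) = N - 1" "int N - 1 <= int L" using assms by auto
 ultimately show "wp L sym_vars (%s'. same {39, 40} s' s & s' 39 0 = 2 ^ (N - 1) & s' 40 0 = 2 ^ N + 1) s"
  using assms by (simp add: sym_vars_def)
qed

definition root_vars :: prog where
 "root_vars = (Assign 24 (Const 1 [<<] Var 20) ;; Assign 34 (Const 1 [<<] Var 21) ;; Assign 35 (Var 34 [<<] Const 1))"

lemma runs_root_vars:
 assumes "s 20 0 = int t" "s 21 0 = int g" "t <= L" "g < L"
 shows "runs root_vars s (wt root_vars * (L + 1))
  (%s'. same {24, 34, 35} s' s & s' 24 0 = int (2 ^ t) & s' 34 0 = int (2 ^ g) & s' 35 0 = int (2 * 2 ^ g))"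
proof (rule runs_wp)
 have "t < 2 ^ L" "g < 2 ^ L" using assms less_exp[of L] by linarith+
 moreover have "(2::int) ^ g < 2 ^ L" using assms by (intro power_strict_increasing) auto
 ultimately show "wp L root_vars (%s'. same {24, 34, 35} s' s & s' 24 0 = int (2 ^ t) & s' 34 0 = int (2 ^ g)
  & s' 35 0 = int (2 * 2 ^ g)) s"
  using assms by (simp add: root_vars_def mult.commute)
qed

text \<open>The final reduction brings the joined number, which may be longer than
  \<open>2 ^ t\<close> bits, back into the redundant range modulo \<open>2 ^ 2 ^ t + 1\<close>; this
  is what the next level up expects.\<close>

definition up :: prog where
 "up = (Assign 22 (Var 20 [>>] Const 1) ;; prep ;; ifft ;; sym_vars ;; sym_loop ;; join ;; root_vars ;; red_loop)"

definition up_wt :: nat where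
 "up_wt = wt (Assign 22 (Var 20 [>>] Const 1)) + 2 * prep_wt + 2 * ifft_wt + 2 * wt sym_vars + 2 * sym_wt
  + join_stage_wt + 2 * wt root_vars + 2 * red_wt"

lemma runs_up:
 assumes s: "s 20 0 = int t" "s 21 0 = int g"
  and lev: "level t (Suc g) a"
  and leaf: "prods (2 ^ (t - t div 2 + 2)) (g + t div 2) a (%i. s 11 (int i))"
  and X: "6 <= t" "t + 2 <= X" "g + t div 2 + 2 <= X"
 shows "runs up s ((t div 2 + 1) * (up_wt * unit g t X))
  (%s'. same {11, 12, 13, 22, 23, 24, 25, 26, 27, 28, 29, 30, 31, 33, 34, 35, 36, 37, 38, 39, 40, 41} s' s &
  prods (2 ^ t) g a (%i. s' 11 (int i)))"
proof -
 let ?M = "{11, 12, 13, 22, 23, 24, 25, 26, 27, 28, 29, 30, 31, 33, 34, 35, 36, 37, 38, 39, 40, 41} :: nat set"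
 define k where "k = t div 2"
 define N :: nat where "N = 2 ^ (t - k + 2)"
 define z where "z i = s 11 (int i)" for i
 have k: "3 <= k" "k <= t" "k <= t - k + 2" "k <= t - k" using X by (auto simp: k_def)
 have N: "N = 4 * 2 ^ (t - k)" by (simp add: N_def power_add)
 have N6: "6 <= N" using power_increasing[of 3 "t - k" "2::nat"] k by (simp add: N)
 define s1 where "s1 = s(22 := (s 22)(0 := int k))"
 have s1: "s1 20 0 = int t" "s1 21 0 = int g" "s1 22 0 = int k" "same ?M s1 s" "s1 11 = s 11"
  using s by (simp_all add: s1_def)
 define lo :: nat where "lo = 2 ^ (g + k)"
 define L where "L = 2 * N + 4 + X"
 define L' where "L' = 2 * 2 ^ t + 4 + X"
 have leaf': "prods N (g + k) a z" using leaf unfolding z_def N_def k_def .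
 have zb: "abs (z e) <= 2 ^ N + 8" if "lo <= e" "e < 2 * lo" for e
  using leaf' that unfolding prods_def lo_def by simp
 \<comment> \<open>The digits of the factors are given only existentially by \<open>level\<close>,
   so the coefficients of the products are chosen separately for every \<open>e\<close>.\<close>
 define good where "good e w = (transf N k e k w z & (ALL i < 2 ^ k. abs (w i) < 2 ^ (N - 2)) &
  [(SUM i<2 ^ k. w i * (2 ^ 2 ^ (t - k)) ^ i) = a (e + 2 ^ g) * a (e + 2 * 2 ^ g)] (mod 2 ^ 2 ^ t + 1))" for e w
 define w where "w e = (SOME w. good e w)" for e
 have "good e (w e)" if "2 ^ g <= e" "e < 2 ^ (g + 1)" for e
 proof -
  have "EX w. good e w"
  by (rule level_prods[OF lev X(1) leaf that]) (unfold good_def k_def N_def z_def, blast)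
  thus ?thesis unfolding w_def by (rule someI_ex)
 qed
 note w = this[unfolded good_def]
 have range: "lo <= e * 2 ^ k + i" "e * 2 ^ k + i < 2 * lo" if "2 ^ g <= e" "e < 2 ^ (g + 1)" "i < 2 ^ k" for e i
 proof -
  have "2 ^ g * 2 ^ k <= e * 2 ^ k" "(e + 1) * 2 ^ k <= 2 ^ (g + 1) * 2 ^ k"
  using that by (intro mult_right_mono; simp)+
  thus "lo <= e * 2 ^ k + i" "e * 2 ^ k + i < 2 * lo" using that
  by (simp only: lo_def power_add trans_le_add1, simp add: lo_def power_add)
 qed
 have index: "EX e i. q = e * 2 ^ k + i & i < 2 ^ k & 2 ^ g <= e & e < 2 ^ (g + 1)" if "lo <= q" "q < 2 * lo" for q
 proof (intro exI conjI)
  show "q = (q div 2 ^ k) * 2 ^ k + q mod 2 ^ k" by (rule div_mult_mod_eq[symmetric])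
  show "q mod 2 ^ k < 2 ^ k" by simp
  have "lo div 2 ^ k <= q div 2 ^ k" using that by (intro div_le_mono)
  thus "2 ^ g <= q div 2 ^ k" by (simp add: lo_def power_add)
  show "q div 2 ^ k < 2 ^ (g + 1)" using that by (simp add: lo_def power_add less_mult_imp_div_less)
 qed
 define P where "P s' = (same ?M s' s & prods (2 ^ t) g a (%i. s' 11 (int i)))" for s'
 have loX: "2 * lo < 2 ^ X"
 proof -
  have "2 * lo = 2 ^ Suc (g + k)" by (simp add: lo_def)
  also have "... < (2::nat) ^ X" using X by (intro power_strict_increasing) (auto simp: k_def)
  finally show ?thesis .
 qed
 hence loL: "2 * lo < 2 ^ L"
  by (rule less_le_trans) (auto intro!: power_increasing simp: L_def)
 have NL': "(2::int) ^ N + 8 < 2 ^ L"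
 proof -
  have "(2::int) ^ N + 8 <= 2 ^ (N + 4)" by (rule two_power_add_8)
  also have "... < (2::int) ^ L" using N6 by (intro power_strict_increasing) (auto simp: L_def)
  finally show ?thesis .
 qed
 define cs where "cs = [wt (Assign 22 (Var 20 [>>] Const 1)) * (X + 1), 2 * (prep_wt * unit g t X),
  (k + 1) * ((2 * lo - lo + 1) * (ifft_wt * (L + 1))), wt sym_vars * (L + 1), (2 * lo - lo + 1) * (sym_wt * (L + 1)),
  (k + 1) * (join_stage_wt * unit g t X), wt root_vars * (L' + 1), (2 * 2 ^ g - 2 ^ g + 1) * (red_wt * (L' + 1))]"
 have cs2: "cs ! 2 = (k + 1) * ((2 * lo - lo + 1) * (ifft_wt * (L + 1)))" by (simp add: cs_def)
 have "runs up s (cs ! 0 + (cs ! 1 + (cs ! 2 + (cs ! 3 + (cs ! 4 + (cs ! 5 + (cs ! 6 + cs ! 7))))))) P"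
  unfolding up_def
 proof (rule runs_Seq[where R = "%s'. s' = s1"])
  have "t < 2 ^ X" using less_exp[of X] X by linarith
  moreover have "int t div 2 = int k" by (simp add: k_def zdiv_int)
  ultimately show "runs (Assign 22 (Var 20 [>>] Const 1)) s (cs ! 0) (%s'. s' = s1)"
  unfolding cs_def nth_Cons_0
  using s by (intro runs_wp) (simp add: s1_def)
  show "runs (prep ;; ifft ;; sym_vars ;; sym_loop ;; join ;; root_vars ;; red_loop) s1'
  (cs ! 1 + (cs ! 2 + (cs ! 3 + (cs ! 4 + (cs ! 5 + (cs ! 6 + cs ! 7)))))) P" if "s1' = s1" for s1'
  unfolding that
  proof (rule runs_Seq)
  show "runs prep s1 (cs ! 1) (%s'. same {13, 23, 24, 27, 34, 35} s' s1 & s' 24 0 = int N &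
  s' 34 0 = int lo & s' 35 0 = int (2 * lo) &
  (ALL i. 1 <= i --> i < 2 ^ Suc k --> s' 13 (int i) = int (root_exp N i)))"
  using runs_prep[where t = t and g = g and k = k and X = X and s = s1] s1 k X unfolding k_def[symmetric]
  by (simp add: cs_def lo_def N_def)
  fix s2
  assume s2: "same {13, 23, 24, 27, 34, 35} s2 s1 & s2 24 0 = int N &
  s2 34 0 = int lo & s2 35 0 = int (2 * lo) &
  (ALL i. 1 <= i --> i < 2 ^ Suc k --> s2 13 (int i) = int (root_exp N i))"
  note s2' = sameD[OF conjunct1[OF s2]]
  have s2_11: "s2 11 (int i) = z i" for i by (simp add: s2' s1 z_def)
  show "runs (ifft ;; sym_vars ;; sym_loop ;; join ;; root_vars ;; red_loop) s2
  (cs ! 2 + (cs ! 3 + (cs ! 4 + (cs ! 5 + (cs ! 6 + cs ! 7))))) P"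
  proof (rule runs_Seq)
  show "runs ifft s2 (cs ! 2) (%s'. same {11, 12, 25, 26, 27, 28, 29, 30, 31, 36, 37, 38, 41} s' s2 &
  (ALL i. ~ (lo <= i & i < 2 * lo) --> s' 11 (int i) = s2 11 (int i)) &
  (ALL i. lo <= i --> i < 2 * lo --> abs (s' 11 (int i)) <= 2 ^ N + 8) &
  (ALL p x. lo <= p * 2 ^ k --> (p + 1) * 2 ^ k <= 2 * lo --> transf N k p k x (%i. s2 11 (int i)) -->
  transf N k p 0 x (%i. s' 11 (int i))))"
  unfolding cs2
  proof (rule runs_ifft[where t = "t - k + 2" and k = k and s = s2 and lo = lo and hi = "2 * lo" and L = L, folded N_def])
  show "s2 13 (int i) = int (root_exp N i)" if "1 <= i" "i < 2 ^ Suc k" for i using s2 that by blast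
  show "abs (s2 11 (int i)) <= 2 ^ N + 8" if "lo <= i" "i < 2 * lo" for i
  unfolding s2_11 using that by (rule zb)
  show "2 ^ k dvd lo" "2 ^ k dvd 2 * lo" by (simp_all add: lo_def power_add)
  qed (use s1 s2 k X loL in "auto simp: s2' L_def k_def")
  fix s3
  assume s3: "same {11, 12, 25, 26, 27, 28, 29, 30, 31, 36, 37, 38, 41} s3 s2 &
  (ALL i. ~ (lo <= i & i < 2 * lo) --> s3 11 (int i) = s2 11 (int i)) &
  (ALL i. lo <= i --> i < 2 * lo --> abs (s3 11 (int i)) <= 2 ^ N + 8) &
  (ALL p x. lo <= p * 2 ^ k --> (p + 1) * 2 ^ k <= 2 * lo --> transf N k p k x (%i. s2 11 (int i)) -->
  transf N k p 0 x (%i. s3 11 (int i)))"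
  note s3' = sameD[OF conjunct1[OF s3]]
  have s3_11: "[s3 11 (int (e * 2 ^ k + i)) = w e i] (mod 2 ^ N + 1)"
  "abs (s3 11 (int (e * 2 ^ k + i))) <= 2 ^ N + 8" if e: "2 ^ g <= e" "e < 2 ^ (g + 1)" and i: "i < 2 ^ k" for e i
  proof -
  have "lo <= e * 2 ^ k" "(e + 1) * 2 ^ k <= 2 * lo" using range[OF e, of 0] range[OF e, of "2 ^ k - 1"] by auto
  moreover have "transf N k e k (w e) (%i. s2 11 (int i))" using w[OF e] unfolding s2_11 by blast
  ultimately have "transf N k e 0 (w e) (%i. s3 11 (int i))" using s3 by blast
  thus "[s3 11 (int (e * 2 ^ k + i)) = w e i] (mod 2 ^ N + 1)"
  using i unfolding transf_def residue_def by simp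
  show "abs (s3 11 (int (e * 2 ^ k + i))) <= 2 ^ N + 8" using s3 range[OF e i] by blast
  qed
  show "runs (sym_vars ;; sym_loop ;; join ;; root_vars ;; red_loop) s3
  (cs ! 3 + (cs ! 4 + (cs ! 5 + (cs ! 6 + cs ! 7)))) P"
  proof (rule runs_Seq)
  show "runs sym_vars s3 (cs ! 3) (%s'. same {39, 40} s' s3 & s' 39 0 = 2 ^ (N - 1) & s' 40 0 = 2 ^ N + 1)"
  using runs_sym_vars[of s3 N L] s2 N6 by (simp add: s3' cs_def L_def)
  fix s4
  assume s4: "same {39, 40} s4 s3 & s4 39 0 = 2 ^ (N - 1) & s4 40 0 = 2 ^ N + 1"
  note s4' = sameD[OF conjunct1[OF s4]]
  show "runs (sym_loop ;; join ;; root_vars ;; red_loop) s4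
  (cs ! 4 + (cs ! 5 + (cs ! 6 + cs ! 7))) P"
  proof (rule runs_Seq)
  have "abs (s4 11 (int e)) < 2 ^ L" if "lo <= e" "e < 2 * lo" for e
  proof -
  have "abs (s4 11 (int e)) <= 2 ^ N + 8" using s3 that by (simp add: s4')
  thus ?thesis using NL' by (rule le_less_trans)
  qed
  thus "runs sym_loop s4 (cs ! 4) (%s'. same {11, 27, 28} s' s4 & (ALL i. s' 11 (int i) = (if lo <= i & i < 2 * lo
  then centre N (s4 11 (int i)) else s4 11 (int i))))"
  using runs_sym_loop[of s4 lo "2 * lo" N L] s2 s4 loL by (simp add: s3' s4' cs_def L_def)
  fix s5
  assume s5: "same {11, 27, 28} s5 s4 & (ALL i. s5 11 (int i) = (if lo <= i & i < 2 * lo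
  then centre N (s4 11 (int i)) else s4 11 (int i)))"
  note s5' = sameD[OF conjunct1[OF s5]]
  have s5v: "s5 11 (int q) = centre N (s4 11 (int q))" if "lo <= q" "q < 2 * lo" for q using s5 that by simp
  have s5_11: "s5 11 (int (e * 2 ^ k + i)) = w e i" "abs (s5 11 (int (e * 2 ^ k + i))) < 2 ^ (N - 2)"
  if e: "2 ^ g <= e" "e < 2 ^ (g + 1)" and i: "i < 2 ^ k" for e i
  proof -
  have wi: "abs (w e i) < 2 ^ (N - 2)" using w[OF e] i by blast
  have "s5 11 (int (e * 2 ^ k + i)) = centre N (s4 11 (int (e * 2 ^ k + i)))"
  using s5v range[OF that] by blast
  also have "s4 11 (int (e * 2 ^ k + i)) = s3 11 (int (e * 2 ^ k + i))" by (simp add: s4')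
  also have "centre N ... = w e i"
  by (rule centre_eqI) (use s3_11[OF that] wi N6 in auto)
  finally show "s5 11 (int (e * 2 ^ k + i)) = w e i" .
  thus "abs (s5 11 (int (e * 2 ^ k + i))) < 2 ^ (N - 2)" using wi by simp
  qed
  have v5: "s5 20 0 = int t" "s5 21 0 = int g" "s5 22 0 = int k" using s1 by (simp_all add: s2' s3' s4' s5')
  show "runs (join ;; root_vars ;; red_loop) s5 (cs ! 5 + (cs ! 6 + cs ! 7)) P"
  proof (rule runs_Seq)
  have "abs (s5 11 (int q)) <= 2 ^ (4 * 2 ^ (t - k))" if "2 ^ (g + k) <= q" "q < 2 ^ (g + k + 1)" for q
  proof -
  have "lo <= q" "q < 2 * lo" using that by (simp_all add: lo_def)
  from index[OF this] obtain e i where q: "q = e * 2 ^ k + i" "i < 2 ^ k" "2 ^ g <= e" "e < 2 ^ (g + 1)" by blast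
  have "abs (s5 11 (int q)) < 2 ^ (N - 2)" using s5_11 q by blast
  also have "(2::int) ^ (N - 2) <= 2 ^ (4 * 2 ^ (t - k))" by (intro power_increasing) (auto simp: N)
  finally show ?thesis by simp
  qed
  thus "runs join s5 (cs ! 5) (%s'. same {11, 25, 27, 33, 34, 35, 41} s' s5 &
  (ALL p. 2 ^ g <= p --> p < 2 ^ (g + 1) -->
  s' 11 (int p) = (SUM i<2 ^ k. s5 11 (int (p * 2 ^ k + i)) * (2 ^ 2 ^ (t - k)) ^ i)
  & abs (s' 11 (int p)) <= 2 ^ (4 * 2 ^ (t - k) + 2 ^ t)))"
  using runs_join[of s5 t g k X] v5 k X by (simp add: cs_def k_def[symmetric])
  fix s6
  assume s6: "same {11, 25, 27, 33, 34, 35, 41} s6 s5 &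
  (ALL p. 2 ^ g <= p --> p < 2 ^ (g + 1) -->
  s6 11 (int p) = (SUM i<2 ^ k. s5 11 (int (p * 2 ^ k + i)) * (2 ^ 2 ^ (t - k)) ^ i)
  & abs (s6 11 (int p)) <= 2 ^ (4 * 2 ^ (t - k) + 2 ^ t))"
  note s6' = sameD[OF conjunct1[OF s6]]
  have s6_11: "[s6 11 (int e) = a (e + 2 ^ g) * a (e + 2 * 2 ^ g)] (mod 2 ^ 2 ^ t + 1)"
  "abs (s6 11 (int e)) <= 2 ^ (2 * 2 ^ t + 2)" if e: "2 ^ g <= e" "e < 2 ^ (g + 1)" for e
  proof -
  have "s6 11 (int e) = (SUM i<2 ^ k. w e i * (2 ^ 2 ^ (t - k)) ^ i)"
  using s6 e s5_11(1)[OF e] by simp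
  thus "[s6 11 (int e) = a (e + 2 ^ g) * a (e + 2 * 2 ^ g)] (mod 2 ^ 2 ^ t + 1)" using w[OF e] by simp
  have "(2::nat) ^ (t - k + 2) <= 2 ^ t" using k by (intro power_increasing) auto
  hence "4 * 2 ^ (t - k) + 2 ^ t <= 2 * (2::nat) ^ t + 2" unfolding N_def[symmetric] N by simp
  hence "(2::int) ^ (4 * 2 ^ (t - k) + 2 ^ t) <= 2 ^ (2 * 2 ^ t + 2)" by (intro power_increasing) auto
  moreover have "abs (s6 11 (int e)) <= 2 ^ (4 * 2 ^ (t - k) + 2 ^ t)" using s6 e by blast
  ultimately show "abs (s6 11 (int e)) <= 2 ^ (2 * 2 ^ t + 2)" by (rule order_trans[rotated])
  qed
  show "runs (root_vars ;; red_loop) s6 (cs ! 6 + cs ! 7) P"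
  proof (rule runs_Seq)
  show "runs root_vars s6 (cs ! 6) (%s'. same {24, 34, 35} s' s6 & s' 24 0 = int (2 ^ t) &
  s' 34 0 = int (2 ^ g) & s' 35 0 = int (2 * 2 ^ g))"
  using runs_root_vars[of s6 t g L'] v5 X by (simp add: s6' cs_def L'_def)
  fix s7
  assume s7: "same {24, 34, 35} s7 s6 & s7 24 0 = int (2 ^ t) & s7 34 0 = int (2 ^ g) & s7 35 0 = int (2 * 2 ^ g)"
  note s7' = sameD[OF conjunct1[OF s7]]
  show "runs red_loop s7 (cs ! 7) P"
  proof (rule runs_mono[OF runs_red_loop[where lo = "2 ^ g" and hi = "2 * 2 ^ g" and N = "2 ^ t" and L = L']])
  have "2 * 2 ^ g = (2::nat) ^ Suc g" by simp
  also have "... < (2::nat) ^ L'" using X by (intro power_strict_increasing) (auto simp: L'_def)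
  finally show "2 * 2 ^ g < (2::nat) ^ L'" .
  show "abs (s7 11 (int e)) <= 2 ^ (2 * 2 ^ t + 2)" if "2 ^ g <= e" "e < 2 * 2 ^ g" for e
  using s6_11(2)[of e] that by (simp add: s7')
  show "(2 * 2 ^ g - 2 ^ g + 1) * (red_wt * (L' + 1)) <= cs ! 7" by (simp add: cs_def)
  fix s8
  assume s8: "same {11, 27, 38} s8 s7 & (ALL i. s8 11 (int i) = (if 2 ^ g <= i & i < 2 * 2 ^ g
  then red (2 ^ t) (red (2 ^ t) (s7 11 (int i))) else s7 11 (int i)))"
  have "prods (2 ^ t) g a (%i. s8 11 (int i))"
  unfolding prods_def
  proof (intro allI impI conjI)
  fix e :: nat
  assume e: "2 ^ g <= e" "e < 2 ^ (g + 1)"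
  have eq: "s8 11 (int e) = red (2 ^ t) (red (2 ^ t) (s6 11 (int e)))" using s8 e by (simp add: s7')
  show "[s8 11 (int e) = a (e + 2 ^ g) * a (e + 2 * 2 ^ g)] (mod 2 ^ 2 ^ t + 1)"
  unfolding eq using red_red_cong s6_11(1)[OF e] by (rule cong_trans)
  show "abs (s8 11 (int e)) <= 2 ^ 2 ^ t + 8"
  unfolding eq using s6_11(2)[OF e] by (rule abs_red_red_le)
  qed
  moreover have "same ?M s8 s"
  using s8 s7 s6 s5 s4 s3 s2 s1(4) unfolding same_def by simp
  ultimately show "P s8" unfolding P_def by blast
  qed (use s7 in "auto simp: L'_def")
  qed simp
  qed simp
  qed simp
  qed simp
  qed simp
  qed simp
 qed simp
 thus ?thesis
 proof (rule runs_mono)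
  define v where "v = wt (Assign 22 (Var 20 [>>] Const 1))"
  define U where "U = unit g t X"
  have c1: "(2 * lo + 1) * (L + 1) <= 2 * U"
  unfolding U_def by (rule leaf_cost[OF lo_def k(2)]) (simp add: L_def N_def)
  have c2: "(2 * 2 ^ g + 1) * (L' + 1) <= 2 * U"
  unfolding U_def by (rule leaf_cost[of _ g 0 t L' X]) (simp_all add: L'_def)
  have m: "(2 * l - l + 1) * (x * y) <= x * ((2 * l + 1) * y)" for l x y :: nat by (simp add: algebra_simps)
  have 0: "cs ! 0 <= (k + 1) * (v * U)"
  proof -
  have "cs ! 0 = v * (X + 1)" by (simp only: cs_def nth_Cons_0 v_def)
  also have "... <= v * U" unfolding U_def using one_le_unit by (rule mult_le_mono2)
  finally show ?thesis by simp
  qed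
  have 1: "cs ! 1 <= (k + 1) * (2 * prep_wt * U)" by (simp add: cs_def U_def)
  have 2: "cs ! 2 <= (k + 1) * (2 * ifft_wt * U)"
  proof -
  have "(2 * lo - lo + 1) * (ifft_wt * (L + 1)) <= ifft_wt * (2 * U)" using m mult_le_mono2[OF c1] by (rule order_trans)
  hence "(k + 1) * ((2 * lo - lo + 1) * (ifft_wt * (L + 1))) <= (k + 1) * (ifft_wt * (2 * U))" by (rule mult_le_mono2)
  thus ?thesis unfolding cs2 by (simp only: mult.assoc mult.left_commute)
  qed
  have 3: "cs ! 3 <= (k + 1) * (2 * wt sym_vars * U)"
  proof -
  have "L + 1 <= (2 * lo + 1) * (L + 1)" by simp
  hence "L + 1 <= 2 * U" using c1 by (rule order_trans)
  hence "wt sym_vars * (L + 1) <= wt sym_vars * (2 * U)" by (rule mult_le_mono2)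
  thus ?thesis by (simp add: cs_def)
  qed
  have 4: "cs ! 4 <= (k + 1) * (2 * sym_wt * U)"
  proof -
  have "(2 * lo - lo + 1) * (sym_wt * (L + 1)) <= sym_wt * (2 * U)" using m mult_le_mono2[OF c1] by (rule order_trans)
  thus ?thesis by (simp add: cs_def)
  qed
  have 5: "cs ! 5 = (k + 1) * (join_stage_wt * U)" by (simp add: cs_def U_def)
  have 6: "cs ! 6 <= (k + 1) * (2 * wt root_vars * U)"
  proof -
  have "L' + 1 <= (2 * 2 ^ g + 1) * (L' + 1)" by simp
  hence "L' + 1 <= 2 * U" using c2 by (rule order_trans)
  hence "wt root_vars * (L' + 1) <= wt root_vars * (2 * U)" by (rule mult_le_mono2)
  thus ?thesis by (simp add: cs_def)
  qed
  have 7: "cs ! 7 <= (k + 1) * (2 * red_wt * U)"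
  proof -
  have "(2 * 2 ^ g - 2 ^ g + 1) * (red_wt * (L' + 1)) <= red_wt * (2 * U)" using m mult_le_mono2[OF c2] by (rule order_trans)
  thus ?thesis by (simp add: cs_def)
  qed
  have "cs ! 0 + (cs ! 1 + (cs ! 2 + (cs ! 3 + (cs ! 4 + (cs ! 5 + (cs ! 6 + cs ! 7)))))) <=
  (k + 1) * (v * U) + ((k + 1) * (2 * prep_wt * U) + ((k + 1) * (2 * ifft_wt * U) + ((k + 1) * (2 * wt sym_vars * U)
  + ((k + 1) * (2 * sym_wt * U) + ((k + 1) * (join_stage_wt * U) + ((k + 1) * (2 * wt root_vars * U) + (k + 1) * (2 * red_wt * U)))))))"
  by (intro add_mono 0 1 2 3 4 6 7 eq_refl[OF 5])
  also have "... = (k + 1) * (up_wt * U)" unfolding up_wt_def v_def[symmetric] by (simp add: algebra_simps)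
  finally show "cs ! 0 + (cs ! 1 + (cs ! 2 + (cs ! 3 + (cs ! 4 + (cs ! 5 + (cs ! 6 + cs ! 7))))))
  <= (t div 2 + 1) * (up_wt * unit g t X)" unfolding U_def k_def .
 qed (simp add: P_def)
qed

section \<open>Depth of the recursion and cost of a level\<close>

fun lev_t :: "nat => nat => nat" where
 "lev_t t 0 = t"
| "lev_t t (Suc r) = lev_t t r - lev_t t r div 2 + 2"

fun lev_g :: "nat => nat => nat" where
 "lev_g t 0 = 0"
| "lev_g t (Suc r) = lev_g t r + lev_t t r div 2"

text \<open>At depth \<open>r\<close> there are \<open>2 ^ lev_g t r\<close> products of numbers of
  \<open>2 ^ lev_t t r\<close> bits. The fourfold length of the smaller ring adds 2 at every
  level.\<close>

lemma lev_sum: "lev_g t r + lev_t t r = t + 2 * r"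
 by (induction r) auto

text \<open>The exponents are roughly halved from one level to the next, so there are about \<open>log t\<close> levels
 and the total number of bits grows by a factor of at most \<open>t^2\<close>.\<close>

lemma lev_t_bound: "(lev_t t r - 5) * 2 ^ r <= t - 5"
proof (induction r)
 case (Suc r)
 \<comment> \<open>The largest fixed point of \<open>T - T div 2 + 2\<close> is 5, and each level at
   least halves the excess over it.\<close>
 have "(lev_t t (Suc r) - 5) * 2 <= lev_t t r - 5" by simp
 hence "(lev_t t (Suc r) - 5) * 2 * 2 ^ r <= (lev_t t r - 5) * 2 ^ r" by (rule mult_le_mono1)
 thus ?case using Suc unfolding power_Suc by (simp only: mult.assoc order_trans)
qed simp

lemma lev_two_pow:
 assumes "6 <= lev_t t r"
 shows "2 ^ r <= t" "r < t"
proof -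
 have "1 * 2 ^ r <= (lev_t t r - 5) * 2 ^ r" using assms by (intro mult_le_mono1) simp
 also have "... <= t - 5" by (rule lev_t_bound)
 finally show "2 ^ r <= t" by simp
 thus "r < t" using less_exp[of r] by linarith
qed

text \<open>A level has at most \<open>3 * t\<close> layers, and a pass over all its numbers costs
  \<open>2 ^ t * 16 * t ^ 2 * (23 * t)\<close>; the constant is 3 * 16 * 23.\<close>

definition level_unit :: "nat => nat" where
 "level_unit t = 2 ^ t * t ^ 4 * 1104"

lemma level_cost:
 assumes "6 <= lev_t t r"
 shows "(lev_t t r div 2 + 1) * (w * unit (lev_g t r) (lev_t t r) (3 * t + 10)) <= w * level_unit t"
  "(lev_t t r div 2 + 1) * (w * unit (Suc (lev_g t r)) (lev_t t r) (3 * t + 10)) <= w * level_unit t"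
proof -
 note r = lev_two_pow[OF assms]
 have T: "lev_t t r <= 3 * t" using lev_sum[of t r] r by linarith
 have t: "1 <= t" using r by simp
 have T2: "lev_t t r div 2 + 1 <= 3 * t" using T t by linarith
 have "Suc (lev_g t r) + lev_t t r + 3 = t + 4 + r * 2" using lev_sum[of t r] by simp
 hence "unit (Suc (lev_g t r)) (lev_t t r) (3 * t + 10) = 2 ^ t * 16 * (2 ^ r) ^ 2 * (3 * t + 20)"
  unfolding unit_def by (simp add: power_add power_mult power2_eq_square)
 also have "... <= 2 ^ t * 16 * t ^ 2 * (23 * t)" using r t by (intro mult_le_mono power_mono) auto
 finally have u: "unit (Suc (lev_g t r)) (lev_t t r) (3 * t + 10) <= 2 ^ t * 16 * t ^ 2 * (23 * t)" .
 have "(lev_t t r div 2 + 1) * (w * unit (Suc (lev_g t r)) (lev_t t r) (3 * t + 10))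
  <= (3 * t) * (w * (2 ^ t * 16 * t ^ 2 * (23 * t)))" using T2 u by (intro mult_le_mono) auto
 also have "... = w * level_unit t" by (simp add: level_unit_def power4_eq_xxxx power2_eq_square)
 finally show 1: "(lev_t t r div 2 + 1) * (w * unit (Suc (lev_g t r)) (lev_t t r) (3 * t + 10)) <= w * level_unit t" .
 have "unit (lev_g t r) (lev_t t r) (3 * t + 10) <= unit (Suc (lev_g t r)) (lev_t t r) (3 * t + 10)"
  unfolding unit_def by (intro mult_le_mono1 power_increasing) auto
 hence "(lev_t t r div 2 + 1) * (w * unit (lev_g t r) (lev_t t r) (3 * t + 10))
  <= (lev_t t r div 2 + 1) * (w * unit (Suc (lev_g t r)) (lev_t t r) (3 * t + 10))" by (intro mult_le_mono2)
 thus "(lev_t t r div 2 + 1) * (w * unit (lev_g t r) (lev_t t r) (3 * t + 10)) <= w * level_unit t"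
  using 1 by (rule order_trans)
qed

abbreviation mul_mods :: "nat set" where
 "mul_mods == {10, 11, 12, 13, 14, 20, 21, 22, 23, 24, 25, 26, 27, 28, 29, 30, 31, 33, 34, 35, 36, 37, 38, 39, 40, 41, 42}"

text \<open>Array 14 is a stack of exponents with its height in 42. The ascent needs it, because
  halving forgets the parity and the previous exponent cannot be recovered from the current
  one.\<close>

definition step_vars :: prog where
 "step_vars = (Write 14 (Var 42) (Var 20) ;; Assign 22 (Var 20 [>>] Const 1) ;; Assign 21 (Var 21 [+] Var 22) ;;
  Assign 20 (Var 20 [-] Var 22 [+] Const 2) ;; Assign 42 (Var 42 [+] Const 1))"

definition down_loop :: prog where
 "down_loop = While (Const 5 [<] Var 20) (down ;; step_vars)"

definition down_inv :: "nat => store => nat => store => bool" where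
 "down_inv t s0 r s = (s 42 0 = int r & s 20 0 = int (lev_t t r) & s 21 0 = int (Suc (lev_g t r)) &
  same mul_mods s s0 & s 10 2 = s0 10 2 & s 10 3 = s0 10 3 &
  (ALL i. 2 ^ Suc (lev_g t r) <= i --> i < 2 ^ Suc (Suc (lev_g t r)) --> abs (s 10 (int i)) <= 2 ^ 2 ^ lev_t t r + 8) &
  (ALL q<r. 6 <= lev_t t q & s 14 (int q) = int (lev_t t q) & level (lev_t t q) (Suc (lev_g t q)) (%i. s 10 (int i))))"

lemma lev_g_mono: "q <= r ==> lev_g t q <= lev_g t r"
 by (induction r) (auto simp: le_Suc_eq)

lemma runs_down_step:
 assumes I: "down_inv t s0 r s" and r: "6 <= lev_t t r"
 shows "runs (down ;; step_vars) s ((down_wt + wt step_vars) * level_unit t) (down_inv t s0 (Suc r))"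
proof -
 define T G k where "T = lev_t t r" and "G = lev_g t r" and "k = T div 2"
 define X where "X = 3 * t + 10"
 note r2 = lev_two_pow[OF r]
 have GT: "G + T = t + 2 * r" unfolding G_def T_def by (rule lev_sum)
 have X: "T + 2 <= X" "Suc G + k + 2 <= X" "r + 1 < X" using GT r2 by (auto simp: X_def k_def)
 have s: "s 42 0 = int r" "s 20 0 = int T" "s 21 0 = int (Suc G)" "same mul_mods s s0"
  using I by (auto simp: down_inv_def T_def G_def)
 show ?thesis
 proof (rule runs_Seq[OF runs_down[where t = T and g = "Suc G" and X = X]])
  show "abs (s 10 (int i)) <= 2 ^ 2 ^ T + 8" if "2 ^ Suc G <= i" "i < 2 ^ (Suc G + 1)" for i
  using I that by (simp add: down_inv_def T_def G_def)
 next
  fix s1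
  assume s1: "same {10, 12, 13, 22, 23, 24, 25, 26, 27, 28, 29, 30, 31, 33, 34, 35, 36, 37, 38} s1 s &
  (ALL i < 2 ^ (Suc G + 1). s1 10 (int i) = s 10 (int i)) & level T (Suc G) (%i. s1 10 (int i)) &
  (ALL i. 2 ^ (Suc G + T div 2) <= i --> i < 2 ^ (Suc G + T div 2 + 1) -->
  abs (s1 10 (int i)) <= 2 ^ 2 ^ (T - T div 2 + 2) + 8)"
  note s1' = sameD[OF conjunct1[OF s1]]
  have v1: "s1 42 0 = int r" "s1 20 0 = int T" "s1 21 0 = int (Suc G)" using s by (simp_all add: s1')
  show "runs step_vars s1 (wt step_vars * (X + 1)) (down_inv t s0 (Suc r))"
  proof (rule runs_wp)
  have b: "T < 2 ^ X" "Suc G < 2 ^ X" "k < 2 ^ X" "r < 2 ^ X" "int G + 1 < 2 ^ X"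
  proof -
  show "T < 2 ^ X" "k < 2 ^ X" "r < 2 ^ X" "Suc G < 2 ^ X" by (rule less_two_power; use X in linarith)+
  hence "int (Suc G) < 2 ^ X" by (simp del: of_nat_Suc)
  thus "int G + 1 < 2 ^ X" by simp
  qed
  have kT: "k <= T" "int T div 2 = int k" by (simp_all add: k_def zdiv_int)
  define s2 where "s2 = s1(14 := (s1 14)(int r := int T), 22 := (s1 22)(0 := int k), 21 := (s1 21)(0 := int (Suc G + k)),
  20 := (s1 20)(0 := int (T - k + 2)), 42 := (s1 42)(0 := int (Suc r)))"
  have "down_inv t s0 (Suc r) s2"
  proof -
  have lv: "lev_t t (Suc r) = T - k + 2" "lev_g t (Suc r) = G + k" by (simp_all add: T_def G_def k_def)
  have "same mul_mods s1 s0" using s1 s(4) unfolding same_def by simp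
  hence "same mul_mods s2 s0" by (simp add: s2_def)
  moreover have "s2 10 2 = s0 10 2" "s2 10 3 = s0 10 3"
  proof -
  have "4 <= (2::nat) ^ (Suc G + 1)" by simp
  hence "2 < (2::nat) ^ (Suc G + 1)" "3 < (2::nat) ^ (Suc G + 1)" by linarith+
  hence "s1 10 (int 2) = s 10 (int 2)" "s1 10 (int 3) = s 10 (int 3)" using s1 by blast+
  thus "s2 10 2 = s0 10 2" "s2 10 3 = s0 10 3" using I by (simp_all add: s2_def down_inv_def)
  qed
  moreover have "6 <= lev_t t q & s2 14 (int q) = int (lev_t t q) & level (lev_t t q) (Suc (lev_g t q)) (%i. s2 10 (int i))"
  if "q < Suc r" for q
  proof (cases "q = r")
  case True
  thus ?thesis using r s1 by (simp add: s2_def T_def G_def)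
  next
  case False
  hence q: "q < r" using that by simp
  \<comment> \<open>The leaves of an earlier level end no later than the operands of the current
    one, hence below everything that the current level writes.\<close>
  have "lev_g t (Suc q) <= lev_g t r" using q by (intro lev_g_mono) simp
  hence "Suc (lev_g t q) + lev_t t q div 2 + 1 <= Suc G + 1" by (simp add: G_def)
  hence "(2::nat) ^ (Suc (lev_g t q) + lev_t t q div 2 + 1) <= 2 ^ (Suc G + 1)" by (intro power_increasing) auto
  moreover have "level (lev_t t q) (Suc (lev_g t q)) (%i. s 10 (int i))" using I q by (simp add: down_inv_def)
  ultimately have "level (lev_t t q) (Suc (lev_g t q)) (%i. s2 10 (int i))"
  proof (elim level_cong)
  fix i :: nat
  assume "i < 2 ^ (Suc (lev_g t q) + lev_t t q div 2 + 1)"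
  and "(2::nat) ^ (Suc (lev_g t q) + lev_t t q div 2 + 1) <= 2 ^ (Suc G + 1)"
  hence "i < 2 ^ (Suc G + 1)" by (rule less_le_trans)
  hence "s1 10 (int i) = s 10 (int i)" using s1 by blast
  thus "s2 10 (int i) = s 10 (int i)" by (simp add: s2_def)
  qed
  thus ?thesis using I q by (simp add: down_inv_def s2_def s1')
  qed
  moreover have "abs (s2 10 (int i)) <= 2 ^ 2 ^ lev_t t (Suc r) + 8"
  if "2 ^ Suc (lev_g t (Suc r)) <= i" "i < 2 ^ Suc (Suc (lev_g t (Suc r)))" for i
  using s1 that unfolding lv by (simp add: s2_def k_def)
  ultimately show ?thesis
  unfolding down_inv_def by (simp add: s2_def lv del: lev_t.simps lev_g.simps)
  qed
  thus "wp X step_vars (down_inv t s0 (Suc r)) s1"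
  using v1 b kT X(2) unfolding s2_def
  by (simp add: step_vars_def X_def algebra_simps of_nat_diff)
  qed
 next
  have t: "1 <= t" using r2 by simp
  have "wt step_vars * (X + 1) <= wt step_vars * (1 * (1 * (X + 1)))" by simp
  also have "... <= wt step_vars * level_unit t"
  proof (intro mult_le_mono2)
  have "X + 1 <= 14 * t" using t by (simp add: X_def)
  also have "... <= t ^ 4 * 1104" using t power_increasing[of 1 4 t] by simp
  also have "... <= 2 ^ t * (t ^ 4 * 1104)" by simp
  finally show "1 * (1 * (X + 1)) <= level_unit t" by (simp add: level_unit_def)
  qed
  finally show "(T div 2 + 1) * (down_wt * unit (Suc G) T X) + wt step_vars * (X + 1)
  <= (down_wt + wt step_vars) * level_unit t"
  using level_cost(2)[OF r, of down_wt] unfolding X_def T_def G_def add_mult_distrib by (intro add_mono)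
 qed (use s r X in "auto simp: k_def T_def")
qed

definition mul_guard_wt :: nat where
 "mul_guard_wt = cost_wt (Const 5 [<] Var 20) + val_wt (Const 5 [<] Var 20) + 1"

lemma lev_t_le: "6 <= t ==> lev_t t r <= t"
proof (induction r)
 case (Suc r)
 thus ?case by (cases "lev_t t r <= 5") auto
qed simp

lemma level_unit_ge: "1 <= t ==> 3 * t + 1104 <= 2 * level_unit t"
proof -
 assume t: "1 <= t"
 define u where "u = 2 ^ t * t ^ 4"
 have "1 * t ^ 1 <= u" unfolding u_def using t by (intro mult_le_mono power_increasing) auto
 moreover have "1 * 1 <= u" unfolding u_def using t by (intro mult_le_mono) auto
 ultimately show ?thesis unfolding level_unit_def u_def[symmetric] by simp
qed

lemma runs_down_loop:
 assumes I: "down_inv t s0 0 s" and t: "3 <= t"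
 shows "runs down_loop s ((t + 1) * ((down_wt + wt step_vars + 2 * mul_guard_wt) * level_unit t))
  (%s'. EX r. down_inv t s0 r s' & lev_t t r <= 5)"
proof -
 define w where "w = (down_wt + wt step_vars) * level_unit t"
 let ?I = "%m s. EX r. m = lev_t t r - 5 & down_inv t s0 r s"
 have "runs down_loop s ((SUM j<t - 5. w) + (t - 5 + 1) * (mul_guard_wt * (3 * t + 1)))
  (%s'. (EX m'. ?I m' s') & val (Const 5 [<] Var 20) s' = 0)"
  unfolding down_loop_def mul_guard_wt_def
 proof (rule runs_While[where I = ?I])
  show "?I (t - 5) s" using I by (intro exI[of _ 0]) simp
 next
  fix m s
  assume "?I m s"
  then obtain r where r: "s 20 0 = int (lev_t t r)" by (auto simp: down_inv_def)
  have "lev_t t r <= max t 5"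
  using lev_t_le[of t r] by (cases "6 <= t") (use lev_t_bound[of t r] in auto)
  hence "lev_t t r <= 3 * t" using t by auto
  hence "lev_t t r < 2 ^ (3 * t)" using less_exp[of "3 * t"] by linarith
  thus "small (3 * t) (Const 5 [<] Var 20) s" using r by simp
 next
  fix s
  assume "?I 0 s"
  thus "val (Const 5 [<] Var 20) s = 0" by (auto simp: down_inv_def)
 next
  fix m s
  assume "?I (Suc m) s"
  then obtain r where r: "Suc m = lev_t t r - 5" "down_inv t s0 r s" by blast
  have r6: "6 <= lev_t t r" using r(1) by simp
  show "runs (down ;; step_vars) s w (%s'. EX m'<=m. ?I m' s')"
  unfolding w_def
  proof (rule runs_mono[OF runs_down_step[OF r(2) r6]])
  fix s'
  assume "down_inv t s0 (Suc r) s'"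
  moreover have "lev_t t (Suc r) - 5 <= m" using r(1) r6 by simp
  ultimately show "EX m'<=m. ?I m' s'" by blast
  qed simp
 qed
 thus ?thesis
 proof (rule runs_mono)
  have "mul_guard_wt * (3 * t + 1) <= mul_guard_wt * (2 * level_unit t)"
  using level_unit_ge[of t] t by (intro mult_le_mono2) simp
  hence "(t - 5) * w + (t - 5 + 1) * (mul_guard_wt * (3 * t + 1))
  <= (t + 1) * w + (t + 1) * (mul_guard_wt * (2 * level_unit t))"
  by (intro add_mono mult_le_mono[of "t - 5 + 1"] mult_le_mono1) auto
  also have "... = (t + 1) * ((down_wt + wt step_vars + 2 * mul_guard_wt) * level_unit t)"
  by (simp add: w_def algebra_simps)
  finally show "(SUM j<t - 5. w) + (t - 5 + 1) * (mul_guard_wt * (3 * t + 1))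
  <= (t + 1) * ((down_wt + wt step_vars + 2 * mul_guard_wt) * level_unit t)" by simp
 next
  fix s'
  assume "(EX m'. ?I m' s') & val (Const 5 [<] Var 20) s' = 0"
  then obtain r where "down_inv t s0 r s'" "val (Const 5 [<] Var 20) s' = 0" by blast
  thus "EX r. down_inv t s0 r s' & lev_t t r <= 5"
  by (intro exI[of _ r]) (auto simp: down_inv_def split: if_splits)
 qed
qed

section \<open>Base case, ascent and the complete multiplication\<close>

definition mul_base :: prog where
 "mul_base = (Assign 21 (Var 21 [-] Const 1) ;; root_vars ;; prod_loop ;; red_loop)"

definition mul_base_wt :: nat where
 "mul_base_wt = wt (Assign 21 (Var 21 [-] Const 1)) + wt root_vars + prod_wt + red_wt"

text \<open>Array 10 does not change during the ascent, so the products of each level are specified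
  by the operands that are still stored there.\<close>

definition up_inv :: "nat => store => nat => store => bool" where
 "up_inv t s0 r s = (s 42 0 = int r & s 21 0 = int (lev_g t r) &
  same mul_mods s s0 & s 10 2 = s0 10 2 & s 10 3 = s0 10 3 &
  prods (2 ^ lev_t t r) (lev_g t r) (%i. s 10 (int i)) (%i. s 11 (int i)) &
  (ALL q<r. 6 <= lev_t t q & s 14 (int q) = int (lev_t t q) & level (lev_t t q) (Suc (lev_g t q)) (%i. s 10 (int i))))"

text \<open>The bound \<open>lev_two_pow\<close> applies only to the level before the last, whose
  exponent was still at least 6; this accounts for \<open>2 * t\<close> in place of
  \<open>t\<close>.\<close>

lemma lev_top:
 assumes "lev_t t r <= 5" "!!q. q < r ==> 6 <= lev_t t q" "1 <= t"
 shows "2 ^ r <= 2 * t" "r <= t" "lev_g t r <= t + 2 * r" "2 ^ lev_g t r <= 2 ^ t * (4 * t ^ 2)"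
proof -
 have "2 ^ r <= 2 * t & r <= t"
 proof (cases r)
  case (Suc q)
  hence "6 <= lev_t t q" using assms(2) by simp
  from lev_two_pow[OF this] show ?thesis using Suc by simp
 qed (use assms in simp)
 thus r: "2 ^ r <= 2 * t" "r <= t" by auto
 show g: "lev_g t r <= t + 2 * r" using lev_sum[of t r] by linarith
 have "(2::nat) ^ lev_g t r <= 2 ^ (t + r * 2)" using g by (intro power_increasing) auto
 also have "... = 2 ^ t * (2 ^ r) ^ 2" by (simp add: power_add power_mult)
 also have "... <= 2 ^ t * (2 * t) ^ 2" using r by (intro mult_le_mono2 power_mono) auto
 finally show "2 ^ lev_g t r <= 2 ^ t * (4 * t ^ 2)" by (simp add: power_mult_distrib)
qed

lemma runs_mul_base:
 assumes I: "down_inv t s0 r s" and r: "lev_t t r <= 5" and t: "3 <= t"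
 shows "runs mul_base s (20 * mul_base_wt * level_unit t) (up_inv t s0 r)"
proof -
 define T G where "T = lev_t t r" and "G = lev_g t r"
 have lv: "!!q. q < r ==> 6 <= lev_t t q" using I by (simp add: down_inv_def)
 have "1 <= t" using t by simp
 note top = lev_top[OF r lv this]
 \<comment> \<open>The constant covers 34 * 34 = 1156, the schoolbook cost of the products in the
   base case.\<close>
 define L where "L = 3 * t + 1200"
 define lo :: nat where "lo = 2 ^ G"
 have G: "G <= 3 * t" using top unfolding G_def by linarith
 have s: "s 42 0 = int r" "s 20 0 = int T" "s 21 0 = int (Suc G)" "same mul_mods s s0"
  using I by (auto simp: down_inv_def T_def G_def)
 have T: "T <= 5" using r by (simp add: T_def)
 have N: "(2::nat) ^ T <= 2 ^ 5" using T by (intro power_increasing) auto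
 have N33: "(2::int) ^ 2 ^ T + 8 < 2 ^ 33"
 proof -
  have "(2::int) ^ 2 ^ T <= 2 ^ 32" using N by (intro power_increasing) auto
  thus ?thesis by simp
 qed
 have loL: "2 * lo < 2 ^ L"
 proof -
  have "2 * lo = 2 ^ Suc G" by (simp add: lo_def)
  also have "... < (2::nat) ^ L" using G by (intro power_strict_increasing) (auto simp: L_def)
  finally show ?thesis .
 qed
 define s1 where "s1 = s(21 := (s 21)(0 := int G))"
 have s1': "s1 k = s k" if "k ~: {21}" for k using that by (simp add: s1_def)
 have "runs mul_base s (wt (Assign 21 (Var 21 [-] Const 1)) * (L + 1) + (wt root_vars * (L + 1) +
  ((2 * lo - lo + 1) * (prod_wt * (L + 1)) + (2 * lo - lo + 1) * (red_wt * (L + 1))))) (up_inv t s0 r)"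
  unfolding mul_base_def
 proof (rule runs_Seq[where R = "%s'. s' = s1"])
  have "Suc G <= L" using G by (simp add: L_def)
  hence "Suc G < 2 ^ L" using less_exp[of L] by linarith
  hence "int (Suc G) < 2 ^ L" by (simp del: of_nat_Suc)
  thus "runs (Assign 21 (Var 21 [-] Const 1)) s (wt (Assign 21 (Var 21 [-] Const 1)) * (L + 1)) (%s'. s' = s1)"
  using s by (intro runs_wp) (simp add: s1_def)
  fix s1a
  assume "s1a = s1"
  show "runs (root_vars ;; prod_loop ;; red_loop) s1a (wt root_vars * (L + 1) +
  ((2 * lo - lo + 1) * (prod_wt * (L + 1)) + (2 * lo - lo + 1) * (red_wt * (L + 1)))) (up_inv t s0 r)"
  unfolding `s1a = s1`
  proof (rule runs_Seq[OF runs_root_vars[where t = T and g = G and L = L]])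
  fix s2
  assume s2: "same {24, 34, 35} s2 s1 & s2 24 0 = int (2 ^ T) & s2 34 0 = int (2 ^ G) & s2 35 0 = int (2 * 2 ^ G)"
  note s2' = sameD[OF conjunct1[OF s2]]
  have A: "abs (s 10 (int e)) <= 2 ^ 2 ^ T + 8" if "2 * lo <= e" "e < 4 * lo" for e
  using I that by (simp add: down_inv_def lo_def T_def G_def)
  show "runs (prod_loop ;; red_loop) s2 ((2 * lo - lo + 1) * (prod_wt * (L + 1)) + (2 * lo - lo + 1) * (red_wt * (L + 1))) (up_inv t s0 r)"
  proof (rule runs_Seq[OF runs_prod_loop[where lo = lo and hi = "2 * lo" and L = L]])
  show "s2 34 0 = int lo" "s2 35 0 = int (2 * lo)" using s2 unfolding lo_def by blast+
  show "abs (s2 10 (int e)) < 2 ^ 33" if "2 * lo <= e" "e < 2 * lo + 2 * lo" for e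
  using le_less_trans[OF A N33, of e] that by (simp add: s1' s2')
  next
  fix s3
  assume s3: "same {11, 27} s3 s2 & (ALL i. s3 11 (int i) = (if lo <= i & i < 2 * lo
  then s2 10 (int (i + lo)) * s2 10 (int (i + 2 * lo)) else s2 11 (int i)))"
  note s3' = sameD[OF conjunct1[OF s3]]
  have s3_11: "s3 11 (int e) = s 10 (int (e + lo)) * s 10 (int (e + 2 * lo))"
  "abs (s3 11 (int e)) <= 2 ^ (2 * 2 ^ T + 2)" if "lo <= e" "e < 2 * lo" for e
  proof -
  show e: "s3 11 (int e) = s 10 (int (e + lo)) * s 10 (int (e + 2 * lo))"
  using s3 that by (simp add: s1' s2')
  have "abs (s3 11 (int e)) <= (2 ^ 2 ^ T + 8) * (2 ^ 2 ^ T + 8)"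
  unfolding e abs_mult using that by (intro mult_mono A) auto
  also have "... <= (2 * 2 ^ 2 ^ T) * (2 * 2 ^ 2 ^ T)"
  proof -
  \<comment> \<open>The last exponent is \<open>t\<close> itself or stems from one of at least 6.
    Being at least 3, it makes \<open>2 ^ 2 ^ T\<close> large enough to absorb the excess 8.\<close>
  have "3 <= T"
  proof (cases r)
  case 0
  thus ?thesis using t by (simp add: T_def)
  next
  case (Suc q)
  thus ?thesis using lv[of q] by (simp add: T_def)
  qed
  hence "(2::nat) ^ 3 <= 2 ^ T" by (intro power_increasing) auto
  hence "(2::int) ^ 8 <= 2 ^ 2 ^ T" by (intro power_increasing) auto
  thus ?thesis by (intro mult_mono) auto
  qed
  also have "... = 2 ^ (2 * 2 ^ T + 2)" by (simp add: power_add power_even_eq power2_eq_square)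
  finally show "abs (s3 11 (int e)) <= 2 ^ (2 * 2 ^ T + 2)" .
  qed
  show "runs red_loop s3 ((2 * lo - lo + 1) * (red_wt * (L + 1))) (up_inv t s0 r)"
  proof (rule runs_mono[OF runs_red_loop[where lo = lo and hi = "2 * lo" and N = "2 ^ T" and L = L]])
  show "s3 34 0 = int lo" "s3 35 0 = int (2 * lo)" "s3 24 0 = int (2 ^ T)" using s2 unfolding lo_def by (simp_all add: s3')
  show "2 * 2 ^ T + 4 <= L" using N by (simp add: L_def)
  show "abs (s3 11 (int e)) <= 2 ^ (2 * 2 ^ T + 2)" if "lo <= e" "e < 2 * lo" for e
  using s3_11(2)[OF that] .
  fix s4
  assume s4: "same {11, 27, 38} s4 s3 & (ALL i. s4 11 (int i) = (if lo <= i & i < 2 * lo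
  then red (2 ^ T) (red (2 ^ T) (s3 11 (int i))) else s3 11 (int i)))"
  have s4': "s4 k = s k" if "k ~: {11, 21, 24, 27, 34, 35, 38}" for k
  using sameD[OF conjunct1[OF s4], of k] that by (simp add: s3' s2' s1')
  have "prods (2 ^ T) G (%i. s4 10 (int i)) (%i. s4 11 (int i))"
  unfolding prods_def
  proof (intro allI impI conjI)
  fix e :: nat
  assume "2 ^ G <= e" "e < 2 ^ (G + 1)"
  hence e: "lo <= e" "e < 2 * lo" by (simp_all add: lo_def)
  have eq: "s4 11 (int e) = red (2 ^ T) (red (2 ^ T) (s3 11 (int e)))" using s4 e by simp
  show "[s4 11 (int e) = s4 10 (int (e + 2 ^ G)) * s4 10 (int (e + 2 * 2 ^ G))] (mod 2 ^ 2 ^ T + 1)"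
  using red_red_cong[of "2 ^ T" "s3 11 (int e)"] unfolding eq s4'[of 10, simplified] s3_11(1)[OF e] lo_def .
  show "abs (s4 11 (int e)) <= 2 ^ 2 ^ T + 8"
  unfolding eq using s3_11(2)[OF e] by (rule abs_red_red_le)
  qed
  moreover have "same mul_mods s4 s0"
  using s4' s(4) unfolding same_def by simp
  moreover have "s4 21 0 = int G"
  using sameD[OF conjunct1[OF s4], of 21] by (simp add: s3' s2' s1_def)
  ultimately show "up_inv t s0 r s4"
  using I unfolding up_inv_def down_inv_def T_def[symmetric] G_def[symmetric] by (simp add: s4')
  qed (use loL in auto)
  qed (use loL in "auto simp: L_def")
  qed (use s T G in "auto simp: s1_def L_def")
 qed simp
 thus ?thesis
 proof (rule runs_mono)
  define v where "v = wt (Assign 21 (Var 21 [-] Const 1))"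
  have "(2 * lo - lo + 1) * (x * (L + 1)) <= x * (20 * level_unit t)" for x
  proof -
  have "2 * lo - lo + 1 <= 2 * lo" by (simp add: lo_def)
  also have "... <= 2 * (2 ^ t * (4 * t ^ 2))" unfolding lo_def G_def using top(4) by (rule mult_le_mono2)
  also have "... = 2 ^ t * (8 * t ^ 2)" by simp
  finally have 1: "2 * lo - lo + 1 <= 2 ^ t * (8 * t ^ 2)" .
  have 2: "L + 1 <= t * 1204" using t by (simp add: L_def)
  have "(2 * lo - lo + 1) * (L + 1) <= (2 ^ t * (8 * t ^ 2)) * (t * 1204)" using 1 2 by (rule mult_le_mono)
  also have "... = 2 ^ t * t ^ 3 * 9632" by (simp add: power3_eq_cube power2_eq_square)
  also have "... <= 2 ^ t * t ^ 4 * 9632" using t by (intro mult_le_mono power_increasing) auto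
  also have "... <= 20 * level_unit t" by (simp add: level_unit_def)
  finally have "x * ((2 * lo - lo + 1) * (L + 1)) <= x * (20 * level_unit t)" by (rule mult_le_mono2)
  thus ?thesis by (simp only: mult.left_commute)
  qed
  moreover have "x * (L + 1) <= (2 * lo - lo + 1) * (x * (L + 1))" for x by simp
  ultimately have *: "x * (L + 1) <= x * (20 * level_unit t)" "(2 * lo - lo + 1) * (x * (L + 1)) <= x * (20 * level_unit t)" for x
  by (meson order_trans)+
  have "v * (L + 1) + (wt root_vars * (L + 1) +
  ((2 * lo - lo + 1) * (prod_wt * (L + 1)) + (2 * lo - lo + 1) * (red_wt * (L + 1))))
  <= v * (20 * level_unit t) + (wt root_vars * (20 * level_unit t) + (prod_wt * (20 * level_unit t) + red_wt * (20 * level_unit t)))"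
  by (intro add_mono *)
  also have "... = 20 * mul_base_wt * level_unit t" unfolding mul_base_wt_def v_def[symmetric] by (simp add: algebra_simps)
  finally show "wt (Assign 21 (Var 21 [-] Const 1)) * (L + 1) + (wt root_vars * (L + 1) +
  ((2 * lo - lo + 1) * (prod_wt * (L + 1)) + (2 * lo - lo + 1) * (red_wt * (L + 1)))) <= 20 * mul_base_wt * level_unit t"
  unfolding v_def .
 qed
qed

definition up_vars :: prog where
 "up_vars = (Assign 42 (Var 42 [-] Const 1) ;; Assign 20 (Read 14 (Var 42)) ;;
  Assign 21 (Var 21 [-] (Var 20 [>>] Const 1)))"

definition up_loop :: prog where
 "up_loop = While (Const 0 [<] Var 42) (up_vars ;; up)"

lemma runs_up_step:
 assumes I: "up_inv t s0 (Suc r) s"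
 shows "runs (up_vars ;; up) s ((wt up_vars * 2 + up_wt) * level_unit t) (up_inv t s0 r)"
proof -
 define T G k where "T = lev_t t r" and "G = lev_g t r" and "k = T div 2"
 define X where "X = 3 * t + 10"
 have r: "6 <= lev_t t r" using I by (simp add: up_inv_def)
 note r2 = lev_two_pow[OF r]
 have GT: "G + T = t + 2 * r" unfolding G_def T_def by (rule lev_sum)
 have X: "T + 2 <= X" "Suc G + k + 2 <= X" "Suc r < X" using GT r2 by (auto simp: X_def k_def)
 have s: "s 42 0 = int (Suc r)" "s 21 0 = int (G + k)" "same mul_mods s s0" "s 14 (int r) = int T"
  using I by (auto simp: up_inv_def T_def G_def k_def)
 define s1 where "s1 = s(42 := (s 42)(0 := int r), 20 := (s 20)(0 := int T), 21 := (s 21)(0 := int G))"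
 have s1': "s1 k = s k" if "k ~: {42, 20, 21}" for k using that by (simp add: s1_def)
 show ?thesis
 proof (rule runs_Seq[where R = "%s'. s' = s1"])
  have b: "T < 2 ^ X" "G + k < 2 ^ X" "r < 2 ^ X" "Suc r < 2 ^ X" by (rule less_two_power; use X in linarith)+
  hence b': "int (Suc r) < 2 ^ X" "int (G + k) < 2 ^ X" by (simp_all del: of_nat_Suc of_nat_add)
  have "int T div 2 = int k" by (simp add: k_def zdiv_int)
  thus "runs up_vars s (wt up_vars * (X + 1)) (%s'. s' = s1)"
  using s b b' by (intro runs_wp) (simp add: up_vars_def s1_def)
 next
  fix s1a
  assume "s1a = s1"
  have leaf: "prods (2 ^ (T - T div 2 + 2)) (G + T div 2) (%i. s 10 (int i)) (%i. s1 11 (int i))"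
  using I unfolding up_inv_def T_def G_def by (simp add: s1')
  have lev: "level T (Suc G) (%i. s 10 (int i))" using I by (simp add: up_inv_def T_def G_def)
  show "runs up s1a ((T div 2 + 1) * (up_wt * unit G T X)) (up_inv t s0 r)"
  unfolding `s1a = s1`
  proof (rule runs_mono[OF runs_up[where t = T and g = G and X = X and a = "%i. s 10 (int i)"]])
  fix s2
  assume s2: "same {11, 12, 13, 22, 23, 24, 25, 26, 27, 28, 29, 30, 31, 33, 34, 35, 36, 37, 38, 39, 40, 41} s2 s1 &
  prods (2 ^ T) G (%i. s 10 (int i)) (%i. s2 11 (int i))"
  note s2' = sameD[OF conjunct1[OF s2]]
  have "same mul_mods s2 s0" using s2 s(3) s1' unfolding same_def by simp
  thus "up_inv t s0 r s2"
  using I s2 unfolding up_inv_def T_def[symmetric] G_def[symmetric]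
  by (simp add: s2' s1') (simp add: s1_def T_def)
  next
  show "level T (Suc G) (%i. s 10 (int i))" by (rule lev)
  show "prods (2 ^ (T - T div 2 + 2)) (G + T div 2) (%i. s 10 (int i)) (%i. s1 11 (int i))" by (rule leaf)
  qed (use s r X in "auto simp: s1_def k_def T_def")
 next
  have "X + 1 <= 3 * t + 1104" by (simp add: X_def)
  also have "... <= 2 * level_unit t" using r2 by (intro level_unit_ge) simp
  finally have "wt up_vars * (X + 1) <= wt up_vars * (2 * level_unit t)" by (rule mult_le_mono2)
  thus "wt up_vars * (X + 1) + (T div 2 + 1) * (up_wt * unit G T X)
  <= (wt up_vars * 2 + up_wt) * level_unit t"
  using level_cost(1)[OF r, of up_wt] unfolding X_def T_def G_def by (simp add: algebra_simps)
 qed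
qed

lemma runs_up_loop:
 assumes I: "up_inv t s0 r s" and t: "3 <= t" "r <= t"
 shows "runs up_loop s ((t + 1) * ((wt up_vars * 2 + up_wt + 2 * (cost_wt (Const 0 [<] Var 42) + val_wt (Const 0 [<] Var 42) + 1)) * level_unit t))
  (up_inv t s0 0)"
proof -
 define w where "w = (wt up_vars * 2 + up_wt) * level_unit t"
 define v where "v = cost_wt (Const 0 [<] Var 42) + val_wt (Const 0 [<] Var 42) + 1"
 let ?I = "%m s. m <= t & up_inv t s0 m s"
 have "runs up_loop s ((SUM j<r. w) + (r + 1) * (v * (t + 1)))
  (%s'. (EX m'. ?I m' s') & val (Const 0 [<] Var 42) s' = 0)"
  unfolding up_loop_def v_def
 proof (rule runs_While[where I = ?I])
  show "?I r s" using I t by simp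
 next
  fix m s
  assume m: "?I m s"
  hence "m < 2 ^ t" using less_exp[of t] by linarith
  thus "small t (Const 0 [<] Var 42) s" using m by (simp add: up_inv_def)
 next
  fix s
  assume "?I 0 s"
  thus "val (Const 0 [<] Var 42) s = 0" by (auto simp: up_inv_def)
 next
  fix m s
  assume "?I (Suc m) s"
  hence r: "up_inv t s0 (Suc m) s" "Suc m <= t" by auto
  show "runs (up_vars ;; up) s w (%s'. EX m'<=m. ?I m' s')"
  unfolding w_def
  by (rule runs_mono[OF runs_up_step[OF r(1)]]) (use r(2) in auto)
 qed
 thus ?thesis
 proof (rule runs_mono)
  have "v * (t + 1) <= v * (2 * level_unit t)"
  using level_unit_ge[of t] t by (intro mult_le_mono2) simp
  hence "r * w + (r + 1) * (v * (t + 1)) <= (t + 1) * w + (t + 1) * (v * (2 * level_unit t))"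
  using t by (intro add_mono mult_le_mono[of "r + 1"] mult_le_mono1) auto
  also have "... = (t + 1) * ((wt up_vars * 2 + up_wt + 2 * v) * level_unit t)"
  by (simp add: w_def algebra_simps)
  finally show "(SUM j<r. w) + (r + 1) * (v * (t + 1))
  <= (t + 1) * ((wt up_vars * 2 + up_wt + 2 * (cost_wt (Const 0 [<] Var 42) + val_wt (Const 0 [<] Var 42) + 1)) * level_unit t)"
  by (simp add: v_def del: cost_wt.simps val_wt.simps)
 next
  fix s'
  assume "(EX m'. ?I m' s') & val (Const 0 [<] Var 42) s' = 0"
  then obtain m where "up_inv t s0 m s'" "val (Const 0 [<] Var 42) s' = 0" by blast
  moreover from this have "m = 0" by (auto simp: up_inv_def split: if_splits)
  ultimately show "up_inv t s0 0 s'" by simp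
 qed
qed

definition mul_init :: prog where
 "mul_init = (Assign 20 (Var 32) ;; Assign 21 (Const 1) ;; Assign 42 (Const 0))"

definition mul_final_vars :: prog where
 "mul_final_vars = (Assign 24 (Const 1 [<<] Var 32) ;; Assign 34 (Const 1) ;; Assign 35 (Const 2))"

text \<open>Schoenhage-Strassen multiplication: with the factors in cells 2 and 3 of array 10, which hold less than
 \<open>2^(t - 1)\<close> bits each, and \<open>t\<close> in variable 32, the product appears in cell 1 of array 11.\<close>

definition mul :: prog where
 "mul = (mul_init ;; down_loop ;; mul_base ;; up_loop ;; mul_final_vars ;; sym_vars ;; sym_loop)"

definition mul_wt :: nat where
 "mul_wt = 2208 * (wt mul_init * 2 + (down_wt + wt step_vars + 2 * mul_guard_wt) + 20 * mul_base_wt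
  + (wt up_vars * 2 + up_wt + 2 * (cost_wt (Const 0 [<] Var 42) + val_wt (Const 0 [<] Var 42) + 1))
  + 2 * wt mul_final_vars + 2 * wt sym_vars + 4 * sym_wt)"

definition mul_cost :: "nat => nat" where
 "mul_cost t = mul_wt * (2 ^ t * t ^ 5)"

theorem runs_mul:
 assumes s: "s 32 0 = int t" and t: "3 <= t"
  and xy: "abs (s 10 2) < 2 ^ (2 ^ (t - 1) - 1)" "abs (s 10 3) < 2 ^ (2 ^ (t - 1) - 1)"
 shows "runs mul s (mul_cost t) (%s'. s' 11 1 = s 10 2 * s 10 3 & same mul_mods s' s)"
proof -
 define s1 where "s1 = s(20 := (s 20)(0 := int t), 21 := (s 21)(0 := 1), 42 := (s 42)(0 := 0))"
 define N :: nat where "N = 2 ^ t"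
 have N8: "8 <= N" using power_increasing[of 3 t "2::nat"] t by (simp add: N_def)
 have Nh: "N = 2 * 2 ^ (t - 1)" unfolding N_def using t by (simp flip: power_Suc)
 define L where "L = N + 2 + t"
 have b0: "abs (s 10 2) <= 2 ^ N" "abs (s 10 3) <= 2 ^ N"
 proof -
  have "(2::int) ^ (2 ^ (t - 1) - 1) <= 2 ^ N" unfolding Nh by (intro power_increasing) auto
  thus "abs (s 10 2) <= 2 ^ N" "abs (s 10 3) <= 2 ^ N" using xy by linarith+
 qed
 have down1: "down_inv t s 0 s1"
 proof -
  have "abs (s1 10 (int i)) <= 2 ^ 2 ^ lev_t t 0 + 8" if "2 ^ Suc (lev_g t 0) <= i" "i < 2 ^ Suc (Suc (lev_g t 0))" for i
  proof -
  have "i = 2 | i = 3" using that by auto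
  thus ?thesis using b0 by (auto simp: s1_def N_def)
  qed
  thus ?thesis unfolding down_inv_def by (simp add: s1_def)
 qed
 define W1 where "W1 = wt mul_init * (t + 1)"
 define W2 where "W2 = (t + 1) * ((down_wt + wt step_vars + 2 * mul_guard_wt) * level_unit t)"
 define W3 where "W3 = 20 * mul_base_wt * level_unit t"
 define W4 where "W4 = (t + 1) * ((wt up_vars * 2 + up_wt + 2 * (cost_wt (Const 0 [<] Var 42) + val_wt (Const 0 [<] Var 42) + 1)) * level_unit t)"
 have "runs mul s (W1 + (W2 + (W3 + (W4 + (wt mul_final_vars * (L + 1) + (wt sym_vars * (L + 1)
  + (2 - 1 + 1) * (sym_wt * (L + 1)))))))) (%s'. s' 11 1 = s 10 2 * s 10 3 & same mul_mods s' s)"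
  unfolding mul_def
 proof (rule runs_Seq[where R = "%s'. s' = s1"])
  have "t < 2 ^ t" by (rule less_exp)
  thus "runs mul_init s W1 (%s'. s' = s1)"
  unfolding W1_def using s by (intro runs_wp) (simp add: mul_init_def s1_def)
  fix s1a
  assume "s1a = s1"
  show "runs (down_loop ;; mul_base ;; up_loop ;; mul_final_vars ;; sym_vars ;; sym_loop) s1a
  (W2 + (W3 + (W4 + (wt mul_final_vars * (L + 1) + (wt sym_vars * (L + 1)
  + (2 - 1 + 1) * (sym_wt * (L + 1))))))) (%s'. s' 11 1 = s 10 2 * s 10 3 & same mul_mods s' s)"
  unfolding `s1a = s1` W2_def
  proof (rule runs_Seq[OF runs_down_loop[OF down1 t]])
  fix s2
  assume "EX r. down_inv t s r s2 & lev_t t r <= 5"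
  then obtain r where r: "down_inv t s r s2" "lev_t t r <= 5" by blast
  have "r <= t" by (rule lev_top(2)[OF r(2)]) (use r(1) t in "auto simp: down_inv_def")
  show "runs (mul_base ;; up_loop ;; mul_final_vars ;; sym_vars ;; sym_loop) s2
  (W3 + (W4 + (wt mul_final_vars * (L + 1) + (wt sym_vars * (L + 1)
  + (2 - 1 + 1) * (sym_wt * (L + 1)))))) (%s'. s' 11 1 = s 10 2 * s 10 3 & same mul_mods s' s)"
  unfolding W3_def
  proof (rule runs_Seq[OF runs_mul_base[OF r t]])
  fix s3
  assume s3: "up_inv t s r s3"
  show "runs (up_loop ;; mul_final_vars ;; sym_vars ;; sym_loop) s3
  (W4 + (wt mul_final_vars * (L + 1) + (wt sym_vars * (L + 1) + (2 - 1 + 1) * (sym_wt * (L + 1)))))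
  (%s'. s' 11 1 = s 10 2 * s 10 3 & same mul_mods s' s)"
  unfolding W4_def
  proof (rule runs_Seq[OF runs_up_loop[OF s3 t `r <= t`]])
  fix s4
  assume s4: "up_inv t s 0 s4"
  have pr: "[s4 11 1 = s 10 2 * s 10 3] (mod 2 ^ N + 1)" "abs (s4 11 1) <= 2 ^ N + 8"
  using s4 unfolding up_inv_def prods_def N_def by (auto dest: spec[of _ 1])
  have sm4: "same mul_mods s4 s" using s4 by (simp add: up_inv_def)
  have s432: "s4 32 0 = int t" using sameD[OF sm4, of 32] s by simp
  define s5 where "s5 = s4(24 := (s4 24)(0 := int N), 34 := (s4 34)(0 := 1), 35 := (s4 35)(0 := 2))"
  show "runs (mul_final_vars ;; sym_vars ;; sym_loop) s4
  (wt mul_final_vars * (L + 1) + (wt sym_vars * (L + 1) + (2 - 1 + 1) * (sym_wt * (L + 1))))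
  (%s'. s' 11 1 = s 10 2 * s 10 3 & same mul_mods s' s)"
  proof (rule runs_Seq[where R = "%s'. s' = s5"])
  have "t <= L" by (simp add: L_def)
  hence "t < 2 ^ L" using less_exp[of L] by linarith
  hence "int t < 2 ^ L" "nat (int t) <= L" "int t <= int L" using `t <= L` by simp_all
  thus "runs mul_final_vars s4 (wt mul_final_vars * (L + 1)) (%s'. s' = s5)"
  using s432 by (intro runs_wp) (simp add: mul_final_vars_def s5_def N_def)
  fix s5a
  assume "s5a = s5"
  show "runs (sym_vars ;; sym_loop) s5a (wt sym_vars * (L + 1) + (2 - 1 + 1) * (sym_wt * (L + 1)))
  (%s'. s' 11 1 = s 10 2 * s 10 3 & same mul_mods s' s)"
  unfolding `s5a = s5`
  proof (rule runs_Seq[OF runs_sym_vars[where N = N and L = L]])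
  fix s6
  assume s6: "same {39, 40} s6 s5 & s6 39 0 = 2 ^ (N - 1) & s6 40 0 = 2 ^ N + 1"
  note s6' = sameD[OF conjunct1[OF s6]]
  have s6_11: "s6 11 1 = s4 11 1" by (simp add: s6' s5_def)
  show "runs sym_loop s6 ((2 - 1 + 1) * (sym_wt * (L + 1)))
  (%s'. s' 11 1 = s 10 2 * s 10 3 & same mul_mods s' s)"
  proof (rule runs_mono[OF runs_sym_loop[where lo = 1 and hi = 2 and N = N and L = L]])
  have "3 <= L" using t by (simp add: L_def)
  thus "(2::nat) < 2 ^ L" using less_exp[of L] by linarith
  next
  fix e :: nat
  assume "1 <= e" "e < 2"
  hence "e = 1" by simp
  have "(2::int) ^ N + 8 <= 2 ^ (N + 4)" by (rule two_power_add_8)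
  also have "... < (2::int) ^ L" using t by (intro power_strict_increasing) (auto simp: L_def)
  finally show "abs (s6 11 (int e)) < 2 ^ L" using pr(2) s6_11 `e = 1` by simp
  next
  fix s7
  assume s7: "same {11, 27, 28} s7 s6 & (ALL i. s7 11 (int i) = (if 1 <= i & i < 2
  then centre N (s6 11 (int i)) else s6 11 (int i)))"
  have "s7 11 (int 1) = centre N (s6 11 (int 1))" using s7 by (metis le_refl one_less_numeral_iff semiring_norm(76))
  hence "s7 11 1 = centre N (s4 11 1)" using s6_11 by simp
  \<comment> \<open>The product has at most \<open>N - 2\<close> bits by the bound on the factors,
    so it is determined by its residue modulo \<open>2 ^ N + 1\<close>.\<close>
  also have "... = s 10 2 * s 10 3"
  proof (rule centre_eqI[OF pr])
  have "abs (s 10 2 * s 10 3) < 2 ^ (2 ^ (t - 1) - 1) * 2 ^ (2 ^ (t - 1) - 1)"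
  unfolding abs_mult using xy by (intro mult_strict_mono) auto
  also have "... = (2::int) ^ (N - 2)" unfolding Nh by (simp add: mult_2 flip: power_add)
  finally show "abs (s 10 2 * s 10 3) < 2 ^ (N - 2)" .
  qed (use N8 in simp)
  finally show "s7 11 1 = s 10 2 * s 10 3 & same mul_mods s7 s"
  using s7 s6 sm4 unfolding s5_def same_def by simp
  qed (use s6 in "auto simp: L_def s6' s5_def")
  qed (use N8 in "auto simp: s5_def L_def")
  qed simp
  qed simp
  qed simp
  qed simp
 qed simp
 thus ?thesis
 proof (rule runs_mono)
  define K where "K = wt mul_init * 2 + (down_wt + wt step_vars + 2 * mul_guard_wt) + 20 * mul_base_wt
  + (wt up_vars * 2 + up_wt + 2 * (cost_wt (Const 0 [<] Var 42) + val_wt (Const 0 [<] Var 42) + 1))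
  + 2 * wt mul_final_vars + 2 * wt sym_vars + 4 * sym_wt"
  define lu where "lu = (t + 1) * level_unit t"
  have lu1: "level_unit t <= lu" by (simp add: lu_def)
  have t1: "t + 1 <= 2 * lu" using level_unit_ge[of t] t lu1 by linarith
  have L1: "L + 1 <= 2 * lu"
  proof -
  have "N * 1 * 1 <= 2 ^ t * t ^ 4 * 1104" unfolding N_def using t by (intro mult_le_mono) auto
  hence "N <= lu" using lu1 by (simp add: level_unit_def)
  moreover have "t + 3 <= lu" using level_unit_ge[of t] t lu1 by linarith
  ultimately show ?thesis by (simp add: L_def)
  qed
  have c: "w * (t + 1) <= w * (2 * lu)" "w * (L + 1) <= w * (2 * lu)" "w * level_unit t <= w * lu"
  "(t + 1) * (w * level_unit t) <= w * lu" for w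
  using t1 L1 lu1 by (auto simp only: mult_le_mono2 lu_def mult.left_commute order_refl)
  have "W1 + (W2 + (W3 + (W4 + (wt mul_final_vars * (L + 1) + (wt sym_vars * (L + 1) + (2 - 1 + 1) * (sym_wt * (L + 1)))))))
  <= wt mul_init * (2 * lu) + ((down_wt + wt step_vars + 2 * mul_guard_wt) * lu + (20 * mul_base_wt * lu +
  ((wt up_vars * 2 + up_wt + 2 * (cost_wt (Const 0 [<] Var 42) + val_wt (Const 0 [<] Var 42) + 1)) * lu
  + (wt mul_final_vars * (2 * lu) + (wt sym_vars * (2 * lu) + 2 * (sym_wt * (2 * lu)))))))"
  unfolding W1_def W2_def W3_def W4_def by (intro add_mono c mult_le_mono) simp
  also have "... = K * lu" unfolding K_def by (simp only: algebra_simps)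
  also have "... <= K * (2208 * (2 ^ t * t ^ 5))"
  proof (rule mult_le_mono2)
  have "lu <= (2 * t) * level_unit t" unfolding lu_def using t by (intro mult_le_mono1) simp
  also have "... = 2208 * (2 ^ t * t ^ 5)" by (simp add: level_unit_def power_Suc[of t 4, symmetric] del: power_Suc)
  finally show "lu <= 2208 * (2 ^ t * t ^ 5)" .
  qed
  also have "... = mul_cost t" unfolding mul_cost_def mul_wt_def K_def[symmetric] by simp
  finally show "W1 + (W2 + (W3 + (W4 + (wt mul_final_vars * (L + 1) + (wt sym_vars * (L + 1) + (2 - 1 + 1) * (sym_wt * (L + 1)))))))
  <= mul_cost t" .
 qed simp
qed

section \<open>Evaluation at many points\<close>

unbundle fps_syntax

text \<open>The reversed subproduct tree: a node of height \<open>h\<close> stands for the product of \<open>1 - a X\<close> over the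
 \<open>2^h\<close> points \<open>a\<close> below it, and for the inverse power series of this product.\<close>

fun node_poly :: "(nat => int) => nat => nat => int poly" where
 "node_poly a 0 p = [:1, - a p:]"
| "node_poly a (Suc h) p = node_poly a h (2 * p) * node_poly a h (2 * p + 1)"

fun node_ser :: "(nat => int) => nat => nat => int fps" where
 "node_ser a 0 p = Abs_fps (%i. a p ^ i)"
| "node_ser a (Suc h) p = node_ser a h (2 * p) * node_ser a h (2 * p + 1)"

lemma fps_mult_linear_nth:
 "(f * fps_of_poly [:1, - c:]) $ n = f $ n - (if n = 0 then 0 else c * f $ (n - 1))" for c :: int
proof -
 have "fps_of_poly [:1, - c:] = 1 - fps_const c * fps_X"
  by (rule fps_ext) (auto simp: coeff_pCons split: nat.splits)
 hence "f * fps_of_poly [:1, - c:] = f - fps_const c * (fps_X * f)" by (simp only:) (simp add: algebra_simps)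
 thus ?thesis by (simp add: fps_sub_nth)
qed

lemma node_ser_poly: "node_ser a h p * fps_of_poly (node_poly a h p) = 1"
proof (induction h arbitrary: p)
 case 0
 show ?case
 proof (rule fps_ext)
  fix n
  show "(node_ser a 0 p * fps_of_poly (node_poly a 0 p)) $ n = 1 $ n"
  unfolding node_poly.simps fps_mult_linear_nth by (cases n) auto
 qed
next
 case (Suc h)
 have "node_ser a (Suc h) p * fps_of_poly (node_poly a (Suc h) p)
  = (node_ser a h (2 * p) * fps_of_poly (node_poly a h (2 * p)))
  * (node_ser a h (2 * p + 1) * fps_of_poly (node_poly a h (2 * p + 1)))"
  by (simp only: node_ser.simps node_poly.simps fps_of_poly_mult ac_simps)
 thus ?case by (simp only: Suc.IH mult_1_right)
qed

lemma degree_node_poly: "degree (node_poly a h p) <= 2 ^ h"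
proof (induction h arbitrary: p)
 case (Suc h)
 have "degree (node_poly a (Suc h) p) <= degree (node_poly a h (2 * p)) + degree (node_poly a h (2 * p + 1))"
  by (simp add: degree_mult_le)
 also have "... <= 2 ^ h + 2 ^ h" by (intro add_mono Suc.IH)
 finally show ?case by simp
qed simp

section \<open>Sizes of the products in the tree and of the quotient series\<close>

definition l1 :: "int poly => int" where
 "l1 p = (SUM i<=degree p. abs (coeff p i))"

lemma poly_altdef_le: "degree p <= n ==> poly p x = (SUM i<=n. coeff p i * x ^ i)" for p :: "int poly"
 unfolding poly_altdef by (rule sum.mono_neutral_left) (auto simp: coeff_eq_0)

lemma sum_coeff_le_poly_1:
 assumes "!!i. 0 <= coeff p i"
 shows "(SUM i<=n. coeff p i) <= poly p (1 :: int)"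
proof -
 have "poly p 1 = (SUM i<=max n (degree p). coeff p i)"
  using poly_altdef_le[of p "max n (degree p)" 1] by simp
 moreover have "(SUM i<=n. coeff p i) <= (SUM i<=max n (degree p). coeff p i)"
  using assms by (intro sum_mono2) auto
 ultimately show ?thesis by simp
qed

lemma l1_eq_poly: "l1 p = poly (map_poly abs p) 1"
proof -
 have "degree (map_poly abs p) <= degree p" by (rule degree_le) (simp add: coeff_map_poly coeff_eq_0)
 thus ?thesis
  unfolding l1_def using poly_altdef_le[of "map_poly abs p" "degree p" 1] by (simp add: coeff_map_poly)
qed

text \<open>Coefficientwise the product is dominated by the product of the polynomials with absolute
  coefficients, and the norms are their values at 1.\<close>

lemma l1_mult_le: "l1 (p * q) <= l1 p * l1 q"
proof -
 have "l1 (p * q) <= (SUM i<=degree (p * q). coeff (map_poly abs p * map_poly abs q) i)"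
  unfolding l1_def
 proof (rule sum_mono)
  fix i
  have "abs (coeff (p * q) i) <= (SUM j<=i. abs (coeff p j * coeff q (i - j)))"
  unfolding coeff_mult by (rule sum_abs)
  thus "abs (coeff (p * q) i) <= coeff (map_poly abs p * map_poly abs q) i"
  by (simp add: coeff_mult coeff_map_poly abs_mult)
 qed
 also have "... <= poly (map_poly abs p * map_poly abs q) 1"
  by (rule sum_coeff_le_poly_1) (auto simp: coeff_mult coeff_map_poly intro!: sum_nonneg)
 finally show ?thesis by (simp add: l1_eq_poly)
qed

lemma l1_nonneg: "0 <= l1 p"
 by (simp add: l1_def sum_nonneg)

lemma l1_node_poly_le:
 assumes "!!q. abs (a q) <= A"
 shows "l1 (node_poly a h p) <= (1 + A) ^ 2 ^ h"
proof (induction h arbitrary: p)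
 case 0
 have "abs (a p) <= A" by (rule assms)
 thus ?case by (auto simp: l1_def)
next
 case (Suc h)
 have "l1 (node_poly a (Suc h) p) <= l1 (node_poly a h (2 * p)) * l1 (node_poly a h (2 * p + 1))"
  by (simp add: l1_mult_le)
 also have "... <= (1 + A) ^ 2 ^ h * (1 + A) ^ 2 ^ h"
  using assms[of 0] by (intro mult_mono Suc.IH l1_nonneg) auto
 also have "... = (1 + A) ^ 2 ^ Suc h" by (simp add: power_add mult_2)
 finally show ?case .
qed

text \<open>Division by one factor \<open>1 - a X\<close> solves
  \<open>d n = c n + a * d (n - 1)\<close>. Against the weight \<open>(2 * A) ^ t\<close> the
  recursive term takes only half of the new bound, so each of the \<open>2 ^ h\<close> factors
  merely doubles \<open>M\<close>.\<close>

lemma abs_ser_le: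
 assumes "!!q. abs (a q) <= A" "!!t. abs (c $ t) <= M * (2 * A) ^ t" "0 <= M"
 shows "abs ((c * node_ser a h p) $ t) <= 2 ^ 2 ^ h * M * (2 * A) ^ t"
 using assms(2,3)
proof (induction h arbitrary: c M p t)
 case 0
 note prems = "0.prems"
 define d where "d = c * node_ser a 0 p"
 have A: "0 <= A" using assms(1)[of 0] by simp
 have "d * fps_of_poly [:1, - a p:] = c"
  using node_ser_poly[of a 0 p] unfolding d_def node_poly.simps mult.assoc by simp
 hence d: "d $ n = c $ n + (if n = 0 then 0 else a p * d $ (n - 1))" for n
  using fps_mult_linear_nth[of d "a p" n] by simp
 have "abs (d $ t) <= 2 * M * (2 * A) ^ t" for t
 proof (induction t)
  case 0
  have "d $ 0 = c $ 0" using d[of 0] by simp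
  thus ?case using prems(1)[of 0] prems(2) by simp
 next
  case (Suc t)
  have "d $ Suc t = c $ Suc t + a p * d $ t" using d[of "Suc t"] by simp
  hence "abs (d $ Suc t) <= abs (c $ Suc t) + abs (a p) * abs (d $ t)" by (metis abs_triangle_ineq abs_mult)
  also have "... <= M * (2 * A) ^ Suc t + A * (2 * M * (2 * A) ^ t)"
  using assms(1) A by (intro add_mono mult_mono Suc prems) auto
  also have "... = 2 * M * (2 * A) ^ Suc t" by (simp add: algebra_simps)
  finally show ?case .
 qed
 thus ?case by (simp add: d_def)
next
 case (Suc h)
 have ih: "abs ((c * node_ser a h (2 * p)) $ t) <= 2 ^ 2 ^ h * M * (2 * A) ^ t" for t
  using Suc.prems by (rule Suc.IH)
 have "abs (((c * node_ser a h (2 * p)) * node_ser a h (2 * p + 1)) $ t) <= 2 ^ 2 ^ h * (2 ^ 2 ^ h * M) * (2 * A) ^ t"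
  by (rule Suc.IH[OF ih]) (use Suc.prems(2) in simp)
 also have "(2::int) ^ 2 ^ h * (2 ^ 2 ^ h * M) = 2 ^ 2 ^ Suc h * M" by (simp add: power_add mult_2 mult.assoc)
 finally show ?case by (simp only: node_ser.simps mult.assoc)
qed

text \<open>Division by \<open>2^M\<close>, rounded to the nearest integer, drops the lower digits of a number given by
 its signed digits in base \<open>2^N\<close>.\<close>

definition rnd :: "nat => int => int" where
 "rnd M x = (x + 2 ^ (M - 1)) div 2 ^ M"

lemma rnd_eq:
 assumes "abs c < 2 ^ (M - 1)" "1 <= M"
 shows "rnd M (c + 2 ^ M * k) = k"
proof -
 have M: "(2::int) ^ M = 2 * 2 ^ (M - 1)" using assms(2) by (simp flip: power_Suc)
 have "(c + 2 ^ (M - 1) + k * 2 ^ M) div 2 ^ M = k + (c + 2 ^ (M - 1)) div 2 ^ M"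
  by (rule div_mult_self1) simp
 moreover have "(c + 2 ^ (M - 1)) div 2 ^ M = 0" using assms(1) unfolding M by (intro div_pos_pos_trivial) auto
 ultimately show ?thesis unfolding rnd_def by (simp add: algebra_simps)
qed

section \<open>Truncation, middle products and inversion of packed polynomials\<close>

lemma poly_cutoff_shift: "p = poly_cutoff k p + monom 1 k * poly_shift k p" for p :: "int poly"
 by (rule poly_eqI) (auto simp: coeff_poly_cutoff coeff_monom_mult coeff_poly_shift)

text \<open>With signed digits of at most \<open>N - 2\<close> bits a truncated number stays below
  half of \<open>2 ^ (N * k)\<close>, so rounding removes it without affecting the digits
  above.\<close>

lemma abs_poly_cutoff_less:
 fixes p :: "int poly"
 assumes "!!t. abs (coeff p t) <= 2 ^ (N - 2)" "2 <= N"
 shows "abs (poly (poly_cutoff k p) (2 ^ N)) < 2 ^ (N * k - 1) | k = 0"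
proof (induction k)
 case (Suc k)
 have eq: "poly_cutoff (Suc k) p = poly_cutoff k p + monom (coeff p k) k"
  by (rule poly_eqI) (auto simp: coeff_poly_cutoff less_Suc_eq)
 have "abs (poly (poly_cutoff (Suc k) p) (2 ^ N)) <= abs (poly (poly_cutoff k p) (2 ^ N)) + abs (coeff p k * (2 ^ N) ^ k)"
  unfolding eq by (simp add: poly_monom)
 also have "abs (coeff p k * (2 ^ N) ^ k) <= 2 ^ (N - 2) * (2 ^ N) ^ k"
  unfolding abs_mult using assms by (intro mult_mono) auto
 also have "(2::int) ^ (N - 2) * (2 ^ N) ^ k = 2 ^ (N - 2 + N * k)" by (simp add: power_add power_mult)
 also have "abs (poly (poly_cutoff k p) (2 ^ N)) < 2 ^ (N - 2 + N * k)"
 proof (cases "k = 0")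
  case True
  hence "poly_cutoff k p = 0" by (intro poly_eqI) (simp add: coeff_poly_cutoff)
  thus ?thesis by simp
 next
  case False
  hence "abs (poly (poly_cutoff k p) (2 ^ N)) < 2 ^ (N * k - 1)" using Suc by simp
  also have "(2::int) ^ (N * k - 1) <= 2 ^ (N - 2 + N * k)" by (intro power_increasing) auto
  finally show ?thesis .
 qed
 also have "(2::int) ^ (N - 2 + N * k) + 2 ^ (N - 2 + N * k) = 2 ^ Suc (N - 2 + N * k)" by simp
 also have "Suc (N - 2 + N * k) = N * Suc k - 1" using assms(2) by simp
 finally show ?case by simp
qed simp

lemma rnd_poly:
 fixes p :: "int poly"
 assumes "!!t. abs (coeff p t) <= 2 ^ (N - 2)" "2 <= N" "1 <= k"
 shows "rnd (N * k) (poly p (2 ^ N)) = poly (poly_shift k p) (2 ^ N)"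
proof -
 have "poly p (2 ^ N) = poly (poly_cutoff k p) (2 ^ N) + 2 ^ (N * k) * poly (poly_shift k p) (2 ^ N)"
  by (subst poly_cutoff_shift[of p k]) (simp add: poly_monom power_mult)
 moreover have "abs (poly (poly_cutoff k p) (2 ^ N)) < 2 ^ (N * k - 1)"
  using abs_poly_cutoff_less[OF assms(1,2)] assms(3) by auto
 ultimately show ?thesis using assms by (simp add: rnd_eq)
qed

definition window :: "int fps => nat => nat => int poly" where
 "window c lo w = (SUM t<w. monom (c $ (lo + t)) t)"

lemma coeff_window: "coeff (window c lo w) i = (if i < w then c $ (lo + i) else 0)"
 unfolding window_def by (simp add: coeff_sum)

text \<open>This is a middle product. As \<open>f\<close> has degree at most \<open>m\<close>, the
  \<open>m\<close> coefficients from \<open>lo + m\<close> on depend only on the window of length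
  \<open>2 * m\<close> from \<open>lo\<close> on. In the packed product they are the digits
  \<open>m\<close> to \<open>2 * m - 1\<close>, cut out by two roundings. The digits outside are not
  coefficients of the series, but \<open>K * M\<close> bounds them as well, so they produce no
  carry.\<close>

lemma window_child:
 fixes f :: "int poly"
 assumes "degree f <= m" "1 <= m"
  and "l1 f <= K" "!!t. t < 2 * m ==> abs (c $ (lo + t)) <= M" "K * M <= 2 ^ (N - 2)" "2 <= N" "0 <= M"
 defines "x == poly (window c lo (2 * m)) (2 ^ N) * poly f (2 ^ N)"
 shows "rnd (N * m) x - rnd (N * (2 * m)) x * 2 ^ (N * m)
  = poly (window (c * fps_of_poly f) (lo + m) m) (2 ^ N)"
proof -
 define q where "q = window c lo (2 * m) * f"
 have x: "x = poly q (2 ^ N)" by (simp add: x_def q_def)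
 have q: "abs (coeff q t) <= 2 ^ (N - 2)" for t
 proof -
  have "abs (coeff q t) = \<bar>SUM j<=t. coeff f j * coeff (window c lo (2 * m)) (t - j)\<bar>"
  unfolding q_def mult.commute[of "window c lo (2 * m)"] coeff_mult ..
  also have "... <= (SUM j<=t. abs (coeff f j * coeff (window c lo (2 * m)) (t - j)))" by (rule sum_abs)
  also have "... <= (SUM j<=t. abs (coeff f j) * M)"
  proof (intro sum_mono)
  fix j
  have "abs (coeff (window c lo (2 * m)) (t - j)) <= M"
  using assms(4)[of "t - j"] assms(7) by (simp add: coeff_window)
  thus "abs (coeff f j * coeff (window c lo (2 * m)) (t - j)) <= abs (coeff f j) * M"
  unfolding abs_mult by (rule mult_left_mono) simp
  qed
  also have "... <= (SUM j<=max t (degree f). abs (coeff f j) * M)" using assms(7) by (intro sum_mono2) auto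
  also have "... = (SUM j<=degree f. abs (coeff f j) * M)"
  by (intro sum.mono_neutral_right) (auto simp: coeff_eq_0)
  also have "... = l1 f * M" by (simp add: l1_def sum_distrib_right)
  also have "... <= K * M" using assms(3,7) by (intro mult_right_mono)
  finally show ?thesis using assms(5) by simp
 qed
 have "poly_shift m q - monom 1 m * poly_shift (2 * m) q = window (c * fps_of_poly f) (lo + m) m"
 proof (rule poly_eqI)
  fix i
  have "coeff (window (c * fps_of_poly f) (lo + m) m) i = coeff q (i + m)" if "i < m"
  proof -
  have "(c * fps_of_poly f) $ (lo + m + i) = (fps_of_poly f * c) $ (lo + m + i)" by (simp add: mult.commute)
  also have "... = (SUM j=0..lo + m + i. coeff f j * c $ (lo + m + i - j))" by (simp add: fps_mult_nth)
  also have "... = (SUM j<=m + i. coeff f j * c $ (lo + m + i - j))"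
  using assms(1) by (intro sum.mono_neutral_right) (auto simp: coeff_eq_0)
  also have "... = (SUM j<=m + i. coeff f j * coeff (window c lo (2 * m)) (m + i - j))"
  using that by (intro sum.cong) (auto simp: coeff_window add.assoc)
  also have "... = coeff q (i + m)"
  unfolding q_def mult.commute[of "window c lo (2 * m)"] coeff_mult by (simp add: add.commute)
  finally show ?thesis using that by (simp add: coeff_window)
  qed
  thus "coeff (poly_shift m q - monom 1 m * poly_shift (2 * m) q) i = coeff (window (c * fps_of_poly f) (lo + m) m) i"
  by (auto simp: coeff_poly_shift coeff_monom_mult coeff_window add.commute)
 qed
 from arg_cong[OF this, of "%p. poly p (2 ^ N)"]
 have "poly (poly_shift m q) (2 ^ N) - poly (poly_shift (2 * m) q) (2 ^ N) * 2 ^ (N * m)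
  = poly (window (c * fps_of_poly f) (lo + m) m) (2 ^ N)"
  by (simp add: poly_monom power_mult mult.commute)
 thus ?thesis unfolding x using rnd_poly[OF q assms(6)] assms(2) by simp
qed

definition smod :: "nat => int => int" where
 "smod M x = x - rnd M x * 2 ^ M"

lemma smod_cong: "[smod M x = x] (mod 2 ^ M)"
 by (simp add: smod_def cong_iff_dvd_diff)

lemma smod_eqI:
 assumes "[x = c] (mod 2 ^ M)" "abs c < 2 ^ (M - 1)" "1 <= M"
 shows "smod M x = c"
proof -
 obtain k where "x = c + 2 ^ M * k" using assms(1) by (metis cong_iff_lin cong_sym)
 thus ?thesis unfolding smod_def using rnd_eq[OF assms(2,3)] by simp
qed

lemma abs_smod_le: "1 <= M ==> abs (smod M x) <= 2 ^ (M - 1)"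
proof -
 assume "1 <= M"
 hence M: "(2::int) ^ M = 2 * 2 ^ (M - 1)" by (simp flip: power_Suc)
 have "smod M x + 2 ^ (M - 1) = (x + 2 ^ (M - 1)) mod 2 ^ M"
  unfolding smod_def rnd_def using minus_div_mult_eq_mod[of "x + 2 ^ (M - 1)" "2 ^ M"] by simp
 moreover have "0 <= (x + 2 ^ (M - 1)) mod 2 ^ M" "(x + 2 ^ (M - 1)) mod 2 ^ M < 2 ^ M" by simp_all
 ultimately show ?thesis using M by linarith
qed

text \<open>The new error \<open>1 - f * v'\<close> is the square of the old one.\<close>

lemma newton_cong:
 fixes v f :: int
 assumes "[f * v = 1] (mod m)"
 shows "[f * (v * (2 - f * v)) = 1] (mod m ^ 2)"
proof -
 have "m dvd f * v - 1" using assms by (simp add: cong_iff_dvd_diff)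
 hence "m ^ 2 dvd (f * v - 1) ^ 2" by (rule dvd_power_same)
 moreover have "f * (v * (2 - f * v)) - 1 = - ((f * v - 1) ^ 2)" by (simp add: power2_eq_square algebra_simps)
 ultimately show ?thesis by (simp only: cong_iff_dvd_diff dvd_minus_iff)
qed

text \<open>The quotient is found with integers: \<open>v\<close> is an inverse modulo
  \<open>2 ^ (N * s)\<close> and need not be a packed series with short digits; only the final
  quotient has to be. Terms of degree \<open>s\<close> and more vanish modulo
  \<open>2 ^ (N * s)\<close>, so comparing the polynomials cut off at \<open>s\<close> is
  enough.\<close>

lemma window_root:
 fixes f g :: "int poly"
 assumes "c * fps_of_poly f = fps_of_poly g" "[poly f (2 ^ N) * v = 1] (mod 2 ^ (N * s))"
  and "!!t. t < s ==> abs (c $ t) <= 2 ^ (N - 2)" "2 <= N" "1 <= s"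
 shows "smod (N * s) (poly g (2 ^ N) * v) = poly (window c 0 s) (2 ^ N)"
proof (rule smod_eqI)
 let ?Y = "2 ^ N :: int"
 have cut: "poly_cutoff s (window c 0 s * f) = poly_cutoff s g"
 proof (rule poly_eqI)
  fix i
  have "coeff (window c 0 s * f) i = (c * fps_of_poly f) $ i" if "i < s"
  unfolding coeff_mult fps_mult_nth atLeast0AtMost using that by (intro sum.cong) (auto simp: coeff_window)
  thus "coeff (poly_cutoff s (window c 0 s * f)) i = coeff (poly_cutoff s g) i"
  by (simp add: coeff_poly_cutoff assms(1))
 qed
 have low: "[poly p ?Y = poly (poly_cutoff s p) ?Y] (mod 2 ^ (N * s))" for p :: "int poly"
 proof -
  have "poly p ?Y - poly (poly_cutoff s p) ?Y = 2 ^ (N * s) * poly (poly_shift s p) ?Y"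
  by (subst poly_cutoff_shift[of p s]) (simp add: poly_monom power_mult)
  thus ?thesis by (simp add: cong_iff_dvd_diff)
 qed
 have "[poly (window c 0 s) ?Y * poly f ?Y = poly g ?Y] (mod 2 ^ (N * s))"
  using low[of "window c 0 s * f"] cong_sym[OF low[of g]] unfolding cut poly_mult by (rule cong_trans)
 from cong_mult[OF this cong_refl, of v]
 have "[poly g ?Y * v = poly (window c 0 s) ?Y * (poly f ?Y * v)] (mod 2 ^ (N * s))"
  by (simp add: mult.assoc cong_sym_eq)
 also have "[poly (window c 0 s) ?Y * (poly f ?Y * v) = poly (window c 0 s) ?Y * 1] (mod 2 ^ (N * s))"
  by (intro cong_mult cong_refl assms(2))
 finally show "[poly g ?Y * v = poly (window c 0 s) ?Y] (mod 2 ^ (N * s))" by simp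
 have "poly_cutoff s (window c 0 s) = window c 0 s"
  by (rule poly_eqI) (simp add: coeff_poly_cutoff coeff_window)
 moreover have "abs (poly (poly_cutoff s (window c 0 s)) ?Y) < 2 ^ (N * s - 1) | s = 0"
  using assms(3,4) by (intro abs_poly_cutoff_less) (auto simp: coeff_window)
 ultimately show "abs (poly (window c 0 s) ?Y) < 2 ^ (N * s - 1)" using assms(5) by simp
 show "1 <= N * s" using assms(4,5) by simp
qed

text \<open>In the product with the geometric series of a point, the coefficient of degree
  \<open>s - 1\<close> is the value of the block in Horner's scheme, with \<open>g 0\<close> as
  leading coefficient.\<close>

lemma window_leaf: "poly (window (fps_of_poly (SUM u<s. monom (g u) u) * node_ser a 0 p) (s - 1) 1) x
  = (SUM u<s. g u * a p ^ (s - 1 - u))" if "1 <= s"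
proof -
 have "poly (window (fps_of_poly (SUM u<s. monom (g u) u) * node_ser a 0 p) (s - 1) 1) x
  = (SUM u=0..s - 1. (if u < s then g u else 0) * a p ^ (s - 1 - u))"
  by (simp add: window_def poly_monom fps_mult_nth coeff_sum)
 also have "... = (SUM u<s. g u * a p ^ (s - 1 - u))"
  using that by (intro sum.cong) auto
 finally show ?thesis .
qed

lemma abs_poly_le_l1:
 fixes p :: "int poly"
 assumes "degree p <= m" "1 <= y"
 shows "abs (poly p y) <= l1 p * y ^ m"
proof -
 have "abs (poly p y) <= (SUM i<=degree p. abs (coeff p i * y ^ i))" unfolding poly_altdef by (rule sum_abs)
 also have "... <= (SUM i<=degree p. abs (coeff p i) * y ^ m)"
  unfolding abs_mult using assms by (intro sum_mono mult_left_mono) (auto intro!: power_increasing)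
 finally show ?thesis by (simp add: l1_def sum_distrib_right)
qed

section \<open>Programs for the single nodes of the tree\<close>

abbreviation mulc_mods :: "nat set" where
 "mulc_mods == {10, 11, 12, 13, 14, 20, 21, 22, 23, 24, 25, 26, 27, 28, 29, 30, 31, 32, 33, 34, 35, 36, 37, 38, 39, 40, 41, 42}"

definition mulc_init :: "expr => expr => expr => prog" where
 "mulc_init e1 e2 te = (Write 10 (Const 2) e1 ;; Write 10 (Const 3) e2 ;; Assign 32 te)"

definition mulc :: "expr => expr => expr => prog" where
 "mulc e1 e2 te = (mulc_init e1 e2 te ;; mul)"

lemma runs_mulc:
 assumes "wp L (mulc_init e1 e2 te) (%s'. s' = s(10 := (s 10)(2 := x, 3 := y), 32 := (s 32)(0 := int t))) s"
  and t: "3 <= t" "abs x < 2 ^ (2 ^ (t - 1) - 1)" "abs y < 2 ^ (2 ^ (t - 1) - 1)"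
 shows "runs (mulc e1 e2 te) s (wt (mulc_init e1 e2 te) * (L + 1) + mul_cost t)
  (%s'. s' 11 1 = x * y & same mulc_mods s' s)"
 unfolding mulc_def
proof (rule runs_Seq[OF runs_wp[OF assms(1)]])
 fix s1
 assume s1: "s1 = s(10 := (s 10)(2 := x, 3 := y), 32 := (s 32)(0 := int t))"
 show "runs mul s1 (mul_cost t) (%s'. s' 11 1 = x * y & same mulc_mods s' s)"
  by (rule runs_mono[OF runs_mul[where t = t]]) (use t s1 in "auto simp: same_def")
qed simp

lemma two_int_less:
 assumes "2 * n < 2 ^ L"
 shows "2 * int n < 2 ^ L"
proof -
 have "int (2 * n) < int (2 ^ L)" using assms by (simp only: of_nat_less_iff)
 thus ?thesis by simp
qed

text \<open>A level has \<open>2 ^ d\<close> nodes of height \<open>h\<close>, each requiring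
  multiplications of \<open>2 ^ (nu + h + 3)\<close> bits; by \<open>d + h <= sg\<close> all levels
  are equally expensive.\<close>

lemma node_cost:
 assumes "d + h <= sg" "nu + sg + 4 <= X"
 shows "(2 ^ d + 1) * (mul_cost (nu + h + 3) + w * (2 ^ (nu + h + 3) + X + 1))
  <= (16 * mul_wt + 20 * w) * (2 ^ (nu + sg) * X ^ 5)"
proof -
 have dh: "(2::nat) ^ (d + h) <= 2 ^ sg" "(2::nat) ^ d <= 2 ^ sg" using assms by (intro power_increasing; simp)+
 have X: "1 <= X" using assms by simp
 have "2 ^ d * mul_cost (nu + h + 3) = mul_wt * (8 * (2 ^ nu * 2 ^ (d + h)) * (nu + h + 3) ^ 5)"
  by (simp add: mul_cost_def power_add algebra_simps)
 also have "... <= mul_wt * (8 * (2 ^ nu * 2 ^ sg) * X ^ 5)"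
  using dh assms by (intro mult_le_mono order_refl power_mono) auto
 finally have 1: "2 ^ d * mul_cost (nu + h + 3) <= mul_wt * 8 * (2 ^ (nu + sg) * X ^ 5)" by (simp add: power_add algebra_simps)
 have "2 ^ d * (w * (2 ^ (nu + h + 3) + X + 1)) = w * (8 * (2 ^ nu * 2 ^ (d + h)) + 2 ^ d * (X + 1))"
  by (simp add: power_add algebra_simps)
 also have "... <= w * (8 * (2 ^ nu * 2 ^ sg) + (2 ^ nu * 2 ^ sg) * (X + 1))"
 proof (intro mult_le_mono2 add_mono mult_le_mono)
  show "(2::nat) ^ (d + h) <= 2 ^ sg" by (rule dh)
  have "(2::nat) ^ d <= 1 * 2 ^ sg" using dh by simp
  also have "... <= 2 ^ nu * 2 ^ sg" by (intro mult_le_mono1) simp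
  finally show "(2::nat) ^ d <= 2 ^ nu * 2 ^ sg" .
 qed simp_all
 also have "... = w * (2 ^ (nu + sg) * (X + 9))" by (simp add: power_add algebra_simps)
 also have "... <= w * (2 ^ (nu + sg) * (10 * X ^ 5))"
 proof (intro mult_le_mono2)
  have "X + 9 <= 10 * X ^ 1" using X by simp
  also have "... <= 10 * X ^ 5" using X by (intro mult_le_mono2 power_increasing) auto
  finally show "X + 9 <= 10 * X ^ 5" .
 qed
 finally have 2: "2 ^ d * (w * (2 ^ (nu + h + 3) + X + 1)) <= 10 * w * (2 ^ (nu + sg) * X ^ 5)" by simp
 have "(2 ^ d + 1) * (mul_cost (nu + h + 3) + w * (2 ^ (nu + h + 3) + X + 1))
  <= (2 * 2 ^ d) * (mul_cost (nu + h + 3) + w * (2 ^ (nu + h + 3) + X + 1))" by (intro mult_le_mono1) simp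
 also have "... = 2 * (2 ^ d * mul_cost (nu + h + 3)) + 2 * (2 ^ d * (w * (2 ^ (nu + h + 3) + X + 1)))"
  by (simp add: algebra_simps)
 also have "... <= 2 * (mul_wt * 8 * (2 ^ (nu + sg) * X ^ 5)) + 2 * (10 * w * (2 ^ (nu + sg) * X ^ 5))"
  using 1 2 by (intro add_mono mult_le_mono2)
 also have "... = (16 * mul_wt + 20 * w) * (2 ^ (nu + sg) * X ^ 5)" by (simp add: algebra_simps)
 finally show ?thesis .
qed

text \<open>Cells of the evaluation: array 50 contains the points, 51 the products of the tree, 52
  the assembled coefficients and 53 the windows, all three indexed as heaps; 60 and 61 hold
  \<open>nv\<close> and \<open>sg\<close>, 68 the digit length \<open>2 ^ nv\<close>, 70 the
  position of the leading coefficient of the block, and 71 the size handed to the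
  multiplication.\<close>

definition leafH_body :: prog where
 "leafH_body = Write 51 (Var 63) (Const 1 [-] (Read 50 (Var 63 [-] Var 66) [<<] Var 68))"

text \<open>The coefficients are read downwards from the leading one. Array 0 contains 0 at negative
  indices, so the last block is padded automatically.\<close>

definition leafG_body :: prog where
 "leafG_body = Write 52 (Var 63) (Read 0 (Var 70 [-] (Var 63 [-] Var 66)))"

lemma runs_leafH:
 assumes s: "s 66 0 = int lo" "s 67 0 = int (2 * lo)" "s 68 0 = int N"
  and L: "2 * lo < 2 ^ L" "N <= L"
  and A: "!!i. i < lo ==> abs (s 50 (int i)) < 2 ^ L"
 shows "runs (For 63 (Var 66) (Var 67) leafH_body) s ((2 * lo - lo + 1) * ((wt leafH_body + for_wt (Var 66) (Var 67)) * (L + 1)))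
  (%s'. same {51, 63} s' s & (ALL i. s' 51 (int i) = (if lo <= i & i < 2 * lo
  then 1 - s 50 (int (i - lo)) * 2 ^ N else s 51 (int i))))"
proof (rule runs_map_vars_wp)
 fix e s1
 assume e: "lo <= e" "e < 2 * lo" and s1: "same {51, 63} s1 s" "s1 63 0 = int e"
 note s1' = sameD[OF s1(1)]
 have "e < 2 ^ L" "lo < 2 ^ L" "N < 2 ^ L" using e L less_exp[of L] by linarith+
 thus "wp L leafH_body (%s'. same {51, 63} s' s & s' 63 0 = int e &
  s' 51 (int e) = 1 - s 50 (int (e - lo)) * 2 ^ N & (ALL i. i ~= e --> s' 51 (int i) = s1 51 (int i))) s1"
  using s s1 e L A[of "e - lo"] by (simp add: leafH_body_def s1' of_nat_diff)
qed (use s L in simp_all)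

lemma runs_leafG:
 assumes s: "s 66 0 = int lo" "s 67 0 = int (2 * lo)" "s 70 0 = z"
  and L: "2 * lo < 2 ^ L" "abs z < 2 ^ L"
  and A: "!!i. i < lo ==> abs (s 0 (z - int i)) < 2 ^ L"
 shows "runs (For 63 (Var 66) (Var 67) leafG_body) s ((2 * lo - lo + 1) * ((wt leafG_body + for_wt (Var 66) (Var 67)) * (L + 1)))
  (%s'. same {52, 63} s' s & (ALL i. s' 52 (int i) = (if lo <= i & i < 2 * lo
  then s 0 (z - int (i - lo)) else s 52 (int i))))"
proof (rule runs_map_vars_wp)
 fix e s1
 assume e: "lo <= e" "e < 2 * lo" and s1: "same {52, 63} s1 s" "s1 63 0 = int e"
 note s1' = sameD[OF s1(1)]
 have "e < 2 ^ L" "lo < 2 ^ L" using e L by linarith+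
 thus "wp L leafG_body (%s'. same {52, 63} s' s & s' 63 0 = int e &
  s' 52 (int e) = s 0 (z - int (e - lo)) & (ALL i. i ~= e --> s' 52 (int i) = s1 52 (int i))) s1"
  using s s1 e L A[of "e - lo"] by (simp add: leafG_body_def s1' of_nat_diff)
qed (use s L in simp_all)

definition nodeH_body :: prog where
 "nodeH_body = (mulc (Read 51 (Var 63 [+] Var 63)) (Read 51 (Var 63 [+] Var 63 [+] Const 1)) (Var 71) ;;
  Write 51 (Var 63) (Read 11 (Const 1)))"

definition nodeH_wt :: nat where
 "nodeH_wt = wt (mulc_init (Read 51 (Var 63 [+] Var 63)) (Read 51 (Var 63 [+] Var 63 [+] Const 1)) (Var 71))
  + wt (Write 51 (Var 63) (Read 11 (Const 1)))"

lemma runs_nodeH: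
 assumes s: "s 66 0 = int lo" "s 67 0 = int (2 * lo)" "s 71 0 = int t"
  and L: "2 * lo < 2 ^ L" "3 <= t" "2 ^ t <= L"
  and A: "!!i. 2 * lo <= i ==> i < 4 * lo ==> abs (s 51 (int i)) < 2 ^ (2 ^ (t - 1) - 1)"
 shows "runs (For 63 (Var 66) (Var 67) nodeH_body) s ((2 * lo - lo + 1) * ((nodeH_wt * (L + 1) + mul_cost t) + for_wt (Var 66) (Var 67) * (L + 1)))
  (%s'. same (insert 51 (insert 63 mulc_mods)) s' s & (ALL i. s' 51 (int i) = (if lo <= i & i < 2 * lo
  then s 51 (int (2 * i)) * s 51 (int (2 * i + 1)) else s 51 (int i))))"
proof (rule runs_map_vars)
 let ?M = "insert 51 (insert 63 mulc_mods)"
 have t1: "2 ^ t = 2 * (2::nat) ^ (t - 1)" using L by (simp flip: power_Suc)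
 have tL: "(2::int) ^ (2 ^ (t - 1) - 1) <= 2 ^ L" "(2::int) ^ (2 ^ t - 2) <= 2 ^ L"
  using L unfolding t1 by (intro power_increasing; simp)+
 fix e s1
 assume e: "lo <= e" "e < 2 * lo" and s1: "same ?M s1 s" "s1 63 0 = int e"
  and W: "!!i. s1 51 (int i) = (if lo <= i & i < e then s 51 (int (2 * i)) * s 51 (int (2 * i + 1)) else s 51 (int i))"
 note s1' = sameD[OF s1(1)]
 define x y where "x = s 51 (int (2 * e))" and "y = s 51 (int (2 * e + 1))"
 have xy: "s1 51 (int (2 * e)) = x" "s1 51 (int (2 * e + 1)) = y" unfolding W x_def y_def using e by auto
 have b: "abs x < 2 ^ (2 ^ (t - 1) - 1)" "abs y < 2 ^ (2 ^ (t - 1) - 1)" unfolding x_def y_def using e by (intro A; simp)+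
 have bL: "abs x < 2 ^ L" "abs y < 2 ^ L" using b tL by linarith+
 have pL: "abs (x * y) < 2 ^ L"
 proof -
  have "abs (x * y) < 2 ^ (2 ^ (t - 1) - 1) * 2 ^ (2 ^ (t - 1) - 1)" unfolding abs_mult using b by (intro mult_strict_mono) auto
  also have "... = (2::int) ^ (2 ^ t - 2)" unfolding t1 by (simp add: mult_2 flip: power_add)
  finally show ?thesis using tL by linarith
 qed
 have vL: "e < 2 ^ L" "t < 2 ^ L" using e L less_exp[of t] less_exp[of L] by linarith+
 show "runs nodeH_body s1 (nodeH_wt * (L + 1) + mul_cost t)
  (%s'. same ?M s' s & s' 63 0 = int e & s' 51 (int e) = s 51 (int (2 * e)) * s 51 (int (2 * e + 1)) &
  (ALL i. i ~= e --> s' 51 (int i) = s1 51 (int i)))"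
  unfolding nodeH_body_def
 proof (rule runs_Seq[OF runs_mulc[where x = x and y = y and t = t and L = L]])
  have i: "int e + int e = int (2 * e)" "int (2 * e) + 1 = int (2 * e + 1)" by simp_all
  have xy': "s1 51 (int e + int e) = x" "s1 51 (int e + int e + 1) = y" by (simp_all only: i xy)
  show "wp L (mulc_init (Read 51 (Var 63 [+] Var 63)) (Read 51 (Var 63 [+] Var 63 [+] Const 1)) (Var 71))
  (%s'. s' = s1(10 := (s1 10)(2 := x, 3 := y), 32 := (s1 32)(0 := int t))) s1"
  using s s1(2) bL vL xy' unfolding mulc_init_def by (simp add: s1')
 next
  fix s2
  assume s2: "s2 11 1 = x * y & same mulc_mods s2 s1"
  note s2' = sameD[OF conjunct2[OF s2]]
  have "same ?M s2 s" using s2 s1(1) unfolding same_def by simp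
  thus "runs (Write 51 (Var 63) (Read 11 (Const 1))) s2 (wt (Write 51 (Var 63) (Read 11 (Const 1))) * (L + 1))
  (%s'. same ?M s' s & s' 63 0 = int e & s' 51 (int e) = s 51 (int (2 * e)) * s 51 (int (2 * e + 1)) &
  (ALL i. i ~= e --> s' 51 (int i) = s1 51 (int i)))"
  using s2 s1(2) vL pL by (intro runs_wp) (simp add: s2' x_def y_def)
 qed (use L b in "auto simp: nodeH_wt_def algebra_simps")
qed (use s L in simp_all)

definition nodeG_body :: prog where
 "nodeG_body = Write 52 (Var 63) (Read 52 (Var 63 [+] Var 63) [+] (Read 52 (Var 63 [+] Var 63 [+] Const 1) [<<] Var 69))"

lemma runs_nodeG:
 assumes s: "s 66 0 = int lo" "s 67 0 = int (2 * lo)" "s 69 0 = int m"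
  and L: "2 * lo < 2 ^ L" "m <= L"
  and A: "!!i. 2 * lo <= i ==> i < 4 * lo ==> abs (s 52 (int i)) < 2 ^ L"
 shows "runs (For 63 (Var 66) (Var 67) nodeG_body) s ((2 * lo - lo + 1) * ((wt nodeG_body + for_wt (Var 66) (Var 67)) * (L + 1)))
  (%s'. same {52, 63} s' s & (ALL i. s' 52 (int i) = (if lo <= i & i < 2 * lo
  then s 52 (int (2 * i)) + s 52 (int (2 * i + 1)) * 2 ^ m else s 52 (int i))))"
proof (rule runs_map_vars_wp)
 fix e s1
 assume e: "lo <= e" "e < 2 * lo" and s1: "same {52, 63} s1 s" "s1 63 0 = int e"
  and W: "!!i. s1 52 (int i) = (if lo <= i & i < e then s 52 (int (2 * i)) + s 52 (int (2 * i + 1)) * 2 ^ m else s 52 (int i))"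
 note s1' = sameD[OF s1(1)]
 have xy: "s1 52 (int (2 * e)) = s 52 (int (2 * e))" "s1 52 (int (2 * e + 1)) = s 52 (int (2 * e + 1))" unfolding W using e by auto
 have b: "abs (s 52 (int (2 * e))) < 2 ^ L" "abs (s 52 (int (2 * e + 1))) < 2 ^ L" using e by (intro A; simp)+
 have i: "int e + int e = int (2 * e)" "int (2 * e) + 1 = int (2 * e + 1)" by simp_all
 have xy': "s1 52 (int e + int e) = s 52 (int (2 * e))" "s1 52 (int e + int e + 1) = s 52 (int (2 * e + 1))" by (simp_all only: i xy)
 have "e < 2 ^ L" "lo < 2 ^ L" "m < 2 ^ L" using e L less_exp[of L] by linarith+
 thus "wp L nodeG_body (%s'. same {52, 63} s' s & s' 63 0 = int e &
  s' 52 (int e) = s 52 (int (2 * e)) + s 52 (int (2 * e + 1)) * 2 ^ m & (ALL i. i ~= e --> s' 52 (int i) = s1 52 (int i))) s1"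
  using s s1 e L b xy' by (simp add: nodeG_body_def s1' del: of_nat_add of_nat_mult of_nat_Suc)
qed (use s L in simp_all)

text \<open>The lowest bit of the index is flipped by adding 1 and subtracting the doubled
  parity.\<close>

definition sibling :: expr where
 "sibling = (Var 63 [+] Const 1 [-] ((Var 63 [-] ((Var 63 [>>] Const 1) [<<] Const 1)) [<<] Const 1))"

definition rnd_expr :: "expr => expr => expr" where
 "rnd_expr m x = ((x [+] (Const 1 [<<] (m [-] Const 1))) [>>] m)"

lemma val_rnd_expr:
 assumes "val m s = int n" "1 <= n"
 shows "val (rnd_expr m x) s = rnd n (val x s)"
proof -
 have "nat (int n - 1) = n - 1" by simp
 thus ?thesis using assms by (simp add: rnd_expr_def rnd_def)
qed

lemma small_rnd_expr:
 assumes "small L m s" "small L x s" "val m s = int n" "n <= L"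
 shows "small L (rnd_expr m x) s"
 using assms by (simp add: rnd_expr_def)

text \<open>For the step to a child, multiplication by the polynomial of its sibling cancels that
  part of the quotient series which belongs to the sibling. The entry of the parent lies below the
  range being written, so the pass works in place.\<close>

definition nodeV_body :: prog where
 "nodeV_body = (mulc (Read 53 (Var 63 [>>] Const 1)) (Read 51 sibling) (Var 71) ;;
  Write 53 (Var 63) (rnd_expr (Var 69) (Read 11 (Const 1)) [-] (rnd_expr (Var 74) (Read 11 (Const 1)) [<<] Var 69)))"

definition nodeV_wt :: nat where
 "nodeV_wt = wt (mulc_init (Read 53 (Var 63 [>>] Const 1)) (Read 51 sibling) (Var 71))
  + wt (Write 53 (Var 63) (rnd_expr (Var 69) (Read 11 (Const 1)) [-] (rnd_expr (Var 74) (Read 11 (Const 1)) [<<] Var 69)))"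

lemma val_sibling:
 assumes "s 63 0 = int e"
 shows "val sibling s = int (if even e then e + 1 else e - 1)"
proof (cases "even e")
 case True
 hence "int e div 2 * 2 = int e" by simp
 thus ?thesis using assms True by (simp add: sibling_def)
next
 case False
 hence "int e div 2 * 2 = int e - 1" "1 <= e" by (auto elim: oddE)
 thus ?thesis using assms False by (simp add: sibling_def of_nat_diff)
qed

lemma runs_nodeV:
 assumes s: "s 66 0 = int lo" "s 67 0 = int (2 * lo)" "s 71 0 = int t" "s 69 0 = int m" "s 74 0 = int (2 * m)"
  and L: "2 * lo < 2 ^ L" "3 <= t" "2 ^ t <= L" "1 <= m" "2 * m <= L" "even lo"
  and A: "!!i. lo <= i ==> i < 2 * lo ==> abs (s 51 (int i)) < 2 ^ (2 ^ (t - 1) - 1)"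
  "!!i. lo <= i ==> i < 2 * lo ==> abs (s 53 (int (i div 2))) < 2 ^ (2 ^ (t - 1) - 1)"
 defines "f == (%i. s 53 (int (i div 2)) * s 51 (int (if even i then i + 1 else i - 1)))"
 shows "runs (For 63 (Var 66) (Var 67) nodeV_body) s ((2 * lo - lo + 1) * ((nodeV_wt * (L + 1) + mul_cost t) + for_wt (Var 66) (Var 67) * (L + 1)))
  (%s'. same (insert 53 (insert 63 mulc_mods)) s' s & (ALL i. s' 53 (int i) = (if lo <= i & i < 2 * lo
  then rnd m (f i) - rnd (2 * m) (f i) * 2 ^ m else s 53 (int i))))"
proof (rule runs_map_vars)
 let ?M = "insert 53 (insert 63 mulc_mods)"
 have t1: "2 ^ t = 2 * (2::nat) ^ (t - 1)" using L by (simp flip: power_Suc)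
 have tL: "(2::int) ^ (2 ^ (t - 1) - 1) <= 2 ^ L" "(2::int) ^ (2 ^ t - 2) <= 2 ^ L"
  using L unfolding t1 by (intro power_increasing; simp)+
 fix e s1
 assume e: "lo <= e" "e < 2 * lo" and s1: "same ?M s1 s" "s1 63 0 = int e"
  and W: "!!i. s1 53 (int i) = (if lo <= i & i < e then rnd m (f i) - rnd (2 * m) (f i) * 2 ^ m else s 53 (int i))"
 note s1' = sameD[OF s1(1)]
 define sb where "sb = (if even e then e + 1 else e - 1)"
 define x y where "x = s 53 (int (e div 2))" and "y = s 51 (int sb)"
 have lo: "1 <= lo" using e by (cases lo) auto
 have "~ lo <= e div 2" using e by linarith
 hence x: "s1 53 (int (e div 2)) = x" unfolding W x_def by simp
 have sb: "lo <= sb" "sb < 2 * lo" using e L(6) unfolding sb_def by (auto elim!: evenE oddE)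
 have b: "abs x < 2 ^ (2 ^ (t - 1) - 1)" "abs y < 2 ^ (2 ^ (t - 1) - 1)" unfolding x_def y_def using e sb A by blast+
 have bL: "abs x < 2 ^ L" "abs y < 2 ^ L" using b tL by linarith+
 have pL: "abs (x * y) < 2 ^ L"
 proof -
  have "abs (x * y) < 2 ^ (2 ^ (t - 1) - 1) * 2 ^ (2 ^ (t - 1) - 1)" unfolding abs_mult using b by (intro mult_strict_mono) auto
  also have "... = (2::int) ^ (2 ^ t - 2)" unfolding t1 by (simp add: mult_2 flip: power_add)
  finally show ?thesis using tL by linarith
 qed
 have vL: "e < 2 ^ L" "t < 2 ^ L" "m < 2 ^ L" "2 * m < 2 ^ L" "m <= L" using e L less_exp[of t] less_exp[of L] by linarith+
 have f: "f e = x * y" by (simp add: f_def x_def y_def sb_def)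
 show "runs nodeV_body s1 (nodeV_wt * (L + 1) + mul_cost t)
  (%s'. same ?M s' s & s' 63 0 = int e & s' 53 (int e) = rnd m (f e) - rnd (2 * m) (f e) * 2 ^ m &
  (ALL i. i ~= e --> s' 53 (int i) = s1 53 (int i)))"
  unfolding nodeV_body_def
 proof (rule runs_Seq[OF runs_mulc[where x = x and y = y and t = t and L = L]])
  define s3 where "s3 = s1(10 := (s1 10)(2 := x))"
  have sbv: "val sibling s3 = int sb" unfolding sb_def by (rule val_sibling) (simp add: s3_def s1(2))
  have "small L sibling s3" using L s1(2) vL by (simp add: sibling_def s3_def)
  moreover have "int e div 2 = int (e div 2)" by simp
  ultimately show "wp L (mulc_init (Read 53 (Var 63 [>>] Const 1)) (Read 51 sibling) (Var 71))
  (%s'. s' = s1(10 := (s1 10)(2 := x, 3 := y), 32 := (s1 32)(0 := int t))) s1"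
  using s s1(2) bL vL x sbv L unfolding mulc_init_def s3_def by (simp add: s1' y_def del: of_nat_div)
 next
  fix s2
  assume s2: "s2 11 1 = x * y & same mulc_mods s2 s1"
  note s2' = sameD[OF conjunct2[OF s2]]
  have sm: "same ?M s2 s" using s2 s1(1) unfolding same_def by simp
  have v: "val (Var 69) s2 = int m" "val (Var 74) s2 = int (2 * m)" "val (Read 11 (Const 1)) s2 = x * y"
  "small L (Var 69) s2" "small L (Var 74) s2" "small L (Read 11 (Const 1)) s2"
  using s s2 vL pL two_int_less[OF vL(4)] by (simp_all add: s2' s1')
  have r: "val (rnd_expr (Var 69) (Read 11 (Const 1))) s2 = rnd m (x * y)" "val (rnd_expr (Var 74) (Read 11 (Const 1))) s2 = rnd (2 * m) (x * y)"
  "small L (rnd_expr (Var 69) (Read 11 (Const 1))) s2" "small L (rnd_expr (Var 74) (Read 11 (Const 1))) s2"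
  using val_rnd_expr[OF v(1)] val_rnd_expr[OF v(2)] small_rnd_expr[OF v(4,6,1)] small_rnd_expr[OF v(5,6,2)] v(3) L vL by auto
  show "runs (Write 53 (Var 63) (rnd_expr (Var 69) (Read 11 (Const 1)) [-] (rnd_expr (Var 74) (Read 11 (Const 1)) [<<] Var 69))) s2
  (wt (Write 53 (Var 63) (rnd_expr (Var 69) (Read 11 (Const 1)) [-] (rnd_expr (Var 74) (Read 11 (Const 1)) [<<] Var 69))) * (L + 1))
  (%s'. same ?M s' s & s' 63 0 = int e & s' 53 (int e) = rnd m (f e) - rnd (2 * m) (f e) * 2 ^ m &
  (ALL i. i ~= e --> s' 53 (int i) = s1 53 (int i)))"
  using s1(2) vL r v sm unfolding f by (intro runs_wp) (simp add: s2')
 qed (use L b in "auto simp: nodeV_wt_def algebra_simps")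
qed (use s L in simp_all)

text \<open>One Newton step for the inverse, in variable 64, of the number at the root of the product tree.\<close>

definition smod_expr :: "expr => expr => expr" where
 "smod_expr m x = (x [-] (rnd_expr m x [<<] m))"

lemma val_smod_expr:
 assumes "val m s = int n" "1 <= n"
 shows "val (smod_expr m x) s = smod n (val x s)"
 using val_rnd_expr[OF assms] assms by (simp add: smod_expr_def smod_def)

lemma small_smod_expr:
 assumes "small L m s" "small L x s" "val m s = int n" "n <= L"
 shows "small L (smod_expr m x) s"
 using small_rnd_expr[OF assms] assms by (simp add: smod_expr_def)

definition newton_step :: prog where
 "newton_step = (mulc (Read 51 (Const 1)) (Var 64) (Var 71) ;; Assign 65 (Const 2 [-] Read 11 (Const 1)) ;;
  mulc (Var 64) (Var 65) (Var 71) ;; Assign 64 (smod_expr (Var 69) (Read 11 (Const 1))))"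

definition newton_wt :: nat where
 "newton_wt = wt (mulc_init (Read 51 (Const 1)) (Var 64) (Var 71)) + wt (Assign 65 (Const 2 [-] Read 11 (Const 1)))
  + wt (mulc_init (Var 64) (Var 65) (Var 71)) + wt (Assign 64 (smod_expr (Var 69) (Read 11 (Const 1))))"

lemma runs_newton_step:
 assumes s: "s 71 0 = int t" "s 69 0 = int m"
  and L: "3 <= t" "2 ^ t <= L" "1 <= m" "m <= L"
  and A: "abs (s 51 1) < 2 ^ (2 ^ (t - 1) - 1)" "abs (s 64 0) < 2 ^ (2 ^ (t - 1) - 1)" "abs (2 - s 51 1 * s 64 0) < 2 ^ (2 ^ (t - 1) - 1)"
 shows "runs newton_step s (newton_wt * (L + 1) + 2 * mul_cost t)
  (%s'. same (insert 64 (insert 65 mulc_mods)) s' s & s' 64 0 = smod m (s 64 0 * (2 - s 51 1 * s 64 0)))"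
proof -
 let ?M = "insert 64 (insert 65 mulc_mods)"
 define f v where "f = s 51 1" and "v = s 64 0"
 have t1: "2 ^ t = 2 * (2::nat) ^ (t - 1)" using L by (simp flip: power_Suc)
 have tL: "(2::int) ^ (2 ^ (t - 1) - 1) <= 2 ^ L" "(2::int) ^ (2 ^ t - 2) <= 2 ^ L"
  using L unfolding t1 by (intro power_increasing; simp)+
 have pL: "abs (x * y) < 2 ^ L" if "abs x < 2 ^ (2 ^ (t - 1) - 1)" "abs y < 2 ^ (2 ^ (t - 1) - 1)" for x y :: int
 proof -
  have "abs (x * y) < 2 ^ (2 ^ (t - 1) - 1) * 2 ^ (2 ^ (t - 1) - 1)" unfolding abs_mult using that by (intro mult_strict_mono) auto
  also have "... = (2::int) ^ (2 ^ t - 2)" unfolding t1 by (simp add: mult_2 flip: power_add)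
  finally show ?thesis using tL by linarith
 qed
 note A' = A[folded f_def v_def]
 have bL: "abs f < 2 ^ L" "abs v < 2 ^ L" "abs (2 - f * v) < 2 ^ L" "abs (f * v) < 2 ^ L" "abs (v * (2 - f * v)) < 2 ^ L"
  using A' tL pL[OF A'(1,2)] pL[OF A'(2,3)] by linarith+
 have vL: "t < 2 ^ L" "m < 2 ^ L" using L less_exp[of t] less_exp[of L] by linarith+
 define w1 where "w1 = wt (mulc_init (Read 51 (Const 1)) (Var 64) (Var 71)) * (L + 1) + mul_cost t"
 define w2 where "w2 = wt (Assign 65 (Const 2 [-] Read 11 (Const 1))) * (L + 1)"
 define w3 where "w3 = wt (mulc_init (Var 64) (Var 65) (Var 71)) * (L + 1) + mul_cost t"
 define w4 where "w4 = wt (Assign 64 (smod_expr (Var 69) (Read 11 (Const 1)))) * (L + 1)"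
 have "runs newton_step s (w1 + (w2 + (w3 + w4))) (%s'. same ?M s' s & s' 64 0 = smod m (v * (2 - f * v)))"
  unfolding newton_step_def w1_def
 proof (rule runs_Seq[OF runs_mulc[where x = f and y = v and t = t and L = L]])
  show "wp L (mulc_init (Read 51 (Const 1)) (Var 64) (Var 71))
  (%s'. s' = s(10 := (s 10)(2 := f, 3 := v), 32 := (s 32)(0 := int t))) s"
  using s bL vL by (simp add: mulc_init_def f_def v_def)
  fix s1
  assume s1: "s1 11 1 = f * v & same mulc_mods s1 s"
  note s1' = sameD[OF conjunct2[OF s1]]
  define s2 where "s2 = s1(65 := (s1 65)(0 := 2 - f * v))"
  show "runs (Assign 65 (Const 2 [-] Read 11 (Const 1)) ;; mulc (Var 64) (Var 65) (Var 71) ;;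
  Assign 64 (smod_expr (Var 69) (Read 11 (Const 1)))) s1 (w2 + (w3 + w4))
  (%s'. same ?M s' s & s' 64 0 = smod m (v * (2 - f * v)))"
  proof (rule runs_Seq[where R = "%s'. s' = s2"])
  show "runs (Assign 65 (Const 2 [-] Read 11 (Const 1))) s1 w2 (%s'. s' = s2)"
  unfolding w2_def using s1 bL by (intro runs_wp) (simp add: s2_def)
  fix s2a
  assume "s2a = s2"
  show "runs (mulc (Var 64) (Var 65) (Var 71) ;; Assign 64 (smod_expr (Var 69) (Read 11 (Const 1)))) s2a (w3 + w4)
  (%s'. same ?M s' s & s' 64 0 = smod m (v * (2 - f * v)))"
  unfolding `s2a = s2` w3_def
  proof (rule runs_Seq[OF runs_mulc[where x = v and y = "2 - f * v" and t = t and L = L]])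
  show "wp L (mulc_init (Var 64) (Var 65) (Var 71))
  (%s'. s' = s2(10 := (s2 10)(2 := v, 3 := 2 - f * v), 32 := (s2 32)(0 := int t))) s2"
  using s bL vL by (simp add: mulc_init_def s2_def s1' v_def)
  fix s3
  assume s3: "s3 11 1 = v * (2 - f * v) & same mulc_mods s3 s2"
  note s3' = sameD[OF conjunct2[OF s3]]
  have sm: "same ?M s3 s" using s3 s1 unfolding same_def s2_def by simp
  have vv: "val (Var 69) s3 = int m" "val (Read 11 (Const 1)) s3 = v * (2 - f * v)"
  "small L (Var 69) s3" "small L (Read 11 (Const 1)) s3"
  using s s3 vL bL by (simp_all add: s3' s1' s2_def)
  show "runs (Assign 64 (smod_expr (Var 69) (Read 11 (Const 1)))) s3 w4
  (%s'. same ?M s' s & s' 64 0 = smod m (v * (2 - f * v)))"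
  unfolding w4_def
  using val_smod_expr[OF vv(1) L(3), of "Read 11 (Const 1)"] small_smod_expr[OF vv(3,4,1) L(4)] sm vv(2)
  by (intro runs_wp) simp
  qed (use L A' in auto)
  qed simp
 qed (use L A' in auto)
 thus ?thesis
  unfolding f_def v_def
  by (rule runs_mono) (simp_all only: w1_def w2_def w3_def w4_def newton_wt_def, simp add: algebra_simps)
qed

definition root_step :: prog where
 "root_step = (mulc (Read 52 (Const 1)) (Var 64) (Var 71) ;; Write 53 (Const 1) (smod_expr (Var 69) (Read 11 (Const 1))))"

definition root_wt :: nat where
 "root_wt = wt (mulc_init (Read 52 (Const 1)) (Var 64) (Var 71)) + wt (Write 53 (Const 1) (smod_expr (Var 69) (Read 11 (Const 1))))"

lemma runs_root_step:
 assumes s: "s 71 0 = int t" "s 69 0 = int m"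
  and L: "3 <= t" "2 ^ t <= L" "1 <= m" "m <= L"
  and A: "abs (s 52 1) < 2 ^ (2 ^ (t - 1) - 1)" "abs (s 64 0) < 2 ^ (2 ^ (t - 1) - 1)"
 shows "runs root_step s (root_wt * (L + 1) + mul_cost t)
  (%s'. same (insert 53 mulc_mods) s' s & s' 53 1 = smod m (s 52 1 * s 64 0))"
 unfolding root_step_def
proof (rule runs_Seq[OF runs_mulc[where x = "s 52 1" and y = "s 64 0" and t = t and L = L]])
 have t1: "2 ^ t = 2 * (2::nat) ^ (t - 1)" using L by (simp flip: power_Suc)
 have tL: "(2::int) ^ (2 ^ (t - 1) - 1) <= 2 ^ L" "(2::int) ^ (2 ^ t - 2) <= 2 ^ L"
  using L unfolding t1 by (intro power_increasing; simp)+
 have pL: "abs (s 52 1 * s 64 0) < 2 ^ L"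
 proof -
  have "abs (s 52 1 * s 64 0) < 2 ^ (2 ^ (t - 1) - 1) * 2 ^ (2 ^ (t - 1) - 1)" unfolding abs_mult using A by (intro mult_strict_mono) auto
  also have "... = (2::int) ^ (2 ^ t - 2)" unfolding t1 by (simp add: mult_2 flip: power_add)
  finally show ?thesis using tL by linarith
 qed
 have bL: "abs (s 52 1) < 2 ^ L" "abs (s 64 0) < 2 ^ L" using A tL by linarith+
 have vL: "t < 2 ^ L" "m < 2 ^ L" using L less_exp[of t] less_exp[of L] by linarith+
 show "wp L (mulc_init (Read 52 (Const 1)) (Var 64) (Var 71))
  (%s'. s' = s(10 := (s 10)(2 := s 52 1, 3 := s 64 0), 32 := (s 32)(0 := int t))) s"
  using s bL vL by (simp add: mulc_init_def)
 fix s3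
 assume s3: "s3 11 1 = s 52 1 * s 64 0 & same mulc_mods s3 s"
 note s3' = sameD[OF conjunct2[OF s3]]
 have sm: "same (insert 53 mulc_mods) s3 s" using s3 unfolding same_def by simp
 have vv: "val (Var 69) s3 = int m" "val (Read 11 (Const 1)) s3 = s 52 1 * s 64 0"
  "small L (Var 69) s3" "small L (Read 11 (Const 1)) s3"
  using s s3 vL bL pL by (simp_all add: s3')
 show "runs (Write 53 (Const 1) (smod_expr (Var 69) (Read 11 (Const 1)))) s3 (wt (Write 53 (Const 1) (smod_expr (Var 69) (Read 11 (Const 1)))) * (L + 1))
  (%s'. same (insert 53 mulc_mods) s' s & s' 53 1 = smod m (s 52 1 * s 64 0))"
  using val_smod_expr[OF vv(1) L(3), of "Read 11 (Const 1)"] small_smod_expr[OF vv(3,4,1) L(4)] sm vv(2)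
  by (intro runs_wp) simp
qed (use L A in "auto simp: root_wt_def algebra_simps")

text \<open>Invariants of the evaluation of a block at \<open>2^sg\<close> points: the products in the tree of points,
 the coefficients assembled to a number in base \<open>2^N\<close>, and the windows of the quotient series.\<close>

locale block =
 fixes pt g :: "nat => int" and l B nv sg :: nat
 assumes pt: "abs (pt q) <= 2 ^ l" and g: "abs (g u) <= 2 ^ B"
  and N_ge: "(2 * l + 3) * 2 ^ sg + B + 4 <= 2 ^ nv"
begin

definition num :: "int poly => int" where "num p = poly p (2 ^ 2 ^ nv)"

definition hnum :: "nat => nat => int" where "hnum h p = num (node_poly pt h p)"

definition gpoly :: "nat => nat => int poly" where
 "gpoly h q = (SUM u<2 ^ h. monom (g (q * 2 ^ h + u)) u)"

definition gnum :: "nat => nat => int" where "gnum h q = num (gpoly h q)"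

definition ser :: "nat => nat => int fps" where
 "ser h p = fps_of_poly (gpoly sg 0) * node_ser pt h p"

definition vnum :: "nat => nat => int" where
 "vnum h p = num (window (ser h p) (2 ^ sg - 2 ^ h) (2 ^ h))"

lemma coeff_gpoly: "coeff (gpoly h q) u = (if u < 2 ^ h then g (q * 2 ^ h + u) else 0)"
 by (simp add: gpoly_def coeff_sum)

lemma N_ge': "(2 * l + 3) * 2 ^ h + B + 4 <= 2 ^ nv" if "h <= sg"
proof -
 have "(2::nat) ^ h <= 2 ^ sg" using that by (intro power_increasing) auto
 hence "(2 * l + 3) * 2 ^ h <= (2 * l + 3) * 2 ^ sg" by (rule mult_le_mono2)
 thus ?thesis using N_ge by linarith
qed

lemma N_ge_B: "B + 7 <= 2 ^ nv"
 using N_ge'[of 0] by simp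

lemma l1_node: "l1 (node_poly pt h p) <= 2 ^ ((l + 1) * 2 ^ h)"
proof -
 have "l1 (node_poly pt h p) <= (1 + 2 ^ l) ^ 2 ^ h" by (rule l1_node_poly_le[OF pt])
 also have "... <= (2 ^ (l + 1)) ^ 2 ^ h" by (intro power_mono) simp_all
 finally show ?thesis by (simp only: power_mult)
qed

lemma abs_hnum: "abs (hnum h p) < 2 ^ (2 ^ nv * 2 ^ h + 2 ^ nv)" if "h <= sg"
proof -
 have "abs (hnum h p) <= l1 (node_poly pt h p) * (2 ^ 2 ^ nv) ^ 2 ^ h"
  unfolding hnum_def num_def by (rule abs_poly_le_l1[OF degree_node_poly]) simp
 also have "... <= 2 ^ ((l + 1) * 2 ^ h) * (2 ^ 2 ^ nv) ^ 2 ^ h" by (intro mult_right_mono l1_node) simp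
 also have "... = 2 ^ (2 ^ nv * 2 ^ h + (l + 1) * 2 ^ h)" by (simp add: power_add power_mult)
 also have "... < 2 ^ (2 ^ nv * 2 ^ h + 2 ^ nv)"
 proof (rule power_strict_increasing)
  have "(l + 1) * 2 ^ h <= (2 * l + 3) * 2 ^ h" by (rule mult_le_mono1) simp
  thus "2 ^ nv * 2 ^ h + (l + 1) * 2 ^ h < 2 ^ nv * 2 ^ h + 2 ^ nv" using N_ge'[OF that] by linarith
 qed simp
 finally show ?thesis .
qed

lemma abs_num:
 assumes "!!t. abs (coeff p t) <= 2 ^ (2 ^ nv - 2)" "!!t. k <= t ==> coeff p t = 0" "1 <= k"
 shows "abs (num p) < 2 ^ (2 ^ nv * k - 1)"
proof -
 have "poly_cutoff k p = p" by (rule poly_eqI) (auto simp: coeff_poly_cutoff assms(2))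
 thus ?thesis using abs_poly_cutoff_less[OF assms(1), of k] N_ge_B assms(3) by (simp add: num_def)
qed

lemma abs_g: "abs (g u) <= 2 ^ (2 ^ nv - 2)"
proof -
 have "(2::int) ^ B <= 2 ^ (2 ^ nv - 2)" using N_ge_B by (intro power_increasing) auto
 thus ?thesis using g[of u] by linarith
qed

lemma abs_gnum: "abs (gnum h q) < 2 ^ (2 ^ nv * 2 ^ h - 1)"
 unfolding gnum_def using abs_g by (intro abs_num) (auto simp: coeff_gpoly)

lemma abs_ser: "abs (ser h p $ t) <= 2 ^ ((l + 2) * 2 ^ sg + B)" if "h <= sg" "t < 2 ^ sg"
proof -
 have "abs ((fps_of_poly (gpoly sg 0) * node_ser pt h p) $ t) <= 2 ^ 2 ^ h * 2 ^ B * (2 * 2 ^ l) ^ t"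
 proof (rule abs_ser_le[OF pt])
  fix t
  define c where "c = (2 * 2 ^ l :: int) ^ t"
  have "1 <= c" unfolding c_def by (rule one_le_power) (simp flip: power_Suc)
  hence "(2::int) ^ B * 1 <= 2 ^ B * c" by (intro mult_left_mono) simp_all
  hence "2 ^ B <= 2 ^ B * c" "0 <= 2 ^ B * c" using zero_le_power[of "2::int" B] by linarith+
  thus "abs (fps_of_poly (gpoly sg 0) $ t) <= 2 ^ B * (2 * 2 ^ l) ^ t"
  unfolding c_def[symmetric] fps_of_poly_nth coeff_gpoly using g[of t] order_trans[OF g] by simp
 qed simp
 also have "(2 * 2 ^ l :: int) ^ t = 2 ^ ((l + 1) * t)" unfolding power_mult by simp
 also have "(2::int) ^ 2 ^ h * 2 ^ B * 2 ^ ((l + 1) * t) = 2 ^ (2 ^ h + B + (l + 1) * t)" by (simp only: power_add)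
 also have "... <= 2 ^ ((l + 2) * 2 ^ sg + B)"
 proof (rule power_increasing)
  have "(2::nat) ^ h <= 2 ^ sg" using that by (intro power_increasing) auto
  moreover have "(l + 1) * t <= (l + 1) * 2 ^ sg" using that by (intro mult_le_mono2) simp
  moreover have "(l + 2) * 2 ^ sg = 2 ^ sg + (l + 1) * 2 ^ sg" by simp
  ultimately show "2 ^ h + B + (l + 1) * t <= (l + 2) * 2 ^ sg + B" by linarith
 qed simp
 finally show ?thesis by (simp only: ser_def)
qed

lemma abs_ser': "abs (ser h p $ t) <= 2 ^ (2 ^ nv - 2)" if "h <= sg" "t < 2 ^ sg"
proof -
 have "(l + 2) * 2 ^ sg <= (2 * l + 3) * 2 ^ sg" by (rule mult_le_mono1) simp
 hence "(2::int) ^ ((l + 2) * 2 ^ sg + B) <= 2 ^ (2 ^ nv - 2)" using N_ge by (intro power_increasing) auto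
 thus ?thesis using abs_ser[OF that, of p] by linarith
qed

lemma abs_vnum: "abs (vnum h p) < 2 ^ (2 ^ nv * 2 ^ h - 1)" if "h <= sg"
 unfolding vnum_def
proof (rule abs_num)
 have "(2::nat) ^ h <= 2 ^ sg" using that by (intro power_increasing) auto
 hence "2 ^ sg - 2 ^ h + t < 2 ^ sg" if "t < 2 ^ h" for t :: nat using that by linarith
 thus "abs (coeff (window (ser h p) (2 ^ sg - 2 ^ h) (2 ^ h)) t) <= 2 ^ (2 ^ nv - 2)" for t
  using abs_ser'[OF `h <= sg`, of "2 ^ sg - 2 ^ h + t" p] unfolding coeff_window by auto
qed (auto simp: coeff_window)

lemma hnum_Suc: "hnum (Suc h) p = hnum h (2 * p) * hnum h (2 * p + 1)"
 by (simp add: hnum_def num_def)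

lemma gnum_Suc: "gnum (Suc h) q = gnum h (2 * q) + gnum h (2 * q + 1) * 2 ^ (2 ^ nv * 2 ^ h)"
proof -
 have "gpoly (Suc h) q = gpoly h (2 * q) + monom 1 (2 ^ h) * gpoly h (2 * q + 1)"
 proof (rule poly_eqI)
  fix u
  have e: "q * (2 * 2 ^ h) = 2 * q * 2 ^ h" by simp
  show "coeff (gpoly (Suc h) q) u = coeff (gpoly h (2 * q) + monom 1 (2 ^ h) * gpoly h (2 * q + 1)) u"
  unfolding coeff_gpoly coeff_add coeff_monom_mult power_Suc e by auto
 qed
 thus ?thesis by (simp add: gnum_def num_def poly_monom power_mult)
qed

lemma vnum_root:
 assumes "[hnum sg p * v = 1] (mod 2 ^ (2 ^ nv * 2 ^ sg))"
 shows "smod (2 ^ nv * 2 ^ sg) (gnum sg 0 * v) = vnum sg p"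
proof -
 have "ser sg p * fps_of_poly (node_poly pt sg p) = fps_of_poly (gpoly sg 0)"
  unfolding ser_def mult.assoc node_ser_poly by simp
 thus ?thesis
  unfolding gnum_def vnum_def num_def using assms N_ge_B
  by (simp add: hnum_def num_def abs_ser' window_root)
qed

text \<open>The children \<open>q\<close> and \<open>r\<close> enter only through the factorisation
  of the series, in either order, so that left and right children are treated alike.\<close>

lemma vnum_child:
 assumes "Suc h <= sg" "node_ser pt (Suc h) p = node_ser pt h q * node_ser pt h r"
 defines "x == vnum (Suc h) p * hnum h r"
 shows "rnd (2 ^ nv * 2 ^ h) x - rnd (2 * (2 ^ nv * 2 ^ h)) x * 2 ^ (2 ^ nv * 2 ^ h) = vnum h q"
proof -
 have hs: "(2::nat) ^ Suc h <= 2 ^ sg" using assms(1) by (intro power_increasing) auto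
 have "ser (Suc h) p * fps_of_poly (node_poly pt h r)
  = fps_of_poly (gpoly sg 0) * node_ser pt h q * (node_ser pt h r * fps_of_poly (node_poly pt h r))"
  unfolding ser_def assms(2) by (simp only: mult.assoc)
 hence e: "ser (Suc h) p * fps_of_poly (node_poly pt h r) = ser h q"
  by (simp only: node_ser_poly mult_1_right ser_def)
 have i: "2 ^ sg - 2 ^ Suc h + 2 ^ h = 2 ^ sg - (2::nat) ^ h" using hs by simp
 let ?m = "(2::nat) ^ h"
 have "rnd (2 ^ nv * ?m) x - rnd (2 ^ nv * (2 * ?m)) x * 2 ^ (2 ^ nv * ?m)
  = poly (window (ser (Suc h) p * fps_of_poly (node_poly pt h r)) (2 ^ sg - 2 ^ Suc h + ?m) ?m) (2 ^ 2 ^ nv)"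
  unfolding x_def vnum_def hnum_def num_def power_Suc
 proof (rule window_child[OF degree_node_poly _ l1_node])
  show "abs (ser (Suc h) p $ (2 ^ sg - 2 * ?m + t)) <= 2 ^ ((l + 2) * 2 ^ sg + B)" if "t < 2 * ?m" for t
  using that hs unfolding power_Suc by (intro abs_ser assms(1)) linarith
  have "(l + 1) * ?m <= (l + 1) * 2 ^ sg" using hs unfolding power_Suc by (intro mult_le_mono2) linarith
  \<comment> \<open>The bits of the polynomial and of the series add up here; this is the origin of
    \<open>2 * l + 3\<close> in the condition on \<open>nv\<close>.\<close>
  hence "(l + 1) * ?m + ((l + 2) * 2 ^ sg + B) <= 2 ^ nv - 2" using N_ge by (simp add: algebra_simps)
  thus "(2::int) ^ ((l + 1) * ?m) * 2 ^ ((l + 2) * 2 ^ sg + B) <= 2 ^ (2 ^ nv - 2)"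
  unfolding power_add[symmetric] by (rule power_increasing) simp
 qed (use N_ge_B in simp_all)
 thus ?thesis unfolding e i by (simp add: vnum_def num_def mult.left_commute)
qed

lemma vnum_leaf: "vnum 0 p = (SUM u<2 ^ sg. g u * pt p ^ (2 ^ sg - 1 - u))"
 using window_leaf[of "2 ^ sg" g pt p] by (simp add: vnum_def num_def ser_def gpoly_def)

end

section \<open>Ascent in the tree, inversion at the top and descent\<close>

definition lift_vars :: prog where
 "lift_vars = (Assign 66 (Const 1 [<<] (Var 61 [-] Var 62 [-] Const 1)) ;; Assign 67 (Var 66 [<<] Const 1) ;;
  Assign 69 (Var 68 [<<] Var 62) ;; Assign 71 (Var 60 [+] Var 62 [+] Const 3))"

definition lift_step :: prog where
 "lift_step = (lift_vars ;; For 63 (Var 66) (Var 67) nodeH_body ;; For 63 (Var 66) (Var 67) nodeG_body)"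

definition lift_wt :: nat where
 "lift_wt = 16 * mul_wt + 20 * (wt lift_vars + nodeH_wt + wt nodeG_body + 2 * for_wt (Var 66) (Var 67))"

context block
begin

definition level_H :: "nat => store => bool" where
 "level_H h s = ((ALL p. 2 ^ (sg - h) <= p --> p < 2 * 2 ^ (sg - h) --> s 51 (int p) = hnum h p))"

text \<open>The tree of points is numbered by heap indices, whereas segments of the block are
  counted from the left end of their level; hence the difference.\<close>

definition level_G :: "nat => store => bool" where
 "level_G h s = ((ALL p. 2 ^ (sg - h) <= p --> p < 2 * 2 ^ (sg - h) --> s 52 (int p) = gnum h (p - 2 ^ (sg - h))))"

definition level_V :: "nat => store => bool" where
 "level_V h s = ((ALL p. 2 ^ (sg - h) <= p --> p < 2 * 2 ^ (sg - h) --> s 53 (int p) = vnum h p))"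

text \<open>All levels of products are preserved, since the descent uses them again; of the
  assembled coefficients only the current level is retained.\<close>

lemma runs_lift_step:
 assumes s: "s 60 0 = int nv" "s 61 0 = int sg" "s 62 0 = int h" "s 68 0 = int (2 ^ nv)" and h: "h < sg"
  and H: "!!i. i <= h ==> level_H i s" and G: "level_G h s"
  and X: "nv + sg + 4 <= X"
 shows "runs lift_step s (lift_wt * (2 ^ (nv + sg) * X ^ 5))
  (%s'. same (mulc_mods Un {51, 52, 63, 66, 67, 69, 71}) s' s & (ALL i<=Suc h. level_H i s') & level_G (Suc h) s')"
proof -
 define d where "d = sg - Suc h"
 define L where "L = 2 ^ (nv + h + 3) + X"
 \<comment> \<open>The factors have at most \<open>m + 2 ^ nv <= 2 * m\<close> bits, and a
   multiplication of size \<open>2 ^ t = 8 * m\<close> accepts factors of \<open>4 * m - 1\<close>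
   bits.\<close>
 define t where "t = nv + h + 3"
 define D where "D = (2::nat) ^ d"
 define m where "m = (2::nat) ^ nv * 2 ^ h"
 have sd: "sg - h = Suc d" "nat (int sg - int h - 1) = d" using h by (simp_all add: d_def)
 have D2: "2 ^ (sg - h) = 2 * D" "2 ^ (sg - Suc h) = D" by (simp_all add: sd D_def d_def[symmetric])
 have tm: "2 ^ t = 8 * m" by (simp add: t_def m_def power_add)
 have L8: "L = 8 * m + X" by (simp add: L_def m_def power_add)
 have "nv <= L" "sg <= L" "h <= L" "t <= L" and b': "h <= L" "d <= L"
  using X h by (simp_all add: L8 t_def d_def)
 note b = this(1-4)[THEN less_two_power] b'
 have nuL: "(2::nat) ^ nv < 2 ^ L"
 proof -
  have "2 ^ nv <= m" by (simp add: m_def)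
  thus ?thesis by (intro less_two_power) (simp add: L8)
 qed
 have DL: "2 * D < 2 ^ L"
 proof -
  have "2 * D = 2 ^ Suc d" by (simp add: D_def)
  also have "... < 2 ^ L" using X h by (intro power_strict_increasing) (auto simp: L8 d_def)
  finally show ?thesis .
 qed
 note DL' = two_int_less[OF DL]
 have t1: "2 ^ (t - 1) = 4 * m" by (simp add: t_def m_def power_add)
 have m1: "1 <= m" "2 ^ nv <= m" by (simp_all add: m_def)
 have bnd: "(2::int) ^ (m + 2 ^ nv) <= 2 ^ (2 ^ (t - 1) - 1)" unfolding t1 using m1 by (intro power_increasing) auto
 have Hb: "abs (hnum h p) < 2 ^ (2 ^ (t - 1) - 1)" for p
 proof -
  have "abs (hnum h p) < 2 ^ (m + 2 ^ nv)" using abs_hnum[of h p] h by (simp add: m_def)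
  thus ?thesis using bnd by (rule less_le_trans)
 qed
 have Gb: "abs (gnum h p) < 2 ^ L" for p
 proof -
  have "(2::int) ^ (m - 1) <= 2 ^ L" by (intro power_increasing) (auto simp: L8)
  with abs_gnum[of h p, folded m_def] show ?thesis by (rule less_le_trans)
 qed
 have hw: "runs lift_vars s (wt lift_vars * (L + 1)) (%s1. same {66, 67, 69, 71} s1 s &
  s1 66 0 = int D & s1 67 0 = int (2 * D) & s1 69 0 = int m & s1 71 0 = int t)"
 proof (rule runs_wp)
  have "D < 2 ^ L" "1 <= L" using DL X by (simp_all add: L8)
  moreover have "int sg - int h - 1 <= int L" using b' h by (simp add: d_def)
  ultimately show "wp L lift_vars (%s1. same {66, 67, 69, 71} s1 s &
  s1 66 0 = int D & s1 67 0 = int (2 * D) & s1 69 0 = int m & s1 71 0 = int t) s"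
  using s b nuL sd by (simp add: lift_vars_def D_def m_def t_def)
 qed
 define W where "W = mul_cost t + (wt lift_vars + nodeH_wt + wt nodeG_body + 2 * for_wt (Var 66) (Var 67)) * (L + 1)"
 have "runs lift_step s ((2 ^ d + 1) * W)
  (%s'. same (mulc_mods Un {51, 52, 63, 66, 67, 69, 71}) s' s & (ALL i<=Suc h. level_H i s') & level_G (Suc h) s')"
  unfolding lift_step_def
 proof (rule runs_Seq[OF hw])
  fix s1
  assume s1: "same {66, 67, 69, 71} s1 s & s1 66 0 = int D & s1 67 0 = int (2 * D) & s1 69 0 = int m & s1 71 0 = int t"
  note s1' = sameD[OF conjunct1[OF s1]]
  have H1: "s1 51 (int i) = hnum h i" if "2 * D <= i" "i < 4 * D" for i
  using H[OF order_refl] that by (simp add: level_H_def D2 s1')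
  show "runs (For 63 (Var 66) (Var 67) nodeH_body ;; For 63 (Var 66) (Var 67) nodeG_body) s1
  ((2 * D - D + 1) * ((nodeH_wt * (L + 1) + mul_cost t) + for_wt (Var 66) (Var 67) * (L + 1))
  + (2 * D - D + 1) * ((wt nodeG_body + for_wt (Var 66) (Var 67)) * (L + 1)))
  (%s'. same (mulc_mods Un {51, 52, 63, 66, 67, 69, 71}) s' s & (ALL i<=Suc h. level_H i s') & level_G (Suc h) s')"
  proof (rule runs_Seq[OF runs_nodeH[where lo = D and t = t and L = L]])
  show "abs (s1 51 (int i)) < 2 ^ (2 ^ (t - 1) - 1)" if "2 * D <= i" "i < 4 * D" for i
  unfolding H1[OF that] by (rule Hb)
  next
  fix s2
  assume s2: "same (insert 51 (insert 63 mulc_mods)) s2 s1 & (ALL i. s2 51 (int i) = (if D <= i & i < 2 * D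
  then s1 51 (int (2 * i)) * s1 51 (int (2 * i + 1)) else s1 51 (int i)))"
  note s2' = sameD[OF conjunct1[OF s2]]
  have H2: "level_H i s2" if "i <= Suc h" for i
  proof (cases "i = Suc h")
  case True
  have "s2 51 (int p) = hnum (Suc h) p" if "D <= p" "p < 2 * D" for p
  proof -
  have "s2 51 (int p) = s1 51 (int (2 * p)) * s1 51 (int (2 * p + 1))" using s2 that by simp
  also have "... = hnum h (2 * p) * hnum h (2 * p + 1)" using that by (intro arg_cong2[of _ _ _ _ "(*)"] H1; linarith)
  finally show ?thesis by (simp only: hnum_Suc)
  qed
  thus ?thesis unfolding True level_H_def D2 by blast
  next
  case False
  hence i: "i <= h" using that by simp
  have "2 ^ Suc d <= (2::nat) ^ (sg - i)" using i h by (intro power_increasing) (auto simp: d_def)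
  hence "~ p < 2 * D" if "2 ^ (sg - i) <= p" for p using that by (simp add: D_def)
  thus ?thesis using H[OF i] s2 unfolding level_H_def by (simp add: s1')
  qed
  have G2: "s2 52 (int i) = gnum h (i - 2 * D)" if "2 * D <= i" "i < 4 * D" for i
  using G that by (simp add: level_G_def D2 s1' s2')
  show "runs (For 63 (Var 66) (Var 67) nodeG_body) s2
  ((2 * D - D + 1) * ((wt nodeG_body + for_wt (Var 66) (Var 67)) * (L + 1)))
  (%s'. same (mulc_mods Un {51, 52, 63, 66, 67, 69, 71}) s' s & (ALL i<=Suc h. level_H i s') & level_G (Suc h) s')"
  proof (rule runs_mono[OF runs_nodeG[where lo = D and m = m and L = L]])
  fix s3
  assume s3: "same {52, 63} s3 s2 & (ALL i. s3 52 (int i) = (if D <= i & i < 2 * D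
  then s2 52 (int (2 * i)) + s2 52 (int (2 * i + 1)) * 2 ^ m else s2 52 (int i)))"
  have s3': "s3 51 = s2 51" using s3 unfolding same_def by simp
  have "level_G (Suc h) s3"
  unfolding level_G_def D2
  proof (intro allI impI)
  fix p
  assume p: "D <= p" "p < 2 * D"
  have "s3 52 (int p) = s2 52 (int (2 * p)) + s2 52 (int (2 * p + 1)) * 2 ^ m" using s3 p by simp
  also have "s2 52 (int (2 * p)) = gnum h (2 * (p - D))" using p by (subst G2) (auto simp: diff_mult_distrib2)
  also have "s2 52 (int (2 * p + 1)) = gnum h (2 * (p - D) + 1)"
  using p by (subst G2) (auto simp: diff_mult_distrib2 Suc_diff_le)
  finally show "s3 52 (int p) = gnum (Suc h) (p - D)" by (simp only: gnum_Suc m_def)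
  qed
  moreover have "level_H i s3" if "i <= Suc h" for i using H2[OF that] unfolding level_H_def s3' .
  moreover have "same (mulc_mods Un {51, 52, 63, 66, 67, 69, 71}) s3 s"
  using s1 s2 s3 unfolding same_def by simp
  ultimately show "same (mulc_mods Un {51, 52, 63, 66, 67, 69, 71}) s3 s & (ALL i<=Suc h. level_H i s3) & level_G (Suc h) s3"
  by blast
  qed (use s1 DL G2 Gb in "simp_all add: s2' L8")
  qed (use s1 DL tm in "simp_all add: t_def L8")
 next
  show "wt lift_vars * (L + 1) + ((2 * D - D + 1) * ((nodeH_wt * (L + 1) + mul_cost t) + for_wt (Var 66) (Var 67) * (L + 1))
  + (2 * D - D + 1) * ((wt nodeG_body + for_wt (Var 66) (Var 67)) * (L + 1))) <= (2 ^ d + 1) * W"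
  by (simp add: W_def D_def algebra_simps)
 qed
 thus ?thesis
 proof (rule runs_mono)
  show "(2 ^ d + 1) * W <= lift_wt * (2 ^ (nv + sg) * X ^ 5)"
  unfolding W_def lift_wt_def t_def L_def using h X by (intro node_cost) (simp_all add: d_def)
 qed
qed

end

text \<open>The products have constant term 1, so 1 can serve as the first approximation in Newton's
  iteration.\<close>

lemma node_poly_cong: "[poly (node_poly a h p) y = 1] (mod y)"
proof (induction h arbitrary: p)
 case (Suc h)
 thus ?case using cong_mult[OF Suc.IH Suc.IH, of "2 * p" "2 * p + 1"] by simp
qed (simp add: cong_iff_dvd_diff)

definition newton_init :: prog where
 "newton_init = (Assign 64 (Const 1) ;; Assign 71 (Var 60 [+] Var 61 [+] Const 3) ;; Assign 69 (Var 68 [<<] Var 61))"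

text \<open>All steps are done with the full length \<open>2 ^ nv * 2 ^ sg\<close> instead of a
  growing precision; this costs a factor \<open>sg\<close>, which is only logarithmic.\<close>

definition newton :: prog where
 "newton = (newton_init ;; For 62 (Const 0) (Var 61) newton_step ;; root_step)"

definition newton_loop_wt :: nat where
 "newton_loop_wt = 16 * mul_wt + 20 * (wt newton_init + newton_wt + root_wt + for_wt (Const 0) (Var 61))"

definition drop_vars :: prog where
 "drop_vars = (Assign 66 (Const 1 [<<] (Var 62 [+] Const 1)) ;; Assign 67 (Var 66 [<<] Const 1) ;;
  Assign 69 (Var 68 [<<] (Var 61 [-] Var 62 [-] Const 1)) ;; Assign 74 (Var 69 [<<] Const 1) ;;
  Assign 71 (Var 60 [+] Var 61 [-] Var 62 [+] Const 2))"

definition drop_step :: prog where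
 "drop_step = (drop_vars ;; For 63 (Var 66) (Var 67) nodeV_body)"

definition drop_wt :: nat where
 "drop_wt = 16 * mul_wt + 20 * (wt drop_vars + nodeV_wt + for_wt (Var 66) (Var 67))"

context block
begin

lemma runs_newton:
 assumes s: "s 60 0 = int nv" "s 61 0 = int sg" "s 68 0 = int (2 ^ nv)"
  and H: "level_H sg s" and G: "level_G sg s"
  and X: "nv + sg + 4 <= X"
 shows "runs newton s (newton_loop_wt * (2 ^ (nv + sg) * X ^ 6))
  (%s'. same (mulc_mods Un {53, 62, 64, 65, 69, 71}) s' s & level_V sg s')"
proof -
 define t where "t = nv + sg + 3"
 define L where "L = 2 ^ t + X"
 define m where "m = (2::nat) ^ nv * 2 ^ sg"
 let ?M = "mulc_mods Un {53, 62, 64, 65, 69, 71}"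
 have tm: "2 ^ t = 8 * m" "2 ^ (t - 1) = 4 * m" by (simp_all add: t_def m_def power_add)
 have L8: "L = 8 * m + X" by (simp add: L_def tm)
 have m1: "1 <= m" "2 ^ nv <= m" by (simp_all add: m_def)
 have "nv <= L" "sg <= L" "t <= L" "2 ^ nv <= L" "1 <= L" and b': "sg <= L" "m <= L"
  using X m1 by (simp_all add: L8 t_def)
 note b = this(1-4)[THEN less_two_power] b'
 have Hv: "s 51 1 = hnum sg 1" and Gv: "s 52 1 = gnum sg 0"
  using H[unfolded level_H_def, rule_format, of 1] G[unfolded level_G_def, rule_format, of 1] by simp_all
 have Hb: "abs (hnum sg 1) < 2 ^ (2 * m)"
 proof -
  have "abs (hnum sg 1) < 2 ^ (m + 2 ^ nv)" using abs_hnum[of sg 1] by (simp add: m_def)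
  also have "(2::int) ^ (m + 2 ^ nv) <= 2 ^ (2 * m)" using m1 by (intro power_increasing) auto
  finally show ?thesis .
 qed
 have Gb: "abs (gnum sg 0) < 2 ^ (m - 1)" using abs_gnum[of sg 0] by (simp add: m_def)
 have mono: "(2::int) ^ (2 * m) <= 2 ^ (4 * m - 1)" "(2::int) ^ (m - 1) < 2 ^ (4 * m - 1)"
  using m1 by (auto intro!: power_increasing power_strict_increasing)
 define I where "I = (%i s'. same ?M s' s & s' 62 0 = int i & s' 71 0 = int t & s' 69 0 = int m & i <= sg &
  [hnum sg 1 * s' 64 0 = 1] (mod 2 ^ (2 ^ nv * 2 ^ i)) & abs (s' 64 0) <= 2 ^ (m - 1))"
 have "runs newton s (wt newton_init * (L + 1) + ((sg - 0 + 1) * (newton_wt * (L + 1) + 2 * mul_cost t + for_wt (Const 0) (Var 61) * (L + 1))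
  + (root_wt * (L + 1) + mul_cost t))) (%s'. same ?M s' s & level_V sg s')"
  unfolding newton_def
 proof (rule runs_Seq[OF runs_wp[where Q = "%s1. same {64, 69, 71} s1 s & s1 64 0 = 1 & s1 69 0 = int m & s1 71 0 = int t"]])
  show "wp L newton_init (%s1. same {64, 69, 71} s1 s & s1 64 0 = 1 & s1 69 0 = int m & s1 71 0 = int t) s"
  using s b by (simp add: newton_init_def m_def t_def)
  fix s1
  assume s1: "same {64, 69, 71} s1 s & s1 64 0 = 1 & s1 69 0 = int m & s1 71 0 = int t"
  note s1' = sameD[OF conjunct1[OF s1]]
  show "runs (For 62 (Const 0) (Var 61) newton_step ;; root_step) s1
  ((sg - 0 + 1) * (newton_wt * (L + 1) + 2 * mul_cost t + for_wt (Const 0) (Var 61) * (L + 1)) + (root_wt * (L + 1) + mul_cost t))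
  (%s'. same ?M s' s & level_V sg s')"
  proof (rule runs_Seq[OF runs_For[where I = I and a = 0 and b = sg]])
  have "[hnum sg 1 = 1] (mod 2 ^ 2 ^ nv)" unfolding hnum_def num_def by (rule node_poly_cong)
  moreover have "same ?M s1 s" using s1 unfolding same_def by simp
  ultimately show "I 0 (s1(62 := (s1 62)(0 := int 0)))" using s1 by (simp add: I_def)
  next
  fix j s2
  assume I: "I j s2"
  hence "j <= L" using b' by (simp add: I_def)
  thus "s2 62 0 = int j & abs (int j) < 2 ^ L" using I less_two_power[of j L] by (simp add: I_def)
  show "small L (Var 61) s2 & val (Var 61) s2 = int sg"
  using sameD[of ?M s2 s 61] I s b by (simp add: I_def)
  next
  fix j s2
  assume j: "j < sg" and I: "I j s2"
  have s2: "same ?M s2 s" "s2 62 0 = int j" "s2 71 0 = int t" "s2 69 0 = int m"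
  "[hnum sg 1 * s2 64 0 = 1] (mod 2 ^ (2 ^ nv * 2 ^ j))" "abs (s2 64 0) <= 2 ^ (m - 1)"
  using I by (simp_all add: I_def)
  have H2: "s2 51 1 = hnum sg 1" using sameD[OF s2(1), of 51] Hv by simp
  show "runs newton_step s2 (newton_wt * (L + 1) + 2 * mul_cost t)
  (%s'. s' 62 0 = int j & I (Suc j) (s'(62 := (s' 62)(0 := int j + 1))))"
  proof (rule runs_mono[OF runs_newton_step[where t = t and m = m and L = L]])
  fix s3
  assume s3: "same (insert 64 (insert 65 mulc_mods)) s3 s2 & s3 64 0 = smod m (s2 64 0 * (2 - s2 51 1 * s2 64 0))"
  note s3' = sameD[OF conjunct1[OF s3]]
  define v where "v = s2 64 0 * (2 - hnum sg 1 * s2 64 0)"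
  have v: "s3 64 0 = smod m v" using s3 by (simp add: v_def H2)
  \<comment> \<open>The squared modulus corresponds to twice as many correct digits. It still
    divides \<open>2 ^ m\<close>, so the reduction by \<open>smod\<close> does not destroy
    them.\<close>
  have "(2 ^ (2 ^ nv * 2 ^ j)) ^ 2 = (2::int) ^ (2 ^ nv * 2 ^ Suc j)" by (simp add: mult.left_commute flip: power_mult)
  hence c1: "[hnum sg 1 * v = 1] (mod 2 ^ (2 ^ nv * 2 ^ Suc j))" using newton_cong[OF s2(5)] by (simp only: v_def)
  have "(2::nat) ^ Suc j <= 2 ^ sg" using j by (intro power_increasing) auto
  hence "2 ^ nv * 2 ^ Suc j <= m" unfolding m_def by (rule mult_le_mono2)
  hence "[smod m v = v] (mod 2 ^ (2 ^ nv * 2 ^ Suc j))"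
  using smod_cong[of m v] by (meson cong_dvd_modulus le_imp_power_dvd)
  hence "[hnum sg 1 * smod m v = hnum sg 1 * v] (mod 2 ^ (2 ^ nv * 2 ^ Suc j))" by (intro cong_mult cong_refl)
  hence "[hnum sg 1 * smod m v = 1] (mod 2 ^ (2 ^ nv * 2 ^ Suc j))" using c1 by (rule cong_trans)
  moreover have "same ?M s3 s" using s3 s2(1) unfolding same_def by simp
  moreover have "s3 62 0 = int j" using s2 by (simp add: s3')
  ultimately show "s3 62 0 = int j & I (Suc j) (s3(62 := (s3 62)(0 := int j + 1)))"
  using j s2 abs_smod_le[OF m1(1), of v] by (simp add: I_def v s3')
  next
  have vb: "abs (s2 64 0) < 2 ^ m"
  proof -
  have "(2::int) ^ (m - 1) < 2 ^ m" using m1 by (intro power_strict_increasing) auto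
  thus ?thesis using s2(6) by linarith
  qed
  show "abs (s2 51 1) < 2 ^ (2 ^ (t - 1) - 1)" unfolding H2 tm using Hb mono(1) by linarith
  show "abs (s2 64 0) < 2 ^ (2 ^ (t - 1) - 1)" unfolding tm using s2(6) mono(2) by linarith
  have "abs (hnum sg 1 * s2 64 0) < 2 ^ (2 * m) * 2 ^ m"
  unfolding abs_mult using Hb vb by (intro mult_strict_mono) auto
  also have "... = 2 ^ (3 * m)" by (simp flip: power_add)
  finally have "abs (2 - hnum sg 1 * s2 64 0) < 2 + 2 ^ (3 * m)" by linarith
  moreover have "(2::int) <= 2 ^ (3 * m)" using m1 power_increasing[of 1 "3 * m" "2::int"] by simp
  ultimately have "abs (2 - hnum sg 1 * s2 64 0) < 2 ^ (3 * m + 1)" by simp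
  also have "(2::int) ^ (3 * m + 1) <= 2 ^ (4 * m - 1)"
  proof (rule power_increasing)
  have "2 ^ nv * 1 <= m" unfolding m_def by (rule mult_le_mono2) simp
  thus "3 * m + 1 <= 4 * m - 1" using N_ge_B by linarith
  qed simp
  finally show "abs (2 - s2 51 1 * s2 64 0) < 2 ^ (2 ^ (t - 1) - 1)" unfolding H2 tm by simp
  qed (use s2 m1 b' tm in "simp_all add: t_def L8")
  next
  fix s2
  assume I: "I sg s2"
  hence s2: "same ?M s2 s" "s2 71 0 = int t" "s2 69 0 = int m"
  "[hnum sg 1 * s2 64 0 = 1] (mod 2 ^ (2 ^ nv * 2 ^ sg))" "abs (s2 64 0) <= 2 ^ (m - 1)"
  by (simp_all add: I_def)
  have G2: "s2 52 1 = gnum sg 0" using sameD[OF s2(1), of 52] Gv by simp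
  show "runs root_step s2 (root_wt * (L + 1) + mul_cost t) (%s'. same ?M s' s & level_V sg s')"
  proof (rule runs_mono[OF runs_root_step[where t = t and m = m and L = L]])
  fix s3
  assume s3: "same (insert 53 mulc_mods) s3 s2 & s3 53 1 = smod m (s2 52 1 * s2 64 0)"
  have "s3 53 1 = vnum sg 1" using s3 vnum_root[OF s2(4)] by (simp add: G2 m_def)
  hence "s3 53 (int p) = vnum sg p" if "1 <= p" "p < 2" for p using that by (cases "p = 1") auto
  hence "level_V sg s3" unfolding level_V_def by simp
  moreover have "same ?M s3 s" using s3 s2(1) unfolding same_def by simp
  ultimately show "same ?M s3 s & level_V sg s3" by simp
  next
  show "abs (s2 52 1) < 2 ^ (2 ^ (t - 1) - 1)" unfolding G2 tm using Gb mono(2) by linarith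
  show "abs (s2 64 0) < 2 ^ (2 ^ (t - 1) - 1)" unfolding tm using s2(5) mono(2) by linarith
  qed (use s2 m1 b' tm in "simp_all add: t_def L8")
  qed (use s1 s b in simp_all)
 qed simp
 thus ?thesis
 proof (rule runs_mono)
  define w where "w = wt newton_init + newton_wt + root_wt + for_wt (Const 0) (Var 61)"
  define U where "U = 2 ^ (nv + sg) * X ^ 5"
  have c: "(2 ^ 0 + 1) * (mul_cost t + w * (L + 1)) <= newton_loop_wt * U"
  unfolding newton_loop_wt_def w_def[symmetric] L_def t_def U_def using X by (intro node_cost) auto
  have "wt newton_init * (L + 1) + ((sg - 0 + 1) * (newton_wt * (L + 1) + 2 * mul_cost t + for_wt (Const 0) (Var 61) * (L + 1))
  + (root_wt * (L + 1) + mul_cost t)) <= (sg + 2) * ((2 ^ 0 + 1) * (mul_cost t + w * (L + 1)))"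
  by (simp add: w_def algebra_simps)
  also have "... <= X * (newton_loop_wt * U)" by (rule mult_le_mono[OF _ c]) (use X in simp)
  also have "... = newton_loop_wt * (2 ^ (nv + sg) * X ^ 6)" by (simp add: U_def eval_nat_numeral)
  finally show "wt newton_init * (L + 1) + ((sg - 0 + 1) * (newton_wt * (L + 1) + 2 * mul_cost t + for_wt (Const 0) (Var 61) * (L + 1))
  + (root_wt * (L + 1) + mul_cost t)) <= newton_loop_wt * (2 ^ (nv + sg) * X ^ 6)" .
 qed simp
qed

lemma runs_drop_step:
 assumes s: "s 60 0 = int nv" "s 61 0 = int sg" "s 62 0 = int d" "s 68 0 = int (2 ^ nv)" and d: "d < sg"
  and H: "level_H (sg - Suc d) s" and V: "level_V (sg - d) s"
  and X: "nv + sg + 4 <= X"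
 shows "runs drop_step s (drop_wt * (2 ^ (nv + sg) * X ^ 5))
  (%s'. same (mulc_mods Un {53, 63, 66, 67, 69, 71, 74}) s' s & level_V (sg - Suc d) s')"
proof -
 define h where "h = sg - Suc d"
 define L where "L = 2 ^ (nv + h + 3) + X"
 define t where "t = nv + h + 3"
 define D where "D = (2::nat) ^ Suc d"
 define m where "m = (2::nat) ^ nv * 2 ^ h"
 let ?M = "mulc_mods Un {53, 63, 66, 67, 69, 71, 74}"
 have hd: "sg - h = Suc d" "sg - Suc h = d" "sg - d = Suc h" "nat (int sg - int d - 1) = h" "nat (int d + 1) = Suc d"
  using d by (simp_all add: h_def)
 have tm: "2 ^ t = 8 * m" "2 ^ (t - 1) = 4 * m" by (simp_all add: t_def m_def power_add)
 have L8: "L = 8 * m + X" by (simp add: L_def m_def power_add)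
 have m1: "1 <= m" "2 ^ nv <= m" by (simp_all add: m_def)
 have "nv <= L" "sg <= L" "d <= L" "t <= L" "2 ^ nv <= L" "2 * m <= L" "1 <= L" "Suc d <= L"
  using X d m1 by (simp_all add: L8 t_def h_def)
 note b = this(1-6)[THEN less_two_power] this(7,8)
 have DL: "2 * D < 2 ^ L"
 proof -
  have "2 * D = 2 ^ Suc (Suc d)" by (simp add: D_def)
  also have "... < 2 ^ L" using X d by (intro power_strict_increasing) (auto simp: L8)
  finally show ?thesis .
 qed
 note DL' = two_int_less[OF DL]
 have Hb: "abs (hnum h p) < 2 ^ (2 ^ (t - 1) - 1)" for p
 proof -
  have "abs (hnum h p) < 2 ^ (m + 2 ^ nv)" using abs_hnum[of h p] d by (simp add: m_def h_def)
  also have "(2::int) ^ (m + 2 ^ nv) <= 2 ^ (2 ^ (t - 1) - 1)" unfolding tm using m1 by (intro power_increasing) auto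
  finally show ?thesis .
 qed
 have Vb: "abs (vnum (Suc h) p) < 2 ^ (2 ^ (t - 1) - 1)" for p
 proof -
  have "abs (vnum (Suc h) p) < 2 ^ (2 * m - 1)" using abs_vnum[of "Suc h" p] d by (simp add: m_def h_def mult.left_commute)
  also have "(2::int) ^ (2 * m - 1) <= 2 ^ (2 ^ (t - 1) - 1)" unfolding tm using m1 by (intro power_increasing) auto
  finally show ?thesis .
 qed
 define W where "W = mul_cost t + (wt drop_vars + nodeV_wt + for_wt (Var 66) (Var 67)) * (L + 1)"
 have "runs drop_step s ((2 ^ Suc d + 1) * W) (%s'. same ?M s' s & level_V h s')"
  unfolding drop_step_def
 proof (rule runs_Seq[OF runs_wp[where Q = "%s1. same {66, 67, 69, 71, 74} s1 s &
  s1 66 0 = int D & s1 67 0 = int (2 * D) & s1 69 0 = int m & s1 74 0 = int (2 * m) & s1 71 0 = int t"]])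
  have e: "(2::int) * 2 ^ d = int D" "(2::int) ^ nv * 2 ^ (sg - Suc d) = int m" by (simp_all add: D_def m_def h_def)
  have "(2::int) * 2 ^ d < 2 ^ L" "(2::int) ^ nv * 2 ^ (sg - Suc d) < 2 ^ L" unfolding e using DL b by simp_all
  moreover have "int sg - int d - 1 <= int L" "int d + 1 <= int L" using b X d by (simp_all add: L8)
  ultimately show "wp L drop_vars (%s1. same {66, 67, 69, 71, 74} s1 s &
  s1 66 0 = int D & s1 67 0 = int (2 * D) & s1 69 0 = int m & s1 74 0 = int (2 * m) & s1 71 0 = int t) s"
  using s b hd d by (simp add: drop_vars_def D_def m_def t_def h_def of_nat_diff)
 next
  fix s1
  assume s1: "same {66, 67, 69, 71, 74} s1 s & s1 66 0 = int D & s1 67 0 = int (2 * D) & s1 69 0 = int m & s1 74 0 = int (2 * m) & s1 71 0 = int t"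
  note s1' = sameD[OF conjunct1[OF s1]]
  have H1: "s1 51 (int i) = hnum h i" if "D <= i" "i < 2 * D" for i
  using H[folded h_def] that by (simp add: level_H_def hd D_def s1')
  have V1: "s1 53 (int (i div 2)) = vnum (Suc h) (i div 2)" if "D <= i" "i < 2 * D" for i
  using V that unfolding level_V_def hd by (simp add: hd D_def s1' del: of_nat_div)
  have ev: "even D" by (simp add: D_def)
  show "runs (For 63 (Var 66) (Var 67) nodeV_body) s1
  ((2 * D - D + 1) * ((nodeV_wt * (L + 1) + mul_cost t) + for_wt (Var 66) (Var 67) * (L + 1)))
  (%s'. same ?M s' s & level_V h s')"
  proof (rule runs_mono[OF runs_nodeV[where lo = D and t = t and m = m and L = L]])
  show "abs (s1 51 (int i)) < 2 ^ (2 ^ (t - 1) - 1)" "abs (s1 53 (int (i div 2))) < 2 ^ (2 ^ (t - 1) - 1)" if "D <= i" "i < 2 * D" for i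
  using H1[OF that] V1[OF that] Hb Vb by simp_all
  next
  fix s2
  define f where "f = (%i. s1 53 (int (i div 2)) * s1 51 (int (if even i then i + 1 else i - 1)))"
  assume s2: "same (insert 53 (insert 63 mulc_mods)) s2 s1 & (ALL i. s2 53 (int i) = (if D <= i & i < 2 * D
  then rnd m (s1 53 (int (i div 2)) * s1 51 (int (if even i then i + 1 else i - 1)))
  - rnd (2 * m) (s1 53 (int (i div 2)) * s1 51 (int (if even i then i + 1 else i - 1))) * 2 ^ m else s1 53 (int i)))"
  have "s2 53 (int i) = vnum h i" if i: "D <= i" "i < 2 * D" for i
  proof -
  define r where "r = (if even i then i + 1 else i - 1)"
  have r: "D <= r" "r < 2 * D" using i ev unfolding r_def by (auto elim!: evenE oddE)
  have n: "node_ser pt (Suc h) (i div 2) = node_ser pt h i * node_ser pt h r"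
  by (cases "even i") (auto simp: r_def mult.commute elim!: evenE oddE)
  have "s2 53 (int i) = rnd m (s1 53 (int (i div 2)) * s1 51 (int r)) - rnd (2 * m) (s1 53 (int (i div 2)) * s1 51 (int r)) * 2 ^ m"
  using spec[OF conjunct2[OF s2], of i] unfolding r_def by (simp only: i simp_thms if_True)
  also have "... = rnd m (vnum (Suc h) (i div 2) * hnum h r) - rnd (2 * m) (vnum (Suc h) (i div 2) * hnum h r) * 2 ^ m"
  unfolding V1[OF i] H1[OF r] ..
  also have "... = vnum h i" unfolding m_def by (rule vnum_child[OF _ n]) (use d in "simp add: h_def")
  finally show ?thesis .
  qed
  hence "level_V h s2" unfolding level_V_def hd D_def by simp
  moreover have "same ?M s2 s" using s1 s2 unfolding same_def by simp
  ultimately show "same ?M s2 s & level_V h s2" by simp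
  qed (use s1 DL m1 tm b ev in "simp_all add: t_def L8")
 next
  show "wt drop_vars * (L + 1) + (2 * D - D + 1) * ((nodeV_wt * (L + 1) + mul_cost t) + for_wt (Var 66) (Var 67) * (L + 1))
  <= (2 ^ Suc d + 1) * W"
  by (simp add: W_def D_def algebra_simps)
 qed
 thus ?thesis unfolding h_def[symmetric]
 proof (rule runs_mono)
  show "(2 ^ Suc d + 1) * W <= drop_wt * (2 ^ (nv + sg) * X ^ 5)"
  unfolding W_def drop_wt_def t_def L_def using d X by (intro node_cost) (simp_all add: h_def)
 qed
qed

end

section \<open>Evaluation of a complete block\<close>

definition block_init :: prog where
 "block_init = (Assign 68 (Const 1 [<<] Var 60) ;; Assign 66 (Const 1 [<<] Var 61) ;; Assign 67 (Var 66 [<<] Const 1))"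

definition block_eval :: prog where
 "block_eval = (block_init ;; For 63 (Var 66) (Var 67) leafH_body ;; For 63 (Var 66) (Var 67) leafG_body ;;
  For 62 (Const 0) (Var 61) lift_step ;; newton ;; For 62 (Const 0) (Var 61) drop_step)"

definition block_wt :: nat where
 "block_wt = 16 * mul_wt + 20 * (wt block_init + wt leafH_body + wt leafG_body + 2 * for_wt (Var 66) (Var 67) + 2 * for_wt (Const 0) (Var 61))
  + lift_wt + newton_loop_wt + drop_wt"

abbreviation block_mods :: "nat set" where
 "block_mods == mulc_mods Un {51, 52, 53, 62, 63, 64, 65, 66, 67, 68, 69, 71, 74}"

lemma runs_level_loop:
 assumes s: "s 61 0 = int sg" and M: "62 : M" "61 ~: M" and L: "sg <= L"
  and J: "J 0 s" "!!i s f. J i (s(62 := f)) = J i s"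
  and body: "!!i s'. i < sg ==> same M s' s ==> s' 62 0 = int i ==> J i s' ==>
  runs c s' T (%s''. same (M - {62}) s'' s' & J (Suc i) s'')"
 shows "runs (For 62 (Const 0) (Var 61) c) s ((sg - 0 + 1) * (T + for_wt (Const 0) (Var 61) * (L + 1))) (%s'. same M s' s & J sg s')"
proof (rule runs_ForM[where J = J])
 show "sg < 2 ^ L" using L by (rule less_two_power)
 thus "small L (Var 61) s' & val (Var 61) s' = int sg" if "same M s' s" for s' using sameD[OF that M(2)] s by simp
qed (use J M body in simp_all)

lemma (in block) level_upd [simp]:
 "level_H i (s(62 := f)) = level_H i s" "level_G i (s(62 := f)) = level_G i s" "level_V i (s(62 := f)) = level_V i s"
 by (simp_all add: level_H_def level_G_def level_V_def)

lemma (in block) runs_block_eval_aux: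
 assumes s: "s 60 0 = int nv" "s 61 0 = int sg" "s 70 0 = z" "abs z < 2 ^ X"
  and X: "nv + sg + 4 <= X"
  and p: "!!p. 2 ^ sg <= p ==> p < 2 * 2 ^ sg ==> pt p = s 50 (int (p - 2 ^ sg))"
  and q: "!!i. i < 2 ^ sg ==> g i = s 0 (z - int i)"
 shows "runs block_eval s (block_wt * (2 ^ (nv + sg) * X ^ 6))
  (%s'. same block_mods s' s & level_V 0 s')"
proof -
 define L where "L = 2 ^ (nv + 0 + 3) + X"
 define D where "D = (2::nat) ^ sg"
 define N where "N = (2::nat) ^ nv"
 define U where "U = 2 ^ (nv + sg) * X ^ 5"
 let ?w = "for_wt (Const 0) (Var 61) * (L + 1)"
 have LN: "L = 8 * N + X" by (simp add: L_def N_def power_add)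
 hence "nv <= L" "sg <= L" "N <= L" and b': "sg <= L" "nv <= L" "N <= L" "1 <= L" using X by simp_all
 note b = this(1-3)[THEN less_two_power] b'
 have DL: "2 * D < 2 ^ L"
 proof -
  have "2 * D = 2 ^ Suc sg" by (simp add: D_def)
  also have "... < 2 ^ L" using X by (intro power_strict_increasing) (auto simp: LN)
  finally show ?thesis .
 qed
 hence DL1: "D < 2 ^ L" by simp
 have zL: "abs z < 2 ^ L"
 proof -
  have "(2::int) ^ X <= 2 ^ L" by (intro power_increasing) (simp_all add: LN)
  thus ?thesis using s by linarith
 qed
 have pL: "abs (pt p) < 2 ^ L" for p
 proof -
  have "l <= N" using N_ge'[of 0] by (simp add: N_def)
  hence "(2::int) ^ l <= 2 ^ N" by (intro power_increasing) auto
  also have "(2::int) ^ N < 2 ^ L" using X by (intro power_strict_increasing) (simp_all add: LN)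
  finally show ?thesis using pt[of p] by linarith
 qed
 have gL: "abs (g u) < 2 ^ L" for u
 proof -
  have "(2::int) ^ B <= 2 ^ N" using N_ge_B by (intro power_increasing) (auto simp: N_def)
  also have "(2::int) ^ N < 2 ^ L" using X by (intro power_strict_increasing) (simp_all add: LN)
  finally show ?thesis using g[of u] by linarith
 qed
 define W where "W = wt block_init * (L + 1) + ((2 * D - D + 1) * ((wt leafH_body + for_wt (Var 66) (Var 67)) * (L + 1)) +
  ((2 * D - D + 1) * ((wt leafG_body + for_wt (Var 66) (Var 67)) * (L + 1)) +
  ((sg - 0 + 1) * (lift_wt * U + ?w) + (newton_loop_wt * (2 ^ (nv + sg) * X ^ 6) + (sg - 0 + 1) * (drop_wt * U + ?w)))))"
 have "runs block_eval s W (%s'. same block_mods s' s & level_V 0 s')"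
  unfolding block_eval_def W_def
 proof (rule runs_Seq[OF runs_wp[where Q = "%s1. same {66, 67, 68} s1 s & s1 66 0 = int D & s1 67 0 = int (2 * D) & s1 68 0 = int N"]])
  show "wp L block_init (%s1. same {66, 67, 68} s1 s & s1 66 0 = int D & s1 67 0 = int (2 * D) & s1 68 0 = int N) s"
  proof -
  have "sg < L" using X by (simp add: LN)
  thus ?thesis using s b by (simp add: block_init_def D_def N_def)
  qed
  fix s1
  assume s1: "same {66, 67, 68} s1 s & s1 66 0 = int D & s1 67 0 = int (2 * D) & s1 68 0 = int N"
  note s1' = sameD[OF conjunct1[OF s1]]
  have p1: "s1 50 (int i) = pt (i + D)" if "i < D" for i using p[of "i + D"] that by (simp add: s1' D_def)
  have q1: "s1 0 (z - int i) = g i" if "i < D" for i using q[of i] that by (simp add: s1' D_def)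
  show "runs (For 63 (Var 66) (Var 67) leafH_body ;; For 63 (Var 66) (Var 67) leafG_body ;;
  For 62 (Const 0) (Var 61) lift_step ;; newton ;; For 62 (Const 0) (Var 61) drop_step) s1
  ((2 * D - D + 1) * ((wt leafH_body + for_wt (Var 66) (Var 67)) * (L + 1)) +
  ((2 * D - D + 1) * ((wt leafG_body + for_wt (Var 66) (Var 67)) * (L + 1)) +
  ((sg - 0 + 1) * (lift_wt * U + ?w) + (newton_loop_wt * (2 ^ (nv + sg) * X ^ 6) + (sg - 0 + 1) * (drop_wt * U + ?w)))))
  (%s'. same block_mods s' s & level_V 0 s')"
  proof (rule runs_Seq[OF runs_leafH[where lo = D and N = N and L = L]])
  show "abs (s1 50 (int i)) < 2 ^ L" if "i < D" for i unfolding p1[OF that] by (rule pL)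
  next
  fix s2
  assume s2: "same {51, 63} s2 s1 & (ALL i. s2 51 (int i) = (if D <= i & i < 2 * D
  then 1 - s1 50 (int (i - D)) * 2 ^ N else s1 51 (int i)))"
  note s2' = sameD[OF conjunct1[OF s2]]
  have "s2 51 (int i) = hnum 0 i" if "D <= i" "i < 2 * D" for i
  proof -
  have "s2 51 (int i) = 1 - s1 50 (int (i - D)) * 2 ^ N" using s2 that by (simp del: of_nat_diff)
  also have "s1 50 (int (i - D)) = pt i" using p1[of "i - D"] that by (simp del: of_nat_diff)
  finally show ?thesis by (simp add: hnum_def num_def N_def)
  qed
  hence H2: "level_H 0 s2" unfolding level_H_def D_def by simp
  show "runs (For 63 (Var 66) (Var 67) leafG_body ;;
  For 62 (Const 0) (Var 61) lift_step ;; newton ;; For 62 (Const 0) (Var 61) drop_step) s2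
  ((2 * D - D + 1) * ((wt leafG_body + for_wt (Var 66) (Var 67)) * (L + 1)) +
  ((sg - 0 + 1) * (lift_wt * U + ?w) + (newton_loop_wt * (2 ^ (nv + sg) * X ^ 6) + (sg - 0 + 1) * (drop_wt * U + ?w))))
  (%s'. same block_mods s' s & level_V 0 s')"
  proof (rule runs_Seq[OF runs_leafG[where lo = D and z = z and L = L]])
  show "abs (s2 0 (z - int i)) < 2 ^ L" if "i < D" for i unfolding s2'[of 0, simplified] q1[OF that] by (rule gL)
  next
  fix s3
  assume s3: "same {52, 63} s3 s2 & (ALL i. s3 52 (int i) = (if D <= i & i < 2 * D
  then s2 0 (z - int (i - D)) else s2 52 (int i)))"
  note s3' = sameD[OF conjunct1[OF s3]]
  have "s3 52 (int i) = gnum 0 (i - D)" if "D <= i" "i < 2 * D" for i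
  proof -
  have "s3 52 (int i) = s2 0 (z - int (i - D))" using s3 that by (simp del: of_nat_diff)
  also have "... = g (i - D)" using q1[of "i - D"] that by (simp add: s2' del: of_nat_diff)
  finally show ?thesis by (simp add: gnum_def num_def gpoly_def poly_monom)
  qed
  hence G3: "level_G 0 s3" unfolding level_G_def D_def by simp
  have H3: "level_H 0 s3" using H2 unfolding level_H_def by (simp add: s3')
  have sm3: "same (block_mods - {62}) s3 s" using s1 s2 s3 unfolding same_def by simp
  have v3: "s3 60 0 = int nv" "s3 61 0 = int sg" "s3 68 0 = int (2 ^ nv)"
  using s1 s by (simp_all add: s3' s2' s1' N_def)
  show "runs (For 62 (Const 0) (Var 61) lift_step ;; newton ;; For 62 (Const 0) (Var 61) drop_step) s3
  ((sg - 0 + 1) * (lift_wt * U + ?w) + (newton_loop_wt * (2 ^ (nv + sg) * X ^ 6) + (sg - 0 + 1) * (drop_wt * U + ?w)))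
  (%s'. same block_mods s' s & level_V 0 s')"
  proof (rule runs_Seq[OF runs_level_loop[where M = "block_mods - {68}" and J = "%i s. (ALL j<=i. level_H j s) & level_G i s" and sg = sg and L = L]])
  fix i s4
  assume a: "i < sg" "same (block_mods - {68}) s4 s3" "s4 62 0 = int i" "(ALL j<=i. level_H j s4) & level_G i s4"
  have v4: "s4 60 0 = int nv" "s4 61 0 = int sg" "s4 68 0 = int (2 ^ nv)"
  using v3 a(2) unfolding same_def by simp_all
  show "runs lift_step s4 (lift_wt * U) (%s''. same (block_mods - {68} - {62}) s'' s4 & (ALL j<=Suc i. level_H j s'') & level_G (Suc i) s'')"
  unfolding U_def using a X v4 by (intro runs_mono[OF runs_lift_step[where h = i]]) (auto simp: same_def)
  next
  fix s4
  assume s4: "same (block_mods - {68}) s4 s3 & (ALL j<=sg. level_H j s4) & level_G sg s4"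
  have v4: "s4 60 0 = int nv" "s4 61 0 = int sg" "s4 68 0 = int (2 ^ nv)"
  using v3 s4 unfolding same_def by simp_all
  show "runs (newton ;; For 62 (Const 0) (Var 61) drop_step) s4
  (newton_loop_wt * (2 ^ (nv + sg) * X ^ 6) + (sg - 0 + 1) * (drop_wt * U + ?w))
  (%s'. same block_mods s' s & level_V 0 s')"
  proof (rule runs_Seq[OF runs_newton[where X = X]])
  fix s5
  assume s5: "same (mulc_mods Un {53, 62, 64, 65, 69, 71}) s5 s4 & level_V sg s5"
  have v5: "s5 60 0 = int nv" "s5 61 0 = int sg" "s5 68 0 = int (2 ^ nv)"
  using v4 s5 unfolding same_def by simp_all
  have H5: "level_H j s5" if "j <= sg" for j
  using s4 s5 that unfolding level_H_def same_def by simp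
  show "runs (For 62 (Const 0) (Var 61) drop_step) s5 ((sg - 0 + 1) * (drop_wt * U + ?w))
  (%s'. same block_mods s' s & level_V 0 s')"
  proof (rule runs_mono[OF runs_level_loop[where M = "block_mods - {51, 68}" and J = "%i. level_V (sg - i)" and sg = sg and L = L]])
  fix i s6
  assume a: "i < sg" "same (block_mods - {51, 68}) s6 s5" "s6 62 0 = int i" "level_V (sg - i) s6"
  have v6: "s6 60 0 = int nv" "s6 61 0 = int sg" "s6 68 0 = int (2 ^ nv)"
  using v5 a(2) unfolding same_def by simp_all
  have "level_H (sg - Suc i) s6"
  using H5[of "sg - Suc i"] a(2) unfolding level_H_def same_def by simp
  thus "runs drop_step s6 (drop_wt * U) (%s''. same (block_mods - {51, 68} - {62}) s'' s6 & level_V (sg - Suc i) s'')"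
  unfolding U_def using a X v6 by (intro runs_mono[OF runs_drop_step[where d = i]]) (auto simp: same_def)
  next
  fix s6
  assume s6: "same (block_mods - {51, 68}) s6 s5 & level_V (sg - sg) s6"
  have "same block_mods s6 s" using s6 s5 s4 sm3 unfolding same_def by simp
  thus "same block_mods s6 s & level_V 0 s6" using s6 by simp
  qed (use s5 v5 b' in simp_all)
  qed (use s4 v4 X in simp_all)
  qed (use v3 H3 G3 b' in simp_all)
  qed (use s s1 DL zL in "simp_all add: s2' s1'")
  qed (use s1 DL b in simp_all)
 qed simp
 thus ?thesis
 proof (rule runs_mono)
  define w where "w = wt block_init + wt leafH_body + wt leafG_body + 2 * for_wt (Var 66) (Var 67) + 2 * for_wt (Const 0) (Var 61)"
  have c: "(2 ^ sg + 1) * (mul_cost (nv + 0 + 3) + w * (L + 1)) <= (16 * mul_wt + 20 * w) * U"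
  unfolding L_def U_def using X by (intro node_cost) auto
  have "(sg + 1) * (2 * ?w) <= (2 ^ sg + 1) * (2 * ?w)" using less_exp[of sg] by (intro mult_le_mono1) simp
  hence "W <= (2 ^ sg + 1) * (mul_cost (nv + 0 + 3) + w * (L + 1)) + ((sg + 1) * (lift_wt * U) + newton_loop_wt * (X * U) + (sg + 1) * (drop_wt * U))"
  by (simp add: W_def w_def D_def U_def eval_nat_numeral algebra_simps)
  also have "... <= (16 * mul_wt + 20 * w) * (X * U) + (X * (lift_wt * U) + newton_loop_wt * (X * U) + X * (drop_wt * U))"
  proof (intro add_mono mult_le_mono1 order_refl)
  have "(16 * mul_wt + 20 * w) * U <= (16 * mul_wt + 20 * w) * (X * U)" using X by (intro mult_le_mono2) simp
  thus "(2 ^ sg + 1) * (mul_cost (nv + 0 + 3) + w * (L + 1)) <= (16 * mul_wt + 20 * w) * (X * U)" using c by (rule order_trans[rotated])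
  qed (use X in simp_all)
  also have "... = block_wt * (X * U)" unfolding block_wt_def w_def[symmetric] by (simp add: algebra_simps)
  also have "X * U = 2 ^ (nv + sg) * X ^ 6" by (simp add: U_def eval_nat_numeral)
  finally show "W <= block_wt * (2 ^ (nv + sg) * X ^ 6)" .
 qed simp
qed

text \<open>Outside the leaves of the tree, points and coefficients are set to 0, so that the bounds
  required by the locale hold for all indices.\<close>

lemma runs_block_eval:
 assumes s: "s 60 0 = int nv" "s 61 0 = int sg" "s 70 0 = z" "abs z < 2 ^ X" and X: "nv + sg + 4 <= X"
  and a: "!!i. i < 2 ^ sg ==> abs (s 50 (int i)) <= 2 ^ l" and f: "!!u. u < 2 ^ sg ==> abs (s 0 (z - int u)) <= 2 ^ B"
  and N: "(2 * l + 3) * 2 ^ sg + B + 4 <= 2 ^ nv"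
 shows "runs block_eval s (block_wt * (2 ^ (nv + sg) * X ^ 6))
  (%s'. same block_mods s' s & (ALL i<2 ^ sg. abs (s' 53 (2 ^ sg + int i)) < 2 ^ 2 ^ nv &
  s' 53 (2 ^ sg + int i) = (SUM u<2 ^ sg. s 0 (z - int u) * s 50 (int i) ^ (2 ^ sg - 1 - u))))"
proof -
 define pt where "pt = (%p. if 2 ^ sg <= p & p < 2 * 2 ^ sg then s 50 (int (p - 2 ^ sg)) else 0)"
 define g where "g = (%u. if u < 2 ^ sg then s 0 (z - int u) else 0)"
 interpret block pt g l B nv sg
 proof
  have "p - 2 ^ sg < 2 ^ sg" if "2 ^ sg <= p" "p < 2 * 2 ^ sg" for p :: nat using that by linarith
  thus "abs (pt q) <= 2 ^ l" for q unfolding pt_def using a[of "q - 2 ^ sg"] by (simp del: of_nat_diff)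
  show "abs (g u) <= 2 ^ B" for u unfolding g_def using f by auto
 qed (rule N)
 show ?thesis
 proof (rule runs_mono[OF runs_block_eval_aux[where z = z and X = X]])
  fix s'
  assume s': "same block_mods s' s & level_V 0 s'"
  have "abs (s' 53 (2 ^ sg + int i)) < 2 ^ 2 ^ nv & s' 53 (2 ^ sg + int i) = (SUM u<2 ^ sg. s 0 (z - int u) * s 50 (int i) ^ (2 ^ sg - 1 - u))"
  if "i < 2 ^ sg" for i
  proof -
  have v: "s' 53 (int (2 ^ sg + i)) = vnum 0 (2 ^ sg + i)"
  using s' that by (simp add: level_V_def del: of_nat_add)
  also have "... = (SUM u<2 ^ sg. g u * pt (2 ^ sg + i) ^ (2 ^ sg - 1 - u))" by (rule vnum_leaf)
  also have "... = (SUM u<2 ^ sg. s 0 (z - int u) * s 50 (int i) ^ (2 ^ sg - 1 - u))"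
  using that by (intro sum.cong) (auto simp: g_def pt_def)
  finally have "s' 53 (2 ^ sg + int i) = (SUM u<2 ^ sg. s 0 (z - int u) * s 50 (int i) ^ (2 ^ sg - 1 - u))" by simp
  moreover have "abs (vnum 0 (2 ^ sg + i)) < 2 ^ 2 ^ nv"
  by (rule less_le_trans[OF abs_vnum]) (auto intro!: power_increasing)
  ultimately show ?thesis using v by simp
  qed
  thus "same block_mods s' s & (ALL i<2 ^ sg. abs (s' 53 (2 ^ sg + int i)) < 2 ^ 2 ^ nv &
  s' 53 (2 ^ sg + int i) = (SUM u<2 ^ sg. s 0 (z - int u) * s 50 (int i) ^ (2 ^ sg - 1 - u)))"
  using s' by blast
 qed (use s X in "auto simp: pt_def g_def")
qed

section \<open>Leading parts of the Horner scheme\<close>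

text \<open>Peeling off the points one at a time, \<open>P = P(a) (x/a)\<^sup>k + (x - a) Q\<close>, divides the bound for the
 \<open>k\<close> lowest coefficients by \<open>A - 1\<close>, and at most doubles the bound for \<open>P(a)/a\<^sup>k\<close> since the points
 have distance at least 1.\<close>

lemma abs_top_coeff_le:
 fixes P :: "real poly" and Y :: "int set" and A :: real
 assumes "finite Y" "card Y = j" "1 <= k" "degree P < k + j" "1 < A" "!!a. a : Y ==> A <= abs (real_of_int a)"
  and "!!i. i < k ==> abs (coeff P i) <= M" "!!a. a : Y ==> abs (poly P a) <= E * abs (real_of_int a) ^ k" "0 <= M" "0 <= E"
 shows "abs (coeff P (k + j - 1)) <= M / (A - 1) ^ j + (2 ^ j - 1) * E"
 using assms(1,2,4,6-)
proof (induction j arbitrary: P Y M E)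
 case 0
 thus ?case using `1 <= k` by simp
next
 case (Suc j)
 obtain a where a: "a : Y" using Suc.prems(2) by fastforce
 define al e where "al = real_of_int a" and "e = poly P al / al ^ k"
 have a0: "A <= abs al" "al ~= 0" using Suc.prems(4)[OF a] `1 < A` by (auto simp: al_def)
 have e: "abs e <= E" using Suc.prems(6)[OF a] a0 by (simp add: e_def al_def abs_divide power_abs divide_le_eq)
 have "poly (P - monom e k) al = 0" using a0 by (simp add: e_def poly_monom)
 then obtain Q where Q: "P - monom e k = [:- al, 1:] * Q" unfolding poly_eq_0_iff_dvd by (elim dvdE)
 have c: "coeff P i - (if i = k then e else 0) = (if i = 0 then 0 else coeff Q (i - 1)) - al * coeff Q i" for i
  using arg_cong[OF Q, of "%p. coeff p i"] by (cases i) (auto simp: coeff_pCons)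
 have dQ: "degree Q < k + j"
 proof (cases "Q = 0")
  case False
  have "degree ([:- al, 1:] * Q) = 1 + degree Q" using False by (subst degree_mult_eq) auto
  moreover have "degree (P - monom e k) <= k + j"
  using Suc.prems(3) by (intro degree_diff_le) (auto intro: order_trans[OF degree_monom_le])
  ultimately show ?thesis using Q by simp
 qed (use `1 <= k` in simp)
 have "abs (coeff Q (k + j - 1)) <= M / (A - 1) / (A - 1) ^ j + (2 ^ j - 1) * (2 * E)"
 proof (rule Suc.IH[where Y = "Y - {a}"])
  show "abs (coeff Q i) <= M / (A - 1)" if "i < k" for i
  using that
  proof (induction i)
  case 0
  have "abs al * abs (coeff Q 0) <= M" using c[of 0] Suc.prems(5)[of 0] 0 by (simp flip: abs_mult)
  with mult_right_mono[OF a0(1), of "abs (coeff Q 0)"] have "A * abs (coeff Q 0) <= M" by simp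
  thus ?case using `1 < A` by (simp add: field_simps)
  next
  case (Suc i)
  have "al * coeff Q (Suc i) = coeff Q i - coeff P (Suc i)" using c[of "Suc i"] Suc.prems by simp
  hence "abs al * abs (coeff Q (Suc i)) <= M / (A - 1) + M"
  using Suc.IH Suc.prems `!!i. i < k ==> \<bar>coeff P i\<bar> <= M`[of "Suc i"] unfolding abs_mult[symmetric] by simp
  with mult_right_mono[OF a0(1), of "abs (coeff Q (Suc i))"] have "A * abs (coeff Q (Suc i)) <= M / (A - 1) + M" by simp
  \<comment> \<open>The bound is the fixed point of the recursion: \<open>(m + M) / A = m\<close>
    for \<open>m = M / (A - 1)\<close>.\<close>
  also have "... = A * (M / (A - 1))" using `1 < A` by (simp add: field_simps)
  finally show ?case by (rule mult_left_le_imp_le) (use `1 < A` in simp)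
  qed
 next
  fix a'
  assume a': "a' : Y - {a}"
  have "abs (real_of_int (a' - a)) \<ge> 1" using a' by auto
  hence d: "1 <= abs (real_of_int a' - al)" by (simp add: al_def)
  have "(real_of_int a' - al) * poly Q a' = poly P a' - e * real_of_int a' ^ k"
  using arg_cong[OF Q, of "%p. poly p a'"] by (simp add: poly_monom algebra_simps)
  hence "abs (real_of_int a' - al) * abs (poly Q a') = abs (poly P a' - e * real_of_int a' ^ k)"
  unfolding abs_mult[symmetric] by (rule arg_cong)
  also have "... <= abs (poly P a') + abs e * abs (real_of_int a') ^ k"
  using abs_triangle_ineq4 unfolding abs_mult[symmetric] power_abs[symmetric] .
  also have "... <= E * abs (real_of_int a') ^ k + E * abs (real_of_int a') ^ k"
  using Suc.prems(6)[of a'] a' e by (intro add_mono mult_right_mono) auto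
  finally have "abs (real_of_int a' - al) * abs (poly Q a') <= 2 * E * abs (real_of_int a') ^ k" by simp
  moreover have "1 * abs (poly Q a') <= abs (real_of_int a' - al) * abs (poly Q a')" using d by (intro mult_right_mono) auto
  ultimately show "abs (poly Q a') <= 2 * E * abs (real_of_int a') ^ k" by simp
 qed (use Suc.prems a dQ `1 < A` in auto)
 hence "abs (coeff Q (k + j - 1)) <= M / (A - 1) ^ Suc j + (2 ^ Suc j - 2) * E" by (simp add: algebra_simps)
 moreover have "coeff Q (k + j) = 0" using dQ by (rule coeff_eq_0)
 hence "coeff P (k + j) = coeff Q (k + j - 1) + (if j = 0 then e else 0)"
  using c[of "k + j"] `1 <= k` by (auto split: if_splits)
 hence "abs (coeff P (k + j)) <= abs (coeff Q (k + j - 1)) + E" using e `0 <= E` by (auto split: if_splits)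
 ultimately show ?case by (simp add: algebra_simps)
qed

text \<open>With \<open>k\<close> such points the leading coefficient \<open>g 0\<close> would be at
  most 1/2: both parts of the bound in \<open>abs_top_coeff_le\<close> are at most
  \<open>2 ^ B / 2 ^ (2 * B)\<close>, that is at most 1/4. The hypothesis
  \<open>4 * B <= kp * k\<close> lets the factor \<open>2 ^ (kp * k)\<close>, gained from dividing
  values by \<open>a ^ k\<close>, outweigh the size of \<open>S\<close> and the factor
  \<open>2 ^ k\<close> lost by peeling.\<close>

lemma card_small_values_less:
 fixes g :: "nat => int" and Y :: "int set"
 assumes g: "g 0 ~= 0" "!!u. u < 2 * k ==> abs (g u) <= S" and S: "S < 2 ^ B" "2 <= B" "2 <= kp" "4 * B <= kp * k" "1 <= k"
  and Y: "finite Y" "!!a. a : Y ==> 2 ^ kp <= abs a & \<bar>SUM u<2 * k. g u * a ^ (2 * k - 1 - u)\<bar> <= S"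
 shows "card Y < k"
proof (rule ccontr)
 assume "~ card Y < k"
 then obtain Z where Z: "Z <= Y" "card Z = k" by (metis not_less obtain_subset_with_card_n)
 define P where "P = (SUM u<2 * k. monom (real_of_int (g u)) (2 * k - 1 - u))"
 \<comment> \<open>One unit of \<open>kp\<close> is lost in both parts, to \<open>2 ^ kp - 1\<close>
   and to the factor \<open>2 ^ k\<close>; by \<open>2 <= kp\<close> at least half of it
   remains.\<close>
 have "kp * k <= 2 * (kp - 1) * k" using S(3) by (intro mult_le_mono1) simp
 hence kB: "2 * B <= (kp - 1) * k" using S(4) unfolding mult.assoc by linarith
 have S0: "0 <= S" using g(2)[of 0] S by simp
 have cP: "coeff P i = (if i < 2 * k then real_of_int (g (2 * k - 1 - i)) else 0)" for i
 proof -
  have "coeff P i = (SUM u<2 * k. if u = 2 * k - 1 - i & i < 2 * k then real_of_int (g u) else 0)"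
  unfolding P_def coeff_sum by (intro sum.cong) auto
  also have "... = (if i < 2 * k then real_of_int (g (2 * k - 1 - i)) else 0)" by (cases "i < 2 * k") simp_all
  finally show ?thesis .
 qed
 define E where "E = real_of_int S / 2 ^ (kp * k)"
 have "abs (coeff P (k + k - 1)) <= S / (2 ^ kp - 1) ^ k + (2 ^ k - 1) * E"
 proof (rule abs_top_coeff_le[where Y = Z])
  show "finite Z" using Z Y finite_subset by blast
  have "degree P <= 2 * k - 1" by (rule degree_le) (auto simp: cP)
  thus "degree P < k + k" using S by simp
  show "(1::real) < 2 ^ kp" using S by simp
  show "abs (coeff P i) <= real_of_int S" if "i < k" for i
  using g(2)[of "2 * k - 1 - i"] that S by (simp add: cP)
  fix a
  assume a: "a : Z"
  hence aY: "2 ^ kp <= abs a" "\<bar>SUM u<2 * k. g u * a ^ (2 * k - 1 - u)\<bar> <= S" using Y Z by blast+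
  have "real_of_int (2 ^ kp) <= real_of_int (abs a)" using aY(1) by (simp only: of_int_le_iff)
  thus aA: "2 ^ kp <= abs (real_of_int a)" by simp
  have "poly P a = real_of_int (SUM u<2 * k. g u * a ^ (2 * k - 1 - u))" by (simp add: P_def poly_sum poly_monom)
  hence "abs (poly P a) <= S" using aY(2) by (simp only: of_int_le_iff flip: of_int_abs)
  also have "real_of_int S = E * (2 ^ kp) ^ k" by (simp add: E_def flip: power_mult)
  also have "... <= E * abs (real_of_int a) ^ k"
  by (intro mult_left_mono power_mono aA) (use S0 in "simp_all add: E_def")
  finally show "abs (poly P a) <= E * abs (real_of_int a) ^ k" by simp
 qed (use Z S S0 in "simp_all add: E_def")
 moreover have "real_of_int S / (2 ^ kp - 1) ^ k <= 2 ^ B / 2 ^ (2 * B)"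
 proof (rule frac_le)
  have "real_of_int S <= real_of_int (2 ^ B)" using S by (simp only: of_int_le_iff)
  thus "real_of_int S <= 2 ^ B" by simp
  have "(2::real) ^ (2 * B) <= (2 ^ (kp - 1)) ^ k" unfolding power_mult[symmetric] using kB by (intro power_increasing) auto
  also have "... <= (2 ^ kp - 1) ^ k"
  proof (rule power_mono)
  have "(2::real) ^ kp = 2 * 2 ^ (kp - 1)" using S(3) by (simp flip: power_Suc)
  thus "(2::real) ^ (kp - 1) <= 2 ^ kp - 1" using one_le_power[of "2::real" "kp - 1"] by linarith
  qed simp
  finally show "(2::real) ^ (2 * B) <= (2 ^ kp - 1) ^ k" by simp
 qed simp_all
 moreover have "(2 ^ k - 1) * E <= 2 ^ B / 2 ^ (2 * B)"
 proof -
  have "(2 ^ k - 1) * E <= 2 ^ k * 2 ^ B / 2 ^ (kp * k)"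
  proof -
  have "real_of_int S <= real_of_int (2 ^ B)" using S by (simp only: of_int_le_iff)
  hence "(2 ^ k - 1) * real_of_int S <= 2 ^ k * 2 ^ B" using S0 by (intro mult_mono) auto
  thus ?thesis by (simp add: E_def divide_right_mono)
  qed
  also have "... = 2 ^ B / 2 ^ ((kp - 1) * k)"
  proof -
  have "kp * k = k + (kp - 1) * k" using S(3) by (cases kp) auto
  thus ?thesis by (simp add: power_add)
  qed
  also have "... <= 2 ^ B / 2 ^ (2 * B)"
  using kB by (intro divide_left_mono power_increasing) simp_all
  finally show ?thesis .
 qed
 moreover have "(2::real) ^ B / 2 ^ (2 * B) <= 1 / 4"
 proof -
  have "(2::real) ^ B / 2 ^ (2 * B) = 1 / 2 ^ B" unfolding mult_2 power_add by simp
  also have "... <= 1 / 2 ^ 2" using S(2) by (intro divide_left_mono power_increasing) auto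
  finally show ?thesis by simp
 qed
 ultimately have "abs (coeff P (k + k - 1)) <= 1 / 2" by linarith
 moreover have "abs (coeff P (k + k - 1)) = real_of_int (abs (g 0))" using S by (simp add: cP)
 moreover have "1 <= abs (g 0)" using g(1) by simp
 ultimately show False by linarith
qed

text \<open>The \<open>r\<close> leading terms in Horner's scheme; beyond the degree, the missing coefficients count as 0.\<close>

definition head :: "int poly => nat => int => int" where
 "head f r a = (SUM u<r. (if u <= degree f then coeff f (degree f - u) else 0) * a ^ (r - 1 - u))"

lemma head_add:
 "head f (r + s) a = head f r a * a ^ s + (SUM u<s. (if r + u <= degree f then coeff f (degree f - (r + u)) else 0) * a ^ (s - 1 - u))"
proof -
 let ?c = "%u. if u <= degree f then coeff f (degree f - u) else 0"
 have "head f (r + s) a = (SUM u<r. ?c u * a ^ (r + s - 1 - u)) + (SUM u=r..<r + s. ?c u * a ^ (r + s - 1 - u))"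
  unfolding head_def by (rule sum_lessThan_split) simp
 also have "(SUM u<r. ?c u * a ^ (r + s - 1 - u)) = head f r a * a ^ s"
  unfolding head_def sum_distrib_right by (intro sum.cong refl) (simp add: mult.assoc flip: power_add)
 also have "(SUM u=r..<r + s. ?c u * a ^ (r + s - 1 - u)) = (SUM u<s. ?c (r + u) * a ^ (s - 1 - u))"
  by (rule sum.reindex_bij_witness[of _ "%u. r + u" "%u. u - r"]) (auto simp: add.commute)
 finally show ?thesis .
qed

lemma head_Suc_degree: "head f (Suc (degree f)) a = poly f a"
proof -
 have "head f (Suc (degree f)) a = (SUM i<=degree f. coeff f (degree f - i) * a ^ (degree f - i))"
  unfolding head_def lessThan_Suc_atMost by (intro sum.cong) auto
 also have "... = (SUM i<=degree f. coeff f i * a ^ i)"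
  by (rule sum.reindex_bij_witness[of _ "%i. degree f - i" "%i. degree f - i"]) auto
 finally show ?thesis by (simp add: poly_altdef)
qed

text \<open>Once the coefficients are exhausted, Horner's scheme only multiplies by
  \<open>a\<close>. For \<open>a ~= 0\<close> the value at the end of the last block therefore
  decides whether \<open>a\<close> is a root.\<close>

lemma head_final:
 assumes "degree f < r"
 shows "head f r a = poly f a * a ^ (r - 1 - degree f)"
proof -
 define s where "s = r - Suc (degree f)"
 have "head f (Suc (degree f) + s) a = poly f a * a ^ s" unfolding head_add head_Suc_degree by simp
 thus ?thesis using assms by (simp add: s_def)
qed

text \<open>For a root, a leading part of Horner's scheme cancels the remaining low terms.\<close>

lemma abs_head_root_le:
 assumes "poly f a = 0" "a ~= 0"
 shows "abs (head f r a) <= (SUM i<=degree f. abs (coeff f i))"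
proof (cases "degree f < r")
 case True
 thus ?thesis using assms by (simp add: head_final sum_nonneg)
next
 case False
 define s where "s = degree f - r"
 let ?c = "%u. if r + u <= degree f then coeff f (degree f - (r + u)) else 0"
 have "head f (r + Suc s) a = 0" using head_Suc_degree[of f a] assms(1) False by (simp add: s_def)
 hence "head f r a * a ^ Suc s = - (SUM u<Suc s. ?c u * a ^ (Suc s - 1 - u))" using head_add[of f r "Suc s" a] by linarith
 from arg_cong[OF this, of abs] have "abs (head f r a) * abs a ^ Suc s = \<bar>SUM u<Suc s. ?c u * a ^ (Suc s - 1 - u)\<bar>"
  unfolding abs_mult power_abs abs_minus_cancel .
 also have "... <= (SUM u<Suc s. abs (?c u * a ^ (Suc s - 1 - u)))" by (rule sum_abs)
 also have "... <= (SUM u<Suc s. abs (coeff f (s - u)) * abs a ^ Suc s)"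
 proof (rule sum_mono)
  fix u
  have "abs a ^ (Suc s - 1 - u) <= abs a ^ Suc s" using assms(2) by (intro power_increasing) auto
  moreover have "abs (?c u) <= abs (coeff f (s - u))" by (simp add: s_def)
  ultimately show "abs (?c u * a ^ (Suc s - 1 - u)) <= abs (coeff f (s - u)) * abs a ^ Suc s"
  unfolding abs_mult power_abs by (intro mult_mono) auto
 qed
 also have "... = (SUM i<Suc s. abs (coeff f i)) * abs a ^ Suc s"
  unfolding sum_distrib_right lessThan_Suc_atMost by (rule sum.reindex_bij_witness[of _ "%i. s - i" "%i. s - i"]) auto
 also have "... <= (SUM i<=degree f. abs (coeff f i)) * abs a ^ Suc s"
  by (intro mult_right_mono sum_mono2) (auto simp: s_def)
 finally show ?thesis by (rule mult_right_le_imp_le) (use assms(2) in simp)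
qed

section \<open>The root test\<close>

lemma runs_wpV: "wp L c Q s ==> L + 1 <= V ==> runs c s (wt c * V) Q"
 by (rule runs_mono[OF runs_wp], assumption, rule mult_le_mono2)

lemma runs_SeqV: "runs c s (K1 * V) R ==> (!!s1. R s1 ==> runs d s1 (K2 * V) Q) ==> runs (c ;; d) s ((K1 + K2) * V) Q"
 by (rule runs_Seq[where R = R]) (auto simp: algebra_simps)

lemma runs_IfV:
 assumes "small L e s" "L + 1 <= V" "val e s ~= 0 ==> runs c s (K1 * V) Q" "val e s = 0 ==> runs d s (K2 * V) Q"
 shows "runs (If e c d) s ((cost_wt e + val_wt e + 1 + K1 + K2) * V) Q"
proof -
 define G where "G = (cost_wt e + val_wt e + 1) * V"
 have "(cost_wt e + val_wt e + 1) * (L + 1) <= G" unfolding G_def using assms(2) by (rule mult_le_mono2)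
 hence e: "cost e s + len (val e s) <= G"
  using cost_le[OF assms(1)] len_val_le[OF assms(1)] unfolding add_mult_distrib by linarith
 have T: "(cost_wt e + val_wt e + 1 + K1 + K2) * V = G + K1 * V + K2 * V" unfolding G_def by (simp add: add_mult_distrib)
 show ?thesis
 proof (cases "val e s = 0")
  case True
  then obtain t s' where t: "exec d s t s'" "t <= K2 * V" "Q s'" using assms(4) unfolding runs_def by blast
  show ?thesis unfolding runs_def T using exec.IfFalse[OF True t(1), of c] t(2,3) e
  by (intro exI[of _ "cost e s + len (val e s) + t"] exI[of _ s']) linarith
 next
  case False
  then obtain t s' where t: "exec c s t s'" "t <= K1 * V" "Q s'" using assms(3) unfolding runs_def by blast
  show ?thesis unfolding runs_def T using exec.IfTrue[OF False t(1), of d] t(2,3) e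
  by (intro exI[of _ "cost e s + len (val e s) + t"] exI[of _ s']) linarith
 qed
qed

text \<open>\<open>S\<close> bounds the coefficients, the points and the leading parts of Horner's scheme at a root.\<close>

locale root_test =
 fixes f :: "int poly" and xs :: "int list" and be et X :: nat
 assumes f: "1 <= degree f" and xs: "distinct xs" "length xs <= degree f"
  and be: "(SUM i<=degree f. abs (coeff f i)) + (SUM i<length xs. abs (xs ! i)) + 1 < 2 ^ 2 ^ be" "1 <= be"
  and et: "degree f < 2 ^ et" "2 ^ et <= 2 * degree f" and X: "2 * be + 2 * et + 20 <= X"
begin

definition S :: int where "S = (SUM i<=degree f. abs (coeff f i)) + (SUM i<length xs. abs (xs ! i)) + 1"

text \<open>The digit length becomes \<open>128 * 2 ^ be\<close>. It suffices for
  \<open>block_size\<close>, and a multiplication of this size accepts factors of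
  \<open>64 * 2 ^ be - 1\<close> bits, enough for the powers of the points.\<close>

definition nv :: nat where "nv = be + 7"
definition L :: nat where "L = 2 ^ nv + X"
definition V\<^sub>0 :: nat where "V\<^sub>0 = 2 ^ nv * X ^ 5"
text \<open>While \<open>V\<^sub>0\<close> is the unit for single multiplications of this length,
  the additional factor \<open>X\<close> pays for loops of logarithmic length such as repeated
  squaring.\<close>

definition V :: nat where "V = 2 ^ nv * X ^ 6"

text \<open>These cells stay fixed during the work on the classes. The changing ones are 84 (class),
  85 and 86 (its limits), 87 (number of remaining points), 88 and 89 (their indices and leading
  values), 92 (block), 93 (position for writing), 94 (group), 95 (place in the group) and 100 (block
  length).\<close>

definition globals :: "store => bool" where
 "globals s = ((ALL k:{0, 1, 2}. s k = input f xs k) & s 80 0 = S & s 82 0 = int be & s 83 0 = int et & s 60 0 = int nv)"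

lemma globals_cong: "(!!k. k : {0, 1, 2, 60, 80, 82, 83} ==> s' k = s k) ==> globals s' = globals s"
 by (simp add: globals_def)

lemma globals_same: "globals s ==> same M s' s ==> M \<inter> {0, 1, 2, 60, 80, 82, 83} = {} ==> globals s'"
 by (subst globals_cong[of s' s]) (auto simp: same_def)

lemma globals_upd [simp]: "k ~: {0, 1, 2, 60, 80, 82, 83} ==> globals (s(k := h)) = globals s"
 by (rule globals_cong) auto

lemma globalsD:
 assumes "globals s"
 shows "s 80 0 = S" "s 82 0 = int be" "s 83 0 = int et" "s 60 0 = int nv" "s 2 0 = int (degree f)" "s 2 1 = int (length xs)"
  "j < length xs ==> s 1 (int j) = xs ! j" "s 0 z = (if 0 <= z then coeff f (nat z) else 0)"
 using assms by (auto simp: globals_def input_def)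

lemma S_less: "S < 2 ^ 2 ^ be" and S_ge: "(SUM i<=degree f. abs (coeff f i)) <= S" "0 < S"
 and abs_coeff_le: "abs (coeff f i) <= S" and abs_pt_less: "j < length xs ==> abs (xs ! j) < S"
proof -
 have nn: "0 <= (SUM i<=degree f. abs (coeff f i))" "0 <= (SUM i<length xs. abs (xs ! i))" by (auto intro: sum_nonneg)
 show "S < 2 ^ 2 ^ be" using be by (simp add: S_def)
 show S: "(SUM i<=degree f. abs (coeff f i)) <= S" "0 < S" using nn by (simp_all add: S_def)
 show "abs (coeff f i) <= S"
 proof (cases "i <= degree f")
  case True
  hence "abs (coeff f i) <= (SUM i<=degree f. abs (coeff f i))" by (intro member_le_sum) auto
  thus ?thesis using S by simp
 qed (use S in "simp add: coeff_eq_0")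
 assume "j < length xs"
 hence "abs (xs ! j) <= (SUM i<length xs. abs (xs ! i))" by (intro member_le_sum) auto
 thus "abs (xs ! j) < S" unfolding S_def using nn by linarith
qed

lemma less_L: "x <= L ==> x < 2 ^ L"
 using less_exp[of L] by linarith

lemma pow_less_L: "k <= L ==> x < 2 ^ k ==> x < 2 ^ L" for x :: int
proof -
 assume "k <= L" "x < 2 ^ k"
 moreover have "(2::int) ^ k <= 2 ^ L" using `k <= L` by (intro power_increasing) auto
 ultimately show ?thesis by linarith
qed

lemma L_ge: "2 ^ nv <= L" "X <= L" "nv <= L" "be <= L" "et <= L" "1 <= L" "128 * 2 ^ be <= L"
 using X by (simp_all add: L_def nv_def power_add)

lemma S_L: "S < 2 ^ L"
 by (rule pow_less_L[OF _ S_less]) (use L_ge(7) in linarith)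

lemma V: "L + 1 <= V\<^sub>0" "V\<^sub>0 * X = V" "V\<^sub>0 <= V" "L + 1 <= V" "mul_cost nv <= mul_wt * V\<^sub>0"
proof -
 define Y where "Y = (2::nat) ^ nv"
 have Y: "1 <= Y" by (simp add: Y_def)
 have "Y + X + 1 <= Y * (X + 2)" using mult_le_mono1[OF Y, of "X + 1"] unfolding add_mult_distrib2 by linarith
 also have "... <= Y * X ^ 5"
 proof (rule mult_le_mono2)
  have "X + 2 <= X ^ 2" using mult_le_mono1[of 2 X X] X unfolding power2_eq_square by linarith
  also have "... <= X ^ 5" using X by (intro power_increasing) auto
  finally show "X + 2 <= X ^ 5" .
 qed
 finally show 1: "L + 1 <= V\<^sub>0" by (simp add: L_def V\<^sub>0_def Y_def)
 show "V\<^sub>0 * X = V" by (simp add: V_def V\<^sub>0_def flip: power_Suc2)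
 show 2: "V\<^sub>0 <= V" using X by (auto simp: V_def V\<^sub>0_def intro!: power_increasing)
 show "L + 1 <= V" using 1 2 by linarith
 have "nv <= X" using X by (simp add: nv_def)
 hence "nv ^ 5 <= X ^ 5" by (intro power_mono) auto
 thus "mul_cost nv <= mul_wt * V\<^sub>0" by (simp add: mul_cost_def V\<^sub>0_def)
qed

lemma runs_mulcV:
 assumes "wp L (mulc_init e1 e2 te) (%s'. s' = s(10 := (s 10)(2 := x, 3 := y), 32 := (s 32)(0 := int nv))) s"
  and "abs x < 2 ^ (64 * 2 ^ be - 1)" "abs y < 2 ^ (64 * 2 ^ be - 1)"
 shows "runs (mulc e1 e2 te) s ((wt (mulc_init e1 e2 te) + mul_wt) * V\<^sub>0) (%s'. s' 11 1 = x * y & same mulc_mods s' s)"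
proof (rule runs_mono[OF runs_mulc[where L = L, OF assms(1)]])
 show "wt (mulc_init e1 e2 te) * (L + 1) + mul_cost nv <= (wt (mulc_init e1 e2 te) + mul_wt) * V\<^sub>0"
  unfolding add_mult_distrib using V by (intro add_mono mult_le_mono2)
 have "2 ^ (nv - 1) = 64 * (2::nat) ^ be" by (simp add: nv_def power_add)
 thus "abs x < 2 ^ (2 ^ (nv - 1) - 1)" "abs y < 2 ^ (2 ^ (nv - 1) - 1)" using assms(2,3) by simp_all
qed (simp_all add: nv_def)

end

definition pow_body :: prog where
 "pow_body = (mulc (Var 97) (Var 97) (Var 60) ;; Assign 97 (Read 11 (Const 1)))"

definition pow_body_wt :: nat where
 "pow_body_wt = wt (mulc_init (Var 97) (Var 97) (Var 60)) + mul_wt + wt (Assign 97 (Read 11 (Const 1)))"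

definition pow_wt :: nat where
 "pow_wt = pow_body_wt + for_wt (Const 0) (Var 61)"

definition keep :: prog where
 "keep = If (Var 80 [<] Var 99) Skip (If (Var 99 [<] (Const 0 [-] Var 80)) Skip
  (Write 88 (Var 93) (Read 88 (Var 96)) ;; Write 89 (Var 93) (Var 99) ;; Assign 93 (Var 93 [+] Const 1)))"

definition item_end :: prog where
 "item_end = (Assign 99 (Read 11 (Const 1) [+] Read 53 (Var 95 [+] Var 100)) ;; keep)"

definition item :: prog where
 "item = (Assign 96 (Var 95 [+] Var 101) ;; If (Var 96 [<] Var 87)
  (Assign 97 (Read 1 (Read 88 (Var 96))) ;; For 98 (Const 0) (Var 61) pow_body ;;
  mulc (Read 89 (Var 96)) (Var 97) (Var 60) ;; item_end) Skip)"

definition item_wt :: nat where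
 "item_wt = wt (Assign 96 (Var 95 [+] Var 101)) + (cost_wt (Var 96 [<] Var 87) + val_wt (Var 96 [<] Var 87) + 1 +
  (wt (Assign 97 (Read 1 (Read 88 (Var 96)))) + (pow_wt + (wt (mulc_init (Read 89 (Var 96)) (Var 97) (Var 60)) + mul_wt + wt item_end))) + 1)"

section \<open>The points of one size class\<close>

locale point_class = root_test +
 fixes i :: nat
 assumes i: "i < be"
begin

text \<open>The block length \<open>2 ^ sg\<close> is \<open>8 * B / l\<close> for
  \<open>B = 2 ^ be\<close> and \<open>l = 2 ^ i\<close>, capped at \<open>2 ^ et\<close>, which
  already exceeds the degree and thus the number of points.\<close>

definition sg :: nat where "sg = min (be + 3 - i) et"

text \<open>The lowest class begins at 1 rather than 2, so that 1 and -1 belong to it.\<close>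

definition in_class :: "nat => bool" where
 "in_class j = ((if i = 0 then 1 else 2 ^ 2 ^ i) <= abs (xs ! j) & abs (xs ! j) < 2 ^ 2 ^ Suc i)"

definition hd_val :: "nat => nat => int" where "hd_val c j = head f (c * 2 ^ sg) (xs ! j)"

fun alive :: "nat => nat list" where
 "alive 0 = filter in_class [0..<length xs]"
| "alive (Suc c) = filter (%j. abs (hd_val (Suc c) j) <= S) (alive c)"

definition entry :: "nat => store => nat => nat => bool" where
 "entry c s j k = (s 88 (int j) = int k & s 89 (int j) = hd_val c k)"

text \<open>The list of the points is compacted in place: the first \<open>r\<close> of them have been processed.\<close>

definition compacted :: "nat => nat => store => bool" where
 "compacted c r s = ((let ks = filter (%j. abs (hd_val (Suc c) j) <= S) (take r (alive c)) in
  s 93 0 = int (length ks) & (ALL j<length ks. entry (Suc c) s j (ks ! j)) &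
  (ALL j. r <= j --> j < length (alive c) --> entry c s j (alive c ! j))))"

lemma sg_le: "sg <= et" "sg <= be + 3" "(2::nat) ^ sg <= 2 * degree f"
proof -
 show "sg <= et" "sg <= be + 3" by (simp_all add: sg_def)
 hence "(2::nat) ^ sg <= 2 ^ et" by (intro power_increasing) auto
 thus "(2::nat) ^ sg <= 2 * degree f" using et by linarith
qed

lemma class_size: "2 ^ i * 2 ^ sg <= 8 * (2::nat) ^ be"
proof -
 have "2 ^ i * 2 ^ sg <= (2::nat) ^ (be + 3)" unfolding power_add[symmetric] using i by (intro power_increasing) (auto simp: sg_def)
 thus ?thesis by (simp add: power_add)
qed

text \<open>The size condition of the block evaluation for points below
  \<open>2 ^ 2 ^ Suc i\<close>. In units of \<open>2 ^ be\<close> the left side is at most 32 + 24 +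
  1 + 4 = 61.\<close>

lemma block_size: "(2 * 2 ^ Suc i + 3) * 2 ^ sg + 2 ^ be + 4 <= (2::nat) ^ nv"
proof -
 have "(1::nat) * 2 ^ sg <= 2 ^ i * 2 ^ sg" by (rule mult_le_mono1) simp
 moreover have "(2 * 2 ^ Suc i + 3) * 2 ^ sg = 4 * (2 ^ i * 2 ^ sg) + 3 * (2::nat) ^ sg" by (simp add: algebra_simps)
 moreover have "(1::nat) <= 2 ^ be" by simp
 moreover have "(2::nat) ^ nv = 128 * 2 ^ be" by (simp add: nv_def power_add)
 ultimately show ?thesis using class_size by linarith
qed

lemma alive_D: "j : set (alive c) ==> j < length xs & in_class j & abs (hd_val c j) <= S"
 using S_ge(2) by (induction c) (auto simp: hd_val_def head_def)

lemma distinct_alive: "distinct (alive c)"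
 by (induction c) auto

lemma length_alive: "length (alive c) <= length xs"
proof (induction c)
 case 0
 show ?case using length_filter_le[of in_class "[0..<length xs]"] by simp
next
 case (Suc c)
 thus ?case unfolding alive.simps(2) by (rule order_trans[OF length_filter_le])
qed

lemma alive_nth: "j < length (alive c) ==> alive c ! j < length xs & in_class (alive c ! j) & abs (hd_val c (alive c ! j)) <= S"
 by (intro alive_D nth_mem)

lemma root_alive:
 assumes "j < length xs" "in_class j" "poly f (xs ! j) = 0"
 shows "j : set (alive c)"
proof (induction c)
 case (Suc c)
 have "xs ! j ~= 0" using assms(2) by (auto simp: in_class_def split: if_splits)
 hence "abs (hd_val (Suc c) j) <= S"
  using abs_head_root_le[OF assms(3), of "Suc c * 2 ^ sg"] S_ge(1) unfolding hd_val_def by linarith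
 thus ?case using Suc by simp
qed (use assms in simp)

text \<open>Points only disappear, so the first block is decisive. If the cap \<open>et\<close> is
  effective, the block length exceeds the number of all points. In the lowest class there are at
  most seven integers, and blocks have length at least 8. Otherwise
  \<open>card_small_values_less\<close> applies, with half of the block length as
  \<open>k\<close>.\<close>

lemma length_alive_Suc: "length (alive (Suc c)) <= 2 ^ sg"
proof (cases "be + 3 - i < et")
 case False
 hence "sg = et" by (simp add: sg_def)
 thus ?thesis using length_alive[of "Suc c"] xs et by simp
next
 case True
 hence s: "sg = be + 3 - i" by (simp add: sg_def)
 define k where "k = (2::nat) ^ (sg - 1)"
 have k: "2 ^ sg = 2 * k" using s i by (simp add: k_def flip: power_Suc)
 define Y where "Y = (%j. xs ! j) ` set (alive 1)"
 have "length (alive (Suc c)) <= length (alive 1)"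
 proof (induction c)
  case (Suc c)
  have "length (alive (Suc (Suc c))) <= length (alive (Suc c))"
  unfolding alive.simps(2)[of "Suc c"] by (rule length_filter_le)
  thus ?case using Suc by linarith
 qed simp
 moreover have "length (alive 1) = card Y"
 proof -
  have "inj_on (%j. xs ! j) (set (alive 1))"
  using alive_D[of _ 1] xs by (intro inj_onI) (metis nth_eq_iff_index_eq)
  thus ?thesis by (simp only: Y_def card_image distinct_card[OF distinct_alive])
 qed
 moreover have "card Y <= 2 ^ sg"
 proof (cases "i = 0")
  case True
  have "abs (xs ! j) < 4" if "j : set (alive 1)" for j
  proof -
  have "abs (xs ! j) < 2 ^ 2 ^ Suc i" using alive_D[OF that] by (simp only: in_class_def)
  also have "(2::int) ^ 2 ^ Suc i = 4" using True by simp
  finally show ?thesis .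
  qed
  hence "Y <= {-3..3}" unfolding Y_def by fastforce
  hence "card Y <= card {-3..3::int}" by (intro card_mono) auto
  moreover have "3 <= sg" unfolding s using True by simp
  hence "(2::nat) ^ 3 <= 2 ^ sg" by (intro power_increasing) auto
  ultimately show ?thesis by simp
 next
  case False
  define g where "g = (%u. if u <= degree f then coeff f (degree f - u) else 0)"
  have "card Y < k"
  proof (rule card_small_values_less[where g = g and S = S and B = "2 ^ be" and kp = "2 ^ i"])
  show "g 0 ~= 0" using f by (auto simp: g_def)
  show "abs (g u) <= S" for u using abs_coeff_le S_ge(2) by (auto simp: g_def)
  show "S < 2 ^ 2 ^ be" by (rule S_less)
  show "2 <= (2::nat) ^ be" "2 <= (2::nat) ^ i" using be(2) False power_increasing[of 1 be "2::nat"] power_increasing[of 1 i "2::nat"] by simp_all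
  \<comment> \<open>The product is \<open>4 * B\<close> with no room to spare; this determines the
    constant 8 in the block length \<open>2 * k\<close>.\<close>
  have "2 ^ i * k = 2 ^ (be + 2)" unfolding k_def power_add[symmetric] using s i by simp
  thus "4 * 2 ^ be <= 2 ^ i * k" by (simp add: power_add)
  show "2 ^ 2 ^ i <= abs a & \<bar>SUM u<2 * k. g u * a ^ (2 * k - 1 - u)\<bar> <= S" if aY: "a : Y" for a
  proof -
  obtain j where j: "j : set (alive 1)" "a = xs ! j" using aY unfolding Y_def by blast
  thus ?thesis using alive_D[OF j(1)] False by (simp add: in_class_def hd_val_def head_def g_def k)
  qed
  qed (auto simp: Y_def k_def)
  thus ?thesis using k by simp
 qed
 ultimately show ?thesis by linarith
qed

text \<open>All powers met in repeated squaring have at most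
  \<open>2 ^ Suc i * 2 ^ sg <= 16 * 2 ^ be\<close> bits.\<close>

lemma abs_pow_less:
 assumes "abs a < 2 ^ 2 ^ Suc i" "j <= sg"
 shows "abs (a ^ 2 ^ j) < (2::int) ^ (64 * 2 ^ be - 1)"
proof -
 have "abs (a ^ 2 ^ j) <= (2 ^ 2 ^ Suc i) ^ 2 ^ j" unfolding power_abs using assms(1) by (intro power_mono) auto
 also have "... = 2 ^ (2 * (2 ^ i * 2 ^ j))" by (simp add: mult.assoc flip: power_mult)
 also have "... < 2 ^ (64 * 2 ^ be - 1)"
 proof (rule power_strict_increasing)
  have "2 ^ i * 2 ^ j <= 2 ^ i * (2::nat) ^ sg" using assms(2) by (intro mult_le_mono2 power_increasing) auto
  moreover have "(1::nat) <= 2 ^ be" by simp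
  ultimately show "2 * (2 ^ i * 2 ^ j) < 64 * (2::nat) ^ be - 1" using class_size by linarith
 qed simp
 finally show ?thesis .
qed

lemma runs_pow:
 assumes s: "globals s" "s 61 0 = int sg" "s 97 0 = a" "abs a < 2 ^ 2 ^ Suc i"
 shows "runs (For 98 (Const 0) (Var 61) pow_body) s (pow_wt * V)
  (%s'. same (mulc_mods Un {97, 98}) s' s & s' 97 0 = a ^ 2 ^ sg)"
proof (rule runs_mono[OF runs_ForS[where L = L and V = V\<^sub>0 and a = 0 and b = sg and M = "mulc_mods Un {97, 98}" and K = pow_body_wt and
  J = "%j s'. s' 97 0 = a ^ 2 ^ j"]])
 have sL: "sg < 2 ^ L" using sg_le L_ge by (intro less_L) linarith
 fix j s'
 assume sm: "same (mulc_mods Un {97, 98}) s' s"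
 have s': "globals s'" "s' 61 0 = int sg" using globals_same[OF s(1) sm] sameD[OF sm, of 61] s by simp_all
 show "small L (Var 61) s' & val (Var 61) s' = int sg" using s' sL by simp
 assume j: "j < sg" and J: "s' 97 0 = a ^ 2 ^ j"
 have b: "abs (a ^ 2 ^ j) < 2 ^ (64 * 2 ^ be - 1)" using j s(4) by (intro abs_pow_less) auto
 have bL: "abs (a ^ 2 ^ j) < 2 ^ L" using pow_less_L[OF _ b] L_ge(7) by linarith
 have nL: "nv < 2 ^ L" using L_ge by (intro less_L)
 show "runs pow_body s' (pow_body_wt * V\<^sub>0) (%s''. same (mulc_mods Un {97, 98} - {98}) s'' s' & s'' 97 0 = a ^ 2 ^ Suc j)"
  unfolding pow_body_def pow_body_wt_def
 proof (rule runs_SeqV[OF runs_mulcV[where x = "a ^ 2 ^ j" and y = "a ^ 2 ^ j"]])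
  show "wp L (mulc_init (Var 97) (Var 97) (Var 60))
  (%s''. s'' = s'(10 := (s' 10)(2 := a ^ 2 ^ j, 3 := a ^ 2 ^ j), 32 := (s' 32)(0 := int nv))) s'"
  using J s' bL nL by (simp add: mulc_init_def globalsD)
  fix s1
  assume s1: "s1 11 1 = a ^ 2 ^ j * a ^ 2 ^ j & same mulc_mods s1 s'"
  have e: "a ^ 2 ^ j * a ^ 2 ^ j = a ^ 2 ^ Suc j" by (simp add: mult_2 flip: power_add)
  have "abs (a ^ 2 ^ j * a ^ 2 ^ j) < 2 ^ L"
  proof -
  have "abs (a ^ 2 ^ j * a ^ 2 ^ j) < 2 ^ (64 * 2 ^ be - 1) * 2 ^ (64 * 2 ^ be - 1)" unfolding abs_mult using b by (intro mult_strict_mono) auto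
  also have "... = (2::int) ^ (64 * 2 ^ be - 1 + (64 * 2 ^ be - 1))" by (rule power_add[symmetric])
  finally show ?thesis by (rule pow_less_L[rotated]) (use L_ge(7) in linarith)
  qed
  moreover have "same (mulc_mods Un {97, 98} - {98}) s1 s'" using s1 unfolding same_def by simp
  ultimately show "runs (Assign 97 (Read 11 (Const 1))) s1 (wt (Assign 97 (Read 11 (Const 1))) * V\<^sub>0)
  (%s''. same (mulc_mods Un {97, 98} - {98}) s'' s' & s'' 97 0 = a ^ 2 ^ Suc j)"
  using s1 unfolding e by (intro runs_wpV[OF _ V(1)]) simp
 qed (use b in simp_all)
next
 have "(sg - 0 + 1) * pow_wt * V\<^sub>0 <= X * pow_wt * V\<^sub>0" using sg_le X by (intro mult_le_mono1) simp
 also have "... = pow_wt * V" by (simp add: V(2)[symmetric])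
 finally show "(sg - 0 + 1) * (pow_body_wt + for_wt (Const 0) (Var 61)) * V\<^sub>0 <= pow_wt * V" unfolding pow_wt_def .
qed (use s V sg_le L_ge in "auto intro!: less_L")

end

context point_class
begin

lemma compacted_cong:
 assumes "s' 88 = s 88" "s' 89 = s 89" "s' 93 = s 93"
 shows "compacted c r s' = compacted c r s"
 unfolding compacted_def entry_def assms ..

lemma runs_item:
 assumes s: "globals s" "s 61 0 = int sg" "s 87 0 = int (length (alive c))" "s 100 0 = 2 ^ sg" "s 101 0 = int b" "s 95 0 = int e"
  and b: "e < 2 ^ sg" "b <= length xs" and C: "compacted c (b + e) s"
  and v: "b + e < length (alive c) ==> abs (s 53 (2 ^ sg + int e)) < 2 ^ 2 ^ nv &
  hd_val (Suc c) (alive c ! (b + e)) = hd_val c (alive c ! (b + e)) * (xs ! (alive c ! (b + e))) ^ 2 ^ sg + s 53 (2 ^ sg + int e)"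
 shows "runs item s (item_wt * V) (%s'. same (mulc_mods Un {88, 89, 93, 96, 97, 98, 99}) s' s & compacted c (Suc (b + e)) s')"
proof -
 define r where "r = b + e"
 let ?M = "mulc_mods Un {88, 89, 93, 96, 97, 98, 99}"
 let ?Q = "%s'. same ?M s' s & compacted c (Suc r) s'"
 define s1 where "s1 = s(96 := (s 96)(0 := int r))"
 define l where "l = length (alive c)"
 have XL: "x < 2 ^ L" if "x <= 3 * degree f" for x
 proof -
  have "x < 4 * 2 ^ et" using that et by linarith
  also have "4 * (2::nat) ^ et = 2 ^ (et + 2)" by simp
  also have "... <= 2 ^ L" using X L_ge(2) by (intro power_increasing) auto
  finally show ?thesis .
 qed
 have lr: "l <= length xs" "r < 3 * degree f" "2 ^ sg <= 2 * degree f" using length_alive sg_le b xs by (simp_all add: l_def r_def)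
 hence "l <= 3 * degree f" "r <= 3 * degree f" "b <= 3 * degree f" "e <= 3 * degree f" using xs b f by linarith+
 note nL = this[THEN XL]
 have "2 ^ sg < (2::nat) ^ L" using lr by (intro XL) simp
 hence sL: "sg < L" by simp
 have "runs item s (item_wt * V) ?Q"
  unfolding item_def item_wt_def
 proof (rule runs_SeqV[where R = "%s'. s' = s1"])
  show "runs (Assign 96 (Var 95 [+] Var 101)) s (wt (Assign 96 (Var 95 [+] Var 101)) * V) (%s'. s' = s1)"
  using s nL by (intro runs_wpV[OF _ V(4)]) (simp add: s1_def r_def add.commute)
  fix s1a
  assume "s1a = s1"
  show "runs (If (Var 96 [<] Var 87) (Assign 97 (Read 1 (Read 88 (Var 96))) ;; For 98 (Const 0) (Var 61) pow_body ;;
  mulc (Read 89 (Var 96)) (Var 97) (Var 60) ;; item_end) Skip) s1a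
  ((cost_wt (Var 96 [<] Var 87) + val_wt (Var 96 [<] Var 87) + 1 + (wt (Assign 97 (Read 1 (Read 88 (Var 96)))) +
  (pow_wt + (wt (mulc_init (Read 89 (Var 96)) (Var 97) (Var 60)) + mul_wt + wt item_end))) + 1) * V) ?Q"
  unfolding `s1a = s1`
  proof (rule runs_IfV[OF _ V(4)])
  show "small L (Var 96 [<] Var 87) s1" using s nL by (simp add: s1_def l_def)
  next
  assume "val (Var 96 [<] Var 87) s1 = 0"
  hence "l <= r" using s by (simp add: s1_def l_def split: if_splits)
  hence "compacted c (Suc r) s1" using C unfolding r_def[symmetric]
  by (simp add: compacted_def l_def s1_def entry_def)
  thus "runs Skip s1 (1 * V) ?Q" using runs_wpV[OF _ V(4), of Skip ?Q s1] by (simp add: s1_def)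
  next
  assume "val (Var 96 [<] Var 87) s1 ~= 0"
  hence rl: "r < l" using s by (simp add: s1_def l_def split: if_splits)
  define j where "j = alive c ! r"
  define a where "a = xs ! j"
  define k where "k = length (filter (%j. abs (hd_val (Suc c) j) <= S) (take r (alive c)))"
  have j: "j < length xs" "abs a < 2 ^ 2 ^ Suc i" "abs (hd_val c j) <= S"
  using alive_nth[of r c] rl by (simp_all add: j_def a_def l_def in_class_def del: power_Suc)
  have ent: "s 88 (int r) = int j" "s 89 (int r) = hd_val c j" and s93: "s 93 0 = int k"
  using C rl unfolding r_def[symmetric] by (simp_all add: compacted_def entry_def Let_def l_def j_def k_def)
  \<comment> \<open>The position for writing never overtakes the one for reading, so the entries
    that wait to be processed survive.\<close>
  have kr: "k <= r" unfolding k_def by (rule order_trans[OF length_filter_le]) simp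
  have "j <= 3 * degree f" "k <= 3 * degree f" using j(1) kr xs lr by linarith+
  note jkL = this[THEN XL]
  have aL: "abs a < 2 ^ L" using abs_pt_less[OF j(1)] S_L by (simp add: a_def)
  have hL: "abs (hd_val c j) < 2 ^ L" using j(3) S_L by linarith
  have xs1: "s1 1 (int j) = a" using globalsD(7)[OF s(1) j(1)] by (simp add: s1_def a_def)
  define s2 where "s2 = s1(97 := (s1 97)(0 := a))"
  show "runs (Assign 97 (Read 1 (Read 88 (Var 96))) ;; For 98 (Const 0) (Var 61) pow_body ;; mulc (Read 89 (Var 96)) (Var 97) (Var 60) ;; item_end) s1
  ((wt (Assign 97 (Read 1 (Read 88 (Var 96)))) + (pow_wt + (wt (mulc_init (Read 89 (Var 96)) (Var 97) (Var 60)) + mul_wt + wt item_end))) * V) ?Q"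
  proof (rule runs_SeqV[where R = "%s'. s' = s2"])
  show "runs (Assign 97 (Read 1 (Read 88 (Var 96)))) s1 (wt (Assign 97 (Read 1 (Read 88 (Var 96)))) * V) (%s'. s' = s2)"
  using xs1 ent nL jkL aL by (intro runs_wpV[OF _ V(4)]) (simp add: s2_def s1_def)
  fix s2a
  assume "s2a = s2"
  have s2: "globals s2" "s2 61 0 = int sg" "s2 97 0 = a" using s by (simp_all add: s2_def s1_def)
  show "runs (For 98 (Const 0) (Var 61) pow_body ;; mulc (Read 89 (Var 96)) (Var 97) (Var 60) ;; item_end) s2a
  ((pow_wt + (wt (mulc_init (Read 89 (Var 96)) (Var 97) (Var 60)) + mul_wt + wt item_end)) * V) ?Q"
  unfolding `s2a = s2`
  proof (rule runs_SeqV[OF runs_pow[OF s2 j(2)]])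
  fix s3
  assume s3: "same (mulc_mods Un {97, 98}) s3 s2 & s3 97 0 = a ^ 2 ^ sg"
  note s3' = sameD[OF conjunct1[OF s3]]
  define y where "y = a ^ 2 ^ sg"
  have bs: "abs (hd_val c j) < 2 ^ (64 * 2 ^ be - 1)" "abs y < 2 ^ (64 * 2 ^ be - 1)"
  proof -
  have "(1::nat) <= 2 ^ be" by simp
  hence "(2::int) ^ 2 ^ be <= 2 ^ (64 * 2 ^ be - 1)" by (intro power_increasing) linarith+
  thus "abs (hd_val c j) < 2 ^ (64 * 2 ^ be - 1)" using j(3) S_less by linarith
  show "abs y < 2 ^ (64 * 2 ^ be - 1)" unfolding y_def by (rule abs_pow_less[OF j(2) order_refl])
  qed
  have yL: "abs y < 2 ^ L" by (rule pow_less_L[OF _ bs(2)]) (use L_ge(7) in linarith)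
  have hyL: "abs (hd_val c j * y) < 2 ^ (2 ^ nv)"
  proof -
  have "abs (hd_val c j * y) < 2 ^ (64 * 2 ^ be - 1) * 2 ^ (64 * 2 ^ be - 1)" unfolding abs_mult using bs by (intro mult_strict_mono) auto
  also have "... = (2::int) ^ (64 * 2 ^ be - 1 + (64 * 2 ^ be - 1))" by (rule power_add[symmetric])
  also have "... <= 2 ^ 2 ^ nv" by (intro power_increasing) (simp_all add: nv_def power_add)
  finally show ?thesis .
  qed
  show "runs (mulc (Read 89 (Var 96)) (Var 97) (Var 60) ;; item_end) s3
  ((wt (mulc_init (Read 89 (Var 96)) (Var 97) (Var 60)) + mul_wt + wt item_end) * V) ?Q"
  proof (rule runs_SeqV[OF runs_mono[OF runs_mulcV[where x = "hd_val c j" and y = y]]])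
  have "s3 89 (int r) = hd_val c j" "s3 97 0 = y" "s3 96 0 = int r" "s3 60 0 = int nv"
  using ent s3 s globalsD(4)[OF s2(1)] by (simp_all add: s3' s2_def s1_def y_def)
  moreover have "nv < 2 ^ L" using L_ge by (intro less_L)
  ultimately show "wp L (mulc_init (Read 89 (Var 96)) (Var 97) (Var 60))
  (%s'. s' = s3(10 := (s3 10)(2 := hd_val c j, 3 := y), 32 := (s3 32)(0 := int nv))) s3"
  using hL yL nL by (simp add: mulc_init_def)
  next
  fix s4
  assume s4: "s4 11 1 = hd_val c j * y & same mulc_mods s4 s3"
  have s4': "s4 q = s q" if "q ~: mulc_mods Un {96, 97, 98}" for q
  using sameD[OF conjunct2[OF s4], of q] s3'[of q] that by (simp add: s2_def s1_def)
  define T where "T = hd_val (Suc c) j"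
  have T: "T = s4 11 1 + s4 53 (int e + 2 ^ sg)" "abs (s4 53 (int e + 2 ^ sg)) < 2 ^ 2 ^ nv"
  using v rl s4 unfolding r_def[symmetric] l_def by (simp_all add: T_def s4' j_def a_def y_def add.commute)
  have TL: "abs T < 2 ^ L"
  proof -
  have "abs T < 2 ^ (2 ^ nv + 1)" using T hyL s4 by (simp add: abs_less_iff)
  thus ?thesis by (rule pow_less_L[rotated]) (use X in "simp add: L_def")
  qed
  have vL: "abs (s4 11 1) < 2 ^ L" "abs (s4 53 (int e + 2 ^ sg)) < 2 ^ L"
  using pow_less_L[OF L_ge(1) hyL] pow_less_L[OF L_ge(1) T(2)] s4 by simp_all
  have v4: "s4 95 0 = int e" "s4 100 0 = 2 ^ sg" "s4 96 0 = int r" "s4 80 0 = S" "s4 93 0 = int k" "s4 88 (int r) = int j"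
  using s s93 ent globalsD(1)[OF s(1)] sameD[OF conjunct2[OF s4], of 96] by (simp_all add: s4' s3' s2_def s1_def)
  have sm: "same ?M s4 s" using s4' unfolding same_def by simp
  define s5 where "s5 = s4(99 := (s4 99)(0 := T))"
  define s6 where "s6 = s5(88 := (s5 88)(int k := int j), 89 := (s5 89)(int k := T), 93 := (s5 93)(0 := int k + 1))"
  have C4: "!!j'. j' < k ==> entry (Suc c) s5 j' (filter (%j. abs (hd_val (Suc c) j) <= S) (take r (alive c)) ! j')"
  "!!j'. r <= j' ==> j' < l ==> entry c s5 j' (alive c ! j')"
  using C unfolding r_def[symmetric] by (simp_all add: compacted_def entry_def Let_def l_def k_def s5_def s4')
  have tk: "take (Suc r) (alive c) = take r (alive c) @ [j]" unfolding j_def by (rule take_Suc_conv_app_nth) (use rl in "simp add: l_def")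
  have "compacted c (Suc r) (if abs T <= S then s6 else s5)"
  proof (cases "abs T <= S")
  case True
  have "entry (Suc c) s6 j' ((filter (%j. abs (hd_val (Suc c) j) <= S) (take r (alive c)) @ [j]) ! j')" if "j' < Suc k" for j'
  using C4(1)[of j'] that by (cases "j' = k") (simp_all add: entry_def s6_def s5_def k_def[symmetric] nth_append T_def)
  moreover have "entry c s6 j' (alive c ! j')" if "Suc r <= j'" "j' < l" for j'
  using C4(2)[of j'] that kr by (simp add: entry_def s6_def)
  ultimately show ?thesis using True unfolding compacted_def tk Let_def
  by (simp add: T_def[symmetric] k_def[symmetric] l_def[symmetric]) (simp add: s6_def)
  next
  case False
  thus ?thesis using C4 unfolding compacted_def tk Let_def
  by (simp add: T_def[symmetric] k_def[symmetric] l_def[symmetric]) (simp add: s5_def v4)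
  qed
  moreover have "same ?M (if abs T <= S then s6 else s5) s" using sm by (simp add: s6_def s5_def)
  ultimately have "wp L item_end ?Q s4"
  using v4 vL TL S_L S_ge(2) nL jkL sL T(1)
  by (simp add: item_end_def keep_def s6_def s5_def abs_le_iff split: if_splits) auto
  thus "runs item_end s4 (wt item_end * V) ?Q" by (rule runs_wpV[OF _ V(4)])
  qed (use bs in "auto intro: mult_le_mono2 V")
  qed
  qed
  qed
 qed
 thus ?thesis by (simp add: r_def)
qed

end

section \<open>Groups of points and blocks of coefficients\<close>

definition fill_body :: prog where
 "fill_body = If (Var 95 [+] Var 101 [<] Var 87) (Write 50 (Var 95) (Read 1 (Read 88 (Var 95 [+] Var 101)))) (Write 50 (Var 95) (Const 0))"

definition group :: prog where
 "group = (Assign 101 (Var 94 [<<] Var 61) ;; For 95 (Const 0) (Var 100) fill_body ;; block_eval ;; For 95 (Const 0) (Var 100) item)"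

definition group_wt :: nat where
 "group_wt = wt (Assign 101 (Var 94 [<<] Var 61)) + (2 * (wt fill_body + for_wt (Const 0) (Var 100)) + (block_wt + 2 * (item_wt + for_wt (Const 0) (Var 100))))"

definition group_count :: expr where
 "group_count = ((Var 87 [+] Var 100 [-] Const 1) [>>] Var 61)"

definition block_vars :: prog where
 "block_vars = (Assign 70 (Read 2 (Const 0) [-] (Var 92 [<<] Var 61)) ;; Assign 93 (Const 0))"

definition block_step :: prog where
 "block_step = (block_vars ;; For 94 (Const 0) group_count group ;; Assign 87 (Var 93))"

definition block_step_wt :: nat where
 "block_step_wt = wt block_vars + group_wt + for_wt (Const 0) group_count + wt (Assign 87 (Var 93))"

definition block_count :: expr where
 "block_count = ((Read 2 (Const 0) [>>] Var 61) [+] Const 1)"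

context point_class
begin

abbreviation group_mods :: "nat set" where
 "group_mods == block_mods Un {50, 88, 89, 93, 95, 96, 97, 98, 99, 101}"

definition U :: nat where "U = 2 ^ sg * V"

lemma compacted_upd [simp]: "k ~: {88, 89, 93} ==> compacted c r (s(k := h)) = compacted c r s"
 by (rule compacted_cong) auto

lemma less_L_deg: "x <= 3 * degree f ==> x < 2 ^ L"
proof -
 assume "x <= 3 * degree f"
 hence "x < 4 * 2 ^ et" using et by linarith
 also have "4 * (2::nat) ^ et = 2 ^ (et + 2)" by simp
 also have "... <= 2 ^ L" using X L_ge(2) by (intro power_increasing) auto
 finally show ?thesis .
qed

lemma sg_L: "sg < L" "2 ^ sg < (2::nat) ^ L"
proof -
 show "2 ^ sg < (2::nat) ^ L" using sg_le by (intro less_L_deg) simp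
 thus "sg < L" by simp
qed

lemma U: "(2 ^ sg + 1) * (w * V) <= 2 * w * U" "V <= U"
proof -
 have "(2 ^ sg + 1) * (w * V) <= (2 * 2 ^ sg) * (w * V)" by (intro mult_le_mono1) simp
 thus "(2 ^ sg + 1) * (w * V) <= 2 * w * U" by (simp add: U_def algebra_simps)
 show "V <= U" by (simp add: U_def)
qed

text \<open>An incomplete last group is filled up with the point 0, and the values obtained there
  are ignored by \<open>item\<close>.\<close>

lemma runs_fill:
 assumes s: "globals s" "s 61 0 = int sg" "s 87 0 = int (length (alive c))" "s 100 0 = 2 ^ sg" "s 101 0 = int b"
  and b: "b <= length xs" and C: "compacted c b s"
 shows "runs (For 95 (Const 0) (Var 100) fill_body) s (2 * (wt fill_body + for_wt (Const 0) (Var 100)) * U)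
  (%s'. same {50, 95} s' s & (ALL e < 2 ^ sg. s' 50 (int e) = (if b + e < length (alive c) then xs ! (alive c ! (b + e)) else 0)))"
proof -
 have L: "2 ^ sg <= 2 * degree f" "length (alive c) <= degree f" "b <= degree f" using sg_le length_alive[of c] xs b by linarith+
 have "runs (For 95 (Const 0) (Var 100) fill_body) s ((2 ^ sg - 0 + 1) * ((wt fill_body + for_wt (Const 0) (Var 100)) * (L + 1)))
  (%s'. same (insert 50 {95}) s' s & (ALL e. s' 50 (int e) = (if 0 <= e & e < 2 ^ sg
  then if b + e < length (alive c) then xs ! (alive c ! (b + e)) else 0 else s 50 (int e))))"
 proof (rule runs_map_wp)
  fix e s1
  assume e: "e < 2 ^ sg" and s1: "same (insert 50 {95}) s1 s" "s1 95 0 = int e"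
  have s1': "s1 k = s k" if "k ~: {50, 95}" for k using sameD[OF s1(1)] that by simp
  have "e <= 3 * degree f" "b <= 3 * degree f" "length (alive c) <= 3 * degree f" using L e by linarith+
  note eL = this[THEN less_L_deg]
  have n: "s 88 (int (b + e)) = int (alive c ! (b + e))" "alive c ! (b + e) < 2 ^ L" "s 1 (int (alive c ! (b + e))) = xs ! (alive c ! (b + e))"
  "abs (xs ! (alive c ! (b + e))) < 2 ^ L" if "b + e < length (alive c)"
  proof -
  note j = alive_nth[OF that]
  show "s 88 (int (b + e)) = int (alive c ! (b + e))" using C that by (simp add: compacted_def entry_def Let_def del: of_nat_add)
  show "alive c ! (b + e) < 2 ^ L" using j xs by (intro less_L_deg) linarith
  show "s 1 (int (alive c ! (b + e))) = xs ! (alive c ! (b + e))" using globalsD(7)[OF s(1)] j by blast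
  show "abs (xs ! (alive c ! (b + e))) < 2 ^ L" using abs_pt_less[of "alive c ! (b + e)"] j S_L by linarith
  qed
  show "wp L fill_body (%s'. same (insert 50 {95}) s' s & s' 95 0 = int e &
  s' 50 (int e) = (if b + e < length (alive c) then xs ! (alive c ! (b + e)) else 0) & (ALL i. i ~= e --> s' 50 (int i) = s1 50 (int i))) s1"
  using s s1 eL n by (simp add: fill_body_def s1' add.commute)
 next
  fix s1
  assume "same (insert 50 {95}) s1 s"
  thus "small L (Var 100) s1 & val (Var 100) s1 = int (2 ^ sg)" using sameD[of _ s1 s 100] s sg_L by simp
 qed (use sg_L in simp_all)
 thus ?thesis
 proof (rule runs_mono)
  have "(2 ^ sg - 0 + 1) * ((wt fill_body + for_wt (Const 0) (Var 100)) * (L + 1)) <= (2 ^ sg + 1) * ((wt fill_body + for_wt (Const 0) (Var 100)) * V)"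
  using V(4) by (intro mult_le_mono mult_le_mono2) auto
  thus "(2 ^ sg - 0 + 1) * ((wt fill_body + for_wt (Const 0) (Var 100)) * (L + 1)) <= 2 * (wt fill_body + for_wt (Const 0) (Var 100)) * U"
  using U(1) order_trans by blast
 qed auto
qed

lemma runs_group:
 assumes s: "globals s" "s 61 0 = int sg" "s 87 0 = int (length (alive c))" "s 100 0 = 2 ^ sg" "s 94 0 = int g"
  and z: "s 70 0 = int (degree f) - int (c * 2 ^ sg)" "c * 2 ^ sg <= degree f"
  and g: "g * 2 ^ sg <= length xs" and C: "compacted c (g * 2 ^ sg) s"
 shows "runs group s (group_wt * U) (%s'. same group_mods s' s & compacted c (Suc g * 2 ^ sg) s')"
proof -
 define b where "b = g * 2 ^ sg"
 define W where "W = item_wt + for_wt (Const 0) (Var 100)"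
 let ?Q = "%s'. same group_mods s' s & compacted c (Suc g * 2 ^ sg) s'"
 have sQ: "Suc g * 2 ^ sg = b + 2 ^ sg" by (simp add: b_def)
 have "g * 1 <= g * 2 ^ sg" by (rule mult_le_mono2) simp
 hence gL: "g < 2 ^ L" using g xs by (intro less_L_deg) linarith
 have bl: "b <= length xs" using g by (simp add: b_def)
 define s1 where "s1 = s(101 := (s 101)(0 := int b))"
 have s1: "globals s1" "s1 61 0 = int sg" "s1 87 0 = int (length (alive c))" "s1 100 0 = 2 ^ sg" "s1 101 0 = int b" "compacted c b s1"
  using s C compacted_cong[of s1 s] by (simp_all add: s1_def b_def)
 show ?thesis
  unfolding group_def group_wt_def
 proof (rule runs_SeqV[where R = "%s'. s' = s1"])
  show "runs (Assign 101 (Var 94 [<<] Var 61)) s (wt (Assign 101 (Var 94 [<<] Var 61)) * U) (%s'. s' = s1)"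
  proof (rule runs_wpV[of L])
  show "wp L (Assign 101 (Var 94 [<<] Var 61)) (%s'. s' = s1) s" using s gL sg_L less_L[of sg] by (simp add: s1_def b_def)
  show "L + 1 <= U" using V(4) U(2) by linarith
  qed
  fix s1a
  assume "s1a = s1"
  show "runs (For 95 (Const 0) (Var 100) fill_body ;; block_eval ;; For 95 (Const 0) (Var 100) item) s1a
  ((2 * (wt fill_body + for_wt (Const 0) (Var 100)) + (block_wt + 2 * (item_wt + for_wt (Const 0) (Var 100)))) * U) ?Q"
  unfolding `s1a = s1` W_def[symmetric]
  proof (rule runs_SeqV[OF runs_fill[OF s1(1-5) bl s1(6)]])
  fix s2
  assume s2: "same {50, 95} s2 s1 & (ALL e < 2 ^ sg. s2 50 (int e) = (if b + e < length (alive c) then xs ! (alive c ! (b + e)) else 0))"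
  note s2' = sameD[OF conjunct1[OF s2]]
  have gl2: "globals s2" by (rule globals_same[OF s1(1) conjunct1[OF s2]]) simp
  have v2: "s2 61 0 = int sg" "s2 87 0 = int (length (alive c))" "s2 100 0 = 2 ^ sg" "s2 101 0 = int b" "compacted c b s2"
  using s1 compacted_cong[of s2 s1] by (simp_all add: s2')
  define z0 where "z0 = int (degree f) - int (c * 2 ^ sg)"
  have F: "s2 0 (z0 - int u) = (if c * 2 ^ sg + u <= degree f then coeff f (degree f - (c * 2 ^ sg + u)) else 0)" for u
  proof (cases "c * 2 ^ sg + u <= degree f")
  case True
  define k where "k = degree f - (c * 2 ^ sg + u)"
  have "z0 - int u = int k" unfolding z0_def k_def using True by linarith
  thus ?thesis unfolding globalsD(8)[OF gl2] k_def[symmetric] using True by simp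
  next
  case False
  hence "~ 0 <= z0 - int u" unfolding z0_def by linarith
  thus ?thesis unfolding globalsD(8)[OF gl2] using False by simp
  qed
  show "runs (block_eval ;; For 95 (Const 0) (Var 100) item) s2 ((block_wt + 2 * W) * U) ?Q"
  proof (rule runs_SeqV[OF runs_mono[OF runs_block_eval[where nv = nv and sg = sg and z = z0 and X = X and l = "2 ^ Suc i" and B = "2 ^ be"]]])
  show "s2 60 0 = int nv" "s2 61 0 = int sg" using globalsD(4)[OF gl2] v2 by simp_all
  show "s2 70 0 = z0" using z by (simp add: s2' s1_def z0_def)
  have "degree f < 2 ^ X"
  proof -
  have "(2::nat) ^ et <= 2 ^ X" using X by (intro power_increasing) auto
  thus ?thesis using et by linarith
  qed
  hence "int (degree f) < 2 ^ X" by simp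
  thus "abs z0 < 2 ^ X" using z(2) unfolding z0_def by linarith
  show "nv + sg + 4 <= X" using X sg_le(2) by (simp add: nv_def)
  show "abs (s2 50 (int e)) <= 2 ^ 2 ^ Suc i" if "e < 2 ^ sg" for e
  using s2 that alive_nth[of "b + e" c] unfolding in_class_def by auto
  show "abs (s2 0 (z0 - int u)) <= 2 ^ 2 ^ be" for u
  proof -
  have "abs (s2 0 (z0 - int u)) <= S" unfolding F using abs_coeff_le S_ge(2) by auto
  thus ?thesis using S_less by linarith
  qed
  show "(2 * 2 ^ Suc i + 3) * 2 ^ sg + 2 ^ be + 4 <= (2::nat) ^ nv" by (rule block_size)
  show "block_wt * (2 ^ (nv + sg) * X ^ 6) <= block_wt * U" by (simp add: U_def V_def power_add)
  next
  fix s3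
  assume s3: "same block_mods s3 s2 & (ALL e<2 ^ sg. abs (s3 53 (2 ^ sg + int e)) < 2 ^ 2 ^ nv &
  s3 53 (2 ^ sg + int e) = (SUM u<2 ^ sg. s2 0 (z0 - int u) * s2 50 (int e) ^ (2 ^ sg - 1 - u)))"
  note s3' = sameD[OF conjunct1[OF s3]]
  have gl3: "globals s3" by (rule globals_same[OF gl2 conjunct1[OF s3]]) simp
  have v3: "s3 61 0 = int sg" "s3 87 0 = int (length (alive c))" "s3 100 0 = 2 ^ sg" "s3 101 0 = int b" "compacted c b s3"
  using v2 compacted_cong[of s3 s2] by (simp_all add: s3')
  have val3: "abs (s3 53 (2 ^ sg + int e)) < 2 ^ 2 ^ nv &
  hd_val (Suc c) (alive c ! (b + e)) = hd_val c (alive c ! (b + e)) * (xs ! (alive c ! (b + e))) ^ 2 ^ sg + s3 53 (2 ^ sg + int e)"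
  if "e < 2 ^ sg" "b + e < length (alive c)" for e
  proof -
  have "Suc c * 2 ^ sg = c * 2 ^ sg + 2 ^ sg" by simp
  moreover have "s2 50 (int e) = xs ! (alive c ! (b + e))" using s2 that by simp
  ultimately have "hd_val (Suc c) (alive c ! (b + e)) = hd_val c (alive c ! (b + e)) * (xs ! (alive c ! (b + e))) ^ 2 ^ sg + s3 53 (2 ^ sg + int e)"
  using s3 that(1) unfolding hd_val_def by (simp only: head_add F[symmetric])
  thus ?thesis using s3 that(1) by blast
  qed
  let ?N = "mulc_mods Un {88, 89, 93, 95, 96, 97, 98, 99}"
  show "runs (For 95 (Const 0) (Var 100) item) s3 (2 * W * U) ?Q"
  proof (rule runs_mono[OF runs_ForS[where L = L and V = V and K = item_wt and a = 0 and b = "2 ^ sg" and M = ?N and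
  J = "%e. compacted c (b + e)"]])
  fix e s4
  assume sm: "same ?N s4 s3"
  note s4' = sameD[OF sm]
  show "small L (Var 100) s4 & val (Var 100) s4 = int (2 ^ sg)" using v3 sg_L by (simp add: s4')
  assume e: "e < 2 ^ sg" and I: "s4 95 0 = int e" "compacted c (b + e) s4"
  show "runs item s4 (item_wt * V) (%s'. same (?N - {95}) s' s4 & compacted c (b + Suc e) s')"
  proof (rule runs_mono[OF runs_item[where c = c and b = b and e = e]])
  show "globals s4" by (rule globals_same[OF gl3 sm]) simp
  qed (use I e v3 bl val3[of e] in "auto simp: s4' same_def")
  next
  have "(2 ^ sg - 0 + 1) * (item_wt + for_wt (Const 0) (Var 100)) * V = (2 ^ sg + 1) * (W * V)" by (simp only: W_def diff_zero mult.assoc)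
  thus "(2 ^ sg - 0 + 1) * (item_wt + for_wt (Const 0) (Var 100)) * V <= 2 * W * U" using U(1) by simp
  next
  fix s4
  assume s4: "same ?N s4 s3 & compacted c (b + 2 ^ sg) s4"
  have "same group_mods s4 s" using s4 s3 s2 unfolding same_def by (simp add: s1_def)
  thus "same group_mods s4 s & compacted c (Suc g * 2 ^ sg) s4" using s4 unfolding sQ by blast
  qed (use v3 V sg_L in simp_all)
  qed
  qed
 qed
qed

end

context point_class
begin

abbreviation class_mods :: "nat set" where
 "class_mods == group_mods Un {70, 87, 92, 94}"

definition stored :: "nat => store => bool" where
 "stored c s = (s 87 0 = int (length (alive c)) & (ALL j<length (alive c). entry c s j (alive c ! j)))"

definition groups :: "nat => nat" where "groups c = (length (alive c) + 2 ^ sg - 1) div 2 ^ sg"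

lemma groups_le: "groups 0 <= degree f div 2 ^ sg + 1" "groups (Suc c) <= 1"
proof -
 have "groups 0 <= (degree f + 2 ^ sg) div 2 ^ sg"
  unfolding groups_def using length_alive[of 0] xs by (intro div_le_mono) linarith
 thus "groups 0 <= degree f div 2 ^ sg + 1" by simp
 have "groups (Suc c) <= (2 ^ sg * 2 - 1) div 2 ^ sg"
  unfolding groups_def using length_alive_Suc[of c] by (intro div_le_mono) linarith
 also have "... < 2"
 proof (rule less_mult_imp_div_less)
  have "0 < (2::nat) ^ sg" by simp
  thus "2 ^ sg * 2 - 1 < 2 * (2::nat) ^ sg" by linarith
 qed
 finally show "groups (Suc c) <= 1" by simp
qed

lemma runs_block_step:
 assumes s: "globals s" "s 61 0 = int sg" "s 100 0 = 2 ^ sg" "s 92 0 = int c" and c: "c * 2 ^ sg <= degree f" and C: "stored c s"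
 shows "runs block_step s ((groups c + 1) * (block_step_wt * U)) (%s'. same (class_mods - {92}) s' s & stored (Suc c) s')"
proof -
 define z where "z = int (degree f) - int (c * 2 ^ sg)"
 define W where "W = (groups c - 0 + 1) * (group_wt + for_wt (Const 0) group_count)"
 let ?Q = "%s'. same (class_mods - {92}) s' s & stored (Suc c) s'"
 let ?M = "group_mods Un {94}"
 have "c * 1 <= c * 2 ^ sg" by (rule mult_le_mono2) simp
 hence cd: "c <= degree f" using c by linarith
 have la: "length (alive c) <= degree f" using length_alive[of c] xs by linarith
 have "c <= 3 * degree f" "degree f <= 3 * degree f" "length (alive c) <= 3 * degree f" using cd la by linarith+
 note L = this[THEN less_L_deg] less_L[of sg] sg_L
 have LU: "L + 1 <= U" using V(4) U(2) by linarith
 have gs: "groups c * 2 ^ sg <= length (alive c) + 2 ^ sg - 1" unfolding groups_def by (rule div_times_less_eq_dividend)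
 have ge: "length (alive c) <= groups c * 2 ^ sg"
 proof -
  have "length (alive c) + 2 ^ sg - 1 < (groups c + 1) * 2 ^ sg"
  unfolding groups_def using dividend_less_div_times[of "2 ^ sg" "length (alive c) + 2 ^ sg - 1"] by (simp add: algebra_simps)
  thus ?thesis by simp
 qed
 have bg: "g * 2 ^ sg <= length xs" if "g < groups c" for g
 proof -
  have "(g + 1) * 2 ^ sg <= groups c * 2 ^ sg" using that by (intro mult_le_mono1) simp
  hence "g * 2 ^ sg + 2 ^ sg <= length (alive c) + 2 ^ sg - 1" using gs by simp
  thus ?thesis using length_alive[of c] by linarith
 qed
 have "groups c <= groups c * 2 ^ sg" by simp
 hence "groups c <= 3 * degree f" using gs sg_le(3) la by linarith
 hence gcL: "groups c < 2 ^ L" by (rule less_L_deg)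
 have "runs block_step s ((wt block_vars + (W + wt (Assign 87 (Var 93)))) * U) ?Q"
  unfolding block_step_def
 proof (rule runs_SeqV[OF runs_wpV[where L = L and Q = "%s1. s1 = s(70 := (s 70)(0 := z), 93 := (s 93)(0 := 0))"]])
  show "wp L block_vars (%s1. s1 = s(70 := (s 70)(0 := z), 93 := (s 93)(0 := 0))) s"
  using s L globalsD(5)[OF s(1)] by (simp add: block_vars_def z_def)
  fix s1
  assume "s1 = s(70 := (s 70)(0 := z), 93 := (s 93)(0 := 0))"
  hence s1: "globals s1" "s1 61 0 = int sg" "s1 100 0 = 2 ^ sg" "s1 87 0 = int (length (alive c))" "s1 70 0 = z"
  and sm1: "same {70, 93} s1 s" and C1: "compacted c 0 s1"
  using s C by (simp_all add: stored_def compacted_def entry_def)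
  have "runs (For 94 (Const 0) group_count group) s1 (W * U) (%s'. same ?M s' s1 & compacted c (groups c * 2 ^ sg) s')"
  unfolding W_def
  proof (rule runs_ForS[where L = L and a = 0 and J = "%g. compacted c (g * 2 ^ sg)"])
  fix g s2
  assume sm: "same ?M s2 s1"
  have v2: "s2 61 0 = int sg" "s2 100 0 = 2 ^ sg" "s2 87 0 = int (length (alive c))" "s2 70 0 = z"
  using sameD[OF sm, of 61] sameD[OF sm, of 100] sameD[OF sm, of 87] sameD[OF sm, of 70] s1 by simp_all
  have "1 <= length (alive c) + (2::nat) ^ sg" using one_le_power[of "2::nat" sg] by linarith
  hence "int (length (alive c)) + 2 ^ sg - 1 = int (length (alive c) + 2 ^ sg - 1)" by (subst of_nat_diff) simp_all
  hence "val group_count s2 = int (groups c)"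
  unfolding groups_def zdiv_int by (simp add: group_count_def v2)
  moreover have "small L group_count s2" using v2 L by (simp add: group_count_def)
  ultimately show "small L group_count s2 & val group_count s2 = int (groups c)" by simp
  assume g: "g < groups c" and I: "s2 94 0 = int g" "compacted c (g * 2 ^ sg) s2"
  show "runs group s2 (group_wt * U) (%s'. same (?M - {94}) s' s2 & compacted c (Suc g * 2 ^ sg) s')"
  proof (rule runs_mono[OF runs_group[where c = c and g = g]])
  show "globals s2" by (rule globals_same[OF s1(1) sm]) simp
  show "same (?M - {94}) s3 s2 & compacted c (Suc g * 2 ^ sg) s3" if "same group_mods s3 s2 & compacted c (Suc g * 2 ^ sg) s3" for s3
  using that unfolding same_def by simp
  qed (use I v2 c bg[OF g] in "simp_all add: z_def")
  qed (use C1 gcL LU in simp_all)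
  thus "runs (For 94 (Const 0) group_count group ;; Assign 87 (Var 93)) s1 ((W + wt (Assign 87 (Var 93))) * U) ?Q"
  proof (rule runs_SeqV)
  fix s2
  assume s2: "same ?M s2 s1 & compacted c (groups c * 2 ^ sg) s2"
  define ks where "ks = alive (Suc c)"
  have C2: "s2 93 0 = int (length ks)" "!!j. j < length ks ==> entry (Suc c) s2 j (ks ! j)"
  using s2 ge by (simp_all add: compacted_def Let_def ks_def)
  have "length ks <= 3 * degree f" using length_alive[of "Suc c"] xs unfolding ks_def by linarith
  hence kL: "length ks < 2 ^ L" by (rule less_L_deg)
  have "same (class_mods - {92}) s2 s" using s2 sm1 unfolding same_def by simp
  thus "runs (Assign 87 (Var 93)) s2 (wt (Assign 87 (Var 93)) * U) ?Q"
  using C2 kL by (intro runs_wpV[OF _ LU]) (simp add: stored_def ks_def[symmetric] entry_def del: alive.simps)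
  qed
 qed (rule LU)
 thus ?thesis
 proof (rule runs_mono)
  have "(wt block_vars + (W + wt (Assign 87 (Var 93)))) * U <= ((groups c + 1) * block_step_wt) * U"
  by (intro mult_le_mono1) (simp add: W_def block_step_wt_def algebra_simps)
  thus "(wt block_vars + (W + wt (Assign 87 (Var 93)))) * U <= (groups c + 1) * (block_step_wt * U)"
  by (simp only: mult.assoc)
 qed
qed

text \<open>With \<open>q = degree f div 2 ^ sg\<close>, the first block needs at most
  \<open>q + 1\<close> groups and each of the \<open>q\<close> later ones at most one, so the sum of
  all \<open>groups c + 1\<close> is at most \<open>3 * q + 2\<close>. A group costs a multiple of
  \<open>2 ^ sg * V\<close>. Since \<open>q * 2 ^ sg <= degree f\<close> and
  \<open>2 ^ sg <= 2 * degree f\<close>, the total is linear in the degree.\<close>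

lemma runs_blocks:
 assumes s: "globals s" "s 61 0 = int sg" "s 100 0 = 2 ^ sg" and C: "stored 0 s"
 shows "runs (For 92 (Const 0) block_count block_step) s ((15 * block_step_wt + 6 * for_wt (Const 0) block_count) * (degree f * V))
  (%s'. same class_mods s' s & stored (degree f div 2 ^ sg + 1) s')"
proof -
 define q where "q = degree f div 2 ^ sg"
 define w where "w = for_wt (Const 0) block_count"
 have qs: "q * 2 ^ sg <= degree f" unfolding q_def by (rule div_times_less_eq_dividend)
 have "q * 1 <= q * 2 ^ sg" by (rule mult_le_mono2) simp
 hence "q + 1 <= 3 * degree f" using qs f by linarith
 hence qL: "q + 1 < 2 ^ L" by (rule less_L_deg)
 have dL: "degree f < 2 ^ L" by (rule less_L_deg) simp
 have "runs (For 92 (Const 0) block_count block_step) s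
  ((SUM c=0..<q + 1. (groups c + 1) * (block_step_wt * U)) + (q + 1 - 0 + 1) * (w * (L + 1)))
  (%s'. s' 92 0 = int (q + 1) & q + 1 <= q + 1 & same class_mods s' s & stored (q + 1) s')"
  unfolding w_def
 proof (rule runs_For_sum[where I = "%c s'. s' 92 0 = int c & c <= q + 1 & same class_mods s' s & stored c s'"])
  show "(s(92 := (s 92)(0 := int 0))) 92 0 = int 0 & 0 <= q + 1 & same class_mods (s(92 := (s 92)(0 := int 0))) s &
  stored 0 (s(92 := (s 92)(0 := int 0)))"
  using C by (simp add: stored_def entry_def)
  fix c s1
  assume I: "s1 92 0 = int c & c <= q + 1 & same class_mods s1 s & stored c s1"
  hence sm: "same class_mods s1 s" by blast
  have gl: "globals s1" by (rule globals_same[OF s(1) sm]) simp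
  have v1: "s1 61 0 = int sg" "s1 100 0 = 2 ^ sg" using sameD[OF sm, of 61] sameD[OF sm, of 100] s by simp_all
  have "c < 2 ^ L" using I qL by linarith
  thus "s1 92 0 = int c & abs (int c) < 2 ^ L" using I by simp
  have "int (degree f) div 2 ^ sg = int q" by (simp add: q_def zdiv_int)
  thus "small L block_count s1 & val block_count s1 = int (q + 1)"
  using v1 globalsD(5)[OF gl] dL less_L[of sg] sg_L by (simp add: block_count_def)
  assume c: "c < q + 1"
  hence "c * 2 ^ sg <= q * 2 ^ sg" by (intro mult_le_mono1) simp
  hence cd: "c * 2 ^ sg <= degree f" using qs by linarith
  show "runs block_step s1 ((groups c + 1) * (block_step_wt * U)) (%s'. s' 92 0 = int c & ((s'(92 := (s' 92)(0 := int c + 1))) 92 0 = int (Suc c) &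
  Suc c <= q + 1 & same class_mods (s'(92 := (s' 92)(0 := int c + 1))) s & stored (Suc c) (s'(92 := (s' 92)(0 := int c + 1)))))"
  proof (rule runs_mono[OF runs_block_step[OF gl v1 _ cd]])
  fix s2
  assume s2: "same (class_mods - {92}) s2 s1 & stored (Suc c) s2"
  have "same class_mods s2 s" using s2 sm unfolding same_def by simp
  moreover have "s2 92 0 = int c" using s2 I unfolding same_def by simp
  ultimately show "s2 92 0 = int c & ((s2(92 := (s2 92)(0 := int c + 1))) 92 0 = int (Suc c) &
  Suc c <= q + 1 & same class_mods (s2(92 := (s2 92)(0 := int c + 1))) s & stored (Suc c) (s2(92 := (s2 92)(0 := int c + 1))))"
  using c s2 by (simp add: stored_def entry_def del: alive.simps)
  qed (use I in simp_all)
 qed simp_all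
 thus ?thesis
 proof (rule runs_mono)
  have "(SUM c=0..<q + 1. (groups c + 1) * (block_step_wt * U)) = (SUM c<q + 1. groups c + 1) * (block_step_wt * U)"
  by (simp only: sum_distrib_right atLeast0LessThan)
  also have "(SUM c<q + 1. groups c + 1) = groups 0 + 1 + (SUM c<q. groups (Suc c) + 1)"
  unfolding Suc_eq_plus1[symmetric] sum.lessThan_Suc_shift ..
  also have "... <= q + 2 + (SUM c<q. 2)"
  proof (rule add_mono)
  show "groups 0 + 1 <= q + 2" using groups_le(1) by (simp add: q_def)
  show "(SUM c<q. groups (Suc c) + 1) <= (SUM c<q. 2)" using groups_le(2) by (intro sum_mono) simp
  qed
  finally have 1: "(SUM c=0..<q + 1. (groups c + 1) * (block_step_wt * U)) <= (3 * q + 2) * (block_step_wt * U)"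
  by (simp add: mult_le_mono1)
  have "q * U <= degree f * V" using mult_le_mono1[OF qs, of V] by (simp add: U_def mult.assoc)
  moreover have "U <= 2 * degree f * V" unfolding U_def using sg_le(3) by (rule mult_le_mono1)
  ultimately have 2: "(3 * q + 2) * U <= 7 * (degree f * V)" by (simp add: algebra_simps)
  have "(q + 1 - 0 + 1) * (w * (L + 1)) <= (3 * degree f) * (w * V)"
  using V(4) `q * 1 <= q * 2 ^ sg` qs f by (intro mult_le_mono mult_le_mono2) linarith+
  thus "(SUM c=0..<q + 1. (groups c + 1) * (block_step_wt * U)) + (q + 1 - 0 + 1) * (w * (L + 1))
  <= (15 * block_step_wt + 6 * for_wt (Const 0) block_count) * (degree f * V)"
  using 1 mult_le_mono2[OF 2, of block_step_wt] unfolding w_def[symmetric] by (simp add: algebra_simps)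
 qed (simp add: q_def)
qed

end

section \<open>One pass over a size class\<close>

definition class_init :: prog where
 "class_init = (Assign 86 (Const 1 [<<] (Const 1 [<<] (Var 84 [+] Const 1))) ;; Assign 61 (Var 82 [+] Const 3 [-] Var 84) ;;
  If (Var 83 [<] Var 61) (Assign 61 (Var 83)) Skip ;; Assign 100 (Const 1 [<<] Var 61) ;; Assign 87 (Const 0))"

definition collect_body :: prog where
 "collect_body = (Assign 91 (Read 1 (Var 90)) ;; If (Var 91 [<] Const 0) (Assign 91 (Const 0 [-] Var 91)) Skip ;;
  If (Var 91 [<] Var 85) Skip (If (Var 91 [<] Var 86)
  (Write 88 (Var 87) (Var 90) ;; Write 89 (Var 87) (Const 0) ;; Assign 87 (Var 87 [+] Const 1)) Skip))"

definition out_body :: prog where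
 "out_body = If (Read 89 (Var 90)) Skip (Write 3 (Read 88 (Var 90)) (Const 1))"

definition class_body :: prog where
 "class_body = (class_init ;; For 90 (Const 0) (Read 2 (Const 1)) collect_body ;; For 92 (Const 0) block_count block_step ;;
  For 90 (Const 0) (Var 87) out_body ;; Assign 85 (Var 86))"

definition class_wt :: nat where
 "class_wt = wt class_init + 2 * (wt collect_body + for_wt (Const 0) (Read 2 (Const 1))) + (15 * block_step_wt + 6 * for_wt (Const 0) block_count)
  + 2 * (wt out_body + for_wt (Const 0) (Var 87)) + wt (Assign 85 (Var 86))"

text \<open>The invariant of the loop over the classes. Undecided points still have the initial
  content 0, so only roots ever have to be written.\<close>

definition (in root_test) output_below :: "int => store => bool" where
 "output_below b s = ((ALL j<length xs. s 3 (int j) = (if abs (xs ! j) < b & poly f (xs ! j) = 0 then 1 else 0)))"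

context point_class
begin

text \<open>After \<open>degree f div 2 ^ sg + 1\<close> blocks all coefficients have been used. The
  surplus terms of the last block multiply the value by a power of the point, which is nonzero in
  every class.\<close>

lemma head_zero_iff:
 assumes "j < length xs" "in_class j"
 shows "hd_val (degree f div 2 ^ sg + 1) j = 0 \<longleftrightarrow> poly f (xs ! j) = 0"
proof -
 have "degree f < (degree f div 2 ^ sg + 1) * 2 ^ sg" using dividend_less_div_times[of "2 ^ sg" "degree f"] by (simp add: algebra_simps)
 moreover have "xs ! j ~= 0" using assms(2) by (auto simp: in_class_def split: if_splits)
 ultimately show ?thesis by (simp add: hd_val_def head_final)
qed

lemma runs_collect:
 assumes s: "globals s" "s 85 0 = (if i = 0 then 1 else 2 ^ 2 ^ i)" "s 86 0 = 2 ^ 2 ^ Suc i" "s 87 0 = 0"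
 shows "runs (For 90 (Const 0) (Read 2 (Const 1)) collect_body) s (2 * (wt collect_body + for_wt (Const 0) (Read 2 (Const 1))) * (degree f * V))
  (%s'. same {87, 88, 89, 90, 91} s' s & stored 0 s')"
proof (rule runs_mono[OF runs_ForS[where L = L and V = V and a = 0 and b = "length xs" and K = "wt collect_body" and M = "{87, 88, 89, 90, 91}" and
  J = "%j s'. s' 87 0 = int (length (filter in_class [0..<j])) & (ALL r<length (filter in_class [0..<j]). entry 0 s' r (filter in_class [0..<j] ! r))"]])
 have dL: "j <= length xs ==> j < 2 ^ L" for j using xs by (intro less_L_deg) linarith
 show "length xs < 2 ^ L" by (rule dL) simp
 have "2 ^ Suc i <= (2::nat) ^ be" using i by (intro power_increasing) auto
 moreover have "0 < (2::nat) ^ be" by simp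
 ultimately have i2: "2 ^ Suc i < L" "2 ^ i < L" using L_ge(7) unfolding power_Suc by linarith+
 have hiL: "(2::int) ^ 2 ^ Suc i < 2 ^ L" "(2::int) ^ 2 ^ i < 2 ^ L" "(1::int) < 2 ^ L"
  using i2 L_ge(6) by (simp_all del: power_Suc)
 fix j s1
 let ?ks = "%j. filter in_class [0..<j]"
 assume sm: "same {87, 88, 89, 90, 91} s1 s"
 have gl: "globals s1" by (rule globals_same[OF s(1) sm]) simp
 show "small L (Read 2 (Const 1)) s1 & val (Read 2 (Const 1)) s1 = int (length xs)"
  using globalsD(6)[OF gl] dL[of "length xs"] by simp
 assume j: "j < length xs" "s1 90 0 = int j" and I: "s1 87 0 = int (length (?ks j)) & (ALL r<length (?ks j). entry 0 s1 r (?ks j ! r))"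
 define x where "x = xs ! j"
 define k where "k = length (?ks j)"
 have kj: "k <= j" unfolding k_def by (rule order_trans[OF length_filter_le]) simp
 have kL: "k < 2 ^ L" "j < 2 ^ L" using kj j by (intro dL; simp)+
 have xL: "abs x < 2 ^ L" using abs_pt_less[OF j(1)] S_L by (simp add: x_def)
 have v1: "s1 85 0 = (if i = 0 then 1 else 2 ^ 2 ^ i)" "s1 86 0 = 2 ^ 2 ^ Suc i" "s1 90 0 = int j" "s1 87 0 = int k" "s1 1 (int j) = x"
  using sameD[OF sm, of 85] sameD[OF sm, of 86] s I j globalsD(7)[OF gl j(1)] by (simp_all add: k_def x_def)
 have loL: "abs (s1 85 0) < 2 ^ L" "abs (s1 86 0) < 2 ^ L" using v1 hiL by simp_all
 define s2 where "s2 = s1(91 := (s1 91)(0 := abs x))"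
 define s3 where "s3 = s2(88 := (s2 88)(int k := int j), 89 := (s2 89)(int k := 0), 87 := (s2 87)(0 := int k + 1))"
 define s4 where "s4 = (if in_class j then s3 else s2)"
 have cl: "in_class j = (~ abs x < s1 85 0 & abs x < s1 86 0)" using v1 by (auto simp: in_class_def x_def)
 have "wp L (If (Var 91 [<] Var 85) Skip (If (Var 91 [<] Var 86)
  (Write 88 (Var 87) (Var 90) ;; Write 89 (Var 87) (Const 0) ;; Assign 87 (Var 87 [+] Const 1)) Skip)) (%s'. s' = s4) s2"
  using v1(3-5) loL xL kL cl by (auto simp: s4_def s3_def s2_def)
 hence w: "wp L collect_body (%s'. s' = s4) s1"
  using v1(3-5) xL kL by (simp add: collect_body_def s2_def abs_if split: if_splits)
 have "same ({87, 88, 89, 90, 91} - {90}) s4 s1 & s4 87 0 = int (length (?ks (Suc j))) & (ALL r<length (?ks (Suc j)). entry 0 s4 r (?ks (Suc j) ! r))"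
  using I by (auto simp: s4_def s3_def s2_def entry_def nth_append k_def hd_val_def head_def less_Suc_eq)
 thus "runs collect_body s1 (wt collect_body * V) (%s'. same ({87, 88, 89, 90, 91} - {90}) s' s1 &
  (s' 87 0 = int (length (?ks (Suc j))) & (ALL r<length (?ks (Suc j)). entry 0 s' r (?ks (Suc j) ! r))))"
  by (intro runs_mono[OF runs_wpV[OF w V(4)] order_refl]) blast
next
 have "(length xs - 0 + 1) * (wt collect_body + for_wt (Const 0) (Read 2 (Const 1))) * V
  <= (2 * degree f) * (wt collect_body + for_wt (Const 0) (Read 2 (Const 1))) * V" using xs f by (intro mult_le_mono1) linarith
 thus "(length xs - 0 + 1) * (wt collect_body + for_wt (Const 0) (Read 2 (Const 1))) * V
  <= 2 * (wt collect_body + for_wt (Const 0) (Read 2 (Const 1))) * (degree f * V)" by (simp only: ac_simps)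
qed (use s V in "simp_all add: stored_def entry_def")

end

context point_class
begin

abbreviation (input) "final == alive (degree f div 2 ^ sg + 1)"

lemma runs_out:
 assumes s: "globals s" "stored (degree f div 2 ^ sg + 1) s" and out: "output_below (if i = 0 then 1 else 2 ^ 2 ^ i) s"
 shows "runs (For 90 (Const 0) (Var 87) out_body) s (2 * (wt out_body + for_wt (Const 0) (Var 87)) * (degree f * V))
  (%s'. same {3, 90} s' s & output_below (2 ^ 2 ^ Suc i) s')"
proof (rule runs_mono[OF runs_ForS[where L = L and V = V and a = 0 and b = "length final" and K = "wt out_body" and M = "{3, 90}" and
  J = "%r s'. ALL j<length xs. s' 3 (int j) = (if (abs (xs ! j) < (if i = 0 then 1 else 2 ^ 2 ^ i) | j : set (take r final)) & poly f (xs ! j) = 0 then 1 else 0)"]])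
 let ?lo = "if i = 0 then 1 else 2 ^ 2 ^ i"
 let ?J = "%r s'. ALL j<length xs. s' 3 (int j) = (if (abs (xs ! j) < ?lo | j : set (take r final)) & poly f (xs ! j) = 0 then 1 else 0)"
 have dL: "j <= length xs ==> j < 2 ^ L" for j using xs by (intro less_L_deg) linarith
 have lf: "length final <= length xs" by (rule length_alive)
 show "length final < 2 ^ L" by (rule dL[OF lf])
 show "?J 0 s" using out unfolding output_below_def by simp
 have ent: "s 87 0 = int (length final)" "!!r. r < length final ==> s 88 (int r) = int (final ! r) & s 89 (int r) = hd_val (degree f div 2 ^ sg + 1) (final ! r)"
  using s(2) unfolding stored_def entry_def by blast+
 {
  fix r s1
  assume sm: "same {3, 90} s1 s"
  show "small L (Var 87) s1 & val (Var 87) s1 = int (length final)" using sameD[OF sm, of 87] ent(1) dL[OF lf] by simp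
  assume r: "r < length final" and s1: "s1 90 0 = int r" and I: "?J r s1"
  define j where "j = final ! r"
  have j: "j < length xs" "in_class j" "abs (hd_val (degree f div 2 ^ sg + 1) j) <= S" using alive_nth[OF r] by (simp_all add: j_def del: alive.simps)
  define s2 where "s2 = (if poly f (xs ! j) = 0 then s1(3 := (s1 3)(int j := 1)) else s1)"
  have v1: "s1 88 (int r) = int j" "s1 89 (int r) = hd_val (degree f div 2 ^ sg + 1) j"
  using sameD[OF sm, of 88] sameD[OF sm, of 89] ent(2)[OF r] by (simp_all add: j_def)
  have "r < 2 ^ L" "j < 2 ^ L" using r lf j(1) by (intro dL; linarith)+
  moreover have "abs (hd_val (degree f div 2 ^ sg + 1) j) < 2 ^ L" using j(3) S_L by linarith
  ultimately have w: "wp L out_body (%s'. s' = s2) s1"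
  using v1 s1 head_zero_iff[OF j(1,2)] by (simp add: out_body_def s2_def)
  have tk: "set (take (Suc r) final) = insert j (set (take r final))"
  unfolding j_def using take_Suc_conv_app_nth[OF r] by simp
  have "same ({3, 90} - {90}) s2 s1 & ?J (Suc r) s2" using I unfolding tk s2_def by auto
  thus "runs out_body s1 (wt out_body * V) (%s'. same ({3, 90} - {90}) s' s1 & ?J (Suc r) s')"
  by (intro runs_mono[OF runs_wpV[OF w V(4)] order_refl]) blast
 next
  fix s1
  assume I: "same {3, 90} s1 s & ?J (length final) s1"
  have "(abs (xs ! j) < ?lo | j : set final) & poly f (xs ! j) = 0 \<longleftrightarrow> abs (xs ! j) < 2 ^ 2 ^ Suc i & poly f (xs ! j) = 0" if "j < length xs" for j
  proof -
  have "?lo <= (2::int) ^ 2 ^ Suc i" by (auto intro: power_increasing)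
  thus ?thesis using root_alive[of j "degree f div 2 ^ sg + 1"] alive_D[of j "degree f div 2 ^ sg + 1"] that unfolding in_class_def by linarith
  qed
  thus "same {3, 90} s1 s & output_below (2 ^ 2 ^ Suc i) s1" using I unfolding output_below_def by (simp del: alive.simps power_Suc)
 }
 have "(length final - 0 + 1) * (wt out_body + for_wt (Const 0) (Var 87)) * V <= (2 * degree f) * (wt out_body + for_wt (Const 0) (Var 87)) * V"
  using lf xs f by (intro mult_le_mono1) linarith
 thus "(length final - 0 + 1) * (wt out_body + for_wt (Const 0) (Var 87)) * V <= 2 * (wt out_body + for_wt (Const 0) (Var 87)) * (degree f * V)"
  by (simp only: ac_simps)
qed (use V in simp_all)

lemma runs_class:
 assumes s: "globals s" "s 84 0 = int i" "s 85 0 = (if i = 0 then 1 else 2 ^ 2 ^ i)" and out: "output_below (if i = 0 then 1 else 2 ^ 2 ^ i) s"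
 shows "runs class_body s (class_wt * (degree f * V)) (%s'. same (class_mods Un {3, 61, 85, 86, 87, 90, 91, 100}) s' s &
  s' 85 0 = 2 ^ 2 ^ Suc i & output_below (2 ^ 2 ^ Suc i) s')"
proof -
 let ?M = "class_mods Un {3, 61, 85, 86, 87, 90, 91, 100}"
 let ?Q = "%s'. same ?M s' s & s' 85 0 = 2 ^ 2 ^ Suc i & output_below (2 ^ 2 ^ Suc i) s'"
 have "1 * V <= degree f * V" using f by (rule mult_le_mono1)
 hence LV: "L + 1 <= degree f * V" using V(4) by linarith
 have "2 ^ Suc i <= (2::nat) ^ be" using i by (intro power_increasing) auto
 moreover have "0 < (2::nat) ^ be" by simp
 ultimately have i2: "2 ^ Suc i < L" using L_ge(7) by linarith
 hence hiL: "(2::int) ^ 2 ^ Suc i < 2 ^ L" by (simp del: power_Suc)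
 define P where "P = (%s2. globals s2 & s2 61 0 = int sg & s2 85 0 = (if i = 0 then 1 else 2 ^ 2 ^ i) & s2 86 0 = 2 ^ 2 ^ Suc i &
  s2 87 0 = 0 & s2 100 0 = 2 ^ sg & same {61, 86, 87, 100} s2 s)"
 have w: "wp L class_init P s"
 proof -
  define e where "e = be + 3 - i"
  have e: "int be + 3 - int i = int e" "sg = (if et < e then et else e)" using i by (simp_all add: e_def sg_def)
  have "i <= L" "be <= L" "et <= L" "e <= L" and sh: "Suc i <= L" "et <= L" "e <= L" using i L_ge(2) X by (simp_all add: e_def)
  note b = this(1-4)[THEN less_L] sh
  have n: "nat (int i + 1) = Suc i" "nat (2 ^ Suc i) = 2 ^ Suc i" "int i + 1 <= int L" "(2::int) ^ Suc i <= int L"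
  proof -
  have "int (2 ^ Suc i) <= int L" using i2 by (simp only: of_nat_le_iff)
  thus "(2::int) ^ Suc i <= int L" by simp
  qed (use sh in "simp_all add: nat_power_eq del: power_Suc")
  show ?thesis
  using s(2) globalsD(2,3)[OF s(1)] b n e L_ge(6)
  by (simp add: class_init_def P_def s(1,3) del: power_Suc)
 qed
 show ?thesis
  unfolding class_body_def class_wt_def add.assoc
 proof (rule runs_SeqV[OF runs_wpV[OF w LV]])
  fix s2
  assume "P s2"
  hence s2: "globals s2" "s2 61 0 = int sg" "s2 85 0 = (if i = 0 then 1 else 2 ^ 2 ^ i)" "s2 86 0 = 2 ^ 2 ^ Suc i" "s2 87 0 = 0" "s2 100 0 = 2 ^ sg"
  and sm2: "same {61, 86, 87, 100} s2 s" unfolding P_def by blast+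
  show "runs (For 90 (Const 0) (Read 2 (Const 1)) collect_body ;; For 92 (Const 0) block_count block_step ;;
  For 90 (Const 0) (Var 87) out_body ;; Assign 85 (Var 86)) s2 ((2 * (wt collect_body + for_wt (Const 0) (Read 2 (Const 1))) + (15 * block_step_wt + (6 * for_wt (Const 0) block_count
  + (2 * (wt out_body + for_wt (Const 0) (Var 87)) + wt (Assign 85 (Var 86)))))) * (degree f * V)) ?Q"
  unfolding add.assoc[symmetric, of "15 * block_step_wt"]
  proof (rule runs_SeqV[OF runs_collect[OF s2(1,3-5)]])
  fix s3
  assume s3: "same {87, 88, 89, 90, 91} s3 s2 & stored 0 s3"
  hence sm3: "same {87, 88, 89, 90, 91} s3 s2" by blast
  have gl3: "globals s3" by (rule globals_same[OF s2(1) sm3]) simp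
  have v3: "s3 61 0 = int sg" "s3 100 0 = 2 ^ sg" using sameD[OF sm3, of 61] sameD[OF sm3, of 100] s2 by simp_all
  show "runs (For 92 (Const 0) block_count block_step ;; For 90 (Const 0) (Var 87) out_body ;; Assign 85 (Var 86)) s3
  ((15 * block_step_wt + 6 * for_wt (Const 0) block_count + (2 * (wt out_body + for_wt (Const 0) (Var 87)) + wt (Assign 85 (Var 86)))) * (degree f * V)) ?Q"
  proof (rule runs_SeqV[OF runs_blocks[OF gl3 v3]])
  show "stored 0 s3" using s3 by blast
  fix s4
  assume s4: "same class_mods s4 s3 & stored (degree f div 2 ^ sg + 1) s4"
  hence sm4: "same class_mods s4 s3" by blast
  have gl4: "globals s4" by (rule globals_same[OF gl3 sm4]) simp
  have "s4 3 = s 3" using sameD[OF sm4, of 3] sameD[OF sm3, of 3] sameD[OF sm2, of 3] by simp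
  hence out4: "output_below (if i = 0 then 1 else 2 ^ 2 ^ i) s4" using out unfolding output_below_def by simp
  show "runs (For 90 (Const 0) (Var 87) out_body ;; Assign 85 (Var 86)) s4
  ((2 * (wt out_body + for_wt (Const 0) (Var 87)) + wt (Assign 85 (Var 86))) * (degree f * V)) ?Q"
  proof (rule runs_SeqV[OF runs_out[OF gl4 conjunct2[OF s4] out4]])
  fix s5
  assume s5: "same {3, 90} s5 s4 & output_below (2 ^ 2 ^ Suc i) s5"
  hence sm5: "same {3, 90} s5 s4" by blast
  have "same ?M s5 s" using sm2 sm3 sm4 sm5 unfolding same_def by simp
  moreover have "s5 86 0 = 2 ^ 2 ^ Suc i"
  using sameD[OF sm5, of 86] sameD[OF sm4, of 86] sameD[OF sm3, of 86] s2(4) by simp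
  ultimately show "runs (Assign 85 (Var 86)) s5 (wt (Assign 85 (Var 86)) * (degree f * V)) ?Q"
  using s5 hiL by (intro runs_wpV[OF _ LV]) (simp add: output_below_def del: power_Suc)
  qed
  qed
  qed
 qed
qed

end

section \<open>The main program\<close>

definition search :: "expr => nat => prog" where
 "search e v = While e (Assign v (Var v [+] Const 1))"

definition search_wt :: "expr => nat => nat" where
 "search_wt e v = wt (Assign v (Var v [+] Const 1)) + (cost_wt e + val_wt e + 1)"

lemma runs_search:
 assumes e: "!!j. a <= j ==> j <= J ==> small L e (s(v := (s v)(0 := int j))) & (val e (s(v := (s v)(0 := int j))) ~= 0 \<longleftrightarrow> j < J)"
  and J: "a <= J" "J < 2 ^ L" and s: "s v 0 = int a"
 shows "runs (search e v) s ((J + 1) * (search_wt e v * (L + 1))) (%s'. s' = s(v := (s v)(0 := int J)))"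
proof -
 let ?s = "%j. s(v := (s v)(0 := int j))"
 define w where "w = wt (Assign v (Var v [+] Const 1))"
 define I where "I = (%m s'. EX j. a <= j & j <= J & m = J - j & s' = ?s j)"
 have II: "I (J - j) (?s j)" if "a <= j" "j <= J" for j unfolding I_def using that by blast
 have "runs (search e v) s ((SUM j<J - a. w * (L + 1)) + (J - a + 1) * ((cost_wt e + val_wt e + 1) * (L + 1))) (%s'. (EX m. I m s') & val e s' = 0)"
  unfolding search_def
 proof (rule runs_While[where I = I])
  have "(s v)(0 := int a) = s v" unfolding s[symmetric] by (rule fun_upd_triv)
  hence "?s a = s" by (simp only: fun_upd_triv)
  thus "I (J - a) s" using II[OF order_refl J(1)] by (simp only:)
 next
  fix m s'
  assume "I m s'"
  then obtain j where j: "a <= j" "j <= J" "s' = ?s j" unfolding I_def by blast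
  show "small L e s'" unfolding j(3) by (rule conjunct1[OF e[OF j(1,2)]])
 next
  fix s'
  assume "I 0 s'"
  then obtain j where j: "a <= j" "j <= J" "0 = J - j" "s' = ?s j" unfolding I_def by blast
  hence "~ j < J" by simp
  thus "val e s' = 0" unfolding j(4) using conjunct2[OF e[OF j(1,2)]] by blast
 next
  fix m s'
  assume "I (Suc m) s'"
  then obtain j where j: "a <= j" "j <= J" "Suc m = J - j" "s' = ?s j" unfolding I_def by blast
  have jL: "j < 2 ^ L" using j J by linarith
  have "m = J - Suc j" "Suc j <= J" using j by linarith+
  hence I: "I m (?s (Suc j))" using II[of "Suc j"] j(1) by simp
  have "wp L (Assign v (Var v [+] Const 1)) (%s''. s'' = ?s (Suc j)) s'" unfolding j(4) using jL by (simp add: add.commute)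
  thus "runs (Assign v (Var v [+] Const 1)) s' (w * (L + 1)) (%s''. EX m' <= m. I m' s'')"
  unfolding w_def by (rule runs_mono[OF runs_wp order_refl]) (use I in blast)
 qed
 thus ?thesis
 proof (rule runs_mono)
  have "(SUM j<J - a. w * (L + 1)) <= (J + 1) * (w * (L + 1))"
  unfolding sum_constant card_lessThan of_nat_id by (rule mult_le_mono1) simp
  moreover have "(J - a + 1) * ((cost_wt e + val_wt e + 1) * (L + 1)) <= (J + 1) * ((cost_wt e + val_wt e + 1) * (L + 1))"
  by (rule mult_le_mono1) simp
  ultimately show "(SUM j<J - a. w * (L + 1)) + (J - a + 1) * ((cost_wt e + val_wt e + 1) * (L + 1)) <= (J + 1) * (search_wt e v * (L + 1))"
  unfolding search_wt_def w_def[symmetric] add_mult_distrib add_mult_distrib2 by linarith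
  fix s'
  assume "(EX m. I m s') & val e s' = 0"
  then obtain j where j: "a <= j" "j <= J" "s' = ?s j" "val e s' = 0" unfolding I_def by blast
  hence "~ j < J" using conjunct2[OF e[OF j(1,2)]] by blast
  hence "j = J" using j(2) by simp
  thus "s' = ?s J" using j(3) by blast
 qed
qed

definition sum_body :: "nat => prog" where
 "sum_body k = If (Read k (Var 81) [<] Const 0) (Assign 80 (Var 80 [-] Read k (Var 81))) (Assign 80 (Var 80 [+] Read k (Var 81)))"

definition sum_abs_wt :: "nat => expr => nat" where
 "sum_abs_wt k hi = 3 * (wt (sum_body k) + for_wt (Const 0) hi)"

text \<open>Comparison with \<open>S + 1\<close> amounts to \<open>2 ^ 2 ^ be <= S\<close>, so the
  search ends at the least exponent with \<open>S < 2 ^ 2 ^ be\<close>.\<close>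

definition loglog_guard :: expr where
 "loglog_guard = (Const 1 [<<] (Const 1 [<<] Var 82) [<] Var 80 [+] Const 1)"

definition log_guard :: expr where
 "log_guard = (Const 1 [<<] Var 83 [<] Read 2 (Const 0) [+] Const 1)"

text \<open>The cancellation argument for leading parts requires a nonzero point, so 0 belongs to no
  class; its value is the constant coefficient.\<close>

definition zero_body :: prog where
 "zero_body = If (Read 1 (Var 90)) Skip (If (Read 0 (Const 0)) Skip (Write 3 (Var 90) (Const 1)))"

abbreviation zero_loop :: prog where
 "zero_loop == For 90 (Const 0) (Read 2 (Const 1)) zero_body"

abbreviation class_loop :: prog where
 "class_loop == For 84 (Const 0) (Var 82) class_body"

definition main_vars :: prog where
 "main_vars = (Assign 60 (Var 82 [+] Const 7) ;; Assign 85 (Const 1))"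

definition main :: prog where
 "main = (Assign 80 (Const 1) ;; For 81 (Const 0) (Read 2 (Const 0) [+] Const 1) (sum_body 0) ;;
  For 81 (Const 0) (Read 2 (Const 1)) (sum_body 1) ;; Assign 82 (Const 1) ;; search loglog_guard 82 ;; search log_guard 83 ;;
  main_vars ;; zero_loop ;; class_loop)"

definition main_wt :: nat where
 "main_wt = wt (Assign 80 (Const 1)) + (sum_abs_wt 0 (Read 2 (Const 0) [+] Const 1) + (sum_abs_wt 1 (Read 2 (Const 1)) +
  (wt (Assign 82 (Const 1)) + (search_wt loglog_guard 82 + (search_wt log_guard 83 + (wt main_vars +
  (3 * (wt zero_body + for_wt (Const 0) (Read 2 (Const 1))) + (class_wt + for_wt (Const 0) (Var 82)))))))))"

context root_test
begin

text \<open>One class costs a multiple of \<open>degree f * V\<close>, and \<open>X\<close> bounds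
  the number of classes.\<close>

definition Y :: nat where "Y = degree f * V * X"

lemma less_L_deg': "x <= degree f + 1 ==> x < 2 ^ L"
proof -
 assume "x <= degree f + 1"
 hence "x < 2 * 2 ^ et" using et f by linarith
 also have "2 * (2::nat) ^ et = 2 ^ (et + 1)" by simp
 also have "... <= 2 ^ L" using X L_ge(2) by (intro power_increasing) auto
 finally show ?thesis .
qed

lemma Y: "L + 1 <= Y" "(degree f + 2) * (w * V) <= 3 * w * Y" "degree f * V <= Y"
proof -
 show 1: "degree f * V <= Y" using X by (simp add: Y_def)
 have "1 * V <= degree f * V" using f by (rule mult_le_mono1)
 thus "L + 1 <= Y" using V(4) 1 by linarith
 have "(degree f + 2) * (w * V) <= 3 * degree f * (w * V)" using f by (intro mult_le_mono1) linarith
 also have "... = 3 * w * (degree f * V)" by (simp only: ac_simps)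
 also have "... <= 3 * w * Y" using 1 by (rule mult_le_mono2)
 finally show "(degree f + 2) * (w * V) <= 3 * w * Y" .
qed

lemma runs_sum_abs:
 assumes k: "k ~= 80" "k ~= 81" and hi: "!!s'. same {80, 81} s' s ==> small L hi s' & val hi s' = int h" and h: "h <= degree f + 1"
  and b: "s 80 0 = b" "0 <= b" "b + (SUM j<h. abs (s k (int j))) <= S"
 shows "runs (For 81 (Const 0) hi (sum_body k)) s (sum_abs_wt k hi * Y) (%s'. same {80, 81} s' s & s' 80 0 = b + (SUM j<h. abs (s k (int j))))"
proof (rule runs_mono[OF runs_ForS[where L = L and V = V and a = 0 and b = h and K = "wt (sum_body k)" and M = "{80, 81}" and
  J = "%j s'. s' 80 0 = b + (SUM r<j. abs (s k (int r)))"]])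
 show "h < 2 ^ L" using h by (rule less_L_deg')
 fix j s1
 assume sm: "same {80, 81} s1 s"
 show "small L hi s1 & val hi s1 = int h" by (rule hi[OF sm])
 assume j: "j < h" "s1 81 0 = int j" and I: "s1 80 0 = b + (SUM r<j. abs (s k (int r)))"
 define P where "P = b + (SUM r<j. abs (s k (int r)))"
 have k1: "s1 k = s k" using sameD[OF sm, of k] k by simp
 have "(SUM r<Suc j. abs (s k (int r))) <= (SUM r<h. abs (s k (int r)))" using j by (intro sum_mono2) auto
 hence "P + abs (s k (int j)) <= S" "0 <= P" using b by (auto simp: P_def sum_nonneg)
 hence bL: "abs P < 2 ^ L" "abs (s k (int j)) < 2 ^ L" "j < 2 ^ L" using S_L j h less_L_deg'[of j] by linarith+
 show "runs (sum_body k) s1 (wt (sum_body k) * V) (%s'. same ({80, 81} - {81}) s' s1 & s' 80 0 = b + (SUM r<Suc j. abs (s k (int r))))"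
  using I j bL k1 by (intro runs_wpV[OF _ V(4)]) (simp add: sum_body_def P_def[symmetric] add.assoc[symmetric])
next
 have "(h - 0 + 1) * ((wt (sum_body k) + for_wt (Const 0) hi) * V) <= (degree f + 2) * ((wt (sum_body k) + for_wt (Const 0) hi) * V)"
  using h by (intro mult_le_mono1) simp
 thus "(h - 0 + 1) * (wt (sum_body k) + for_wt (Const 0) hi) * V <= sum_abs_wt k hi * Y"
  unfolding sum_abs_wt_def mult.assoc[of _ _ V] using Y(2) order_trans by blast
qed (use b V in auto)

lemma runs_searchY:
 assumes "!!j. a <= j ==> j <= J ==> small L e (s(v := (s v)(0 := int j))) & (val e (s(v := (s v)(0 := int j))) ~= 0 \<longleftrightarrow> j < J)"
  and "a <= J" "J < X" "s v 0 = int a"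
 shows "runs (search e v) s (search_wt e v * Y) (%s'. s' = s(v := (s v)(0 := int J)))"
proof (rule runs_mono[OF runs_search[where L = L and a = a, OF assms(1,2) _ assms(4)]])
 show "J < 2 ^ L" using assms(3) L_ge(2) by (intro less_L) linarith
 have "(J + 1) * (search_wt e v * (L + 1)) <= X * (search_wt e v * (1 * V))"
  using assms(3) V(4) by (intro mult_le_mono mult_le_mono2) auto
 also have "... <= X * (search_wt e v * (degree f * V))" using f by (intro mult_le_mono2 mult_le_mono1)
 finally show "(J + 1) * (search_wt e v * (L + 1)) <= search_wt e v * Y" by (simp only: Y_def ac_simps)
qed

lemma runs_zero_loop:
 assumes s: "globals s" "s 3 = (%_. 0)"
 shows "runs zero_loop s (3 * (wt zero_body + for_wt (Const 0) (Read 2 (Const 1))) * Y) (%s'. same {3, 90} s' s & output_below 1 s')"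
proof (rule runs_mono[OF runs_ForS[where L = L and V = V and a = 0 and b = "length xs" and K = "wt zero_body" and M = "{3, 90}" and
  J = "%r s'. ALL j. s' 3 (int j) = (if j < r & xs ! j = 0 & poly f 0 = 0 then 1 else 0)"]])
 have dL: "j <= length xs ==> j < 2 ^ L" for j using xs by (intro less_L_deg') linarith
 show "length xs < 2 ^ L" by (rule dL) simp
 fix r s1
 assume sm: "same {3, 90} s1 s"
 have gl: "globals s1" by (rule globals_same[OF s(1) sm]) simp
 show "small L (Read 2 (Const 1)) s1 & val (Read 2 (Const 1)) s1 = int (length xs)"
  using globalsD(6)[OF gl] dL[of "length xs"] by simp
 assume r: "r < length xs" and I: "s1 90 0 = int r" "ALL j. s1 3 (int j) = (if j < r & xs ! j = 0 & poly f 0 = 0 then 1 else 0)"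
 have b: "abs (xs ! r) < 2 ^ L" "abs (coeff f 0) < 2 ^ L" "r < 2 ^ L" using abs_pt_less[OF r] abs_coeff_le[of 0] S_L dL[of r] r by linarith+
 have v: "s1 1 (int r) = xs ! r" "s1 0 0 = coeff f 0" using globalsD(7)[OF gl r] globalsD(8)[OF gl, of 0] by simp_all
 show "runs zero_body s1 (wt zero_body * V) (%s'. same ({3, 90} - {90}) s' s1 &
  (ALL j. s' 3 (int j) = (if j < Suc r & xs ! j = 0 & poly f 0 = 0 then 1 else 0)))"
  using I r b v by (intro runs_wpV[OF _ V(4)]) (auto simp: zero_body_def less_Suc_eq poly_0_coeff_0)
next
 have "(length xs - 0 + 1) * ((wt zero_body + for_wt (Const 0) (Read 2 (Const 1))) * V) <= (degree f + 2) * ((wt zero_body + for_wt (Const 0) (Read 2 (Const 1))) * V)"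
  using xs by (intro mult_le_mono1) simp
 thus "(length xs - 0 + 1) * (wt zero_body + for_wt (Const 0) (Read 2 (Const 1))) * V <= 3 * (wt zero_body + for_wt (Const 0) (Read 2 (Const 1))) * Y"
  unfolding mult.assoc[of _ _ V] using Y(2) order_trans by blast
qed (use s V in "auto simp: output_below_def")

text \<open>From one class to the next only the global cells, the limit in 85 and the output have to
  be known, so the frame may contain everything but the globals.\<close>

lemma runs_class_loop:
 assumes s: "globals s" "s 85 0 = 1" "output_below 1 s"
 shows "runs class_loop s ((class_wt + for_wt (Const 0) (Var 82)) * Y) (output_below (2 ^ 2 ^ be))"
proof (rule runs_mono[OF runs_ForS[where L = L and V = "degree f * V" and a = 0 and b = be and K = class_wt and
  M = "- {0, 1, 2, 60, 80, 82, 83}" and J = "%i s'. s' 85 0 = (if i = 0 then 1 else 2 ^ 2 ^ i) & output_below (if i = 0 then 1 else 2 ^ 2 ^ i) s'"]])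
 let ?M = "- {0, 1, 2, 60, 80, 82, 83} :: nat set"
 show bL: "be < 2 ^ L" using L_ge by (intro less_L)
 fix i s1
 assume "same ?M s1 s"
 hence gl: "globals s1" by (rule globals_same[OF s(1)]) simp
 show "small L (Var 82) s1 & val (Var 82) s1 = int be" using globalsD(2)[OF gl] bL by simp
 assume i: "i < be" and I: "s1 84 0 = int i" "s1 85 0 = (if i = 0 then 1 else 2 ^ 2 ^ i) & output_below (if i = 0 then 1 else 2 ^ 2 ^ i) s1"
 interpret point_class f xs be et X i by unfold_locales (rule i)
 show "runs class_body s1 (class_wt * (degree f * V)) (%s'. same (?M - {84}) s' s1 &
  (s' 85 0 = (if Suc i = 0 then 1 else 2 ^ 2 ^ Suc i) & output_below (if Suc i = 0 then 1 else 2 ^ 2 ^ Suc i) s'))"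
  by (rule runs_mono[OF runs_class]) (use I gl in "auto simp: same_def simp del: power_Suc")
next
 show "L + 1 <= degree f * V" using mult_le_mono1[OF f, of V] V(4) by linarith
 have "(be - 0 + 1) * ((class_wt + for_wt (Const 0) (Var 82)) * (degree f * V)) <= X * ((class_wt + for_wt (Const 0) (Var 82)) * (degree f * V))"
  using X by (intro mult_le_mono1) simp
 thus "(be - 0 + 1) * (class_wt + for_wt (Const 0) (Var 82)) * (degree f * V) <= (class_wt + for_wt (Const 0) (Var 82)) * Y"
  by (simp only: Y_def ac_simps)
qed (use s be(2) in "simp_all add: output_below_def")

end

context root_test
begin

text \<open>The program finds its exponent by searching upwards, so the \<open>be\<close> of the
  locale has to be the least admissible one.\<close>

lemma runs_main:
 assumes be_least: "1 < be ==> 2 ^ 2 ^ (be - 1) <= S"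
 shows "runs main (input f xs) (main_wt * Y) (correct_output f xs)"
proof -
 let ?Q = "correct_output f xs"
 define s0 where "s0 = input f xs"
 define s1 where "s1 = s0(80 := (s0 80)(0 := 1))"
 have dL: "degree f + 1 < 2 ^ L" "length xs < 2 ^ L" using xs by (auto intro!: less_L_deg')
 hence "int (degree f + 1) < int (2 ^ L)" by (simp only: of_nat_less_iff)
 hence dL': "degree f < 2 ^ L" "int (degree f) + 1 < 2 ^ L" using dL by simp_all
 have s0: "s0 2 0 = int (degree f)" "s0 2 1 = int (length xs)" by (simp_all add: s0_def input_def)
 have f0: "(SUM j<degree f + 1. abs (s0 0 (int j))) = (SUM i<=degree f. abs (coeff f i))"
  by (simp add: s0_def input_def lessThan_Suc_atMost)
 have f1: "(SUM j<length xs. abs (s0 1 (int j))) = (SUM i<length xs. abs (xs ! i))"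
  by (simp add: s0_def input_def)
 have nn: "0 <= (SUM i<=degree f. abs (coeff f i))" "0 <= (SUM i<length xs. abs (xs ! i))" by (auto intro: sum_nonneg)
 have "runs main s0 (main_wt * Y) ?Q"
  unfolding main_def main_wt_def
 proof (rule runs_SeqV[OF runs_wpV[where L = L and Q = "%s'. s' = s1"]])
  show "wp L (Assign 80 (Const 1)) (%s'. s' = s1) s0" by (simp add: s1_def)
  fix s1'
  assume "s1' = s1"
  have s1: "s1 0 = s0 0" "s1 1 = s0 1" "s1 2 = s0 2" "s1 3 = s0 3" "s1 80 0 = 1" by (simp_all add: s1_def)
  show "runs (For 81 (Const 0) (Read 2 (Const 0) [+] Const 1) (sum_body 0) ;;
  For 81 (Const 0) (Read 2 (Const 1)) (sum_body 1) ;; Assign 82 (Const 1) ;; search loglog_guard 82 ;; search log_guard 83 ;;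
  main_vars ;; zero_loop ;; class_loop) s1' ((sum_abs_wt 0 (Read 2 (Const 0) [+] Const 1) + (sum_abs_wt 1 (Read 2 (Const 1)) +
  (wt (Assign 82 (Const 1)) + (search_wt loglog_guard 82 + (search_wt log_guard 83 + (wt main_vars +
  (3 * (wt zero_body + for_wt (Const 0) (Read 2 (Const 1))) + (class_wt + for_wt (Const 0) (Var 82))))))))) * Y) ?Q"
  unfolding `s1' = s1`
  proof (rule runs_SeqV[OF runs_sum_abs[where b = 1 and h = "degree f + 1"]])
  show "small L (Read 2 (Const 0) [+] Const 1) s' & val (Read 2 (Const 0) [+] Const 1) s' = int (degree f + 1)" if "same {80, 81} s' s1" for s'
  using sameD[OF that, of 2] s0 s1 dL' by simp
  show "1 + (SUM j<degree f + 1. abs (s1 0 (int j))) <= S" unfolding s1 f0 using nn by (simp add: S_def)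
  fix s2
  assume s2: "same {80, 81} s2 s1 & s2 80 0 = 1 + (SUM j<degree f + 1. abs (s1 0 (int j)))"
  have s2': "s2 k = s0 k" if "k ~= 80" "k ~= 81" for k using sameD[OF conjunct1[OF s2], of k] that by (simp add: s1_def)
  show "runs (For 81 (Const 0) (Read 2 (Const 1)) (sum_body 1) ;; Assign 82 (Const 1) ;; search loglog_guard 82 ;; search log_guard 83 ;;
  main_vars ;; zero_loop ;; class_loop) s2 ((sum_abs_wt 1 (Read 2 (Const 1)) +
  (wt (Assign 82 (Const 1)) + (search_wt loglog_guard 82 + (search_wt log_guard 83 + (wt main_vars +
  (3 * (wt zero_body + for_wt (Const 0) (Read 2 (Const 1))) + (class_wt + for_wt (Const 0) (Var 82)))))))) * Y) ?Q"
  proof (rule runs_SeqV[OF runs_sum_abs[where b = "1 + (SUM i<=degree f. abs (coeff f i))" and h = "length xs"]])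
  show "small L (Read 2 (Const 1)) s' & val (Read 2 (Const 1)) s' = int (length xs)" if "same {80, 81} s' s2" for s'
  using sameD[OF that, of 2] s2' s0 dL by simp
  show "s2 80 0 = 1 + (SUM i<=degree f. abs (coeff f i))" using conjunct2[OF s2] unfolding s1 f0 .
  show "1 + (SUM i<=degree f. abs (coeff f i)) + (SUM j<length xs. abs (s2 1 (int j))) <= S"
  using s2'[of 1] f1 by (simp add: S_def)
  fix s3
  assume s3: "same {80, 81} s3 s2 & s3 80 0 = 1 + (SUM i<=degree f. abs (coeff f i)) + (SUM j<length xs. abs (s2 1 (int j)))"
  have s3': "s3 k = s0 k" if "k ~= 80" "k ~= 81" for k using sameD[OF conjunct1[OF s3], of k] s2' that by simp
  have S3: "s3 80 0 = S" using conjunct2[OF s3] s2'[of 1] f1 by (simp add: S_def)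
  define s4 where "s4 = s3(82 := (s3 82)(0 := 1))"
  define s5 where "s5 = s4(82 := (s4 82)(0 := int be))"
  define s6 where "s6 = s5(83 := (s5 83)(0 := int et))"
  show "runs (Assign 82 (Const 1) ;; search loglog_guard 82 ;; search log_guard 83 ;; main_vars ;; zero_loop ;; class_loop) s3
  ((wt (Assign 82 (Const 1)) + (search_wt loglog_guard 82 + (search_wt log_guard 83 + (wt main_vars +
  (3 * (wt zero_body + for_wt (Const 0) (Read 2 (Const 1))) + (class_wt + for_wt (Const 0) (Var 82))))))) * Y) ?Q"
  proof (rule runs_SeqV[OF runs_wpV[where L = L and Q = "%s'. s' = s4"]])
  show "wp L (Assign 82 (Const 1)) (%s'. s' = s4) s3" by (simp add: s4_def)
  fix s4'
  assume "s4' = s4"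
  show "runs (search loglog_guard 82 ;; search log_guard 83 ;; main_vars ;; zero_loop ;; class_loop) s4'
  ((search_wt loglog_guard 82 + (search_wt log_guard 83 + (wt main_vars +
  (3 * (wt zero_body + for_wt (Const 0) (Read 2 (Const 1))) + (class_wt + for_wt (Const 0) (Var 82)))))) * Y) ?Q"
  unfolding `s4' = s4`
  proof (rule runs_SeqV[OF runs_searchY[where a = 1 and J = be]])
  fix j
  assume j: "1 <= j" "j <= be"
  have "(2::nat) ^ j <= 2 ^ be" using j by (intro power_increasing) auto
  hence sh: "(2::nat) ^ j <= L" "j <= L" "j < 2 ^ L" using L_ge(4,7) j less_L[of j] by linarith+
  hence "int (2 ^ j) <= int L" by (simp only: of_nat_le_iff)
  hence sh': "(2::int) ^ j <= int L" by simp
  have "2 ^ 2 ^ j <= S \<longleftrightarrow> j < be"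
  proof (cases "j < be")
  case True
  hence "(2::nat) ^ j <= 2 ^ (be - 1)" by (intro power_increasing) auto
  hence "(2::int) ^ 2 ^ j <= 2 ^ 2 ^ (be - 1)" by (intro power_increasing) auto
  thus ?thesis using True j be_least by linarith
  next
  case False
  hence "j = be" using j by simp
  thus ?thesis using S_less by simp
  qed
  thus "small L loglog_guard (s4(82 := (s4 82)(0 := int j))) & (val loglog_guard (s4(82 := (s4 82)(0 := int j))) ~= 0 \<longleftrightarrow> j < be)"
  using sh sh' S3 S_L S_ge(2) by (simp add: loglog_guard_def s4_def nat_power_eq)
  next
  fix s5'
  assume "s5' = s4(82 := (s4 82)(0 := int be))"
  hence "s5' = s5" by (simp add: s5_def)
  show "runs (search log_guard 83 ;; main_vars ;; zero_loop ;; class_loop) s5'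
  ((search_wt log_guard 83 + (wt main_vars +
  (3 * (wt zero_body + for_wt (Const 0) (Read 2 (Const 1))) + (class_wt + for_wt (Const 0) (Var 82))))) * Y) ?Q"
  unfolding `s5' = s5`
  proof (rule runs_SeqV[OF runs_searchY[where a = 0 and J = et]])
  fix j
  assume j: "j <= et"
  have sh: "j <= L" "j < 2 ^ L" using j L_ge(5) less_L[of j] by linarith+
  have "2 ^ j <= degree f \<longleftrightarrow> j < et"
  proof (cases "j < et")
  case True
  hence "(2::nat) ^ Suc j <= 2 ^ et" by (intro power_increasing) auto
  thus ?thesis using True et by simp
  next
  case False
  hence "j = et" using j by simp
  thus ?thesis using et by simp
  qed
  moreover have "(2::int) ^ j < int (degree f) + 1 \<longleftrightarrow> 2 ^ j <= degree f"
  using of_nat_le_iff[of "2 ^ j" "degree f", where ?'a = int] by (simp add: zless_add1_eq order_le_less)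
  ultimately show "small L log_guard (s5(83 := (s5 83)(0 := int j))) & (val log_guard (s5(83 := (s5 83)(0 := int j))) ~= 0 \<longleftrightarrow> j < et)"
  using sh dL' s0 s3'[of 2] by (simp add: log_guard_def s5_def s4_def)
  next
  fix s6'
  assume "s6' = s5(83 := (s5 83)(0 := int et))"
  hence "s6' = s6" by (simp add: s6_def)
  define P where "P = (%s'. globals s' & s' 85 0 = 1 & s' 3 = (%_. 0))"
  have i0: "s0 3 = (%_. 0)" by (simp add: s0_def input_def fun_eq_iff)
  have w: "wp L main_vars P s6"
  using be(2) less_L[OF L_ge(4)] S3 s3'[of 3] i0 s3'[of 0] s3'[of 1] s3'[of 2]
  by (simp add: main_vars_def s6_def s5_def s4_def P_def globals_def nv_def s0_def[symmetric])
  show "runs (main_vars ;; zero_loop ;; class_loop) s6' ((wt main_vars +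
  (3 * (wt zero_body + for_wt (Const 0) (Read 2 (Const 1))) + (class_wt + for_wt (Const 0) (Var 82)))) * Y) ?Q"
  unfolding `s6' = s6`
  proof (rule runs_SeqV[OF runs_wpV[OF w Y(1)]])
  fix s7
  assume "P s7"
  hence s7: "globals s7" "s7 85 0 = 1" "s7 3 = (%_. 0)" by (simp_all add: P_def)
  show "runs (zero_loop ;; class_loop) s7 ((3 * (wt zero_body + for_wt (Const 0) (Read 2 (Const 1))) +
  (class_wt + for_wt (Const 0) (Var 82))) * Y) ?Q"
  proof (rule runs_SeqV[OF runs_zero_loop[OF s7(1,3)]])
  fix s8
  assume s8: "same {3, 90} s8 s7 & output_below 1 s8"
  have gl8: "globals s8" by (rule globals_same[OF s7(1) conjunct1[OF s8]]) simp
  have "s8 85 0 = 1" using sameD[OF conjunct1[OF s8], of 85] s7 by simp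
  thus "runs class_loop s8 ((class_wt + for_wt (Const 0) (Var 82)) * Y) ?Q"
  proof (rule runs_mono[OF runs_class_loop[OF gl8]])
  fix s9
  assume "output_below (2 ^ 2 ^ be) s9"
  moreover have "abs (xs ! j) < 2 ^ 2 ^ be" if "j < length xs" for j using abs_pt_less[OF that] S_less by linarith
  ultimately show "correct_output f xs s9" by (simp add: output_below_def correct_output_def)
  qed (use s8 in simp_all)
  qed
  qed
  qed (use X in "simp_all add: s5_def s4_def s3' s0_def input_def")
  qed (use X be(2) in "simp_all add: s4_def")
  qed (rule Y(1))
  qed (use xs nn in "simp_all")
  qed (use s1 in simp_all)
 qed (rule Y(1))
 thus ?thesis by (simp only: s0_def)
qed

end

section \<open>The running time in terms of \<open>n\<close> and \<open>b\<close>\<close>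

definition main_time :: "nat => nat => nat" where
 "main_time n b = main_wt * (n * (256 * (b + floorlog 2 (n + b) + 1)) * (30 * floorlog 2 (n + b)) ^ 7)"

lemma exec_main:
 fixes f :: "int poly"
 assumes n: "1 <= n" "degree f = n" and b: "1 <= b" "inf_norm f < 2 ^ b" "ALL x : set xs. abs x < 2 ^ b"
  and xs: "distinct xs" "length xs <= n"
 shows "EX t s. exec main (input f xs) t s & t <= main_time n b & correct_output f xs s"
proof -
 define w where "w = floorlog 2 (n + b)"
 define A where "A = (SUM i<=degree f. abs (coeff f i)) + (SUM i<length xs. abs (xs ! i)) + 1"
 have w: "n + b < 2 ^ w" "2 ^ (w - 1) <= n + b" using floorlog_bounds[of "n + b" 2] n by (auto simp: w_def)
 have w1: "1 <= w" using w(1) n by (cases w) auto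
 have ww: "w < 2 ^ w" by (rule less_exp)
 \<comment> \<open>There are \<open>n + 1\<close> coefficients, at most \<open>n\<close> points and
   the summand 1, each at most \<open>2 ^ b\<close>, hence the factor \<open>2 * n + 2\<close>
   below.\<close>
 have A: "A < 2 ^ (b + w + 1)"
 proof -
  have "abs (coeff f i) <= 2 ^ b" if "i : {..degree f}" for i
  proof -
  have "abs (coeff f i) <= inf_norm f" unfolding inf_norm_def using that by (intro Max_ge) auto
  thus ?thesis using b by linarith
  qed
  hence "(SUM i<=degree f. abs (coeff f i)) <= (SUM i<=degree f. 2 ^ b)" by (rule sum_mono)
  also have "... = int n * 2 ^ b + 2 ^ b" by (simp add: n algebra_simps)
  finally have 1: "(SUM i<=degree f. abs (coeff f i)) <= int n * 2 ^ b + 2 ^ b" .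
  have "(SUM i<length xs. abs (xs ! i)) <= (SUM i<length xs. 2 ^ b)" using b by (intro sum_mono less_imp_le) simp
  also have "... = int (length xs) * 2 ^ b" by simp
  also have "... <= int n * 2 ^ b" using xs by (intro mult_right_mono) auto
  finally have "A <= (int n * 2 ^ b + 2 ^ b) + int n * 2 ^ b + 2 ^ b" using 1 one_le_power[of "2::int" b] unfolding A_def by linarith
  also have "... = (2 * int n + 2) * 2 ^ b" by (simp add: algebra_simps)
  also have "... < 2 ^ (w + 1) * 2 ^ b"
  proof (rule mult_strict_right_mono)
  have "int (n + b) < int (2 ^ w)" using w by (simp only: of_nat_less_iff)
  thus "2 * int n + 2 < (2::int) ^ (w + 1)" using b by simp
  qed simp
  also have "... = 2 ^ (b + w + 1)" by (simp add: power_add)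
  finally show ?thesis .
 qed
 \<comment> \<open>By minimality \<open>2 ^ be\<close> is at most twice the bound
   \<open>b + w + 1\<close> for the length of \<open>A\<close>. The program thus works with numbers
   of about \<open>b\<close> bits without being told \<open>b\<close>.\<close>
 define be where "be = (LEAST k. 1 <= k & A < 2 ^ 2 ^ k)"
 have "b + w + 1 < 2 ^ (b + w + 1)" by (rule less_exp)
 hence "(2::int) ^ (b + w + 1) <= 2 ^ 2 ^ (b + w + 1)" by (intro power_increasing) auto
 hence "1 <= b + w + 1 & A < 2 ^ 2 ^ (b + w + 1)" using A by simp
 hence be: "1 <= be & A < 2 ^ 2 ^ be" unfolding be_def by (rule LeastI)
 have be_least: "2 ^ 2 ^ (be - 1) <= A" if "1 < be"
  using not_less_Least[of "be - 1" "%k. 1 <= k & A < 2 ^ 2 ^ k"] that unfolding be_def[symmetric] by linarith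
 have be_le: "2 ^ be <= 2 * (b + w + 1)"
 proof (cases "be = 1")
  case False
  hence "(2::int) ^ 2 ^ (be - 1) < 2 ^ (b + w + 1)" using be_least be A by linarith
  hence lt: "2 ^ (be - 1) < b + w + 1" by (rule power_less_imp_less_exp[rotated]) simp
  have e: "(2::nat) ^ be = 2 * 2 ^ (be - 1)" using be by (simp flip: power_Suc)
  show ?thesis unfolding e using less_imp_le[OF lt] by (rule mult_le_mono2)
 qed simp
 have be_w: "be <= w + 2"
 proof -
  define P where "P = (2::nat) ^ w"
  have P: "(2::nat) ^ (w + 2) = 4 * P" "w < P" "n + b < P" using w(1) ww by (simp_all add: P_def)
  hence "2 * (b + w + 1) <= 4 * P" using n(1) by simp
  hence "(2::nat) ^ be <= 2 ^ (w + 2)" unfolding P(1) by (rule order_trans[OF be_le])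
  thus ?thesis by (rule power_le_imp_le_exp[rotated]) simp
 qed
 define et where "et = (LEAST k. n < 2 ^ k)"
 have et: "n < 2 ^ et" unfolding et_def by (rule LeastI[of _ n]) (rule less_exp)
 hence "et ~= 0" using n by (cases et) auto
 hence "2 ^ (et - 1) <= n" using not_less_Least[of "et - 1" "%k. n < 2 ^ k"] unfolding et_def[symmetric] by simp
 moreover have "(2::nat) ^ et = 2 * 2 ^ (et - 1)" using `et ~= 0` by (simp flip: power_Suc)
 ultimately have et2: "2 ^ et <= 2 * n" by simp
 have et_w: "et <= w + 1"
 proof -
  have "(2::nat) ^ et <= 2 ^ (w + 1)" using et2 w by simp
  thus ?thesis by (rule power_le_imp_le_exp[rotated]) simp
 qed
 define X where "X = 2 * be + 2 * et + 20"
 interpret root_test f xs be et X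
  by unfold_locales (use n xs be et et2 in "simp_all add: A_def X_def")
 have "S = A" by (simp add: S_def A_def)
 hence "runs main (input f xs) (main_wt * Y) (correct_output f xs)" using be_least by (intro runs_main) simp
 moreover have "main_wt * Y <= main_time n b"
 proof -
  \<comment> \<open>Five factors \<open>X\<close> come from a multiplication, one from the loops of
    logarithmic length and one from the number of classes.\<close>
  have "Y = n * (128 * 2 ^ be) * X ^ 7"
  by (simp add: Y_def V_def nv_def n power_add flip: power_Suc2)
  also have "... <= n * (256 * (b + w + 1)) * (30 * w) ^ 7"
  proof (rule mult_le_mono[OF mult_le_mono2 power_mono])
  show "128 * 2 ^ be <= 256 * (b + w + 1)" using be_le by linarith
  \<comment> \<open>The bounds on both exponents give \<open>4 * w + 26\<close>, and
    \<open>w\<close> is at least 1.\<close>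
  show "X <= 30 * w" unfolding X_def using be_w et_w w1 by linarith
  qed simp_all
  finally show ?thesis unfolding main_time_def w_def[symmetric] by (rule mult_le_mono2)
 qed
 ultimately show ?thesis unfolding runs_def by (meson order_trans)
qed

text \<open>The inequality \<open>b + w + 1 <= 3 * (b * w)\<close> turns the sum into a product; it
  explains 768 = 3 * 256 and the eighth logarithmic factor. The power of two in the constant comes
  from \<open>w <= 2 * l\<close>.\<close>

lemma main_time_soft_O:
 "(%n b. real (main_time n b)) : soft_O (%n b. real n * real b + min (real n ^ 2) (real n * real b ^ 2))"
 unfolding soft_O_def
proof (intro CollectI exI[of _ "real (main_wt * 768 * 30 ^ 7 * 2 ^ 8)"] exI[of _ 8] allI impI)
 fix n b :: nat
 assume nb: "1 <= n" "1 <= b"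
 define w where "w = floorlog 2 (n + b)"
 define l where "l = log 2 (real n + real b)"
 have "2 ^ (w - 1) <= n + b" using floorlog_bounds[of "n + b" 2] nb by (auto simp: w_def)
 hence "real (2 ^ (w - 1)) <= real (n + b)" by (simp only: of_nat_le_iff)
 hence "real (w - 1) <= l" unfolding l_def using nb by (intro le_log_of_power) simp_all
 moreover have "1 <= l" unfolding l_def using nb by (subst le_log_iff) simp_all
 ultimately have wl: "real w <= 2 * l" "0 <= l" by linarith+
 have w1: "1 <= w" using nb by (simp add: w_def floorlog_def)
 have "b + w + 1 <= 3 * (b * w)"
  using mult_le_mono2[OF w1, of b] mult_le_mono1[OF nb(2), of w] mult_le_mono[OF nb(2) w1] by linarith
 hence "main_time n b <= main_wt * (n * (256 * (3 * (b * w))) * (30 * w) ^ 7)"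
  unfolding main_time_def w_def[symmetric] by (intro mult_le_mono order_refl)
 also have "... = main_wt * 768 * 30 ^ 7 * (n * b) * w ^ 8" by (simp add: power_mult_distrib flip: power_Suc)
 finally have "real (main_time n b) <= real (main_wt * 768 * 30 ^ 7 * (n * b) * w ^ 8)" by (simp only: of_nat_le_iff)
 also have "... = real (main_wt * 768 * 30 ^ 7) * (real n * real b) * real w ^ 8" by simp
 also have "... <= real (main_wt * 768 * 30 ^ 7) * (real n * real b) * (2 * l) ^ 8"
  using wl by (intro mult_left_mono power_mono) simp_all
 also have "... = real (main_wt * 768 * 30 ^ 7 * 2 ^ 8) * (real n * real b) * l ^ 8" by (simp add: power_mult_distrib)
 also have "... <= real (main_wt * 768 * 30 ^ 7 * 2 ^ 8) * abs (real n * real b + min (real n ^ 2) (real n * real b ^ 2)) * l ^ 8"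
  using wl by (intro mult_right_mono mult_left_mono) simp_all
 finally show "abs (real (main_time n b)) <= real (main_wt * 768 * 30 ^ 7 * 2 ^ 8) * abs (real n * real b + min (real n ^ 2) (real n * real b ^ 2)) * log 2 (real n + real b) ^ 8"
  by (simp add: l_def)
qed

theorem theorem1p3:
  shows "\<exists>(A :: prog) (T :: nat \<Rightarrow> nat \<Rightarrow> nat).
    (\<lambda>n b. real (T n b)) \<in>
      soft_O (\<lambda>n b. real n * real b + min (real n ^ 2) (real n * real b ^ 2)) \<and>
    (\<forall>(n::nat) (b::nat) (f :: int poly) (xs :: int list).
       1 \<le> n \<longrightarrow> 1 \<le> b \<longrightarrow> degree f = n \<longrightarrow> inf_norm f < 2 ^ b \<longrightarrow>
       distinct xs \<longrightarrow> (\<forall>x \<in> set xs. \<bar>x\<bar> < 2 ^ b) \<longrightarrow> length xs \<le> n \<longrightarrow>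
       (\<exists>t s. exec A (input f xs) t s \<and> t \<le> T n b \<and> correct_output f xs s))"
  using main_time_soft_O exec_main by (intro exI[of _ main] exI[of _ main_time]) blast

end
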